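(* Let $N\in\{0,1,2,\ldots\}$, let $\mu,\nu\ge 0$ and $\alpha>0$ be real, let $a,b>0$ with $\chi=b^2/a^2<1$ and $0<a+b\le 2\pi$, and put $\vartheta=\alpha-\mu-\nu$. (i) If $\vartheta=2N$, then $$S_{\mu,\nu}(a,b)=\hat F(1)+\frac{1}{\Gamma(1+\nu)}\sum_{m=0}^{N}B_m\left(\tfrac12 a\right)^{2m}.$$ (ii) If $\vartheta=2N+1$, then $$S_{\mu,\nu}(a,b)=\frac{(-1)^N(\frac12 a)^{2N}}{\Gamma(1+\nu)\,\Gamma(N+1+\mu)\,N!}\left\{\hat\Upsilon_N(a)\,F_N(\mu,\chi)-\tfrac12\Delta_N(\chi)\right\}+\frac{1}{\Gamma(1+\nu)}\sum_{\substack{m=0\\ m\neq N}}^\infty B_m\left(\tfrac12 a\right)^{2m}.$$ The quantities $\hat F(1)$, $B_m$, $\hat\Upsilon_N(a)$, $F_N(\mu,\chi)$ and $\Delta_N(\chi)$ are as defined in the context.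
   Context: $J_\nu$ is the Bessel function of the first kind, $\zeta$ is the (analytically continued) Riemann zeta function, $\psi=\Gamma'/\Gamma$ is the psi (digamma) function, $\gamma$ is the Euler–Mascheroni constant, ${}_2F_1$ and ${}_3F_2$ are generalized hypergeometric functions (numerator parameters; denominator parameters; argument), $(x)_r=\Gamma(x+r)/\Gamma(x)=x(x+1)\cdots(x+r-1)$ is the Pochhammer symbol, $\binom{x}{r}=x(x-1)\cdots(x-r+1)/r!$, and $1/\Gamma$ is understood to be $0$ at the poles of $\Gamma$. For $a,b>0$, $$S_{\mu,\nu}(a,b)=\frac{2^{\mu+\nu}}{a^\mu b^\nu}\sum_{n=1}^\infty\frac{J_\mu(na)\,J_\nu(nb)}{n^{\alpha}}.$$ With $\vartheta=\alpha-\mu-\nu$ and $\chi=b^2/a^2$ define $$\hat F(1)=\frac{(\frac12 a)^{\vartheta-1}\,\Gamma(\frac12\mu+\frac12\nu+\frac12-\frac12\alpha)}{2\,\Gamma(1+\nu)\,\Gamma(\frac12\mu-\frac12\nu+\frac12\alpha+\frac12)}\;{}_2F_1\left(\frac{\mu+\nu+1-\alpha}{2},\frac{\nu-\mu+1-\alpha}{2};1+\nu;\chi\right),$$ $$F_m(\mu,\chi)={}_2F_1(-m,-m-\mu;1+\nu;\chi)\quad(m=0,1,2,\ldots),$$ $$B_m=\frac{(-1)^m\,\zeta(\vartheta-2m)}{m!\,\Gamma(1+\mu+m)}\,F_m(\mu,\chi),$$ $$\hat\Upsilon_N(a)=\gamma-\log\left(\tfrac12 a\right)+\tfrac12\psi(N+1+\mu)+\tfrac12\psi(N+1),$$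 $$\Delta_N(\chi)=\sum_{r=1}^N\binom{N}{r}\binom{N+\mu}{r}\frac{D_r(N,\mu)\,\chi^r}{(1+\nu)_r}+\frac{(\mu)_{N+1}\,\chi^{N+1}}{(1+\nu)_{N+1}(N+1)}\;{}_3F_2(1,1,1-\mu;N+\nu+2,N+2;\chi),$$ $$D_r(N,\mu)=r!\sum_{k=0}^{r-1}\left(\frac{1}{N-k}+\frac{1}{N+\mu-k}\right).$$ *)

theory Defs
  imports "HOL-Analysis.Analysis"
begin

text \<open>
  The defining property determines the function at every point of the domain \<open>s \<noteq> 1\<close> (identity
  theorem); the value at the pole \<open>s = 1\<close> is left unspecified.
\<close>

definition zeta :: "complex \<Rightarrow> complex" where
  "zeta = (SOME f. f holomorphic_on (- {1}) \<and>
     (\<forall>s. Re s > 1 \<longrightarrow> (\<lambda>n. of_nat (Suc n) powr (- s)) sums f s))"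

definition zeta_real :: "real \<Rightarrow> real" where
  "zeta_real x = Re (zeta (of_real x))"

text \<open>For arguments \<open>x > 0\<close> only: for \<open>x < 0\<close> the real power is not the intended branch.\<close>

definition bessel_J :: "real \<Rightarrow> real \<Rightarrow> real" where
  "bessel_J \<nu> x = (x / 2) powr \<nu> *
     (\<Sum>k. (- 1) ^ k / fact k * rGamma (\<nu> + real k + 1) * (x / 2) ^ (2 * k))"

definition hypergeo :: "real list \<Rightarrow> real list \<Rightarrow> real \<Rightarrow> real" where
  "hypergeo as bs z = eval_fps (fps_hypergeo as bs 1) z"

lemma hypergeo_2_1:
  "hypergeo [p, q] [c] z =
     (\<Sum>n. pochhammer p n * pochhammer q n / (pochhammer c n * fact n) * z ^ n)"
  by (simp add: hypergeo_def eval_fps_def)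

definition bessel_term :: "real \<Rightarrow> real \<Rightarrow> real \<Rightarrow> real \<Rightarrow> real \<Rightarrow> nat \<Rightarrow> real" where
  "bessel_term \<mu> \<nu> \<alpha> a b n =
     bessel_J \<mu> (real n * a) * bessel_J \<nu> (real n * b) / real n powr \<alpha>"

definition S_bessel :: "real \<Rightarrow> real \<Rightarrow> real \<Rightarrow> real \<Rightarrow> real \<Rightarrow> real" where
  "S_bessel \<mu> \<nu> \<alpha> a b =
     2 powr (\<mu> + \<nu>) / (a powr \<mu> * b powr \<nu>) * (\<Sum>n. bessel_term \<mu> \<nu> \<alpha> a b (Suc n))"

definition F_hat :: "real \<Rightarrow> real \<Rightarrow> real \<Rightarrow> real \<Rightarrow> real \<Rightarrow> real" where
  "F_hat \<mu> \<nu> \<alpha> a b =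
     (a / 2) powr ((\<alpha> - \<mu> - \<nu>) - 1) * Gamma (\<mu> / 2 + \<nu> / 2 + 1 / 2 - \<alpha> / 2) / 2
       * rGamma (1 + \<nu>) * rGamma (\<mu> / 2 - \<nu> / 2 + \<alpha> / 2 + 1 / 2)
       * hypergeo [(\<mu> + \<nu> + 1 - \<alpha>) / 2, (\<nu> - \<mu> + 1 - \<alpha>) / 2] [1 + \<nu>] (b\<^sup>2 / a\<^sup>2)"

text \<open>
  The argument \<open>\<xi>\<close> below is the parameter $\chi = b^2/a^2$: the Greek letter chi itself is a
  binder (vector abstraction) in HOL-Analysis. Similarly \<open>\<theta>\<close> stands for
  $\vartheta = \alpha - \mu - \nu$.
\<close>

definition F_poly :: "real \<Rightarrow> nat \<Rightarrow> real \<Rightarrow> real \<Rightarrow> real" where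
  "F_poly \<nu> m \<mu> \<xi> = hypergeo [- real m, - real m - \<mu>] [1 + \<nu>] \<xi>"

definition B_coeff :: "real \<Rightarrow> real \<Rightarrow> real \<Rightarrow> real \<Rightarrow> nat \<Rightarrow> real" where
  "B_coeff \<mu> \<nu> \<theta> \<xi> m =
     (- 1) ^ m * zeta_real (\<theta> - 2 * real m) / (fact m * Gamma (1 + \<mu> + real m))
       * F_poly \<nu> m \<mu> \<xi>"

definition Upsilon_hat :: "real \<Rightarrow> nat \<Rightarrow> real \<Rightarrow> real" where
  "Upsilon_hat \<mu> N a = euler_mascheroni - ln (a / 2)
     + Digamma (real N + 1 + \<mu>) / 2 + Digamma (real N + 1) / 2"

definition D_coeff :: "nat \<Rightarrow> nat \<Rightarrow> real \<Rightarrow> real" where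
  "D_coeff r N \<mu> =
     fact r * (\<Sum>k<r. 1 / (real N - real k) + 1 / (real N + \<mu> - real k))"

definition Delta :: "real \<Rightarrow> real \<Rightarrow> nat \<Rightarrow> real \<Rightarrow> real" where
  "Delta \<mu> \<nu> N \<xi> =
     (\<Sum>r=1..N. (real N gchoose r) * ((real N + \<mu>) gchoose r) * D_coeff r N \<mu> * \<xi> ^ r
        / pochhammer (1 + \<nu>) r)
     + pochhammer \<mu> (N + 1) * \<xi> ^ (N + 1) / (pochhammer (1 + \<nu>) (N + 1) * (real N + 1))
       * hypergeo [1, 1, 1 - \<mu>] [real N + \<nu> + 2, real N + 2] \<xi>"

end

theory Submission
  imports Defs "HOL-Complex_Analysis.Complex_Analysis" "HOL-Real_Asymp.Real_Asymp"
begin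

text \<open>
Put \<open>j\<^sub>\<nu>(x) = (2/x)^\<nu> J\<^sub>\<nu>(x)\<close>, an even entire function. The factor in front of the sum removes all
  non-integral powers: the quantity to be computed is
  \<open>\<Sum>n\<ge>1. j\<^sub>\<mu>(n a) j\<^sub>\<nu>(n b) / n^\<theta>\<close> with a non-negative integer \<open>\<theta> = \<alpha> - \<mu> - \<nu>\<close>.

  Poisson's integral exhibits \<open>j\<^sub>\<nu>(x)\<close> as an average of \<open>cos (x t)\<close> over \<open>-1 \<le> t \<le> 1\<close>. The addition
  theorem of the cosine therefore turns the sum into a double average, over \<open>s\<close> and \<open>t\<close>, of the cosine
  series \<open>\<Sum>n\<ge>1. cos (n x) / n^\<theta>\<close> at \<open>x = a s + b t\<close>. As \<open>|x| \<le> a + b\<close>, this is the range in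
  which that series is explicitly known: for \<open>|x| < 2\<pi>\<close> it is a power series with coefficients
  \<open>(-1)^m \<zeta>(\<theta> - 2 m) / (2 m)!\<close> plus one singular function, which is a multiple of \<open>|x|^(\<theta> - 1)\<close> for even
  \<open>\<theta>\<close> and of \<open>x^(\<theta> - 1) (H - log |x|)\<close>, with a harmonic number \<open>H\<close>, for odd \<open>\<theta>\<close>
  (\<open>cos_series_kernel\<close>). The averages of the powers
  \<open>x^(2 m)\<close> are the terms \<open>B\<^sub>m\<close> (\<open>mean_power_F_poly\<close>). The average of the singular function is the
  remaining term: it is \<open>F_hat\<close> for even \<open>\<theta>\<close> (\<open>F_hat_eq\<close>) and
  the expression in \<open>Upsilon_hat\<close> and \<open>Delta\<close> for odd \<open>\<theta>\<close> (\<open>bessel_series_sing_odd\<close>).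

  The average of the singular function over \<open>s\<close> alone, as a function of \<open>y = b t\<close>, satisfies a
  second order differential equation of Gegenbauer type whose singular points are \<open>y = \<plusminus>a\<close>. Being
  even and regular for \<open>|y| < a\<close>, it is determined by its value at \<open>0\<close>, a known moment, and its Taylor
  coefficients obey a two-term recursion (\<open>poisson_avg_sing_kernel\<close>). The hypothesis \<open>\<xi> < 1\<close>, that
  is \<open>b < a\<close>, is what makes the expansion converge.

  Three points need extra care. First, the differential equation needs a singular function with two continuous
  derivatives, that is \<open>\<theta> \<ge> 4\<close>, but the theorem covers all \<open>\<theta> \<ge> 0\<close>. Smaller \<open>\<theta>\<close> are reached by differentiating the identity with respect to \<open>b\<close>: the
  two differentiation rules of Bessel functions, applied one after the other, lower \<open>\<theta>\<close> by \<open>2\<close> and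
  restore \<open>\<nu>\<close> (\<open>schlomilch_sum_descent\<close>). The decay \<open>j\<^sub>\<nu>(x) = O(x^(-\<nu> - 1/2))\<close> together with \<open>\<alpha> > 0\<close> gives the
  uniform convergence that this requires. Second, the case \<open>a + b = 2\<pi>\<close> is
  obtained as a limit \<open>b' \<rightarrow> b\<close> from below, where the series over \<open>m\<close> is handled by monotone
  convergence, because its terms with \<open>2 m > \<theta>\<close> all have the same sign and increase with \<open>b\<close>. Third, the zeta
  function is only given by its characterisation, so its continuation has to be constructed, and its
  values at the non-positive integers have to be found; their generating function
  is \<open>1/w + e^w / (1 - e^w)\<close>, which yields both the cosine series and the signs just mentioned.
\<close>

section \<open>Series of Bessel type\<close>

text \<open>The choice \<open>s r = (-1)^r\<close> gives \<open>(2/x)^\<nu> J\<^sub>\<nu>(x)\<close>. General coefficients are admitted because the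
right-hand sides of the final identities have the same shape, and the differentiation rules of Bessel
functions hold for all of them.\<close>

definition bessel_series :: "real \<Rightarrow> (nat \<Rightarrow> real) \<Rightarrow> real \<Rightarrow> real" where
  "bessel_series \<nu> s x = (\<Sum>r. s r / fact r * rGamma (\<nu> + real r + 1) * (x / 2) ^ (2 * r))"

text \<open>Absolute convergence of the cosine-like series \<open>\<Sum>r. s r x^(2 r) / (2 r)!\<close>, whose terms dominate those of every
\<open>bessel_series \<nu> s\<close> up to a constant factor.\<close>

definition even_conv :: "real \<Rightarrow> (nat \<Rightarrow> real) \<Rightarrow> bool" where
  "even_conv B s \<longleftrightarrow> (\<forall>x. 0 \<le> x \<longrightarrow> x < B \<longrightarrow> summable (\<lambda>r. \<bar>s r\<bar> * x ^ (2 * r) / fact (2 * r)))"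

text \<open>The average of \<open>t^(2 r)\<close> in Poisson's integral. Multiplication of the \<open>r\<close>-th coefficient by it turns
\<open>\<Sum>r. s r x^(2 r) / (2 r)!\<close> into \<open>bessel_series \<nu> s x\<close>.\<close>

definition sin_moment :: "real \<Rightarrow> nat \<Rightarrow> real" where
  "sin_moment \<nu> r = fact (2 * r) / (4 ^ r * fact r) * rGamma (\<nu> + real r + 1)"

lemma rGamma_pos_real: "(x::real) > 0 \<Longrightarrow> rGamma x > 0"
  by (simp add: rGamma_inverse_Gamma)

lemma sin_moment_nonneg: "\<nu> \<ge> - 1/2 \<Longrightarrow> 0 \<le> sin_moment \<nu> r"
  unfolding sin_moment_def by (intro mult_nonneg_nonneg less_imp_le[OF rGamma_pos_real]) auto

lemma sin_moment_0: "sin_moment \<nu> 0 = rGamma (\<nu> + 1)"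
  by (simp add: sin_moment_def)

lemma sin_moment_Suc:
  assumes "\<nu> \<ge> - 1/2"
  shows "sin_moment \<nu> (Suc r) = (real r + 1/2) / (\<nu> + real r + 1) * sin_moment \<nu> r"
proof -
  have "rGamma (\<nu> + real r + 1) = (\<nu> + real r + 1) * rGamma (\<nu> + real (Suc r) + 1)"
    using rGamma_plus1[of "\<nu> + real r + 1"] by (simp add: add_ac)
  moreover have "\<nu> + real r + 1 \<noteq> 0" using assms by linarith
  moreover have "(fact (2 * Suc r) :: real) / (4 ^ Suc r * fact (Suc r)) 
     = (real r + 1/2) * (fact (2 * r) / (4 ^ r * fact r))"
    by (simp add: divide_simps) (simp add: algebra_simps)
  ultimately show ?thesis
    unfolding sin_moment_def by simp
qed

lemma sin_moment_le:
  assumes "\<nu> \<ge> - 1/2"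
  shows "sin_moment \<nu> r \<le> rGamma (\<nu> + 1)"
proof (induction r)
  case (Suc r)
  have "(real r + 1/2) / (\<nu> + real r + 1) \<le> 1" using assms by (simp add: field_simps)
  moreover have "sin_moment \<nu> r \<ge> 0" using assms by (rule sin_moment_nonneg)
  ultimately have "sin_moment \<nu> (Suc r) \<le> sin_moment \<nu> r"
    unfolding sin_moment_Suc[OF assms] using mult_right_mono[of _ 1 "sin_moment \<nu> r"] by (metis mult_1)
  with Suc show ?case by simp
qed (simp add: sin_moment_0)

lemma bessel_series_term:
  "s r / fact r * rGamma (\<nu> + real r + 1) * (x / 2) ^ (2 * r) =
     sin_moment \<nu> r * (s r * x ^ (2 * r) / fact (2 * r))"
proof -
  have "(2::real) ^ (2 * r) = 4 ^ r" by (simp add: power_mult)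
  thus ?thesis by (simp add: sin_moment_def power_divide field_simps)
qed

lemma bessel_series_summable:
  assumes "even_conv B s" "\<bar>x\<bar> < B" "\<nu> \<ge> - 1/2"
  shows "summable (\<lambda>r. \<bar>s r / fact r * rGamma (\<nu> + real r + 1) * (x / 2) ^ (2 * r)\<bar>)"
proof -
  have "summable (\<lambda>r. rGamma (\<nu> + 1) * (\<bar>s r\<bar> * \<bar>x\<bar> ^ (2 * r) / fact (2 * r)))"
    using assms by (intro summable_mult) (auto simp: even_conv_def)
  thus ?thesis
  proof (rule summable_comparison_test'[of _ 0])
    fix r :: nat
    have "sin_moment \<nu> r * (\<bar>s r\<bar> * \<bar>x\<bar> ^ (2 * r) / fact (2 * r)) \<le>
            rGamma (\<nu> + 1) * (\<bar>s r\<bar> * \<bar>x\<bar> ^ (2 * r) / fact (2 * r))"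
      by (intro mult_right_mono sin_moment_le assms) simp
    thus "norm \<bar>s r / fact r * rGamma (\<nu> + real r + 1) * (x / 2) ^ (2 * r)\<bar> \<le>
            rGamma (\<nu> + 1) * (\<bar>s r\<bar> * \<bar>x\<bar> ^ (2 * r) / fact (2 * r))"
      unfolding bessel_series_term using sin_moment_nonneg[OF assms(3), of r]
      by (simp add: abs_mult power_abs)
  qed
qed

lemma bessel_series_sums:
  assumes "even_conv B s" "\<bar>x\<bar> < B" "\<nu> \<ge> - 1/2"
  shows "(\<lambda>r. s r / fact r * rGamma (\<nu> + real r + 1) * (x / 2) ^ (2 * r)) sums bessel_series \<nu> s x"
  unfolding bessel_series_def
  by (rule summable_sums, rule summable_rabs_cancel, rule bessel_series_summable[OF assms])

lemma bessel_series_cmult: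
  assumes "even_conv B s" "\<bar>x\<bar> < B" "\<nu> \<ge> - 1/2"
  shows "bessel_series \<nu> (\<lambda>r. c * s r) x = c * bessel_series \<nu> s x"
proof -
  have "(\<lambda>r. c * s r / fact r * rGamma (\<nu> + real r + 1) * (x / 2) ^ (2 * r)) sums (c * bessel_series \<nu> s x)"
    using sums_mult[OF bessel_series_sums[OF assms], of c] by (simp add: mult.assoc)
  thus ?thesis unfolding bessel_series_def[of _ "\<lambda>r. c * s r"] by (rule sums_unique[symmetric])
qed

lemma bessel_series_minus:
  assumes "even_conv B s" "\<bar>x\<bar> < B" "\<nu> \<ge> - 1/2"
  shows "bessel_series \<nu> (\<lambda>r. - s r) x = - bessel_series \<nu> s x"
proof -
  have "(\<lambda>r. - s r) = (\<lambda>r. - 1 * s r)" by simp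
  thus ?thesis using bessel_series_cmult[OF assms, of "-1"] by (simp only: mult_minus1)
qed

lemma even_conv_shift:
  assumes "even_conv B s"
  shows "even_conv B (\<lambda>r. s (Suc r))"
  unfolding even_conv_def
proof (intro allI impI)
  fix x :: real assume x: "0 \<le> x" "x < B"
  define c where "c r = \<bar>s r\<bar> / fact (2 * r)" for r
  define d where "d = diffs c"
  have 0: "summable (\<lambda>r. c r * t ^ r)" if "norm t < B\<^sup>2" "0 \<le> t" for t
  proof -
    have "0 \<le> B" using x by linarith
    moreover have "t < B\<^sup>2" using that by simp
    ultimately have "sqrt t < B" by (intro real_less_lsqrt)
    moreover have "0 \<le> sqrt t" using that(2) by (rule real_sqrt_ge_zero)
    ultimately have "summable (\<lambda>r. \<bar>s r\<bar> * sqrt t ^ (2 * r) / fact (2 * r))"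
      using assms unfolding even_conv_def by blast
    moreover have "sqrt t ^ (2 * r) = t ^ r" for r using that(2) by (simp add: power_mult)
    ultimately show ?thesis by (simp add: c_def)
  qed
  have 1: "summable (\<lambda>r. c r * t ^ r)" if "norm t < B\<^sup>2" for t
    by (rule summable_comparison_test'[OF 0[of "\<bar>t\<bar>"], of 0]) (use that in \<open>auto simp: abs_mult c_def power_abs\<close>)
  have 2: "summable (\<lambda>r. d r * t ^ r)" if "norm t < B\<^sup>2" for t
    unfolding d_def by (rule termdiff_converges[OF that 1])
  have 3: "summable (\<lambda>r. diffs d r * t ^ r)" if "norm t < B\<^sup>2" for t
    by (rule termdiff_converges[OF that 2])
  define t where "t = x\<^sup>2"
  have t: "norm t < B\<^sup>2" using x by (simp add: t_def power_strict_mono)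
  have "summable (\<lambda>r. real (Suc r) * d (Suc r) * t ^ (Suc r))"
    using summable_mult[OF 3[OF t], of t] by (simp add: diffs_def mult_ac)
  hence "summable (\<lambda>r. real r * d r * t ^ r)"
    by (subst (asm) summable_Suc_iff)
  from summable_add[OF this 2[OF t]] have "summable (\<lambda>r. 4 * ((real r + 1) * d r * t ^ r))"
    by (intro summable_mult) (simp add: algebra_simps)
  thus "summable (\<lambda>r. \<bar>s (Suc r)\<bar> * x ^ (2 * r) / fact (2 * r))"
  proof (rule summable_comparison_test'[of _ 0])
    fix r :: nat
    have "(2 * real r + 1) * (2 * real r + 2) \<le> 4 * ((real r + 1) * (real r + 1))"
      by (simp add: algebra_simps)
    hence "\<bar>s (Suc r)\<bar> * x ^ (2 * r) / fact (2 * Suc r) * ((2 * real r + 1) * (2 * real r + 2))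
       \<le> \<bar>s (Suc r)\<bar> * x ^ (2 * r) / fact (2 * Suc r) * (4 * ((real r + 1) * (real r + 1)))"
      by (intro mult_left_mono) (auto simp: x)
    moreover have "\<bar>s (Suc r)\<bar> * x ^ (2 * r) / fact (2 * r) =
        \<bar>s (Suc r)\<bar> * x ^ (2 * r) / fact (2 * Suc r) * ((2 * real r + 1) * (2 * real r + 2))"
      by (simp add: divide_simps) (simp add: algebra_simps)
    moreover have "\<bar>s (Suc r)\<bar> * x ^ (2 * r) / fact (2 * Suc r) * (4 * ((real r + 1) * (real r + 1)))
         = 4 * ((real r + 1) * d r * t ^ r)"
      by (simp add: d_def c_def diffs_def t_def power_mult[symmetric] mult_ac add_ac)
    ultimately show "norm (\<bar>s (Suc r)\<bar> * x ^ (2 * r) / fact (2 * r)) \<le> 4 * ((real r + 1) * d r * t ^ r)"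
      by (simp add: x)
  qed
qed

lemma bessel_series_split:
  assumes "even_conv B s" "\<bar>x\<bar> < B" "\<nu> \<ge> - 1/2"
  shows "bessel_series \<nu> s x = (\<nu> + 1) * bessel_series (\<nu> + 1) s x
           + (x / 2)\<^sup>2 * bessel_series (\<nu> + 2) (\<lambda>r. s (Suc r)) x"
proof -
  let ?f = "\<lambda>r. s r / fact r * rGamma (\<nu> + real r + 2) * real r * (x / 2) ^ (2 * r)"
  have "(\<lambda>r. (x/2)\<^sup>2 * (s (Suc r) / fact r * rGamma ((\<nu> + 2) + real r + 1) * (x / 2) ^ (2 * r))) sums
          ((x / 2)\<^sup>2 * bessel_series (\<nu> + 2) (\<lambda>r. s (Suc r)) x)"
    by (intro sums_mult bessel_series_sums[OF even_conv_shift[OF assms(1)] assms(2)]) (use assms in auto)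
  also have "(\<lambda>r. (x/2)\<^sup>2 * (s (Suc r) / fact r * rGamma ((\<nu> + 2) + real r + 1) * (x / 2) ^ (2 * r))) =
     (\<lambda>r. ?f (Suc r))"
  proof
    fix r :: nat
    have 1: "1 / fact r = real (Suc r) / fact (Suc r)" by simp
    have 2: "(x / 2) ^ (2 * Suc r) = (x / 2)\<^sup>2 * (x / 2) ^ (2 * r)" by (simp add: power2_eq_square)
    have 3: "\<nu> + real (Suc r) + 2 = (\<nu> + 2) + real r + 1" by simp
    have "(x/2)\<^sup>2 * (s (Suc r) / fact r * rGamma ((\<nu> + 2) + real r + 1) * (x / 2) ^ (2 * r)) =
       s (Suc r) * (1 / fact r) * rGamma ((\<nu> + 2) + real r + 1) * ((x/2)\<^sup>2 * (x / 2) ^ (2 * r))" by simp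
    also have "\<dots> = ?f (Suc r)" unfolding 1 2 3 by (simp del: fact_Suc of_nat_Suc)
    finally show "(x/2)\<^sup>2 * (s (Suc r) / fact r * rGamma ((\<nu> + 2) + real r + 1) * (x / 2) ^ (2 * r)) = ?f (Suc r)" .
  qed
  finally have 1: "?f sums ((x / 2)\<^sup>2 * bessel_series (\<nu> + 2) (\<lambda>r. s (Suc r)) x)"
    by (subst (asm) sums_Suc_iff) simp
  have 2: "(\<lambda>r. (\<nu> + 1) * (s r / fact r * rGamma ((\<nu> + 1) + real r + 1) * (x / 2) ^ (2 * r))) sums
      ((\<nu> + 1) * bessel_series (\<nu> + 1) s x)"
    by (intro sums_mult bessel_series_sums[OF assms(1,2)]) (use assms in auto)
  have "rGamma (\<nu> + real r + 1) = (\<nu> + real r + 1) * rGamma (\<nu> + real r + 2)" for r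
    using rGamma_plus1[of "\<nu> + real r + 1"] by (simp add: add_ac)
  hence "(\<lambda>r. s r / fact r * rGamma (\<nu> + real r + 1) * (x / 2) ^ (2 * r)) =
    (\<lambda>r. (\<nu> + 1) * (s r / fact r * rGamma ((\<nu> + 1) + real r + 1) * (x / 2) ^ (2 * r)) + ?f r)"
    by (auto simp: fun_eq_iff algebra_simps add_divide_distrib)
  with sums_add[OF 2 1] have "(\<lambda>r. s r / fact r * rGamma (\<nu> + real r + 1) * (x / 2) ^ (2 * r)) sums
    ((\<nu> + 1) * bessel_series (\<nu> + 1) s x + (x / 2)\<^sup>2 * bessel_series (\<nu> + 2) (\<lambda>r. s (Suc r)) x)"
    by simp
  with bessel_series_sums[OF assms] show ?thesis by (rule sums_unique2)
qed

text \<open>The analogue of \<open>(x^(-\<nu>) J\<^sub>\<nu>)' = - x^(-\<nu>) J\<^sub>(\<nu>+1)\<close>: the index rises by one and the coefficients move by one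
place.\<close>

lemma DERIV_bessel_series:
  assumes "even_conv B s" "\<bar>x\<bar> < B" "\<nu> \<ge> - 1/2"
  shows "(bessel_series \<nu> s has_real_derivative (x / 2) * bessel_series (\<nu> + 1) (\<lambda>r. s (Suc r)) x) (at x)"
proof -
  define c where "c r = s r / fact r * rGamma (\<nu> + real r + 1)" for r
  have conv: "summable (\<lambda>r. c r * t ^ r)" if "norm t < (B / 2)\<^sup>2" for t
  proof -
    have "sqrt \<bar>t\<bar> < \<bar>B / 2\<bar>"
    proof (rule real_less_lsqrt)
      show "\<bar>t\<bar> < \<bar>B / 2\<bar>\<^sup>2" using that by (simp only: power2_abs real_norm_def)
    qed simp
    hence "\<bar>2 * sqrt \<bar>t\<bar>\<bar> < B" using assms(2) by auto
    from bessel_series_summable[OF assms(1) this assms(3)]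
    have "summable (\<lambda>r. \<bar>c r * t ^ r\<bar>)" by (simp add: c_def power_mult power_abs abs_mult)
    thus ?thesis by (rule summable_rabs_cancel)
  qed
  have "norm ((x / 2)\<^sup>2) < (B / 2)\<^sup>2"
    using assms(2) power_strict_mono[of "\<bar>x\<bar> / 2" "B / 2" 2] by (simp add: power_divide)
  from termdiffs_strong'[OF conv this]
  have "((\<lambda>t. \<Sum>r. c r * t ^ r) has_real_derivative (\<Sum>r. diffs c r * ((x / 2)\<^sup>2) ^ r)) (at ((x / 2)\<^sup>2))" .
  moreover have "((\<lambda>x::real. (x / 2)\<^sup>2) has_real_derivative x / 2) (at x)"
    by (auto intro!: derivative_eq_intros)
  ultimately have "((\<lambda>x. \<Sum>r. c r * ((x / 2)\<^sup>2) ^ r) has_real_derivative (\<Sum>r. diffs c r * ((x / 2)\<^sup>2) ^ r) * (x / 2)) (at x)"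
    by (rule DERIV_chain2)
  moreover have "(\<lambda>x. \<Sum>r. c r * ((x / 2)\<^sup>2) ^ r) = bessel_series \<nu> s"
    by (simp add: bessel_series_def c_def power_mult fun_eq_iff)
  moreover have "(\<Sum>r. diffs c r * ((x / 2)\<^sup>2) ^ r) = bessel_series (\<nu> + 1) (\<lambda>r. s (Suc r)) x"
  proof -
    have "real (Suc r) * (s (Suc r) / fact (Suc r) * G) = s (Suc r) / fact r * G" for r G by simp
    moreover have "\<nu> + real (Suc r) + 1 = \<nu> + 1 + real r + 1" for r by simp
    ultimately show ?thesis unfolding bessel_series_def diffs_def c_def power_mult by (simp only:)
  qed
  ultimately show ?thesis by (simp only: mult.commute)
qed

text \<open>The analogue of \<open>(x^(\<nu>+1) J\<^sub>(\<nu>+1))' = x^(\<nu>+1) J\<^sub>\<nu>\<close>: the index falls by one and the coefficients stay.\<close>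

lemma DERIV_powr_bessel_series:
  assumes "even_conv B s" "0 < x" "x < B" "\<nu> \<ge> - 1/2"
  shows "((\<lambda>x. x powr (2 * \<nu> + 2) * bessel_series (\<nu> + 1) s x) has_real_derivative
            2 * x powr (2 * \<nu> + 1) * bessel_series \<nu> s x) (at x)"
proof -
  have "\<bar>x\<bar> < B" using assms by simp
  have "\<nu> + 1 \<ge> - 1/2" using assms by simp
  note D = DERIV_bessel_series[OF assms(1) \<open>\<bar>x\<bar> < B\<close> this]
  have p: "x powr (2 * \<nu> + 2) = x powr (2 * \<nu> + 1) * x"
    using assms powr_add[of x "2 * \<nu> + 1" 1] by (simp add: add_ac)
  have e: "2 * \<nu> + 2 - 1 = 2 * \<nu> + 1" "\<nu> + 1 + 1 = \<nu> + 2" by simp_all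
  have "((\<lambda>x. x powr (2 * \<nu> + 2) * bessel_series (\<nu> + 1) s x) has_real_derivative
      (2 * \<nu> + 2) * x powr (2 * \<nu> + 1) * bessel_series (\<nu> + 1) s x
      + (x / 2) * bessel_series (\<nu> + 2) (\<lambda>r. s (Suc r)) x * x powr (2 * \<nu> + 2)) (at x)"
    using DERIV_mult[OF has_real_derivative_powr[OF assms(2), of "2 * \<nu> + 2"] D] unfolding e .
  also have "(2 * \<nu> + 2) * x powr (2 * \<nu> + 1) * bessel_series (\<nu> + 1) s x
      + (x / 2) * bessel_series (\<nu> + 2) (\<lambda>r. s (Suc r)) x * x powr (2 * \<nu> + 2) =
      2 * x powr (2 * \<nu> + 1) * bessel_series \<nu> s x"
    unfolding p bessel_series_split[OF assms(1) \<open>\<bar>x\<bar> < B\<close> assms(4)]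
    by (simp add: algebra_simps power2_eq_square)
  finally show ?thesis .
qed

lemma isCont_bessel_series:
  assumes "even_conv B s" "\<bar>x\<bar> < B" "\<nu> \<ge> - 1/2"
  shows "isCont (bessel_series \<nu> s) x"
  by (rule DERIV_isCont, rule DERIV_bessel_series[OF assms])

lemma even_conv_alt: "even_conv B (\<lambda>r. (-1) ^ r)"
  unfolding even_conv_def
proof (intro allI impI)
  fix x :: real assume "0 \<le> x"
  have "summable (\<lambda>n. x ^ n / fact n)" using summable_exp[of x] by (simp add: field_simps)
  hence "summable (\<lambda>r. \<bar>x ^ (2*r) / fact (2*r)\<bar>)"
    using \<open>0 \<le> x\<close> summable_reindex[of "\<lambda>n. x ^ n / fact n" "\<lambda>r. 2*r"] 
    by (simp add: o_def inj_on_def)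
  thus "summable (\<lambda>r. \<bar>(- 1) ^ r\<bar> * x ^ (2 * r) / fact (2 * r))"
    using \<open>0 \<le> x\<close> by (simp add: power_abs)
qed

section \<open>Bessel functions\<close>

abbreviation bessel_even :: "real \<Rightarrow> real \<Rightarrow> real" where
  "bessel_even \<nu> \<equiv> bessel_series \<nu> (\<lambda>r. (- 1) ^ r)"

lemma bessel_J_eq: "bessel_J \<nu> x = (x / 2) powr \<nu> * bessel_even \<nu> x"
  by (simp add: bessel_J_def bessel_series_def)

lemma bessel_even_shift:
  assumes "\<nu> \<ge> - 1/2"
  shows "bessel_series \<nu> (\<lambda>r. (- 1) ^ Suc r) x = - bessel_even \<nu> x"
proof -
  have "\<bar>x\<bar> < \<bar>x\<bar> + 1" by simp
  from bessel_series_minus[OF even_conv_alt this assms] show ?thesis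
    by (simp only: power_Suc mult_minus1)
qed

lemma DERIV_bessel_even:
  assumes "\<nu> \<ge> - 1/2"
  shows "(bessel_even \<nu> has_real_derivative - (x / 2) * bessel_even (\<nu> + 1) x) (at x)"
proof -
  have "\<bar>x\<bar> < \<bar>x\<bar> + 1" "\<nu> + 1 \<ge> - 1/2" using assms by simp_all
  note * = this
  from DERIV_bessel_series[OF even_conv_alt *(1) assms]
  show ?thesis unfolding bessel_even_shift[OF *(2)] by (simp only: mult_minus_left mult_minus_right)
qed

lemma bessel_even_split:
  assumes "\<nu> \<ge> - 1/2"
  shows "bessel_even \<nu> x = (\<nu> + 1) * bessel_even (\<nu> + 1) x - (x / 2)\<^sup>2 * bessel_even (\<nu> + 2) x"
proof -
  have "\<bar>x\<bar> < \<bar>x\<bar> + 1" "\<nu> + 2 \<ge> - 1/2" using assms by simp_all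
  note * = this
  from bessel_series_split[OF even_conv_alt *(1) assms]
  show ?thesis unfolding bessel_even_shift[OF *(2)] by (simp only: mult_minus_right diff_conv_add_uminus)
qed

lemma continuous_on_bessel_even: "\<nu> \<ge> - 1/2 \<Longrightarrow> continuous_on A (bessel_even \<nu>)"
  by (intro continuous_at_imp_continuous_on ballI, rule DERIV_isCont, rule DERIV_bessel_even)

text \<open>The function \<open>u x = x^(\<nu>+1/2) j\<^sub>\<nu>(x)\<close> satisfies \<open>u'' = - (1 - (\<nu>\<^sup>2 - 1/4) / x\<^sup>2) u\<close>, an integrable perturbation of
the harmonic oscillator. Hence its energy \<open>u'\<^sup>2 + u\<^sup>2\<close>, corrected by the factor \<open>exp (c / x)\<close>, does not
increase, and \<open>u\<close> is bounded.\<close>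

lemma bessel_even_bound:
  assumes "\<nu> \<ge> - 1/2"
  obtains C where "C > 0" "\<And>x. x > 0 \<Longrightarrow> \<bar>bessel_even \<nu> x\<bar> \<le> C * x powr (- \<nu> - 1/2)"
proof -
  define u where "u x = x powr (\<nu> + 1/2) * bessel_even \<nu> x" for x
  define v where "v x = (\<nu> + 1/2) * x powr (\<nu> - 1/2) * bessel_even \<nu> x
                         - x powr (\<nu> + 3/2) / 2 * bessel_even (\<nu> + 1) x" for x
  define c where "c = \<bar>\<nu>\<^sup>2 - 1/4\<bar>"
  have p: "x powr (\<nu> + 1/2) = x powr (\<nu> - 1/2) * x" "x powr (\<nu> + 3/2) = x powr (\<nu> - 1/2) * x\<^sup>2"
    "x powr (\<nu> - 3/2) = x powr (\<nu> - 1/2) / x" if "x > 0" for x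
    using that powr_add[of x "\<nu> - 1/2" 1] powr_add[of x "\<nu> - 1/2" 2] powr_diff[of x "\<nu> - 1/2" 1]
    by (simp_all add: add_ac)
  have P: "((\<lambda>x. x powr p) has_real_derivative p * x powr (p - 1)) (at x)" if "x > 0" for x p :: real
    using that by (rule has_real_derivative_powr)
  have e: "\<nu> + 1/2 - 1 = \<nu> - 1/2" "\<nu> - 1/2 - 1 = \<nu> - 3/2" "\<nu> + 3/2 - 1 = \<nu> + 1/2" by simp_all
  have Du: "(u has_real_derivative v x) (at x)" if "x > 0" for x
  proof -
    have "(u has_real_derivative (\<nu> + 1/2) * x powr (\<nu> - 1/2) * bessel_even \<nu> x
        + - (x / 2) * bessel_even (\<nu> + 1) x * x powr (\<nu> + 1/2)) (at x)"
      unfolding u_def using DERIV_mult[OF P[OF that, of "\<nu> + 1/2"] DERIV_bessel_even[OF assms, of x]]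
      unfolding e .
    also have "(\<nu> + 1/2) * x powr (\<nu> - 1/2) * bessel_even \<nu> x
        + - (x / 2) * bessel_even (\<nu> + 1) x * x powr (\<nu> + 1/2) = v x"
      unfolding v_def p[OF that] by (simp add: power2_eq_square)
    finally show ?thesis .
  qed
  have Dv: "(v has_real_derivative - (1 - (\<nu>\<^sup>2 - 1/4) / x\<^sup>2) * u x) (at x)" if "x > 0" for x
  proof -
    define q where "q = x powr (\<nu> - 1/2)"
    define j0 j1 j2 where "j0 = bessel_even \<nu> x" and "j1 = bessel_even (\<nu> + 1) x" and "j2 = bessel_even (\<nu> + 2) x"
    have "\<nu> + 1 \<ge> - 1/2" using assms by simp
    note D1 = DERIV_bessel_even[OF this, of x]
    have e2: "\<nu> + 1 + 1 = \<nu> + 2" by simp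
    have j2: "(x / 2)\<^sup>2 * j2 = (\<nu> + 1) * j1 - j0"
      using bessel_even_split[OF assms, of x] by (simp add: j0_def j1_def j2_def)
    have "((\<lambda>x. (\<nu> + 1/2) * (x powr (\<nu> - 1/2) * bessel_even \<nu> x)
                         - (1/2) * (x powr (\<nu> + 3/2) * bessel_even (\<nu> + 1) x)) has_real_derivative 
       (\<nu> + 1/2) * ((\<nu> - 1/2) * x powr (\<nu> - 3/2) * bessel_even \<nu> x
         + - (x / 2) * bessel_even (\<nu> + 1) x * x powr (\<nu> - 1/2))
       - (1/2) * ((\<nu> + 3/2) * x powr (\<nu> + 1/2) * bessel_even (\<nu> + 1) x 
          + - (x / 2) * bessel_even (\<nu> + 2) x * x powr (\<nu> + 3/2))) (at x)"
      using DERIV_diff[OF DERIV_cmult[OF DERIV_mult[OF P[OF that, of "\<nu> - 1/2"] DERIV_bessel_even[OF assms, of x]], of "\<nu> + 1/2"]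
         DERIV_cmult[OF DERIV_mult[OF P[OF that, of "\<nu> + 3/2"] D1], of "1/2"]]
      unfolding e e2 .
    also have "(\<lambda>x. (\<nu> + 1/2) * (x powr (\<nu> - 1/2) * bessel_even \<nu> x)
                         - (1/2) * (x powr (\<nu> + 3/2) * bessel_even (\<nu> + 1) x)) = v"
      unfolding v_def by (simp add: fun_eq_iff)
    also have "(\<nu> + 1/2) * ((\<nu> - 1/2) * x powr (\<nu> - 3/2) * bessel_even \<nu> x
         + - (x / 2) * bessel_even (\<nu> + 1) x * x powr (\<nu> - 1/2))
       - (1/2) * ((\<nu> + 3/2) * x powr (\<nu> + 1/2) * bessel_even (\<nu> + 1) x 
          + - (x / 2) * bessel_even (\<nu> + 2) x * x powr (\<nu> + 3/2))
       = (\<nu> + 1/2) * ((\<nu> - 1/2) * (q / x) * j0 - (x / 2) * j1 * q)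
         - (1/2) * ((\<nu> + 3/2) * (q * x) * j1 - 2 * q * x * ((x / 2)\<^sup>2 * j2))"
      unfolding p[OF that] q_def[symmetric] j0_def[symmetric] j1_def[symmetric] j2_def[symmetric]
      by (simp add: power2_eq_square)
    also have "\<dots> = - (1 - (\<nu>\<^sup>2 - 1/4) / x\<^sup>2) * (q * x * j0)"
      unfolding j2 using that by (simp add: field_simps power2_eq_square)
    also have "q * x * j0 = u x" unfolding u_def p[OF that] by (simp add: q_def j0_def)
    finally show ?thesis .
  qed
  (* the exponential factor absorbs the perturbation term of the energy balance *)
  define E where "E x = ((v x)\<^sup>2 + (u x)\<^sup>2) * exp (c / x)" for x
  have DE: "(E has_real_derivative 
      (2 * v x * u x * (\<nu>\<^sup>2 - 1/4) / x\<^sup>2 - c / x\<^sup>2 * ((v x)\<^sup>2 + (u x)\<^sup>2)) * exp (c / x)) (at x)"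
    if "x > 0" for x
  proof -
    have D1: "((\<lambda>x. (v x)\<^sup>2 + (u x)\<^sup>2) has_real_derivative
        2 * (- (1 - (\<nu>\<^sup>2 - 1/4) / x\<^sup>2) * u x) * v x + 2 * v x * u x) (at x)"
      using DERIV_add[OF DERIV_power[OF Dv[OF that], of 2] DERIV_power[OF Du[OF that], of 2]]
      by (simp only: numeral_2_eq_2 diff_Suc_Suc diff_zero power_Suc power_0 mult_1_right of_nat_Suc of_nat_0 add_0_right)
         (simp add: mult_ac)
    have "((\<lambda>x. c / x) has_real_derivative - c / x\<^sup>2) (at x)"
      using that by (auto intro!: derivative_eq_intros simp: power2_eq_square)
    hence D2: "((\<lambda>x. exp (c / x)) has_real_derivative exp (c / x) * (- c / x\<^sup>2)) (at x)"
      by (rule DERIV_fun_exp)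
    show ?thesis unfolding E_def
      by (rule DERIV_cong[OF DERIV_mult[OF D1 D2]]) (simp add: algebra_simps diff_divide_distrib)
  qed
  have neg: "(2 * v x * u x * (\<nu>\<^sup>2 - 1/4) / x\<^sup>2 - c / x\<^sup>2 * ((v x)\<^sup>2 + (u x)\<^sup>2)) * exp (c / x) \<le> 0" for x
  proof -
    have "2 * v x * u x * (\<nu>\<^sup>2 - 1/4) \<le> c * \<bar>2 * v x * u x\<bar>"
      unfolding c_def by (metis abs_ge_self abs_mult mult.commute)
    also have "\<dots> \<le> c * ((v x)\<^sup>2 + (u x)\<^sup>2)"
    proof (rule mult_left_mono)
      have "0 \<le> (\<bar>v x\<bar> - \<bar>u x\<bar>)\<^sup>2" by simp
      thus "\<bar>2 * v x * u x\<bar> \<le> (v x)\<^sup>2 + (u x)\<^sup>2"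
        by (simp add: power2_diff abs_mult)
    qed (simp add: c_def)
    finally have "2 * v x * u x * (\<nu>\<^sup>2 - 1/4) / x\<^sup>2 \<le> c * ((v x)\<^sup>2 + (u x)\<^sup>2) / x\<^sup>2"
      by (rule divide_right_mono) simp
    thus ?thesis by (intro mult_nonpos_nonneg) simp_all
  qed
  have E_le: "E x \<le> E 1" if "x \<ge> 1" for x
    by (rule DERIV_nonpos_imp_nonincreasing[OF that]) (use DE neg in \<open>meson less_le_trans zero_less_one\<close>)
  have u_le: "\<bar>u x\<bar> \<le> sqrt (E 1)" if "x \<ge> 1" for x
  proof (rule real_le_rsqrt)
    have "(u x)\<^sup>2 \<le> ((v x)\<^sup>2 + (u x)\<^sup>2) * 1" by simp
    also have "\<dots> \<le> E x" unfolding E_def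
      by (intro mult_left_mono) (use that in \<open>auto simp: c_def\<close>)
    finally show "\<bar>u x\<bar>\<^sup>2 \<le> E 1" using E_le[OF that] by simp
  qed
  have "compact (bessel_even \<nu> ` {0..1})"
    by (intro compact_continuous_image continuous_on_bessel_even assms) auto
  hence "bounded (bessel_even \<nu> ` {0..1})" by (rule compact_imp_bounded)
  then obtain M where M: "\<forall>x\<in>{0..1}. \<bar>bessel_even \<nu> x\<bar> \<le> M"
    by (auto simp: bounded_iff)
  define C where "C = max (sqrt (E 1)) (max M 1)"
  show ?thesis
  proof (rule that[of C])
    show "C > 0" by (simp add: C_def)
    fix x :: real assume x: "x > 0"
    have "\<bar>u x\<bar> \<le> C"
    proof (cases "x \<ge> 1")
      case True thus ?thesis using u_le[of x] by (simp add: C_def)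
    next
      case False
      have "x powr (\<nu> + 1/2) \<le> 1" using False x assms by (intro powr_le1) auto
      hence "\<bar>u x\<bar> \<le> 1 * \<bar>bessel_even \<nu> x\<bar>"
        unfolding u_def abs_mult by (intro mult_right_mono) auto
      also have "\<dots> \<le> C" using M[rule_format, of x] False x by (simp add: C_def)
      finally show ?thesis .
    qed
    hence "x powr (- \<nu> - 1/2) * \<bar>u x\<bar> \<le> x powr (- \<nu> - 1/2) * C" by (intro mult_left_mono) auto
    moreover have "x powr (- \<nu> - 1/2) * \<bar>u x\<bar> = \<bar>bessel_even \<nu> x\<bar>"
      using x by (simp add: u_def abs_mult flip: mult.assoc powr_add)
    ultimately show "\<bar>bessel_even \<nu> x\<bar> \<le> C * x powr (- \<nu> - 1/2)" by (simp add: mult.commute)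
  qed
qed

section \<open>Averages against the weight of Poisson's integral\<close>

text \<open>The case \<open>\<nu> = 0\<close> is separated because \<open>0 powr 0 = 0\<close> would make the weight discontinuous at the ends of
the interval.\<close>

definition sin_weight :: "real \<Rightarrow> real \<Rightarrow> real" where
  "sin_weight \<nu> \<phi> = (if \<nu> = 0 then 1 else sin \<phi> powr (2 * \<nu>))"

text \<open>Poisson's integral after the substitution \<open>t = cos \<phi>\<close>, which removes the singularity of
\<open>(1 - t\<^sup>2)^(\<nu> - 1/2)\<close> at the ends. The total mass is \<open>1 / \<Gamma>(\<nu> + 1)\<close>, so that \<open>cos (x t)\<close> averages to
\<open>j\<^sub>\<nu>(x)\<close> without a further factor.\<close>

definition poisson_avg :: "real \<Rightarrow> (real \<Rightarrow> real) \<Rightarrow> real" where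
  "poisson_avg \<nu> f =
     rGamma (\<nu> + 1/2) / sqrt pi * integral {0..pi} (\<lambda>\<phi>. f (cos \<phi>) * sin_weight \<nu> \<phi>)"

lemma continuous_on_sin_weight: "\<nu> \<ge> 0 \<Longrightarrow> continuous_on {0..pi} (sin_weight \<nu>)"
  unfolding sin_weight_def
  by (cases "\<nu> = 0") (auto intro!: continuous_on_powr' continuous_on_sin continuous_on_id continuous_on_const sin_ge_zero)

lemma sin_weight_bounds: "\<nu> \<ge> 0 \<Longrightarrow> \<phi> \<in> {0..pi} \<Longrightarrow> 0 \<le> sin_weight \<nu> \<phi> \<and> sin_weight \<nu> \<phi> \<le> 1"
  using sin_ge_zero[of \<phi>] by (auto simp: sin_weight_def intro!: powr_le1)

lemma sin_weight_reflect: "sin_weight \<nu> (pi - \<phi>) = sin_weight \<nu> \<phi>"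
  by (simp add: sin_weight_def)

lemma continuous_on_poisson_integrand:
  assumes "\<nu> \<ge> 0" "continuous_on {-1..1} f"
  shows "continuous_on {0..pi} (\<lambda>\<phi>. f (cos \<phi>) * sin_weight \<nu> \<phi>)"
proof (rule continuous_on_mult[OF _ continuous_on_sin_weight[OF assms(1)]])
  show "continuous_on {0..pi} (\<lambda>\<phi>. f (cos \<phi>))"
    by (rule continuous_on_compose2[OF assms(2)]) (auto intro!: continuous_intros)
qed

lemma integrable_poisson:
  assumes "\<nu> \<ge> 0" "continuous_on {-1..1} f"
  shows "(\<lambda>\<phi>. f (cos \<phi>) * sin_weight \<nu> \<phi>) integrable_on {0..pi}"
  by (rule integrable_continuous_real, rule continuous_on_poisson_integrand[OF assms])

lemma poisson_avg_cong:
  "(\<And>s. s \<in> {-1..1} \<Longrightarrow> f s = g s) \<Longrightarrow> poisson_avg \<nu> f = poisson_avg \<nu> g"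
  unfolding poisson_avg_def by simp

lemma poisson_avg_add:
  assumes "\<nu> \<ge> 0" "continuous_on {-1..1} f" "continuous_on {-1..1} g"
  shows "poisson_avg \<nu> (\<lambda>s. f s + g s) = poisson_avg \<nu> f + poisson_avg \<nu> g"
  unfolding poisson_avg_def
  by (simp add: distrib_right distrib_left integral_add[OF integrable_poisson integrable_poisson] assms)

lemma poisson_avg_cmult: "poisson_avg \<nu> (\<lambda>s. c * f s) = c * poisson_avg \<nu> f"
  unfolding poisson_avg_def by (simp add: mult.assoc)

lemma poisson_avg_minus: "poisson_avg \<nu> (\<lambda>s. - f s) = - poisson_avg \<nu> f"
  unfolding poisson_avg_def by simp

lemma poisson_avg_diff:
  assumes "\<nu> \<ge> 0" "continuous_on {-1..1} f" "continuous_on {-1..1} g"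
  shows "poisson_avg \<nu> (\<lambda>s. f s - g s) = poisson_avg \<nu> f - poisson_avg \<nu> g"
  unfolding poisson_avg_def
  by (simp add: left_diff_distrib right_diff_distrib integral_diff[OF integrable_poisson integrable_poisson] assms)

lemma poisson_avg_reflect: "poisson_avg \<nu> (\<lambda>s. f (- s)) = poisson_avg \<nu> f"
proof -
  let ?g = "\<lambda>\<phi>. f (cos \<phi>) * sin_weight \<nu> \<phi>"
  have "integral {0..pi} ?g = integral {-pi..-0} (\<lambda>\<phi>. ?g (- \<phi>))"
    by (rule Henstock_Kurzweil_Integration.integral_reflect_real[symmetric])
  also have "\<dots> = integral {0..pi} ((\<lambda>\<phi>. ?g (- \<phi>)) \<circ> (+) (- pi))"
    by (simp add: integral_shift_Icc_real)
  also have "(\<lambda>\<phi>. ?g (- \<phi>)) \<circ> (+) (- pi) = (\<lambda>\<phi>. f (- cos \<phi>) * sin_weight \<nu> \<phi>)"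
    by (auto simp: fun_eq_iff sin_weight_reflect)
  finally show ?thesis by (simp add: poisson_avg_def)
qed

lemma poisson_avg_odd: "(\<And>s. f (- s) = - f s) \<Longrightarrow> poisson_avg \<nu> f = 0"
  using poisson_avg_reflect[of \<nu> f] by (simp add: poisson_avg_minus)

text \<open>An upper bound for the total mass, obtained by replacing the weight by \<open>1\<close>.\<close>

definition poisson_mass :: "real \<Rightarrow> real" where
  "poisson_mass \<nu> = rGamma (\<nu> + 1/2) * sqrt pi"

lemma poisson_mass_pos: "\<nu> \<ge> 0 \<Longrightarrow> poisson_mass \<nu> > 0"
  by (simp add: poisson_mass_def rGamma_pos_real)

lemma poisson_avg_bound:
  assumes "\<nu> \<ge> 0" "continuous_on {-1..1} f" "\<And>s. s \<in> {-1..1} \<Longrightarrow> \<bar>f s\<bar> \<le> M"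
  shows "\<bar>poisson_avg \<nu> f\<bar> \<le> poisson_mass \<nu> * M"
proof -
  have "norm (integral {0..pi} (\<lambda>\<phi>. f (cos \<phi>) * sin_weight \<nu> \<phi>)) \<le> M * (pi - 0)"
  proof (rule integral_bound[OF _ continuous_on_poisson_integrand[OF assms(1,2)]])
    fix t assume t: "t \<in> {0..pi}"
    have "\<bar>f (cos t)\<bar> * sin_weight \<nu> t \<le> M * 1"
      using sin_weight_bounds[OF assms(1) t] assms(3)[of "cos t"] assms(3)[of 0]
      by (intro mult_mono) auto
    thus "norm (f (cos t) * sin_weight \<nu> t) \<le> M"
      using sin_weight_bounds[OF assms(1) t] by (simp add: abs_mult)
  qed simp
  moreover have "rGamma (\<nu> + 1/2) / sqrt pi \<ge> 0" using assms(1) by (simp add: rGamma_pos_real less_imp_le)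
  ultimately have "rGamma (\<nu> + 1/2) / sqrt pi * \<bar>integral {0..pi} (\<lambda>\<phi>. f (cos \<phi>) * sin_weight \<nu> \<phi>)\<bar>
     \<le> rGamma (\<nu> + 1/2) / sqrt pi * (M * pi)"
    by (intro mult_left_mono) auto
  also have "\<dots> = poisson_mass \<nu> * M"
    by (simp add: poisson_mass_def field_simps)
  finally show ?thesis
    using \<open>rGamma (\<nu> + 1/2) / sqrt pi \<ge> 0\<close> unfolding poisson_avg_def abs_mult by (simp only: abs_of_nonneg)
qed

lemma poisson_avg_sums:
  assumes "\<nu> \<ge> 0" "\<And>k. continuous_on {-1..1} (f k)"
    and "\<And>k s. s \<in> {-1..1} \<Longrightarrow> \<bar>f k s\<bar> \<le> M k" "summable M"
  shows "(\<lambda>k. poisson_avg \<nu> (f k)) sums poisson_avg \<nu> (\<lambda>s. \<Sum>k. f k s)"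
    and "continuous_on {-1..1} (\<lambda>s. \<Sum>k. f k s)"
proof -
  have lim: "uniform_limit {-1..1} (\<lambda>n s. \<Sum>k<n. f k s) (\<lambda>s. \<Sum>k. f k s) sequentially"
    by (rule Weierstrass_m_test) (use assms in auto)
  show cont: "continuous_on {-1..1} (\<lambda>s. \<Sum>k. f k s)"
    by (rule uniform_limit_theorem[OF _ lim]) (auto intro!: always_eventually continuous_intros assms)
  have "uniform_limit {0..pi} (\<lambda>n \<phi>. \<Sum>k<n. f k (cos \<phi>) * sin_weight \<nu> \<phi>)
         (\<lambda>\<phi>. \<Sum>k. f k (cos \<phi>) * sin_weight \<nu> \<phi>) sequentially"
  proof (rule Weierstrass_m_test[OF _ assms(4)])
    fix k t assume t: "t \<in> {0..pi}"
    have "\<bar>f k (cos t)\<bar> * sin_weight \<nu> t \<le> M k * 1"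
      using sin_weight_bounds[OF assms(1) t] assms(3)[of "cos t"] assms(3)[of 0 k]
      by (intro mult_mono) auto
    thus "norm (f k (cos t) * sin_weight \<nu> t) \<le> M k"
      using sin_weight_bounds[OF assms(1) t] by (simp add: abs_mult)
  qed
  moreover have "(\<Sum>k. f k (cos \<phi>) * sin_weight \<nu> \<phi>) = (\<Sum>k. f k (cos \<phi>)) * sin_weight \<nu> \<phi>" for \<phi>
  proof (rule suminf_mult2[symmetric], rule summable_rabs_cancel, rule summable_comparison_test'[OF assms(4)])
    fix k show "norm \<bar>f k (cos \<phi>)\<bar> \<le> M k" using assms(3)[of "cos \<phi>"] by simp
  qed
  ultimately have ul: "uniform_limit {0..pi} (\<lambda>n \<phi>. \<Sum>k<n. f k (cos \<phi>) * sin_weight \<nu> \<phi>)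
         (\<lambda>\<phi>. (\<Sum>k. f k (cos \<phi>)) * sin_weight \<nu> \<phi>) sequentially" by simp
  obtain I J where I: "\<And>n. ((\<lambda>\<phi>. \<Sum>k<n. f k (cos \<phi>) * sin_weight \<nu> \<phi>) has_integral I n) {0..pi}"
     and J: "((\<lambda>\<phi>. (\<Sum>k. f k (cos \<phi>)) * sin_weight \<nu> \<phi>) has_integral J) {0..pi}" and IJ: "(I \<longlongrightarrow> J) sequentially"
  proof (rule uniform_limit_integral[OF ul])
    show "continuous_on {0..pi} (\<lambda>\<phi>. \<Sum>k<n. f k (cos \<phi>) * sin_weight \<nu> \<phi>)" for n
      by (intro continuous_on_sum continuous_on_poisson_integrand assms)
  qed auto
  have "I n = (\<Sum>k<n. integral {0..pi} (\<lambda>\<phi>. f k (cos \<phi>) * sin_weight \<nu> \<phi>))" for n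
  proof -
    have "I n = integral {0..pi} (\<lambda>\<phi>. \<Sum>k<n. f k (cos \<phi>) * sin_weight \<nu> \<phi>)"
      using I[of n] by (rule integral_unique[symmetric])
    also have "\<dots> = (\<Sum>k<n. integral {0..pi} (\<lambda>\<phi>. f k (cos \<phi>) * sin_weight \<nu> \<phi>))"
      by (rule integral_sum) (auto intro!: integrable_poisson assms)
    finally show ?thesis .
  qed
  hence "I = (\<lambda>n. \<Sum>k<n. integral {0..pi} (\<lambda>\<phi>. f k (cos \<phi>) * sin_weight \<nu> \<phi>))" by (rule ext)
  with IJ have "(\<lambda>k. integral {0..pi} (\<lambda>\<phi>. f k (cos \<phi>) * sin_weight \<nu> \<phi>)) sums J"
    unfolding sums_def by simp
  from sums_mult[OF this, of "rGamma (\<nu> + 1/2) / sqrt pi"]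
  show "(\<lambda>k. poisson_avg \<nu> (f k)) sums poisson_avg \<nu> (\<lambda>s. \<Sum>k. f k s)"
    unfolding poisson_avg_def using integral_unique[OF J] by simp
qed

lemma DERIV_poisson_avg_translate:
  assumes "\<nu> \<ge> 0" "\<And>x. (f has_real_derivative f' x) (at x)" "continuous_on UNIV f'"
  shows "((\<lambda>y. poisson_avg \<nu> (\<lambda>s. f (a * s + y))) has_real_derivative
            poisson_avg \<nu> (\<lambda>s. f' (a * s + y))) (at y)"
proof -
  have cf: "continuous_on UNIV f"
    by (intro continuous_at_imp_continuous_on ballI, rule DERIV_isCont, rule assms(2))
  have "((\<lambda>y. integral (cbox 0 pi) (\<lambda>\<phi>. f (a * cos \<phi> + y) * sin_weight \<nu> \<phi>)) has_real_derivative
      integral (cbox 0 pi) (\<lambda>\<phi>. f' (a * cos \<phi> + y) * sin_weight \<nu> \<phi>)) (at y within UNIV)"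
  proof (rule leibniz_rule_field_derivative)
    fix x t :: real
    have g: "((\<lambda>x. a * cos t + x) has_real_derivative 1) (at x)"
      by (auto intro!: derivative_eq_intros)
    have "((\<lambda>x. f (a * cos t + x)) has_real_derivative f' (a * cos t + x)) (at x)"
      using DERIV_chain2[where f = f and g = "\<lambda>x. a * cos t + x", OF assms(2) g] by simp
    thus "((\<lambda>x. f (a * cos t + x) * sin_weight \<nu> t) has_real_derivative f' (a * cos t + x) * sin_weight \<nu> t) (at x)"
      by (rule DERIV_cmult_right)
  next
    fix x :: real
    have "continuous_on {-1..1} (\<lambda>s. f (a * s + x))"
      by (rule continuous_on_compose2[OF cf]) (auto intro!: continuous_intros)
    from integrable_poisson[OF assms(1) this]
    show "(\<lambda>\<phi>. f (a * cos \<phi> + x) * sin_weight \<nu> \<phi>) integrable_on cbox 0 pi" by simp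
  next
    have "continuous_on (UNIV \<times> {0..pi}) (\<lambda>p. f' (a * cos (snd p) + fst p) * sin_weight \<nu> (snd p))"
      by (intro continuous_on_mult continuous_on_compose2[OF assms(3)] continuous_on_compose2[OF continuous_on_sin_weight[OF assms(1)]])
         (auto intro!: continuous_intros)
    thus "continuous_on (UNIV \<times> cbox 0 pi) (\<lambda>(x, t). f' (a * cos t + x) * sin_weight \<nu> t)"
      by (simp add: case_prod_unfold)
  qed auto
  from DERIV_cmult[OF this, of "rGamma (\<nu> + 1/2) / sqrt pi"]
  show ?thesis by (simp add: poisson_avg_def)
qed

section \<open>Moments\<close>

lemma rGamma_Gamma_real: "x > 0 \<Longrightarrow> rGamma x * Gamma x = 1" for x :: real
  using Gamma_real_pos[of x] by (simp add: rGamma_inverse_Gamma del: Gamma_real_pos)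

lemma has_integral_cos_powr_sin_weight_half:
  assumes "\<nu> \<ge> 0" "z > -1"
  shows "((\<lambda>\<phi>. \<bar>cos \<phi>\<bar> powr z * sin_weight \<nu> \<phi>) has_integral Beta ((z + 1) / 2) (\<nu> + 1/2) / 2) {0..pi/2}"
proof -
  let ?S = "{0<..<pi/2}" and ?g = "\<lambda>\<phi>::real. (cos \<phi>)\<^sup>2"
  let ?f = "\<lambda>u::real. u powr ((z + 1) / 2 - 1) * (1 - u) powr ((\<nu> + 1/2) - 1)"
  have "(?f has_integral Beta ((z + 1) / 2) (\<nu> + 1/2)) {0<..<1}"
    using has_integral_Beta_real[of "(z + 1) / 2" "\<nu> + 1/2"] assms by (simp add: has_integral_Icc_iff_Ioo)
  moreover have "?f absolutely_integrable_on {0<..<1}"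
    by (rule nonnegative_absolutely_integrable_1) (use calculation in auto)
  moreover have im: "?g ` ?S = {0<..<1}"
  proof safe
    fix \<phi> :: real assume p: "\<phi> \<in> {0<..<pi/2}"
    have c: "cos \<phi> > 0" "sin \<phi> > 0" using p by (auto intro!: cos_gt_zero sin_gt_zero)
    have "(sin \<phi>)\<^sup>2 > 0" "(cos \<phi>)\<^sup>2 > 0" using c by simp_all
    moreover have "(cos \<phi>)\<^sup>2 = 1 - (sin \<phi>)\<^sup>2" by (simp add: cos_squared_eq)
    ultimately show "(cos \<phi>)\<^sup>2 \<in> {0<..<1}" unfolding greaterThanLessThan_iff by linarith
  next
    fix u :: real assume u: "u \<in> {0<..<1}"
    have s: "0 < sqrt u" "sqrt u < 1" using u by auto
    hence "- 1 < sqrt u" by linarith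
    with s have "arccos (sqrt u) \<in> ?S"
      using arccos_lt_bounded[of "sqrt u"] arccos_less_mono[of "sqrt u" 0] by auto
    moreover have "cos (arccos (sqrt u)) = sqrt u" using s by (intro cos_arccos) linarith+
    hence "u = ?g (arccos (sqrt u))" using u by simp
    ultimately show "u \<in> ?g ` ?S" by blast
  qed
  moreover have inj: "inj_on ?g ?S"
  proof (rule inj_onI)
    fix x y :: real assume xy: "x \<in> ?S" "y \<in> ?S" "?g x = ?g y"
    have "cos x > 0" "cos y > 0" using xy by (auto intro!: cos_gt_zero)
    hence "cos x = cos y" using xy(3) by (simp add: power2_eq_iff_nonneg)
    moreover have "0 \<le> x" "x \<le> pi" "0 \<le> y" "y \<le> pi"
      using xy(1,2) pi_gt_zero unfolding greaterThanLessThan_iff by linarith+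
    ultimately show "x = y" using cos_inj_pi by blast
  qed
  moreover have "(?g has_field_derivative - 2 * cos \<phi> * sin \<phi>) (at \<phi> within ?S)" for \<phi> :: real
    by (auto intro!: derivative_eq_intros)
  ultimately have "(\<lambda>\<phi>. \<bar>- 2 * cos \<phi> * sin \<phi>\<bar> * ?f (?g \<phi>)) absolutely_integrable_on ?S \<and>
      integral ?S (\<lambda>\<phi>. \<bar>- 2 * cos \<phi> * sin \<phi>\<bar> * ?f (?g \<phi>)) = Beta ((z + 1) / 2) (\<nu> + 1/2)"
    by (subst has_absolute_integral_change_of_variables_1'[where g = ?g]) (auto simp: integral_unique)
  hence "((\<lambda>\<phi>. \<bar>- 2 * cos \<phi> * sin \<phi>\<bar> * ?f (?g \<phi>)) has_integral Beta ((z + 1) / 2) (\<nu> + 1/2)) ?S"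
    by (metis (no_types, lifting) integrable_integral set_lebesgue_integral_eq_integral(1))
  hence "((\<lambda>\<phi>. 2 * (\<bar>cos \<phi>\<bar> powr z * sin_weight \<nu> \<phi>)) has_integral Beta ((z + 1) / 2) (\<nu> + 1/2)) ?S"
  proof (rule has_integral_eq[rotated])
    fix \<phi> :: real assume p: "\<phi> \<in> ?S"
    have c: "cos \<phi> > 0" "sin \<phi> > 0" using p by (auto intro!: cos_gt_zero sin_gt_zero)
    have sq: "(c\<^sup>2) powr p = c powr (2 * p)" if "c > 0" for c p :: real
      using that by (simp add: powr_powr flip: powr_numeral)
    have e: "2 * ((z + 1) / 2 - 1) = z - 1" "2 * ((\<nu> + 1/2) - 1) = 2 * \<nu> - 1" by simp_all
    have "1 - (cos \<phi>)\<^sup>2 = (sin \<phi>)\<^sup>2" by (simp add: sin_squared_eq)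
    hence "?f (?g \<phi>) = cos \<phi> powr (z - 1) * sin \<phi> powr (2 * \<nu> - 1)"
      by (simp only: sq[OF c(1)] sq[OF c(2)] e)
    moreover have "\<bar>- 2 * cos \<phi> * sin \<phi>\<bar> = 2 * (cos \<phi> * sin \<phi>)" using c by (simp add: abs_mult)
    ultimately have "\<bar>- 2 * cos \<phi> * sin \<phi>\<bar> * ?f (?g \<phi>) =
        2 * ((cos \<phi> * cos \<phi> powr (z - 1)) * (sin \<phi> * sin \<phi> powr (2 * \<nu> - 1)))" by simp
    also have "cos \<phi> * cos \<phi> powr (z - 1) = \<bar>cos \<phi>\<bar> powr z"
      using c powr_add[of "cos \<phi>" 1 "z - 1"] by simp
    also have "sin \<phi> * sin \<phi> powr (2 * \<nu> - 1) = sin_weight \<nu> \<phi>"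
      using c powr_add[of "sin \<phi>" 1 "2 * \<nu> - 1"] by (auto simp: sin_weight_def)
    finally show "\<bar>- 2 * cos \<phi> * sin \<phi>\<bar> * ?f (?g \<phi>) = 2 * (\<bar>cos \<phi>\<bar> powr z * sin_weight \<nu> \<phi>)" .
  qed
  from has_integral_mult_right[OF this, of "1/2"] show ?thesis
    by (simp add: has_integral_Icc_iff_Ioo)
qed

lemma has_integral_cos_powr_sin_weight:
  assumes "\<nu> \<ge> 0" "z > -1"
  shows "((\<lambda>\<phi>. \<bar>cos \<phi>\<bar> powr z * sin_weight \<nu> \<phi>) has_integral Beta ((z + 1) / 2) (\<nu> + 1/2)) {0..pi}"
proof -
  let ?g = "\<lambda>\<phi>. \<bar>cos \<phi>\<bar> powr z * sin_weight \<nu> \<phi>" and ?B = "Beta ((z + 1) / 2) (\<nu> + 1/2)"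
  note h = has_integral_cos_powr_sin_weight_half[OF assms]
  have "((\<lambda>\<phi>. ?g (- 1 * \<phi> + pi)) has_integral (1 / \<bar>- 1\<bar>) * (?B / 2)) ((\<lambda>x. (x - pi) / (-1)) ` cbox 0 (pi/2))"
    using has_integral_affinity[of ?g "?B / 2" 0 "pi/2" "- 1" pi] h by (simp add: image_def)
  hence "((\<lambda>\<phi>. ?g (pi - \<phi>)) has_integral (?B / 2)) ((\<lambda>x. pi - x) ` {0..pi/2})"
    by (simp add: minus_divide_left algebra_simps)
  moreover have "(\<lambda>x. pi - x) ` {0..pi/2} = {pi/2..pi}"
    by (simp add: image_diff_atLeastAtMost)
  moreover have "(\<lambda>\<phi>. ?g (pi - \<phi>)) = ?g" by (simp add: sin_weight_reflect)
  ultimately have "(?g has_integral (?B / 2)) {pi/2..pi}" by simp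
  from has_integral_combine[OF _ _ h this] show ?thesis by simp
qed

text \<open>A Beta integral. The exponent is real because the logarithmic moments arise by differentiation with
respect to it.\<close>

lemma poisson_avg_powr:
  assumes "\<nu> \<ge> 0" "z > -1"
  shows "poisson_avg \<nu> (\<lambda>s. \<bar>s\<bar> powr z) = Gamma ((z + 1) / 2) / sqrt pi * rGamma (\<nu> + 1 + z / 2)"
proof -
  have e1: "(z + 1) / 2 + (\<nu> + 1/2) = \<nu> + 1 + z / 2" by (simp add: field_simps)
  have e2: "rGamma (\<nu> + 1/2) * Gamma (\<nu> + 1/2) = 1"
    by (rule rGamma_Gamma_real) (use assms in simp)
  have e3: "g / q * (x * G * h) = x / q * (g * G) * h" for g q x G h :: real by simp
  show ?thesis
    unfolding poisson_avg_def integral_unique[OF has_integral_cos_powr_sin_weight[OF assms]] Beta_altdef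
      e3[of _ _ "Gamma ((z + 1) / 2)"] e2 e1 by simp
qed

lemma Gamma_half_nat: "Gamma (real r + 1/2) / sqrt pi = fact (2 * r) / (4 ^ r * fact r)"
proof (induction r)
  case 0 show ?case by (simp add: Gamma_one_half_real)
next
  case (Suc r)
  have "Gamma (real (Suc r) + 1/2) = (real r + 1/2) * Gamma (real r + 1/2)"
    using Gamma_plus1[of "real r + 1/2"] by (simp add: add_ac nonpos_Ints_def)
  moreover have "(fact (2 * Suc r) :: real) / (4 ^ Suc r * fact (Suc r)) 
     = (real r + 1/2) * (fact (2 * r) / (4 ^ r * fact r))"
    by (simp add: divide_simps) (simp add: algebra_simps)
  ultimately show ?case using Suc by (metis times_divide_eq_right)
qed

lemma poisson_avg_even_power:
  assumes "\<nu> \<ge> 0"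
  shows "poisson_avg \<nu> (\<lambda>s. s ^ (2 * r)) = sin_moment \<nu> r"
proof -
  have "((\<lambda>\<phi>. (cos \<phi>) ^ (2 * r) * sin_weight \<nu> \<phi>) has_integral Beta ((real (2 * r) + 1) / 2) (\<nu> + 1/2)) {0..pi}"
  proof (rule has_integral_spike_finite[OF _ _ has_integral_cos_powr_sin_weight[OF assms]])
    fix \<phi> :: real assume p: "\<phi> \<in> {0..pi} - {pi/2}"
    have "cos \<phi> \<noteq> 0"
    proof
      assume "cos \<phi> = 0"
      hence "cos \<phi> = cos (pi/2)" by simp
      from cos_inj_pi[OF _ _ _ _ this] p show False by auto
    qed
    thus "cos \<phi> ^ (2 * r) * sin_weight \<nu> \<phi> = \<bar>cos \<phi>\<bar> powr real (2 * r) * sin_weight \<nu> \<phi>"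
      by (subst powr_realpow) (auto simp: power_even_abs)
  qed auto
  moreover have "((\<lambda>\<phi>. \<bar>cos \<phi>\<bar> powr real (2 * r) * sin_weight \<nu> \<phi>) has_integral Beta ((real (2 * r) + 1) / 2) (\<nu> + 1/2)) {0..pi}"
    by (rule has_integral_cos_powr_sin_weight) (use assms in auto)
  ultimately have "poisson_avg \<nu> (\<lambda>s. s ^ (2 * r)) = poisson_avg \<nu> (\<lambda>s. \<bar>s\<bar> powr real (2 * r))"
    unfolding poisson_avg_def by (simp only: integral_unique)
  also have "\<dots> = Gamma (real r + 1/2) / sqrt pi * rGamma (\<nu> + real r + 1)"
    by (subst poisson_avg_powr) (use assms in \<open>auto simp: add_ac add_divide_distrib\<close>)
  also have "\<dots> = sin_moment \<nu> r" unfolding Gamma_half_nat sin_moment_def ..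
  finally show ?thesis .
qed

lemma poisson_avg_odd_power: "odd k \<Longrightarrow> poisson_avg \<nu> (\<lambda>s. s ^ k) = 0"
  by (rule poisson_avg_odd) simp

definition even_series :: "(nat \<Rightarrow> real) \<Rightarrow> real \<Rightarrow> real" where
  "even_series s y = (\<Sum>r. s r * y ^ (2 * r) / fact (2 * r))"

lemma poisson_avg_even_series:
  assumes "\<nu> \<ge> 0" "even_conv B s" "\<bar>b\<bar> < B"
  shows "poisson_avg \<nu> (\<lambda>t. even_series s (b * t)) = bessel_series \<nu> s b"
proof -
  have "(\<lambda>r. poisson_avg \<nu> (\<lambda>t. s r * (b * t) ^ (2 * r) / fact (2 * r))) sums
          poisson_avg \<nu> (\<lambda>t. \<Sum>r. s r * (b * t) ^ (2 * r) / fact (2 * r))"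
  proof (rule poisson_avg_sums(1))
    show "summable (\<lambda>r. \<bar>s r\<bar> * \<bar>b\<bar> ^ (2 * r) / fact (2 * r))"
      using assms(2,3) unfolding even_conv_def by auto
  next
    fix k t assume t: "t \<in> {-1..1::real}"
    have "\<bar>b * t\<bar> ^ (2 * k) \<le> \<bar>b\<bar> ^ (2 * k)"
      by (rule power_mono) (use t in \<open>auto simp: abs_mult intro!: mult_left_le\<close>)
    hence "\<bar>s k\<bar> * \<bar>b * t\<bar> ^ (2 * k) / fact (2 * k) \<le> \<bar>s k\<bar> * \<bar>b\<bar> ^ (2 * k) / fact (2 * k)"
      by (intro divide_right_mono mult_left_mono) auto
    thus "\<bar>s k * (b * t) ^ (2 * k) / fact (2 * k)\<bar> \<le> \<bar>s k\<bar> * \<bar>b\<bar> ^ (2 * k) / fact (2 * k)"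
      by (simp add: abs_mult power_abs)
  qed (use assms in \<open>auto intro!: continuous_intros\<close>)
  moreover have "poisson_avg \<nu> (\<lambda>t. s r * (b * t) ^ (2 * r) / fact (2 * r)) =
      s r / fact r * rGamma (\<nu> + real r + 1) * (b / 2) ^ (2 * r)" for r
  proof -
    have "poisson_avg \<nu> (\<lambda>t. s r * (b * t) ^ (2 * r) / fact (2 * r)) =
        poisson_avg \<nu> (\<lambda>t. s r * b ^ (2 * r) / fact (2 * r) * t ^ (2 * r))"
      by (simp add: power_mult_distrib mult_ac)
    thus ?thesis unfolding bessel_series_term poisson_avg_cmult poisson_avg_even_power[OF assms(1)] by simp
  qed
  ultimately have "(\<lambda>r. s r / fact r * rGamma (\<nu> + real r + 1) * (b / 2) ^ (2 * r)) sums
     poisson_avg \<nu> (\<lambda>t. even_series s (b * t))" by (simp add: even_series_def)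
  thus ?thesis unfolding bessel_series_def by (rule sums_unique)
qed

lemma even_series_cos: "even_series (\<lambda>r. (- 1) ^ r) x = cos x"
proof -
  have "(\<lambda>r. (- 1) ^ r * x ^ (2 * r) / fact (2 * r)) sums cos x"
    using cos_paired[of x] by simp
  thus ?thesis unfolding even_series_def by (rule sums_unique[symmetric])
qed

text \<open>Poisson's integral representation of the Bessel function, by integrating the cosine series term by
term.\<close>

lemma poisson_avg_cos: "\<nu> \<ge> 0 \<Longrightarrow> poisson_avg \<nu> (\<lambda>t. cos (x * t)) = bessel_even \<nu> x"
  using poisson_avg_even_series[of \<nu> "\<bar>x\<bar> + 1" "\<lambda>r. (- 1) ^ r" x] even_conv_alt
  by (simp add: even_series_cos)

section \<open>Even solutions of Gegenbauer's differential equation\<close>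

text \<open>Gronwall's argument for the energy \<open>d\<^sup>2 + d'\<^sup>2\<close>; on \<open>[0, Y]\<close> the leading coefficient is at least
\<open>a\<^sup>2 - Y\<^sup>2 > 0\<close>.\<close>

lemma gegenbauer_ode_unique_nonneg:
  fixes d d1 d2 :: "real \<Rightarrow> real"
  assumes "\<And>y. \<bar>y\<bar> < a \<Longrightarrow> (d has_real_derivative d1 y) (at y)"
    and "\<And>y. \<bar>y\<bar> < a \<Longrightarrow> (d1 has_real_derivative d2 y) (at y)"
    and "\<And>y. \<bar>y\<bar> < a \<Longrightarrow> (a\<^sup>2 - y\<^sup>2) * d2 y = A * y * d1 y + B * d y"
    and "d 0 = 0" "d1 0 = 0" "0 \<le> Y" "Y < a"
  shows "d Y = 0"
proof -
  define m where "m = a\<^sup>2 - Y\<^sup>2"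
  have m: "m > 0" using assms(6,7) by (simp add: m_def power_strict_mono)
  define K where "K = (\<bar>A\<bar> * a + \<bar>B\<bar>) / m"
  have K: "K \<ge> 0" using assms(6,7) m by (simp add: K_def)
  (* the derivative of the energy is at most L times the energy on [0, Y] *)
  define L where "L = 1 + 3 * K"
  define E where "E y = (d y)\<^sup>2 + (d1 y)\<^sup>2" for y
  define F where "F y = E y * exp (- L * y)" for y
  have DE: "(E has_real_derivative 2 * d y * d1 y + 2 * d1 y * d2 y) (at y)" if "\<bar>y\<bar> < a" for y
    unfolding E_def
    using DERIV_add[OF DERIV_power[OF assms(1)[OF that], of 2] DERIV_power[OF assms(2)[OF that], of 2]]
    by (simp add: mult_ac)
  have De: "((\<lambda>y. exp (- L * y)) has_real_derivative exp (- L * y) * (- L)) (at y)" for y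
    by (auto intro!: derivative_eq_intros)
  have DF: "(F has_real_derivative (2 * d y * d1 y + 2 * d1 y * d2 y - L * E y) * exp (- L * y)) (at y)" if "\<bar>y\<bar> < a" for y
    unfolding F_def by (rule DERIV_cong[OF DERIV_mult[OF DE[OF that] De]]) (simp add: algebra_simps)
  have neg: "(2 * d y * d1 y + 2 * d1 y * d2 y - L * E y) * exp (- L * y) \<le> 0" if y: "0 \<le> y" "y \<le> Y" for y
  proof -
    have ya: "\<bar>y\<bar> < a" using y assms(7) by simp
    have my: "m \<le> a\<^sup>2 - y\<^sup>2" unfolding m_def using y by (simp add: power_mono)
    have "m * \<bar>d2 y\<bar> \<le> (a\<^sup>2 - y\<^sup>2) * \<bar>d2 y\<bar>" using my by (rule mult_right_mono) simp
    also have "\<dots> = \<bar>A * y * d1 y + B * d y\<bar>"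
      using assms(3)[OF ya] my m by (metis abs_mult abs_of_nonneg less_imp_le order_trans)
    also have "\<dots> \<le> \<bar>A\<bar> * \<bar>y\<bar> * \<bar>d1 y\<bar> + \<bar>B\<bar> * \<bar>d y\<bar>"
      by (rule order_trans[OF abs_triangle_ineq]) (simp add: abs_mult)
    also have "\<dots> \<le> (\<bar>A\<bar> * a + \<bar>B\<bar>) * (\<bar>d1 y\<bar> + \<bar>d y\<bar>)"
    proof -
      have "\<bar>A\<bar> * \<bar>y\<bar> * \<bar>d1 y\<bar> \<le> \<bar>A\<bar> * a * \<bar>d1 y\<bar>"
        using ya by (intro mult_right_mono mult_left_mono) auto
      moreover have "0 \<le> \<bar>A\<bar> * a * \<bar>d y\<bar>" "0 \<le> \<bar>B\<bar> * \<bar>d1 y\<bar>" using ya by auto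
      moreover have "(\<bar>A\<bar> * a + \<bar>B\<bar>) * (\<bar>d1 y\<bar> + \<bar>d y\<bar>) =
         \<bar>A\<bar> * a * \<bar>d1 y\<bar> + \<bar>A\<bar> * a * \<bar>d y\<bar> + \<bar>B\<bar> * \<bar>d1 y\<bar> + \<bar>B\<bar> * \<bar>d y\<bar>"
        by (simp add: algebra_simps)
      ultimately show ?thesis by linarith
    qed
    finally have "\<bar>d2 y\<bar> \<le> K * (\<bar>d1 y\<bar> + \<bar>d y\<bar>)"
      using m by (simp add: K_def field_simps)
    hence "\<bar>d1 y\<bar> * \<bar>d2 y\<bar> \<le> \<bar>d1 y\<bar> * (K * (\<bar>d1 y\<bar> + \<bar>d y\<bar>))" by (intro mult_left_mono) auto
    also have "\<dots> = K * ((d1 y)\<^sup>2 + \<bar>d1 y\<bar> * \<bar>d y\<bar>)" by (simp add: algebra_simps power2_eq_square)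
    finally have 1: "d1 y * d2 y \<le> K * ((d1 y)\<^sup>2 + \<bar>d1 y\<bar> * \<bar>d y\<bar>)"
      by (metis abs_ge_self abs_mult order_trans)
    have 2: "2 * (\<bar>d1 y\<bar> * \<bar>d y\<bar>) \<le> E y"
      using sum_squares_bound[of "\<bar>d1 y\<bar>" "\<bar>d y\<bar>"] by (simp add: E_def mult.assoc)
    have 3: "d y * d1 y \<le> \<bar>d1 y\<bar> * \<bar>d y\<bar>" by (metis abs_ge_self abs_mult mult.commute)
    have 4: "(d1 y)\<^sup>2 \<le> E y" by (simp add: E_def)
    have "2 * (K * ((d1 y)\<^sup>2 + \<bar>d1 y\<bar> * \<bar>d y\<bar>)) = K * (2 * (d1 y)\<^sup>2 + 2 * (\<bar>d1 y\<bar> * \<bar>d y\<bar>))"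
      by (simp add: algebra_simps)
    also have "\<dots> \<le> K * (3 * E y)" using 2 4 by (intro mult_left_mono K) linarith
    finally have "2 * d y * d1 y + 2 * d1 y * d2 y \<le> L * E y"
      using 1 2 3 by (simp add: L_def algebra_simps)
    thus ?thesis by (intro mult_nonpos_nonneg) auto
  qed
  have "F Y \<le> F 0"
  proof (rule DERIV_nonpos_imp_nonincreasing[OF assms(6)])
    fix y assume "0 \<le> y" "y \<le> Y"
    thus "\<exists>D. (F has_real_derivative D) (at y) \<and> D \<le> 0"
      using DF[of y] neg[of y] assms(7) by (intro exI[of _ "(2 * d y * d1 y + 2 * d1 y * d2 y - L * E y) * exp (- L * y)"]) auto
  qed
  also have "F 0 = 0" by (simp add: F_def E_def assms(4,5))
  finally have "E Y \<le> 0" by (simp add: F_def mult_le_0_iff)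
  thus ?thesis by (simp add: E_def sum_power2_le_zero_iff)
qed

lemma gegenbauer_ode_unique:
  fixes d d1 d2 :: "real \<Rightarrow> real"
  assumes D: "\<And>y. \<bar>y\<bar> < a \<Longrightarrow> (d has_real_derivative d1 y) (at y)"
    and D1: "\<And>y. \<bar>y\<bar> < a \<Longrightarrow> (d1 has_real_derivative d2 y) (at y)"
    and ode: "\<And>y. \<bar>y\<bar> < a \<Longrightarrow> (a\<^sup>2 - y\<^sup>2) * d2 y = A * y * d1 y + B * d y"
    and "d 0 = 0" "d1 0 = 0" "\<bar>Y\<bar> < a"
  shows "d Y = 0"
proof (cases "Y \<ge> 0")
  case True
  thus ?thesis using gegenbauer_ode_unique_nonneg[OF assms(1-5) True] assms(6) by simp
next
  case False
  have m: "((\<lambda>y. f (- y)) has_real_derivative - f') (at y)" if "(f has_real_derivative f') (at (- y))" for f f' and y :: real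
    using DERIV_mirror[of f f' y] that by simp
  have "d (- (- Y)) = 0"
  proof (rule gegenbauer_ode_unique_nonneg[where a = a and d = "\<lambda>y. d (- y)" and ?d1.0 = "\<lambda>y. - d1 (- y)" and ?d2.0 = "\<lambda>y. d2 (- y)" and A = A and B = B])
    fix y :: real assume y: "\<bar>y\<bar> < a"
    show "((\<lambda>y. d (- y)) has_real_derivative - d1 (- y)) (at y)" by (rule m, rule D) (use y in simp)
    show "((\<lambda>y. - d1 (- y)) has_real_derivative d2 (- y)) (at y)"
      using DERIV_minus[OF m[OF D1[of "- y"]]] y by simp
    show "(a\<^sup>2 - y\<^sup>2) * d2 (- y) = A * y * - d1 (- y) + B * d (- y)" using ode[of "- y"] y by simp
  qed (use False assms in auto)
  thus ?thesis by simp
qed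

text \<open>A convergent power series whose coefficients obey the recursion solves the equation formally, hence
actually; uniqueness identifies it with \<open>u\<close>.\<close>

lemma gegenbauer_ode_series:
  fixes c g :: "nat \<Rightarrow> real"
  assumes D: "\<And>y. \<bar>y\<bar> < a \<Longrightarrow> (u has_real_derivative u1 y) (at y)"
    and D1: "\<And>y. \<bar>y\<bar> < a \<Longrightarrow> (u1 has_real_derivative u2 y) (at y)"
    and ode: "\<And>y. \<bar>y\<bar> < a \<Longrightarrow>
       (\<lambda>n. g n * y ^ n) sums ((a\<^sup>2 - y\<^sup>2) * u2 y + (2 * z + 2 * \<mu> - 1) * y * u1 y - z * (z + 2 * \<mu>) * u y)"
    and c: "\<And>y. \<bar>y\<bar> < a \<Longrightarrow> summable (\<lambda>n. c n * y ^ n)"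
    and rec: "\<And>n. a\<^sup>2 * (real n + 2) * (real n + 1) * c (n + 2) = (z - real n) * (z + 2 * \<mu> - real n) * c n + g n"
    and init: "u 0 = c 0" "u1 0 = c 1" and Y: "\<bar>Y\<bar> < a"
  shows "(\<lambda>n. c n * Y ^ n) sums u Y"
proof -
  define v where "v y = (\<Sum>n. c n * y ^ n)" for y
  define v1 where "v1 y = (\<Sum>n. diffs c n * y ^ n)" for y
  define v2 where "v2 y = (\<Sum>n. diffs (diffs c) n * y ^ n)" for y
  have c1: "summable (\<lambda>n. diffs c n * y ^ n)" if "\<bar>y\<bar> < a" for y
    using termdiff_converges[of y a c] c that by simp
  have c2: "summable (\<lambda>n. diffs (diffs c) n * y ^ n)" if "\<bar>y\<bar> < a" for y
    using termdiff_converges[of y a "diffs c"] c1 that by simp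
  have Dv: "(v has_real_derivative v1 y) (at y)" if "\<bar>y\<bar> < a" for y
    unfolding v_def v1_def using termdiffs_strong'[of a c y] c that by simp
  have Dv1: "(v1 has_real_derivative v2 y) (at y)" if "\<bar>y\<bar> < a" for y
    unfolding v1_def v2_def using termdiffs_strong'[of a "diffs c" y] c1 that by simp
  have v_ode: "(\<lambda>n. g n * y ^ n) sums ((a\<^sup>2 - y\<^sup>2) * v2 y + (2 * z + 2 * \<mu> - 1) * y * v1 y - z * (z + 2 * \<mu>) * v y)"
    if y: "\<bar>y\<bar> < a" for y
  proof -
    have s0: "(\<lambda>n. c n * y ^ n) sums v y" unfolding v_def by (rule summable_sums[OF c[OF y]])
    have "(\<lambda>n. y * (diffs c n * y ^ n)) sums (y * v1 y)" unfolding v1_def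
      by (intro sums_mult summable_sums[OF c1[OF y]])
    also have "(\<lambda>n. y * (diffs c n * y ^ n)) = (\<lambda>n. real (Suc n) * c (Suc n) * y ^ Suc n)"
      by (simp add: diffs_def fun_eq_iff mult_ac)
    finally have s1: "(\<lambda>n. real n * c n * y ^ n) sums (y * v1 y)"
      by (subst (asm) sums_Suc_iff) simp
    have s2: "(\<lambda>n. diffs (diffs c) n * y ^ n) sums v2 y" unfolding v2_def
      by (rule summable_sums[OF c2[OF y]])
    have "(\<lambda>n. y\<^sup>2 * (diffs (diffs c) n * y ^ n)) sums (y\<^sup>2 * v2 y)" by (intro sums_mult s2)
    also have "(\<lambda>n. y\<^sup>2 * (diffs (diffs c) n * y ^ n)) = (\<lambda>n. (real (n + 2)) * (real (n + 2) - 1) * c (n + 2) * y ^ (n + 2))"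
      by (simp add: diffs_def fun_eq_iff mult_ac power2_eq_square)
    finally have "(\<lambda>n. real (n + 2) * (real (n + 2) - 1) * c (n + 2) * y ^ (n + 2)) sums (y\<^sup>2 * v2 y)" .
    hence s3: "(\<lambda>n. real n * (real n - 1) * c n * y ^ n) sums (y\<^sup>2 * v2 y)"
      using sums_iff_shift[of "\<lambda>n. real n * (real n - 1) * c n * y ^ n" 2 "y\<^sup>2 * v2 y"]
      by (simp add: numeral_2_eq_2)
    have "(\<lambda>n. a\<^sup>2 * (diffs (diffs c) n * y ^ n) - real n * (real n - 1) * c n * y ^ n
             + (2 * z + 2 * \<mu> - 1) * (real n * c n * y ^ n) - z * (z + 2 * \<mu>) * (c n * y ^ n)) sums
          (a\<^sup>2 * v2 y - y\<^sup>2 * v2 y + (2 * z + 2 * \<mu> - 1) * (y * v1 y) - z * (z + 2 * \<mu>) * v y)"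
      by (intro sums_diff sums_add sums_mult s0 s1 s2 s3)
    also have "(\<lambda>n. a\<^sup>2 * (diffs (diffs c) n * y ^ n) - real n * (real n - 1) * c n * y ^ n
             + (2 * z + 2 * \<mu> - 1) * (real n * c n * y ^ n) - z * (z + 2 * \<mu>) * (c n * y ^ n)) = (\<lambda>n. g n * y ^ n)"
    proof
      fix n
      have "a\<^sup>2 * diffs (diffs c) n = a\<^sup>2 * (real n + 2) * (real n + 1) * c (n + 2)"
        by (simp add: diffs_def algebra_simps)
      also note rec
      finally have "a\<^sup>2 * diffs (diffs c) n - real n * (real n - 1) * c n
             + (2 * z + 2 * \<mu> - 1) * (real n * c n) - z * (z + 2 * \<mu>) * c n = g n"
        by (simp add: algebra_simps)
      from arg_cong[OF this, of "\<lambda>t. t * y ^ n"]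
      show "a\<^sup>2 * (diffs (diffs c) n * y ^ n) - real n * (real n - 1) * c n * y ^ n
             + (2 * z + 2 * \<mu> - 1) * (real n * c n * y ^ n) - z * (z + 2 * \<mu>) * (c n * y ^ n) = g n * y ^ n"
        by (simp add: algebra_simps)
    qed
    finally show ?thesis by (simp add: algebra_simps)
  qed
  have "u Y - v Y = 0"
  proof (rule gegenbauer_ode_unique[where a = a and d = "\<lambda>y. u y - v y" and ?d1.0 = "\<lambda>y. u1 y - v1 y" and ?d2.0 = "\<lambda>y. u2 y - v2 y"
       and A = "- (2 * z + 2 * \<mu> - 1)" and B = "z * (z + 2 * \<mu>)"])
    fix y assume y: "\<bar>y\<bar> < a"
    show "((\<lambda>y. u y - v y) has_real_derivative u1 y - v1 y) (at y)" by (rule DERIV_diff[OF D[OF y] Dv[OF y]])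
    show "((\<lambda>y. u1 y - v1 y) has_real_derivative u2 y - v2 y) (at y)" by (rule DERIV_diff[OF D1[OF y] Dv1[OF y]])
    from sums_unique2[OF ode[OF y] v_ode[OF y]]
    show "(a\<^sup>2 - y\<^sup>2) * (u2 y - v2 y) = - (2 * z + 2 * \<mu> - 1) * y * (u1 y - v1 y) + z * (z + 2 * \<mu>) * (u y - v y)"
      by (simp add: algebra_simps)
  qed (use init Y in \<open>auto simp: v_def v1_def diffs_def\<close>)
  thus ?thesis using summable_sums[OF c[OF Y]] by (simp add: v_def)
qed

section \<open>Averages of translated kernels\<close>

text \<open>The integrand is the derivative of \<open>sin \<phi> (sin \<phi>)^(2 \<mu>) f1 (a cos \<phi> + y)\<close> with respect to \<open>\<phi>\<close>, up to a constant,
and this function vanishes at both ends. It is the source of all differential equations for averages.\<close>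

lemma poisson_avg_ibp:
  assumes "\<mu> \<ge> 0" "\<And>x. (f1 has_real_derivative f2 x) (at x)" "continuous_on UNIV f2"
  shows "poisson_avg \<mu> (\<lambda>s. (2 * \<mu> + 1) * (a * s) * f1 (a * s + y) - a\<^sup>2 * (1 - s\<^sup>2) * f2 (a * s + y)) = 0"
proof -
  define q where "q \<phi> = a * (sin \<phi> * sin_weight \<mu> \<phi>) * f1 (a * cos \<phi> + y)" for \<phi>
  have c1: "continuous_on UNIV f1"
    by (intro continuous_at_imp_continuous_on ballI, rule DERIV_isCont, rule assms(2))
  have cq: "continuous_on {0..pi} q" unfolding q_def
    by (intro continuous_on_mult continuous_on_compose2[OF c1] continuous_on_sin_weight assms(1))
       (auto intro!: continuous_intros)
  have dq: "(q has_vector_derivative ((2 * \<mu> + 1) * (a * cos \<phi>) * f1 (a * cos \<phi> + y) - a\<^sup>2 * (1 - (cos \<phi>)\<^sup>2) * f2 (a * cos \<phi> + y)) * sin_weight \<mu> \<phi>) (at \<phi>)"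
    if p: "\<phi> \<in> {0<..<pi}" for \<phi>
  proof -
    have s: "sin \<phi> > 0" using p by (intro sin_gt_zero) auto
    have "((\<lambda>\<phi>. sin \<phi> powr (2 * \<mu> + 1)) has_real_derivative (2 * \<mu> + 1) * sin \<phi> powr (2 * \<mu> + 1 - 1) * cos \<phi>) (at \<phi>)"
      by (rule DERIV_chain2[OF has_real_derivative_powr[OF s] DERIV_sin])
    moreover have "sin \<phi> powr (2 * \<mu> + 1 - 1) = sin_weight \<mu> \<phi>" using s by (auto simp: sin_weight_def)
    ultimately have "((\<lambda>\<phi>. sin \<phi> powr (2 * \<mu> + 1)) has_real_derivative (2 * \<mu> + 1) * cos \<phi> * sin_weight \<mu> \<phi>) (at \<phi>)"
      by (simp only: mult_ac)
    moreover have "eventually (\<lambda>\<phi>. \<phi> \<in> {0<..<pi}) (nhds \<phi>)"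
      by (rule eventually_nhds_in_open) (use p in auto)
    hence "eventually (\<lambda>\<phi>. sin \<phi> powr (2 * \<mu> + 1) = sin \<phi> * sin_weight \<mu> \<phi>) (nhds \<phi>)"
    proof eventually_elim
      case (elim \<phi>)
      hence "sin \<phi> > 0" by (intro sin_gt_zero) auto
      thus ?case by (auto simp: sin_weight_def powr_add)
    qed
    ultimately have d1: "((\<lambda>\<phi>. sin \<phi> * sin_weight \<mu> \<phi>) has_real_derivative (2 * \<mu> + 1) * cos \<phi> * sin_weight \<mu> \<phi>) (at \<phi>)"
      by (subst (asm) DERIV_cong_ev[OF refl _ refl])
    have "((\<lambda>\<phi>. a * cos \<phi> + y) has_real_derivative - a * sin \<phi>) (at \<phi>)"
      by (auto intro!: derivative_eq_intros)
    from DERIV_chain2[where f = f1 and g = "\<lambda>\<phi>. a * cos \<phi> + y", OF assms(2) this]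
    have d2: "((\<lambda>\<phi>. f1 (a * cos \<phi> + y)) has_real_derivative f2 (a * cos \<phi> + y) * (- a * sin \<phi>)) (at \<phi>)" .
    have "(q has_real_derivative a * ((2 * \<mu> + 1) * cos \<phi> * sin_weight \<mu> \<phi>) * f1 (a * cos \<phi> + y)
        + f2 (a * cos \<phi> + y) * (- a * sin \<phi>) * (a * (sin \<phi> * sin_weight \<mu> \<phi>))) (at \<phi>)"
      unfolding q_def by (rule DERIV_mult[OF DERIV_cmult[OF d1] d2])
    also have "a * ((2 * \<mu> + 1) * cos \<phi> * sin_weight \<mu> \<phi>) * f1 (a * cos \<phi> + y)
        + f2 (a * cos \<phi> + y) * (- a * sin \<phi>) * (a * (sin \<phi> * sin_weight \<mu> \<phi>))
        = ((2 * \<mu> + 1) * (a * cos \<phi>) * f1 (a * cos \<phi> + y) - a\<^sup>2 * ((sin \<phi>)\<^sup>2) * f2 (a * cos \<phi> + y)) * sin_weight \<mu> \<phi>"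
      by (simp add: algebra_simps power2_eq_square)
    also have "(sin \<phi>)\<^sup>2 = 1 - (cos \<phi>)\<^sup>2" by (rule sin_squared_eq)
    finally show ?thesis by (simp only: has_real_derivative_iff_has_vector_derivative)
  qed
  have "q pi - q 0 = 0" by (simp add: q_def)
  with fundamental_theorem_of_calculus_interior[OF _ cq dq]
  have "((\<lambda>\<phi>. ((2 * \<mu> + 1) * (a * cos \<phi>) * f1 (a * cos \<phi> + y) - a\<^sup>2 * (1 - (cos \<phi>)\<^sup>2) * f2 (a * cos \<phi> + y)) * sin_weight \<mu> \<phi>) has_integral 0) {0..pi}"
    by simp
  from integral_unique[OF this] show ?thesis unfolding poisson_avg_def by simp
qed

lemma poisson_avg_lin3:
  assumes "\<mu> \<ge> 0" "continuous_on {-1..1} f" "continuous_on {-1..1} g" "continuous_on {-1..1} h"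
  shows "poisson_avg \<mu> (\<lambda>s. A * f s + B * g s + C * h s) =
           A * poisson_avg \<mu> f + B * poisson_avg \<mu> g + C * poisson_avg \<mu> h"
proof -
  have c: "continuous_on {-1..1} (\<lambda>s. A * f s)" "continuous_on {-1..1} (\<lambda>s. B * g s)" "continuous_on {-1..1} (\<lambda>s. C * h s)"
    by (intro continuous_on_mult continuous_on_const assms)+
  show ?thesis
    by (simp only: poisson_avg_add[OF assms(1) continuous_on_add[OF c(1,2)] c(3)] poisson_avg_add[OF assms(1) c(1,2)] poisson_avg_cmult)
qed

lemma DERIV_abs_real: "x \<noteq> 0 \<Longrightarrow> ((\<lambda>x::real. \<bar>x\<bar>) has_real_derivative sgn x) (at x)"
proof (cases "x > 0")
  case True
  show ?thesis
    by (rule has_field_derivative_transform_within_open[of "\<lambda>x. x" _ _ "{0<..}"])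
       (use True in \<open>auto intro!: derivative_eq_intros\<close>)
next
  case False
  assume "x \<noteq> 0"
  with False show ?thesis
    by (rule_tac has_field_derivative_transform_within_open[of "\<lambda>x. - x" _ _ "{..<0}"])
       (auto intro!: derivative_eq_intros)
qed

lemma DERIV_abs_power:
  assumes "k \<ge> 1"
  shows "((\<lambda>x::real. \<bar>x\<bar> * x ^ k) has_real_derivative (real k + 1) * (\<bar>x\<bar> * x ^ (k - 1))) (at x)"
proof (cases "x = 0")
  case False
  have "((\<lambda>x::real. \<bar>x\<bar>) has_real_derivative sgn x) (at x)"
    by (rule DERIV_abs_real[OF False])
  hence "((\<lambda>x::real. \<bar>x\<bar> * x ^ k) has_real_derivative sgn x * x ^ k + (real k * x ^ (k - 1)) * \<bar>x\<bar>) (at x)"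
    by (rule DERIV_mult) (auto intro!: derivative_eq_intros)
  moreover have "sgn x * x ^ k = \<bar>x\<bar> * x ^ (k - 1)"
    using assms by (cases k) (auto simp: abs_sgn mult_ac)
  ultimately show ?thesis by (simp add: algebra_simps)
next
  case True
  have "((\<lambda>h::real. \<bar>h\<bar> * h ^ (k - 1)) \<longlongrightarrow> 0) (at 0)"
    by (rule tendsto_eq_intros refl)+ simp
  moreover have "eventually (\<lambda>h::real. (\<bar>h\<bar> * h ^ k - \<bar>0\<bar> * 0 ^ k) / h = \<bar>h\<bar> * h ^ (k - 1)) (at 0)"
    by (rule eventually_mono[OF eventually_neq_at_within[of 0]]) (use assms in \<open>cases k, auto\<close>)
  ultimately have "((\<lambda>h::real. (\<bar>h\<bar> * h ^ k - \<bar>0\<bar> * 0 ^ k) / h) \<longlongrightarrow> 0) (at 0)"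
    by (subst tendsto_cong)
  thus ?thesis using True by (simp add: DERIV_def)
qed

lemma tendsto_power_ln_abs_0:
  assumes "k \<ge> 1"
  shows "((\<lambda>x::real. x ^ k * ln \<bar>x\<bar>) \<longlongrightarrow> 0) (at 0)"
proof -
  have 1: "((\<lambda>u::real. u * ln u) \<longlongrightarrow> 0) (at_right 0)" by real_asymp
  have "filterlim (\<lambda>x::real. \<bar>x\<bar>) (at_right 0) (at 0)"
    unfolding filterlim_at by (auto intro!: tendsto_rabs_zero tendsto_ident_at simp: eventually_at_filter)
  from filterlim_compose[OF 1 this] have "((\<lambda>x::real. \<bar>x\<bar> * ln \<bar>x\<bar>) \<longlongrightarrow> 0) (at 0)" by simp
  hence "((\<lambda>x::real. \<bar>x * ln \<bar>x\<bar>\<bar>) \<longlongrightarrow> 0) (at 0)"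
    by (drule_tac tendsto_rabs_zero) (simp only: abs_mult abs_abs)
  hence "((\<lambda>x::real. x * ln \<bar>x\<bar>) \<longlongrightarrow> 0) (at 0)" by (rule tendsto_rabs_zero_cancel)
  moreover have "((\<lambda>x::real. x ^ (k - 1)) \<longlongrightarrow> 0 ^ (k - 1)) (at 0)" by (intro tendsto_intros)
  ultimately have "((\<lambda>x::real. x ^ (k - 1) * (x * ln \<bar>x\<bar>)) \<longlongrightarrow> 0 ^ (k - 1) * 0) (at 0)"
    by (intro tendsto_mult)
  thus ?thesis using assms by (cases k) (auto simp: mult_ac)
qed

lemma DERIV_power_ln_abs:
  assumes "k \<ge> 2"
  shows "((\<lambda>x::real. x ^ k * ln \<bar>x\<bar>) has_real_derivative real k * (x ^ (k - 1) * ln \<bar>x\<bar>) + x ^ (k - 1)) (at x)"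
proof (cases "x = 0")
  case False
  have "((\<lambda>x::real. ln \<bar>x\<bar>) has_real_derivative 1 / x) (at x)"
  proof -
    have "((\<lambda>x::real. \<bar>x\<bar>) has_real_derivative sgn x) (at x)"
      by (rule DERIV_abs_real[OF False])
    from DERIV_chain2[OF DERIV_ln_divide this] False show ?thesis
      by (simp add: sgn_real_def split: if_splits)
  qed
  hence "((\<lambda>x::real. x ^ k * ln \<bar>x\<bar>) has_real_derivative (real k * x ^ (k - 1)) * ln \<bar>x\<bar> + (1 / x) * x ^ k) (at x)"
    by (intro DERIV_mult) (auto intro!: derivative_eq_intros)
  moreover have "(1 / x) * x ^ k = x ^ (k - 1)" using False assms by (cases k) auto
  ultimately show ?thesis by (simp only: mult.assoc)
next
  case True
  have "((\<lambda>h::real. h ^ (k - 1) * ln \<bar>h\<bar>) \<longlongrightarrow> 0) (at 0)"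
    by (rule tendsto_power_ln_abs_0) (use assms in simp)
  moreover have "eventually (\<lambda>h::real. (h ^ k * ln \<bar>h\<bar> - 0 ^ k * ln \<bar>0\<bar>) / h = h ^ (k - 1) * ln \<bar>h\<bar>) (at 0)"
    by (rule eventually_mono[OF eventually_neq_at_within[of 0]]) (use assms in \<open>cases k, auto\<close>)
  ultimately have "((\<lambda>h::real. (h ^ k * ln \<bar>h\<bar> - 0 ^ k * ln \<bar>0\<bar>) / h) \<longlongrightarrow> 0) (at 0)"
    by (subst tendsto_cong)
  moreover have z: "(0::real) ^ (k - Suc 0) = 0" using assms by (simp add: zero_power)
  ultimately show ?thesis using True assms by (simp add: DERIV_def z)
qed

lemma continuous_on_power_ln_abs:
  assumes "k \<ge> 1"
  shows "continuous_on A (\<lambda>x::real. x ^ k * ln \<bar>x\<bar>)"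
proof (intro continuous_at_imp_continuous_on ballI)
  fix x :: real
  show "isCont (\<lambda>x::real. x ^ k * ln \<bar>x\<bar>) x"
  proof (cases "x = 0")
    case True
    thus ?thesis using tendsto_power_ln_abs_0[OF assms] assms by (simp add: isCont_def)
  qed (auto intro!: continuous_intros)
qed

section \<open>The logarithmic moment\<close>

lemma exp_minus_bound: "x \<ge> 0 \<Longrightarrow> exp (- x) \<le> 1 - x + x\<^sup>2" for x :: real
proof -
  assume x: "x \<ge> 0"
  have "1 \<le> 1 + x ^ 3" using x by simp
  also have "\<dots> = (1 + x) * (1 - x + x\<^sup>2)" by (simp add: algebra_simps power2_eq_square power3_eq_cube)
  also have "\<dots> \<le> exp x * (1 - x + x\<^sup>2)"
  proof (rule mult_right_mono[OF exp_ge_add_one_self])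
    have "0 \<le> (1 - x)\<^sup>2" by simp
    moreover have "(1 - x)\<^sup>2 = 1 - 2 * x + x\<^sup>2" by (simp add: power2_diff)
    ultimately show "0 \<le> 1 - x + x\<^sup>2" using x by linarith
  qed
  finally show ?thesis by (simp add: exp_minus field_simps)
qed

text \<open>The derivative of the moment \<open>poisson_avg_powr\<close> with respect to the exponent. As only this
one derivative is needed, the difference quotient is estimated directly through
\<open>exp (-x) \<le> 1 - x + x\<^sup>2\<close> (see \<open>exp_minus_bound\<close>).\<close>

lemma poisson_avg_power_ln:
  assumes \<mu>: "\<mu> \<ge> 0" and N: "N \<ge> 1"
  shows "poisson_avg \<mu> (\<lambda>s. s ^ (2 * N) * ln \<bar>s\<bar>) =
           sin_moment \<mu> N * (Digamma (real N + 1/2) / 2 - Digamma (real N + 1 + \<mu>) / 2)"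
proof -
  define M where "M z = Gamma ((z + 1) / 2) / sqrt pi * rGamma (\<mu> + 1 + z / 2)" for z :: real
  define n where "n = 2 * real N"
  define \<Lambda> where "\<Lambda> = poisson_avg \<mu> (\<lambda>s. s ^ (2 * N) * ln \<bar>s\<bar>)"
  define M' where "M' = Gamma ((n + 1) / 2) * Digamma ((n + 1) / 2) * (1/2) / sqrt pi * rGamma (\<mu> + 1 + n / 2)
      + (- rGamma (\<mu> + 1 + n / 2) * Digamma (\<mu> + 1 + n / 2)) * (1/2) * (Gamma ((n + 1) / 2) / sqrt pi)"
  have np: "(n + 1) / 2 > 0" "\<mu> + 1 + n / 2 > 0" using \<mu> by (auto simp: n_def)
  have DM: "(M has_real_derivative M') (at n)"
  proof -
    have a: "((\<lambda>z::real. (z + 1) / 2) has_real_derivative 1 / 2) (at n)"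
      "((\<lambda>z::real. \<mu> + 1 + z / 2) has_real_derivative 1 / 2) (at n)"
      by (auto intro!: derivative_eq_intros)
    have "(n + 1) / 2 \<notin> \<int>\<^sub>\<le>\<^sub>0" "\<mu> + 1 + n / 2 \<notin> \<int>\<^sub>\<le>\<^sub>0" using np nonpos_Ints_nonpos by fastforce+
    note b = DERIV_chain2[OF has_field_derivative_Gamma[OF this(1)] a(1)]
      DERIV_chain2[OF has_field_derivative_rGamma_no_nonpos_int[OF this(2)] a(2)]
    show ?thesis unfolding M_def M'_def
      by (rule DERIV_mult[OF DERIV_cdivide[OF b(1)] b(2)])
  qed
  have Mn: "M n = sin_moment \<mu> N"
  proof -
    have "(n + 1) / 2 = real N + 1/2" "\<mu> + 1 + n / 2 = \<mu> + real N + 1" by (simp_all add: n_def field_simps)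
    thus ?thesis unfolding M_def sin_moment_def Gamma_half_nat[symmetric] by (simp only:)
  qed
  have M'_eq: "M' = sin_moment \<mu> N * (Digamma (real N + 1/2) / 2 - Digamma (real N + 1 + \<mu>) / 2)"
  proof -
    have e: "(n + 1) / 2 = real N + 1/2" "\<mu> + 1 + n / 2 = real N + 1 + \<mu>" by (simp_all add: n_def field_simps)
    have "sin_moment \<mu> N = Gamma (real N + 1/2) / sqrt pi * rGamma (real N + 1 + \<mu>)"
      unfolding Mn[symmetric] M_def e ..
    thus ?thesis unfolding M'_def e by (simp add: algebra_simps)
  qed
  have bound: "\<bar>(M (n + h) - M n) / h - \<Lambda>\<bar> \<le> poisson_mass \<mu> * h" if h: "h > 0" for h
  proof -
    have cp: "continuous_on {-1..1} (\<lambda>s::real. \<bar>s\<bar> powr (n + h))"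
      using h by (intro continuous_on_powr' continuous_intros) (auto simp: n_def)
    have "M (n + h) - M n - h * \<Lambda> = poisson_avg \<mu> (\<lambda>s. 1 * \<bar>s\<bar> powr (n + h) + (-1) * s ^ (2 * N) + (- h) * (s ^ (2 * N) * ln \<bar>s\<bar>))"
      using poisson_avg_powr[OF \<mu>, of "n + h"] h poisson_avg_even_power[OF \<mu>, of N] Mn \<mu> N
      by (subst poisson_avg_lin3)
         (auto simp: M_def \<Lambda>_def n_def intro!: cp[unfolded n_def] continuous_on_power_ln_abs continuous_intros N)
    also have "\<bar>\<dots>\<bar> \<le> poisson_mass \<mu> * h\<^sup>2"
    proof (rule poisson_avg_bound[OF \<mu>])
      show "continuous_on {-1..1} (\<lambda>s. 1 * \<bar>s\<bar> powr (n + h) + (-1) * s ^ (2 * N) + (- h) * (s ^ (2 * N) * ln \<bar>s\<bar>))"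
        by (intro continuous_on_add continuous_on_mult continuous_on_const cp continuous_on_power continuous_on_id
             continuous_on_power_ln_abs[of "2 * N", simplified]) (use N in auto)
    next
      fix s :: real assume s: "s \<in> {-1..1}"
      show "\<bar>1 * \<bar>s\<bar> powr (n + h) + (-1) * s ^ (2 * N) + (- h) * (s ^ (2 * N) * ln \<bar>s\<bar>)\<bar> \<le> h\<^sup>2"
      proof (cases "s = 0")
        case True thus ?thesis using N by (simp add: power_0_left)
      next
        case False
        define t where "t = - ln \<bar>s\<bar>"
        have t: "t \<ge> 0" using False s by (simp add: t_def ln_le_zero_iff abs_le_iff)
        have st: "\<bar>s\<bar> = exp (- t)" using False by (simp add: t_def)
        have "\<bar>s\<bar> powr (n + h) = \<bar>s\<bar> powr n * exp (- (h * t))"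
          using False by (simp add: powr_add st) (simp add: powr_def)
        also have "\<bar>s\<bar> powr n = s ^ (2 * N)"
        proof -
          have "n = real (2 * N)" by (simp add: n_def)
          moreover have "\<bar>s\<bar> powr real (2 * N) = \<bar>s\<bar> ^ (2 * N)" by (rule powr_realpow) (use False in simp)
          moreover have "\<bar>s\<bar> ^ (2 * N) = s ^ (2 * N)" by (simp add: power_even_abs)
          ultimately show ?thesis by simp
        qed
        finally have eq: "1 * \<bar>s\<bar> powr (n + h) + (-1) * s ^ (2 * N) + (- h) * (s ^ (2 * N) * ln \<bar>s\<bar>)
            = s ^ (2 * N) * (exp (- (h * t)) - 1 + h * t)"
          by (simp add: t_def algebra_simps)
        have "0 \<le> exp (- (h * t)) - 1 + h * t" using exp_ge_add_one_self[of "- (h * t)"] by simp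
        moreover have "exp (- (h * t)) - 1 + h * t \<le> (h * t)\<^sup>2"
          using exp_minus_bound[of "h * t"] h t by simp
        ultimately have "\<bar>s ^ (2 * N) * (exp (- (h * t)) - 1 + h * t)\<bar> \<le> s ^ (2 * N) * (h * t)\<^sup>2"
          by (simp add: abs_mult) (intro mult_left_mono, auto)
        also have "\<dots> = h\<^sup>2 * (s ^ (2 * N) * t\<^sup>2)" by (simp add: power_mult_distrib)
        also have "\<dots> \<le> h\<^sup>2 * 1"
        proof (rule mult_left_mono)
          have "s ^ (2 * N) = exp (- t) ^ (2 * N)" unfolding st[symmetric] by (simp add: power_even_abs)
          also have "\<dots> \<le> exp (- t) ^ 2" using t N by (intro power_decreasing) auto
          finally have "s ^ (2 * N) * t\<^sup>2 \<le> exp (- t) ^ 2 * t\<^sup>2" by (rule mult_right_mono) simp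
          also have "\<dots> = (exp (- t) * t)\<^sup>2" by (simp add: power_mult_distrib)
          also have "\<dots> \<le> 1\<^sup>2"
          proof (rule power_mono)
            have "t \<le> exp t" using exp_ge_add_one_self[of t] by linarith
            thus "exp (- t) * t \<le> 1" by (simp add: exp_minus field_simps)
          qed (use t in auto)
          finally show "s ^ (2 * N) * t\<^sup>2 \<le> 1" by simp
        qed simp
        finally show ?thesis unfolding eq by simp
      qed
    qed
    finally have "\<bar>M (n + h) - M n - h * \<Lambda>\<bar> / h \<le> poisson_mass \<mu> * h\<^sup>2 / h"
      using h by (intro divide_right_mono) auto
    moreover have "\<bar>M (n + h) - M n - h * \<Lambda>\<bar> / h = \<bar>(M (n + h) - M n) / h - \<Lambda>\<bar>"
    proof -
      have "(M (n + h) - M n) / h - \<Lambda> = (M (n + h) - M n - h * \<Lambda>) / h" using h by (simp add: field_simps)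
      thus ?thesis using h by (simp add: abs_divide)
    qed
    ultimately show ?thesis using h by (simp add: power2_eq_square)
  qed
  have "((\<lambda>h. (M (n + h) - M n) / h - \<Lambda>) \<longlongrightarrow> 0) (at_right 0)"
  proof (rule Lim_null_comparison)
    show "eventually (\<lambda>h. norm ((M (n + h) - M n) / h - \<Lambda>) \<le> poisson_mass \<mu> * h) (at_right 0)"
      using bound by (auto simp: eventually_at_filter)
    show "((\<lambda>h. poisson_mass \<mu> * h) \<longlongrightarrow> 0) (at_right 0)" by (rule tendsto_eq_intros refl)+ simp
  qed
  hence "((\<lambda>h. (M (n + h) - M n) / h) \<longlongrightarrow> \<Lambda>) (at_right 0)" by (subst (asm) LIM_zero_iff)
  moreover have "((\<lambda>h. (M (n + h) - M n) / h) \<longlongrightarrow> M') (at_right 0)"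
    using DM unfolding DERIV_def by (rule tendsto_mono[rotated]) (simp add: at_le)
  ultimately have "\<Lambda> = M'" by (intro tendsto_unique[of "at_right (0::real)"]) auto
  thus ?thesis unfolding \<Lambda>_def M'_eq .
qed

lemma even_series_sums_iff:
  "(\<lambda>n. (if even n then s (n div 2) / fact n else 0) * y ^ n) sums x \<longleftrightarrow>
     (\<lambda>r. s r * y ^ (2 * r) / fact (2 * r)) sums (x :: real)"
proof -
  have "strict_mono (\<lambda>r::nat. 2 * r)" by (simp add: strict_mono_def)
  moreover have "(if even n then s (n div 2) / fact n else 0) * y ^ n = 0" if "n \<notin> range (\<lambda>r::nat. 2 * r)" for n
  proof -
    have "odd n" using that by (metis evenE rangeI)
    thus ?thesis by simp
  qed
  ultimately have "(\<lambda>r. (if even (2 * r) then s (2 * r div 2) / fact (2 * r) else 0) * y ^ (2 * r)) sums x \<longleftrightarrow>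
      (\<lambda>n. (if even n then s (n div 2) / fact n else 0) * y ^ n) sums x"
    by (rule sums_mono_reindex)
  thus ?thesis by simp
qed

lemma even_series_sums:
  assumes "even_conv B s" "\<bar>y\<bar> < B"
  shows "(\<lambda>r. s r * y ^ (2 * r) / fact (2 * r)) sums even_series s y"
  unfolding even_series_def
proof (rule summable_sums, rule summable_rabs_cancel)
  have "summable (\<lambda>r. \<bar>s r\<bar> * \<bar>y\<bar> ^ (2 * r) / fact (2 * r))"
    using assms unfolding even_conv_def by auto
  thus "summable (\<lambda>r. \<bar>s r * y ^ (2 * r) / fact (2 * r)\<bar>)" by (simp add: abs_mult power_abs)
qed

lemma gegenbauer_even_series:
  assumes D: "\<And>y. \<bar>y\<bar> < a \<Longrightarrow> (u has_real_derivative u1 y) (at y)"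
    and D1: "\<And>y. \<bar>y\<bar> < a \<Longrightarrow> (u1 has_real_derivative u2 y) (at y)"
    and ode: "\<And>y. \<bar>y\<bar> < a \<Longrightarrow>
       (\<lambda>r. g r * y ^ (2 * r) / fact (2 * r)) sums
         ((a\<^sup>2 - y\<^sup>2) * u2 y + (2 * z + 2 * \<mu> - 1) * y * u1 y - z * (z + 2 * \<mu>) * u y)"
    and s: "even_conv a s"
    and rec: "\<And>r. a\<^sup>2 * s (Suc r) = (z - 2 * real r) * (z + 2 * \<mu> - 2 * real r) * s r + g r"
    and init: "u 0 = s 0" "u1 0 = 0" and Y: "\<bar>Y\<bar> < a"
  shows "u Y = even_series s Y"
proof -
  define c where "c n = (if even n then s (n div 2) / fact n else 0)" for n
  define g' where "g' n = (if even n then g (n div 2) / fact n else 0)" for n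
  have "(\<lambda>n. c n * Y ^ n) sums u Y"
  proof (rule gegenbauer_ode_series[where g = g', OF D D1 _ _ _ _ _ Y])
    fix y assume y: "\<bar>y\<bar> < a"
    show "(\<lambda>n. g' n * y ^ n) sums
         ((a\<^sup>2 - y\<^sup>2) * u2 y + (2 * z + 2 * \<mu> - 1) * y * u1 y - z * (z + 2 * \<mu>) * u y)"
      unfolding g'_def even_series_sums_iff by (rule ode[OF y])
    have "(\<lambda>n. c n * y ^ n) sums even_series s y"
      unfolding c_def even_series_sums_iff by (rule even_series_sums[OF s y])
    thus "summable (\<lambda>n. c n * y ^ n)" by (rule sums_summable)
  next
    fix n
    show "a\<^sup>2 * (real n + 2) * (real n + 1) * c (n + 2) = (z - real n) * (z + 2 * \<mu> - real n) * c n + g' n"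
    proof (cases "even n")
      case True
      then obtain r where n: "n = 2 * r" by (elim evenE)
      have "a\<^sup>2 * (real n + 2) * (real n + 1) * c (n + 2) = a\<^sup>2 * s (Suc r) / fact n"
        by (simp add: c_def n divide_simps) (simp add: algebra_simps)
      also have "\<dots> = ((z - real n) * (z + 2 * \<mu> - real n) * s r + g r) / fact n"
        unfolding rec by (simp add: n)
      also have "\<dots> = (z - real n) * (z + 2 * \<mu> - real n) * c n + g' n"
        by (simp add: c_def g'_def n add_divide_distrib)
      finally show ?thesis .
    qed (simp add: c_def g'_def)
  qed (use init in \<open>auto simp: c_def\<close>)
  hence "(\<lambda>r. s r * Y ^ (2 * r) / fact (2 * r)) sums u Y"
    unfolding c_def even_series_sums_iff .
  thus ?thesis using even_series_sums[OF s Y] by (rule sums_unique2)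
qed

text \<open>The ratio test: the quotient of consecutive terms of the cosine-like series tends to \<open>(x / a)\<^sup>2\<close>.\<close>

lemma even_conv_of_rec:
  assumes a: "a > 0"
    and rec: "\<And>r. r \<ge> r0 \<Longrightarrow> a\<^sup>2 * s (Suc r) = (z - 2 * real r) * (z + 2 * \<mu> - 2 * real r) * s r"
  shows "even_conv a s"
  unfolding even_conv_def
proof (intro allI impI)
  fix x :: real assume x: "0 \<le> x" "x < a"
  define q where "q = (x / a)\<^sup>2"
  define c where "c = (1 + q) / 2"
  have "x / a < 1" "0 \<le> x / a" using x a by auto
  hence q: "0 \<le> q" "q < 1" by (auto simp: q_def power_less_one_iff)
  define \<rho> where "\<rho> r = (z - 2 * real r) * (z + 2 * \<mu> - 2 * real r) / ((2 * real r + 1) * (2 * real r + 2))" for r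
  have "\<rho> \<longlonglongrightarrow> 1" unfolding \<rho>_def by real_asymp
  hence "(\<lambda>r. q * \<bar>\<rho> r\<bar>) \<longlonglongrightarrow> q * \<bar>1\<bar>" by (intro tendsto_intros)
  moreover have "q * \<bar>1\<bar> < c" using q by (simp add: c_def)
  ultimately have "eventually (\<lambda>r. q * \<bar>\<rho> r\<bar> < c) sequentially" by (rule order_tendstoD)
  then obtain r1 where r1: "\<And>r. r \<ge> r1 \<Longrightarrow> q * \<bar>\<rho> r\<bar> < c" by (auto simp: eventually_sequentially)
  show "summable (\<lambda>r. \<bar>s r\<bar> * x ^ (2 * r) / fact (2 * r))"
  proof (rule summable_ratio_test[of c "max r0 r1"])
    show "c < 1" using q by (simp add: c_def)
    fix r assume r: "r \<ge> max r0 r1"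
    have "s (Suc r) = (z - 2 * real r) * (z + 2 * \<mu> - 2 * real r) * s r / a\<^sup>2"
      using rec[of r] r a by (simp add: field_simps)
    hence "\<bar>s (Suc r)\<bar> * x ^ (2 * Suc r) / fact (2 * Suc r) =
       \<bar>(z - 2 * real r) * (z + 2 * \<mu> - 2 * real r)\<bar> * \<bar>s r\<bar> / a\<^sup>2 * (x\<^sup>2 * x ^ (2 * r)) / ((2 * real r + 1) * (2 * real r + 2) * fact (2 * r))"
      by (simp add: abs_mult power2_eq_square mult_ac add_ac)
    also have "\<dots> = q * \<bar>\<rho> r\<bar> * (\<bar>s r\<bar> * x ^ (2 * r) / fact (2 * r))"
      by (simp add: q_def \<rho>_def abs_mult power_divide mult_ac)
    also have "\<dots> \<le> c * (\<bar>s r\<bar> * x ^ (2 * r) / fact (2 * r))"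
      using r1[of r] r x by (intro mult_right_mono) auto
    finally show "norm (\<bar>s (Suc r)\<bar> * x ^ (2 * Suc r) / fact (2 * Suc r)) \<le> c * norm (\<bar>s r\<bar> * x ^ (2 * r) / fact (2 * r))"
      using x by simp
  qed
qed

section \<open>Coefficients of the singular and of the polynomial part\<close>

text \<open>The three sequences below are indexed by integers: the Taylor coefficient of
order \<open>2 r\<close> of an average that belongs to \<open>\<theta>\<close>, or to the power \<open>x^\<theta>\<close>, has index
\<open>k = \<theta> div 2 - r\<close>, up to sign. It does not depend on \<open>\<theta>\<close> and \<open>r\<close> separately, because differentiating twice lowers \<open>\<theta>\<close> by \<open>2\<close>.
Negative indices occur as soon as \<open>r > \<theta> div 2\<close>.\<close>

definition poly_coeff :: "real \<Rightarrow> real \<Rightarrow> int \<Rightarrow> real" where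
  "poly_coeff \<mu> a k =
     (if k \<ge> 0 then (- 1) ^ nat k * (a / 2) ^ (2 * nat k) / fact (nat k) * rGamma (of_int k + 1 + \<mu>) else 0)"

definition sing_even :: "real \<Rightarrow> real \<Rightarrow> int \<Rightarrow> real" where
  "sing_even \<mu> a k =
     1/2 * (a / 2) powi (2 * k - 1) * Gamma (1/2 - of_int k) * rGamma (\<mu> + of_int k + 1/2)"

text \<open>The branch \<open>k < 0\<close> is the limit of the first expression: there \<open>1 / \<Gamma>(k + 1)\<close> vanishes while
\<open>\<psi>(k + 1)\<close> has a pole.\<close>

definition sing_odd :: "real \<Rightarrow> real \<Rightarrow> int \<Rightarrow> real" where
  "sing_odd \<mu> a k =
     (if k \<ge> 0 then poly_coeff \<mu> a k * Upsilon_hat \<mu> (nat k) a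
      else 1/2 * (a / 2) powi (2 * k) * fact (nat (- k - 1)) * rGamma (\<mu> + of_int k + 1))"

text \<open>Taylor coefficients of the average of \<open>(-1)^m (a s + y)^(2 m) / (2 m)!\<close>, see
\<open>poisson_avg_even_power_translate\<close>.\<close>

definition power_coeff :: "real \<Rightarrow> real \<Rightarrow> nat \<Rightarrow> nat \<Rightarrow> real" where
  "power_coeff \<mu> a m r = (- 1) ^ r * poly_coeff \<mu> a (int m - int r)"

text \<open>Taylor coefficients of the average of the singular function; for \<open>\<theta> < 4\<close> this is the continuation of the
pattern found for \<open>\<theta> \<ge> 4\<close>, which the descent in \<open>\<theta>\<close> justifies.\<close>

definition sing_coeff :: "real \<Rightarrow> real \<Rightarrow> nat \<Rightarrow> nat \<Rightarrow> real" where
  "sing_coeff \<mu> a \<theta> r =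
     (- 1) ^ r * (if even \<theta> then sing_even \<mu> a (int (\<theta> div 2) - int r)
                  else sing_odd \<mu> a (int (\<theta> div 2) - int r))"

lemma sing_coeff_shift: "sing_coeff \<mu> a (\<theta> + 2) (Suc r) = - sing_coeff \<mu> a \<theta> r"
  by (simp add: sing_coeff_def)

lemma power_coeff_shift: "power_coeff \<mu> a (Suc m) (Suc r) = - power_coeff \<mu> a m r"
  by (simp add: power_coeff_def)

lemma power_coeff_0_Suc: "power_coeff \<mu> a 0 (Suc r) = 0"
  by (simp add: power_coeff_def poly_coeff_def)

lemma half_not_nonpos_Int: "(1/2 - of_int k :: real) \<notin> \<int>\<^sub>\<le>\<^sub>0"
proof
  assume "(1/2 - of_int k :: real) \<in> \<int>\<^sub>\<le>\<^sub>0"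
  then obtain n where "(1/2 - of_int k :: real) = of_int n" by (auto elim: nonpos_Ints_cases)
  hence "(1::real) = of_int (2 * (n + k))" by simp
  hence "1 = 2 * (n + k)" by (metis of_int_1 of_int_eq_iff)
  thus False by presburger
qed

lemma sing_even_rec:
  assumes a: "a > 0"
  shows "a\<^sup>2 * sing_even \<mu> a (k - 1) = - (2 * of_int k - 1) * (2 * of_int k - 1 + 2 * \<mu>) * sing_even \<mu> a k"
proof -
  define G where "G = Gamma (1/2 - of_int k :: real)"
  define R where "R = rGamma (\<mu> + of_int k + 1/2)"
  have "Gamma (1/2 - of_int (k - 1) :: real) = (1/2 - of_int k) * G"
    unfolding G_def using Gamma_plus1[OF half_not_nonpos_Int[of k]] by (simp add: algebra_simps)
  moreover have "rGamma (\<mu> + of_int (k - 1) + 1/2) = (\<mu> + of_int k - 1/2) * R"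
    unfolding R_def using rGamma_plus1[of "\<mu> + of_int k - 1/2"] by (simp add: algebra_simps)
  moreover have "a\<^sup>2 * (a / 2) powi (2 * (k - 1) - 1) = 4 * (a / 2) powi (2 * k - 1)"
  proof -
    have "(a / 2) powi (2 * k - 1) = (a / 2) powi (2 * (k - 1) - 1) * (a / 2) ^ 2"
      using power_int_add[of "a / 2" "2 * (k - 1) - 1" 2] a by (simp add: algebra_simps)
    thus ?thesis by (simp add: power_divide field_simps)
  qed
  ultimately have "a\<^sup>2 * sing_even \<mu> a (k - 1) =
      1/2 * (4 * (a / 2) powi (2 * k - 1)) * ((1/2 - of_int k) * G) * ((\<mu> + of_int k - 1/2) * R)"
    unfolding sing_even_def by (simp add: mult_ac)
  also have "\<dots> = - (2 * of_int k - 1) * (2 * of_int k - 1 + 2 * \<mu>) * sing_even \<mu> a k"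
    unfolding sing_even_def G_def[symmetric] R_def[symmetric] by (simp add: algebra_simps)
  finally show ?thesis .
qed

lemma poly_coeff_rec:
  assumes a: "a > 0"
  shows "a\<^sup>2 * poly_coeff \<mu> a (k - 1) = - 4 * of_int k * (of_int k + \<mu>) * poly_coeff \<mu> a k"
proof (cases "k \<ge> 1")
  case True
  define m where "m = nat (k - 1)"
  have k: "k = int (Suc m)" and k1: "k - 1 = int m" using True by (simp_all add: m_def)
  define R where "R = rGamma (of_int k + 1 + \<mu>)"
  define Q where "Q = (- 1) ^ m * (a / 2) ^ (2 * m)"
  have R: "rGamma (of_int (k - 1) + 1 + \<mu>) = (of_int k + \<mu>) * R"
    using rGamma_plus1[of "of_int k + \<mu>"] by (simp add: R_def algebra_simps)
  have f: "of_int k / fact (Suc m) = (1 / fact m :: real)" by (simp add: k)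
  have "a\<^sup>2 * poly_coeff \<mu> a (k - 1) = a\<^sup>2 * (Q * (1 / fact m) * ((of_int k + \<mu>) * R))"
    unfolding poly_coeff_def R by (simp add: k1 Q_def)
  also have "\<dots> = - 4 * of_int k * (of_int k + \<mu>) * (- Q * (a\<^sup>2 / 4) / fact (Suc m) * R)"
    unfolding f[symmetric] by simp
  also have "- Q * (a\<^sup>2 / 4) / fact (Suc m) * R = poly_coeff \<mu> a k"
  proof -
    have "nat k = Suc m" "k \<ge> 0" by (simp_all add: k)
    moreover have "(- 1) ^ Suc m * (a / 2) ^ (2 * Suc m) = - Q * (a\<^sup>2 / 4)"
      by (simp add: Q_def power2_eq_square)
    ultimately show ?thesis unfolding poly_coeff_def R_def by (simp only: if_True)
  qed
  finally show ?thesis .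
qed (auto simp: poly_coeff_def)

lemma Upsilon_hat_Suc:
  assumes "\<mu> \<ge> 0"
  shows "Upsilon_hat \<mu> (Suc n) a = Upsilon_hat \<mu> n a + 1 / 2 * (1 / real (Suc n) + 1 / (real (Suc n) + \<mu>))"
proof -
  have "Digamma (real (Suc n) + 1 + \<mu>) = Digamma (real n + 1 + \<mu>) + 1 / (real n + 1 + \<mu>)"
    using Digamma_plus1[of "real n + 1 + \<mu>"] assms by (simp add: add_ac)
  moreover have "Digamma (real (Suc n) + 1) = Digamma (real n + 1) + 1 / (real n + 1)"
    using Digamma_plus1[of "real n + 1"] by (simp add: add_ac)
  ultimately show ?thesis by (simp add: Upsilon_hat_def add_ac add_divide_distrib)
qed

text \<open>The inhomogeneous term appears because \<open>Upsilon_hat\<close> changes from one index to the next, by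
the recursion of the digamma function.\<close>

lemma sing_odd_rec:
  assumes a: "a > 0" and \<mu>: "\<mu> \<ge> 0"
  shows "a\<^sup>2 * sing_odd \<mu> a (k - 1) =
           - 4 * of_int k * (of_int k + \<mu>) * sing_odd \<mu> a k + (4 * of_int k + 2 * \<mu>) * poly_coeff \<mu> a k"
proof -
  consider "k \<ge> 1" | "k = 0" | "k < 0" by linarith
  thus ?thesis
  proof cases
    case 1
    define n where "n = nat (k - 1)"
    have k: "k = int (Suc n)" using 1 by (simp add: n_def)
    define K where "K = (of_int k :: real)"
    have K: "K > 0" using 1 by (simp add: K_def)
    have u: "Upsilon_hat \<mu> (nat k) a = Upsilon_hat \<mu> (nat (k - 1)) a + 1 / 2 * (1 / K + 1 / (K + \<mu>))"
      using Upsilon_hat_Suc[OF \<mu>, of n a] by (simp add: k K_def nat_add_distrib)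
    have exp: "- 4 * K * (K + \<mu>) * P * (U - 1/2 * t) = - 4 * K * (K + \<mu>) * (P * U) + 2 * (K * (K + \<mu>) * t) * P" for P U t
      by (simp add: algebra_simps)
    have "a\<^sup>2 * sing_odd \<mu> a (k - 1) = (a\<^sup>2 * poly_coeff \<mu> a (k - 1)) * Upsilon_hat \<mu> (nat (k - 1)) a"
      using 1 by (simp add: sing_odd_def)
    also have "\<dots> = - 4 * K * (K + \<mu>) * poly_coeff \<mu> a k * (Upsilon_hat \<mu> (nat k) a - 1 / 2 * (1 / K + 1 / (K + \<mu>)))"
      unfolding poly_coeff_rec[OF a] u K_def by simp
    also have "\<dots> = - 4 * K * (K + \<mu>) * (poly_coeff \<mu> a k * Upsilon_hat \<mu> (nat k) a)
        + 2 * (K * (K + \<mu>) * (1 / K + 1 / (K + \<mu>))) * poly_coeff \<mu> a k"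
      by (rule exp)
    also have "K * (K + \<mu>) * (1 / K + 1 / (K + \<mu>)) = 2 * K + \<mu>"
      using K \<mu> by (simp add: divide_simps)
    finally show ?thesis using 1 by (simp add: sing_odd_def K_def algebra_simps)
  next
    case 2
    have "rGamma \<mu> = \<mu> * rGamma (\<mu> + 1)" using rGamma_plus1[of \<mu>] by simp
    moreover have "(a / 2) powi (- 2) = 4 / a\<^sup>2" by (simp add: power_int_minus power_divide)
    hence "sing_odd \<mu> a (- 1) = 1/2 * (4 / a\<^sup>2) * rGamma \<mu>" by (simp add: sing_odd_def)
    hence "a\<^sup>2 * sing_odd \<mu> a (- 1) = 2 * rGamma \<mu>" using a by simp
    moreover have "poly_coeff \<mu> a 0 = rGamma (\<mu> + 1)" by (simp add: poly_coeff_def add.commute)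
    ultimately show ?thesis unfolding 2 by simp
  next
    case 3
    define j where "j = nat (- k - 1)"
    have k: "k = - int j - 1" using 3 by (simp add: j_def)
    have "a\<^sup>2 * (a / 2) powi (2 * (k - 1)) = 4 * (a / 2) powi (2 * k)"
    proof -
      have "(a / 2) powi (2 * k) = (a / 2) powi (2 * (k - 1)) * (a / 2) ^ 2"
        using power_int_add[of "a / 2" "2 * (k - 1)" 2] a by (simp add: algebra_simps)
      thus ?thesis by (simp add: power_divide field_simps)
    qed
    moreover have "rGamma (\<mu> + of_int (k - 1) + 1) = (\<mu> + of_int k) * rGamma (\<mu> + of_int k + 1)"
      using rGamma_plus1[of "\<mu> + of_int k"] by (simp add: algebra_simps)
    moreover have "fact (nat (- (k - 1) - 1)) = - of_int k * (fact (nat (- k - 1)) :: real)"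
      by (simp add: k nat_add_distrib Suc_nat_eq_nat_zadd1[symmetric])
    ultimately have "a\<^sup>2 * sing_odd \<mu> a (k - 1) = 1/2 * (4 * (a / 2) powi (2 * k)) * (- of_int k * fact (nat (- k - 1)))
         * ((\<mu> + of_int k) * rGamma (\<mu> + of_int k + 1))"
      unfolding sing_odd_def using 3 by (simp add: mult_ac)
    thus ?thesis using 3 by (simp add: sing_odd_def poly_coeff_def algebra_simps)
  qed
qed

lemma even_conv_sing_coeff:
  assumes a: "a > 0" and \<mu>: "\<mu> \<ge> 0"
  shows "even_conv a (sing_coeff \<mu> a \<theta>)"
proof (cases "even \<theta>")
  case True
  show ?thesis
  proof (rule even_conv_of_rec[OF a, where z = "2 * real (\<theta> div 2) - 1" and \<mu> = \<mu> and ?r0.0 = 0])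
    fix r
    define k where "k = int (\<theta> div 2) - int r"
    have k1: "int (\<theta> div 2) - int (Suc r) = k - 1" by (simp add: k_def)
    have z: "2 * real (\<theta> div 2) - 1 - 2 * real r = 2 * of_int k - 1"
      "2 * real (\<theta> div 2) - 1 + 2 * \<mu> - 2 * real r = 2 * of_int k - 1 + 2 * \<mu>" by (simp_all add: k_def)
    have s: "sing_coeff \<mu> a \<theta> r = (- 1) ^ r * sing_even \<mu> a k"
      "sing_coeff \<mu> a \<theta> (Suc r) = - ((- 1) ^ r) * sing_even \<mu> a (k - 1)"
      unfolding sing_coeff_def k1 k_def[symmetric] using True by simp_all
    have "a\<^sup>2 * sing_coeff \<mu> a \<theta> (Suc r) = - ((- 1) ^ r) * (a\<^sup>2 * sing_even \<mu> a (k - 1))"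
      unfolding s by simp
    thus "a\<^sup>2 * sing_coeff \<mu> a \<theta> (Suc r) =
       (2 * real (\<theta> div 2) - 1 - 2 * real r) * (2 * real (\<theta> div 2) - 1 + 2 * \<mu> - 2 * real r) * sing_coeff \<mu> a \<theta> r"
      unfolding z s(1) sing_even_rec[OF a, of \<mu> k] by (simp add: algebra_simps)
  qed
next
  case False
  show ?thesis
  proof (rule even_conv_of_rec[OF a, where z = "2 * real (\<theta> div 2)" and \<mu> = \<mu> and ?r0.0 = "\<theta>"])
    fix r assume r: "r \<ge> \<theta>"
    define k where "k = int (\<theta> div 2) - int r"
    have k1: "int (\<theta> div 2) - int (Suc r) = k - 1" by (simp add: k_def)
    have z: "2 * real (\<theta> div 2) - 2 * real r = 2 * of_int k"
      "2 * real (\<theta> div 2) + 2 * \<mu> - 2 * real r = 2 * of_int k + 2 * \<mu>" by (simp_all add: k_def)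
    have "k < 0" using r False by (auto simp: k_def elim!: oddE)
    hence "poly_coeff \<mu> a k = 0" by (simp add: poly_coeff_def)
    hence rec: "a\<^sup>2 * sing_odd \<mu> a (k - 1) = - (2 * of_int k) * (2 * of_int k + 2 * \<mu>) * sing_odd \<mu> a k"
      using sing_odd_rec[OF a \<mu>, of k] by (simp add: algebra_simps)
    have s: "sing_coeff \<mu> a \<theta> r = (- 1) ^ r * sing_odd \<mu> a k"
      "sing_coeff \<mu> a \<theta> (Suc r) = - ((- 1) ^ r) * sing_odd \<mu> a (k - 1)"
      unfolding sing_coeff_def k1 k_def[symmetric] using False by simp_all
    have "a\<^sup>2 * sing_coeff \<mu> a \<theta> (Suc r) = - ((- 1) ^ r) * (a\<^sup>2 * sing_odd \<mu> a (k - 1))"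
      unfolding s by simp
    thus "a\<^sup>2 * sing_coeff \<mu> a \<theta> (Suc r) =
       (2 * real (\<theta> div 2) - 2 * real r) * (2 * real (\<theta> div 2) + 2 * \<mu> - 2 * real r) * sing_coeff \<mu> a \<theta> r"
      unfolding z s(1) rec by simp
  qed
qed

lemma power_coeff_eq_0: "r > m \<Longrightarrow> power_coeff \<mu> a m r = 0"
  by (simp add: power_coeff_def poly_coeff_def)

lemma power_coeff_le: "r \<le> m \<Longrightarrow>
   power_coeff \<mu> a m r = (- 1) ^ m * ((a / 2) ^ (2 * (m - r)) / fact (m - r) * rGamma (real (m - r) + 1 + \<mu>))"
proof -
  assume r: "r \<le> m"
  have p: "(- 1 :: real) ^ m = (- 1) ^ r * (- 1) ^ (m - r)" using r by (simp flip: power_add)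
  have q: "int m - int r = int (m - r)" using r by simp
  show ?thesis unfolding power_coeff_def q poly_coeff_def p
    by (simp only: nat_int of_nat_0_le_iff if_True of_int_of_nat_eq mult.assoc times_divide_eq_right times_divide_eq_left)
qed

lemma poisson_avg_sum:
  assumes "\<mu> \<ge> 0" "finite I" "\<And>i. i \<in> I \<Longrightarrow> continuous_on {-1..1} (f i)"
  shows "poisson_avg \<mu> (\<lambda>s. \<Sum>i\<in>I. f i s) = (\<Sum>i\<in>I. poisson_avg \<mu> (f i))"
  using assms(2,3)
proof (induction I rule: finite_induct)
  case (insert i I)
  have "poisson_avg \<mu> (\<lambda>s. f i s + (\<Sum>i\<in>I. f i s)) = poisson_avg \<mu> (f i) + poisson_avg \<mu> (\<lambda>s. \<Sum>i\<in>I. f i s)"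
    by (rule poisson_avg_add[OF assms(1)]) (use insert in \<open>auto intro!: continuous_on_sum\<close>)
  thus ?case using insert by simp
qed (simp add: poisson_avg_def)

lemma sum_even_only:
  fixes f :: "nat \<Rightarrow> real"
  assumes "\<And>i. odd i \<Longrightarrow> f i = 0"
  shows "(\<Sum>i\<le>2 * m. f i) = (\<Sum>i\<le>m. f (2 * i))"
proof (induction m)
  case (Suc m)
  have "(\<Sum>i\<le>2 * Suc m. f i) = (\<Sum>i\<le>2 * m. f i) + f (Suc (2 * m)) + f (2 * Suc m)" by simp
  thus ?case using Suc assms[of "Suc (2 * m)"] by simp
qed simp

lemma poisson_avg_even_power_translate:
  assumes \<mu>: "\<mu> \<ge> 0"
  shows "poisson_avg \<mu> (\<lambda>s. (- 1) ^ m * (a * s + y) ^ (2 * m) / fact (2 * m)) =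
           (\<Sum>r\<le>m. power_coeff \<mu> a m r * y ^ (2 * r) / fact (2 * r))"
proof -
  let ?f = "\<lambda>i s. (- 1) ^ m * y ^ (2 * m - i) * a ^ i / (fact i * fact (2 * m - i)) * s ^ i"
  have "poisson_avg \<mu> (\<lambda>s. (- 1) ^ m * (a * s + y) ^ (2 * m) / fact (2 * m)) = poisson_avg \<mu> (\<lambda>s. \<Sum>i\<le>2 * m. ?f i s)"
  proof (rule poisson_avg_cong)
    fix s :: real
    have "(a * s + y) ^ (2 * m) = (\<Sum>i\<le>2 * m. of_nat (2 * m choose i) * (a * s) ^ i * y ^ (2 * m - i))"
      by (rule binomial_ring)
    hence "(- 1) ^ m * (a * s + y) ^ (2 * m) / fact (2 * m) =
       (\<Sum>i\<le>2 * m. (- 1) ^ m * (of_nat (2 * m choose i) * (a * s) ^ i * y ^ (2 * m - i)) / fact (2 * m))"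
      by (simp add: sum_distrib_left sum_divide_distrib)
    also have "\<dots> = (\<Sum>i\<le>2 * m. ?f i s)"
      by (rule sum.cong[OF refl]) (simp add: binomial_fact power_mult_distrib mult_ac)
    finally show "(- 1) ^ m * (a * s + y) ^ (2 * m) / fact (2 * m) = (\<Sum>i\<le>2 * m. ?f i s)" .
  qed
  also have "\<dots> = (\<Sum>i\<le>2 * m. poisson_avg \<mu> (?f i))"
    by (rule poisson_avg_sum[OF \<mu>]) (auto intro!: continuous_intros)
  also have "\<dots> = (\<Sum>i\<le>m. poisson_avg \<mu> (?f (2 * i)))"
    by (rule sum_even_only, unfold poisson_avg_cmult) (simp add: poisson_avg_odd_power)
  also have "\<dots> = (\<Sum>i\<le>m. power_coeff \<mu> a m (m - i) * y ^ (2 * (m - i)) / fact (2 * (m - i)))"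
  proof (rule sum.cong[OF refl])
    fix i assume "i \<in> {..m}"
    hence i: "i \<le> m" by simp
    have e: "m - (m - i) = i" "2 * m - 2 * i = 2 * (m - i)" using i by auto
    have "power_coeff \<mu> a m (m - i) = (- 1) ^ m * ((a / 2) ^ (2 * i) / fact i * rGamma (real i + 1 + \<mu>))"
      using power_coeff_le[of "m - i" m \<mu> a] unfolding e by simp
    moreover have "sin_moment \<mu> i = fact (2 * i) / (4 ^ i * fact i) * rGamma (real i + 1 + \<mu>)"
      by (simp add: sin_moment_def add_ac)
    moreover have "(a / 2) ^ (2 * i) = a ^ (2 * i) / 4 ^ i" by (simp add: power_divide power_mult)
    ultimately show "poisson_avg \<mu> (?f (2 * i)) = power_coeff \<mu> a m (m - i) * y ^ (2 * (m - i)) / fact (2 * (m - i))"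
      unfolding poisson_avg_cmult poisson_avg_even_power[OF \<mu>] e by (simp add: mult_ac)
  qed
  also have "\<dots> = (\<Sum>r\<le>m. power_coeff \<mu> a m r * y ^ (2 * r) / fact (2 * r))"
    using sum.nat_diff_reindex[of "\<lambda>r. power_coeff \<mu> a m r * y ^ (2 * r) / fact (2 * r)" "Suc m"]
    by (simp add: lessThan_Suc_atMost)
  finally show ?thesis .
qed

section \<open>Averages of the singular kernels\<close>

text \<open>The non-analytic part at \<open>0\<close> of \<open>\<Sum>n. cos (n x) / n^\<theta>\<close>, written so as to be even in \<open>x\<close>. For odd \<open>\<theta>\<close> the
summand with the harmonic number is the substitute for the term of the power series that would contain \<open>\<zeta>(1)\<close>.\<close>

definition sing_kernel :: "nat \<Rightarrow> real \<Rightarrow> real" where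
  "sing_kernel \<theta> x =
     (if even \<theta> then (- 1) ^ (\<theta> div 2) * (pi / 2) / fact (\<theta> - 1) * (\<bar>x\<bar> * x ^ (\<theta> - 2))
      else (- 1) ^ (\<theta> div 2) / fact (\<theta> - 1) * (harm (\<theta> - 1) * x ^ (\<theta> - 1) - x ^ (\<theta> - 1) * ln \<bar>x\<bar>))"

lemma Gamma_half_minus: "Gamma (1/2 - real n) = (- 1) ^ n * 4 ^ n * fact n / fact (2 * n) * sqrt pi"
proof (induction n)
  case 0 show ?case by (simp add: Gamma_one_half_real)
next
  case (Suc n)
  have "1/2 - of_int (int (Suc n)) \<notin> (\<int>\<^sub>\<le>\<^sub>0 :: real set)" by (rule half_not_nonpos_Int)
  from Gamma_plus1[OF this] have "Gamma (1/2 - real n) = (1/2 - real (Suc n)) * Gamma (1/2 - real (Suc n))"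
    by (simp add: algebra_simps)
  hence "Gamma (1/2 - real (Suc n)) = Gamma (1/2 - real n) / (1/2 - real (Suc n))" by simp
  also have "\<dots> = (- 1) ^ Suc n * 4 ^ Suc n * fact (Suc n) / fact (2 * Suc n) * sqrt pi"
    unfolding Suc by (simp add: divide_simps) (simp add: algebra_simps)
  finally show ?case .
qed

lemma sing_even_int:
  assumes N: "N \<ge> 1"
  shows "sing_even \<mu> a (int N) = (- 1) ^ N * (pi / 2) / fact (2 * N - 1) * a ^ (2 * N - 1) *
     (Gamma (real N) / sqrt pi * rGamma (\<mu> + real N + 1/2))"
proof -
  obtain M where M: "N = Suc M" using N by (cases N) auto
  have p: "(a / 2) powi (2 * int N - 1) = a ^ (2 * M + 1) / 2 ^ (2 * M + 1)"
  proof -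
    have "2 * int N - 1 = int (2 * M + 1)" by (simp add: M)
    thus ?thesis by (simp only: power_int_of_nat power_divide)
  qed
  have g: "Gamma (real N) = fact M" using Gamma_fact[of M, where ?'a = real] by (simp add: M add.commute)
  have q: "pi / 2 / sqrt pi = sqrt pi / 2" by (simp add: real_div_sqrt field_simps)
  have f: "fact (2 * N) = (2 * real N) * fact (2 * M + 1)" "fact N = real N * (fact M :: real)"
    by (simp_all add: M)
  have "(4::real) ^ N = 2 * 2 ^ (2 * M + 1)" by (simp add: M power_mult)
  hence "1/2 * (a ^ (2 * M + 1) / 2 ^ (2 * M + 1)) * Gamma (1/2 - real N) =
     (- 1) ^ N * a ^ (2 * M + 1) * sqrt pi * (real N * fact M / (2 * real N * fact (2 * M + 1)))"
    unfolding Gamma_half_minus f by (simp add: field_simps)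
  also have "real N * fact M / (2 * real N * fact (2 * M + 1)) = fact M / (2 * fact (2 * M + 1))"
    using N by simp
  also have "(- 1) ^ N * a ^ (2 * M + 1) * sqrt pi * (fact M / (2 * fact (2 * M + 1))) =
     (- 1) ^ N * (pi / 2 / sqrt pi) / fact (2 * M + 1) * a ^ (2 * M + 1) * fact M"
    unfolding q by simp
  finally have "1/2 * (a ^ (2 * M + 1) / 2 ^ (2 * M + 1)) * Gamma (1/2 - real N) =
     (- 1) ^ N * (pi / 2 / sqrt pi) / fact (2 * M + 1) * a ^ (2 * M + 1) * fact M" .
  moreover have "2 * N - 1 = 2 * M + 1" by (simp add: M)
  ultimately show ?thesis unfolding sing_even_def p g of_int_of_nat_eq by (simp add: mult_ac)
qed

text \<open>For a homogeneous function \<open>f\<close> of degree \<open>z\<close> Euler's relations \<open>x f' = z f\<close> and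
\<open>x\<^sup>2 f'' = z (z - 1) f\<close>, inserted into \<open>poisson_avg_ibp\<close>, give the homogeneous Gegenbauer equation
for the average. The initial value is a moment.\<close>

lemma poisson_avg_sing_kernel_even:
  fixes M :: nat
  assumes \<mu>: "\<mu> \<ge> 0" and a: "a > 0" and y: "\<bar>Y\<bar> < a"
  defines "N \<equiv> M + 2"
  shows "poisson_avg \<mu> (\<lambda>s. sing_kernel (2 * N) (a * s + Y)) = even_series (sing_coeff \<mu> a (2 * N)) Y"
proof -
  define A where "A = (- 1) ^ N * (pi / 2) / fact (2 * N - 1)"
  define z where "z = 2 * real M + 3"
  define f where "f x = A * (\<bar>x\<bar> * x ^ (2 * M + 2))" for x
  define f1 where "f1 x = A * (z * (\<bar>x\<bar> * x ^ (2 * M + 1)))" for x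
  define f2 where "f2 x = A * (z * ((z - 1) * (\<bar>x\<bar> * x ^ (2 * M))))" for x
  have Df: "(f has_real_derivative f1 x) (at x)" for x
    using DERIV_cmult[OF DERIV_abs_power[of "2 * M + 2" x], of A] by (simp add: f_def[abs_def] f1_def z_def add_ac)
  have Df1: "(f1 has_real_derivative f2 x) (at x)" for x
    using DERIV_cmult[OF DERIV_cmult[OF DERIV_abs_power[of "2 * M + 1" x], of z], of A]
    by (simp add: f1_def[abs_def] f2_def z_def add_ac)
  have c: "continuous_on S f" "continuous_on S f1" "continuous_on S f2" for S
    unfolding f_def[abs_def] f1_def[abs_def] f2_def[abs_def] by (intro continuous_intros)+
  have cc: "continuous_on {-1..1} (\<lambda>s. h (a * s + y))" if "\<And>S. continuous_on S h" for h :: "real \<Rightarrow> real" and y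
    by (rule continuous_on_compose2[OF that[of UNIV]]) (auto intro!: continuous_intros)
  define u where "u y = poisson_avg \<mu> (\<lambda>s. f (a * s + y))" for y
  define u1 where "u1 y = poisson_avg \<mu> (\<lambda>s. f1 (a * s + y))" for y
  define u2 where "u2 y = poisson_avg \<mu> (\<lambda>s. f2 (a * s + y))" for y
  have ode: "(a\<^sup>2 - y\<^sup>2) * u2 y + (2 * z + 2 * \<mu> - 1) * y * u1 y - z * (z + 2 * \<mu>) * u y = 0" for y
  proof -
    have "0 = - poisson_avg \<mu> (\<lambda>s. (2 * \<mu> + 1) * (a * s) * f1 (a * s + y) - a\<^sup>2 * (1 - s\<^sup>2) * f2 (a * s + y))"
      using poisson_avg_ibp[OF \<mu> Df1 c(3), of a y] by simp
    also have "\<dots> = poisson_avg \<mu> (\<lambda>s. - ((2 * \<mu> + 1) * (a * s) * f1 (a * s + y) - a\<^sup>2 * (1 - s\<^sup>2) * f2 (a * s + y)))"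
      by (rule poisson_avg_minus[symmetric])
    also have "\<dots> = poisson_avg \<mu> (\<lambda>s. (a\<^sup>2 - y\<^sup>2) * f2 (a * s + y) + ((2 * z + 2 * \<mu> - 1) * y) * f1 (a * s + y)
          + (- (z * (z + 2 * \<mu>))) * f (a * s + y))"
    proof (rule poisson_avg_cong)
      fix s :: real
      define x where "x = a * s + y"
      define w where "w = \<bar>x\<bar> * x ^ (2 * M)"
      have e: "f x = A * w * x\<^sup>2" "f1 x = A * z * w * x" "f2 x = A * z * (z - 1) * w"
        by (simp_all add: f_def f1_def f2_def w_def power_add power2_eq_square mult_ac)
      have s: "a * s = x - y" "a\<^sup>2 * (1 - s\<^sup>2) = a\<^sup>2 - (x - y)\<^sup>2"
        by (simp_all add: x_def algebra_simps power2_eq_square)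
      show "- ((2 * \<mu> + 1) * (a * s) * f1 (a * s + y) - a\<^sup>2 * (1 - s\<^sup>2) * f2 (a * s + y)) =
         (a\<^sup>2 - y\<^sup>2) * f2 (a * s + y) + ((2 * z + 2 * \<mu> - 1) * y) * f1 (a * s + y)
          + (- (z * (z + 2 * \<mu>))) * f (a * s + y)"
        unfolding x_def[symmetric] unfolding e s by (simp add: algebra_simps power2_eq_square)
    qed
    also have "\<dots> = (a\<^sup>2 - y\<^sup>2) * u2 y + ((2 * z + 2 * \<mu> - 1) * y) * u1 y + (- (z * (z + 2 * \<mu>))) * u y"
      unfolding u_def u1_def u2_def by (rule poisson_avg_lin3[OF \<mu> cc cc cc]) (rule c)+
    finally show ?thesis by simp
  qed
  have "u Y = even_series (sing_coeff \<mu> a (2 * N)) Y"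
  proof (rule gegenbauer_even_series[where g = "\<lambda>_. 0" and z = z and \<mu> = \<mu> and a = a and ?u1.0 = u1 and ?u2.0 = u2])
    fix y
    show "(u has_real_derivative u1 y) (at y)" unfolding u_def[abs_def] u1_def
      by (rule DERIV_poisson_avg_translate[OF \<mu> Df c(2)])
    show "(u1 has_real_derivative u2 y) (at y)" unfolding u1_def[abs_def] u2_def
      by (rule DERIV_poisson_avg_translate[OF \<mu> Df1 c(3)])
    show "(\<lambda>r. 0 * y ^ (2 * r) / fact (2 * r)) sums
            ((a\<^sup>2 - y\<^sup>2) * u2 y + (2 * z + 2 * \<mu> - 1) * y * u1 y - z * (z + 2 * \<mu>) * u y)"
      unfolding ode by simp
  next
    fix r
    define k where "k = int N - int r"
    have k1: "int N - int (Suc r) = k - 1" by (simp add: k_def)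
    have zz: "z - 2 * real r = 2 * of_int k - 1" "z + 2 * \<mu> - 2 * real r = 2 * of_int k - 1 + 2 * \<mu>"
      by (simp_all add: k_def z_def N_def)
    have d: "2 * N div 2 = N" by simp
    have s: "sing_coeff \<mu> a (2 * N) r = (- 1) ^ r * sing_even \<mu> a k"
      "sing_coeff \<mu> a (2 * N) (Suc r) = - ((- 1) ^ r) * sing_even \<mu> a (k - 1)"
      unfolding sing_coeff_def d k1 k_def[symmetric] by simp_all
    have "a\<^sup>2 * sing_coeff \<mu> a (2 * N) (Suc r) = - ((- 1) ^ r) * (a\<^sup>2 * sing_even \<mu> a (k - 1))"
      unfolding s by simp
    thus "a\<^sup>2 * sing_coeff \<mu> a (2 * N) (Suc r) =
       (z - 2 * real r) * (z + 2 * \<mu> - 2 * real r) * sing_coeff \<mu> a (2 * N) r + 0"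
      unfolding zz s(1) sing_even_rec[OF a, of \<mu> k] by (simp add: algebra_simps)
  next
    have "u 0 = poisson_avg \<mu> (\<lambda>s. A * a ^ (2 * N - 1) * \<bar>s\<bar> powr z)"
      unfolding u_def
    proof (rule poisson_avg_cong)
      fix s :: real
      have "\<bar>s\<bar> powr z = \<bar>s\<bar> ^ (2 * M + 3)"
      proof (cases "s = 0")
        case False
        have "\<bar>s\<bar> powr real (2 * M + 3) = \<bar>s\<bar> ^ (2 * M + 3)" by (rule powr_realpow) (use False in simp)
        thus ?thesis by (simp add: z_def)
      qed simp
      also have "\<dots> = \<bar>s\<bar> * s ^ (2 * M + 2)"
      proof -
        have "\<bar>s\<bar> ^ (2 * (M + 1)) = s ^ (2 * (M + 1))" by (simp add: power_even_abs)
        thus ?thesis by (simp add: numeral_3_eq_3)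
      qed
      finally show "f (a * s + 0) = A * a ^ (2 * N - 1) * \<bar>s\<bar> powr z"
        using a by (simp add: f_def N_def abs_mult power_mult_distrib mult_ac numeral_3_eq_3)
    qed
    also have "\<dots> = A * a ^ (2 * N - 1) * (Gamma ((z + 1) / 2) / sqrt pi * rGamma (\<mu> + 1 + z / 2))"
      unfolding poisson_avg_cmult by (subst poisson_avg_powr[OF \<mu>]) (auto simp: z_def)
    also have "(z + 1) / 2 = real N" by (simp add: z_def N_def)
    also have "\<mu> + 1 + z / 2 = \<mu> + real N + 1/2" by (simp add: z_def N_def add_divide_distrib)
    also have "A * a ^ (2 * N - 1) * (Gamma (real N) / sqrt pi * rGamma (\<mu> + real N + 1/2)) = sing_even \<mu> a (int N)"
      unfolding A_def by (rule sing_even_int[symmetric]) (simp add: N_def)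
    finally show "u 0 = sing_coeff \<mu> a (2 * N) 0" by (simp add: sing_coeff_def)
    show "u1 0 = 0" unfolding u1_def by (rule poisson_avg_odd) (simp add: f1_def algebra_simps)
  qed (use y even_conv_sing_coeff[OF a \<mu>] in auto)
  moreover have "sing_kernel (2 * N) = f"
    by (simp add: sing_kernel_def f_def A_def N_def fun_eq_iff)
  ultimately show ?thesis by (simp add: u_def)
qed

lemma Upsilon_hat_eq:
  "Upsilon_hat \<mu> N a = harm (2 * N) - ln (a / 2) - ln 2 - Digamma (real N + 1/2) / 2 + Digamma (real N + 1 + \<mu>) / 2"
proof -
  have 1: "Digamma (real N + 1) = harm N - euler_mascheroni"
    using Digamma_of_nat[of N, where ?'a = real] by (simp add: add.commute)
  have 2: "Digamma (real N + 1/2) = (\<Sum>k<N. 2 / (2 * real k + 1)) - euler_mascheroni - 2 * ln 2"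
    using Digamma_half_integer[of N, where ?'a = real] by (simp add: add.commute)
  have 3: "2 * harm (2 * N) = harm N + (\<Sum>k<N. 2 / (2 * real k + 1))"
  proof (induction N)
    case (Suc N)
    have "2 * harm (2 * Suc N) = 2 * harm (2 * N) + 2 / (2 * real N + 1) + 1 / real (Suc N)"
      by (simp add: harm_Suc inverse_eq_divide divide_simps) (simp add: algebra_simps)
    thus ?case unfolding Suc by (simp add: harm_Suc inverse_eq_divide)
  qed (simp add: harm_def)
  show ?thesis unfolding Upsilon_hat_def 1 2 using 3 by (simp add: field_simps)
qed

text \<open>As in the even case, but the logarithm spoils homogeneity: Euler's relations acquire multiples of
\<open>x^(2 N)\<close>, whose averages form the right-hand side of the equation. The
initial value combines an ordinary and a logarithmic moment.\<close>

lemma poisson_avg_sing_kernel_odd: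
  fixes M :: nat
  assumes \<mu>: "\<mu> \<ge> 0" and a: "a > 0" and y: "\<bar>Y\<bar> < a"
  defines "N \<equiv> M + 2"
  shows "poisson_avg \<mu> (\<lambda>s. sing_kernel (2 * N + 1) (a * s + Y)) = even_series (sing_coeff \<mu> a (2 * N + 1)) Y"
proof -
  define A where "A = (- 1) ^ N / (fact (2 * N) :: real)"
  define H where "H = (harm (2 * N) :: real)"
  define z where "z = 2 * real M + 4"
  define f where "f x = A * (H * x ^ (2 * M + 4) - x ^ (2 * M + 4) * ln \<bar>x\<bar>)" for x
  define f1 where "f1 x = A * (H * (z * x ^ (2 * M + 3)) - (z * (x ^ (2 * M + 3) * ln \<bar>x\<bar>) + x ^ (2 * M + 3)))" for x
  define f2 where "f2 x = A * (H * (z * ((z - 1) * x ^ (2 * M + 2)))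
     - (z * ((z - 1) * (x ^ (2 * M + 2) * ln \<bar>x\<bar>) + x ^ (2 * M + 2)) + (z - 1) * x ^ (2 * M + 2)))" for x
  have dp: "((\<lambda>x::real. x ^ Suc n) has_real_derivative (real n + 1) * x ^ n) (at x)" for n x
    using DERIV_pow[of "Suc n" x UNIV] by (simp add: add.commute)
  have dl: "((\<lambda>x::real. x ^ Suc n * ln \<bar>x\<bar>) has_real_derivative (real n + 1) * (x ^ n * ln \<bar>x\<bar>) + x ^ n) (at x)" if "n \<ge> 1" for n x
    using DERIV_power_ln_abs[of "Suc n" x] that by (simp add: add.commute)
  have nz: "real (2 * M + 3) + 1 = z" "real (2 * M + 2) + 1 = z - 1" by (simp_all add: z_def)
  have ns: "2 * M + 4 = Suc (2 * M + 3)" "2 * M + 3 = Suc (2 * M + 2)" by simp_all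
  have Df: "(f has_real_derivative f1 x) (at x)" for x
    unfolding f_def[abs_def] f1_def ns(1) nz(1)[symmetric]
    by (intro DERIV_cmult DERIV_diff dp dl) simp
  have Df1: "(f1 has_real_derivative f2 x) (at x)" for x
    unfolding f1_def[abs_def] f2_def ns(2) nz(2)[symmetric]
    by (intro DERIV_cmult DERIV_diff DERIV_add dp dl) simp
  have c: "continuous_on S f" "continuous_on S f1" "continuous_on S f2" for S
    unfolding f_def[abs_def] f1_def[abs_def] f2_def[abs_def]
    by (intro continuous_on_mult continuous_on_diff continuous_on_add continuous_on_const continuous_on_power
         continuous_on_id continuous_on_power_ln_abs; simp)+
  have cc: "continuous_on {-1..1} (\<lambda>s. h (a * s + y))" if "\<And>S. continuous_on S h" for h :: "real \<Rightarrow> real" and y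
    by (rule continuous_on_compose2[OF that[of UNIV]]) (auto intro!: continuous_intros)
  define u where "u y = poisson_avg \<mu> (\<lambda>s. f (a * s + y))" for y
  define u1 where "u1 y = poisson_avg \<mu> (\<lambda>s. f1 (a * s + y))" for y
  define u2 where "u2 y = poisson_avg \<mu> (\<lambda>s. f2 (a * s + y))" for y
  define p where "p x = A * x ^ (2 * M + 4)" for x
  define p1 where "p1 x = A * (z * x ^ (2 * M + 3))" for x
  define P where "P y = poisson_avg \<mu> (\<lambda>s. p (a * s + y))" for y
  define P1 where "P1 y = poisson_avg \<mu> (\<lambda>s. p1 (a * s + y))" for y
  have cp: "continuous_on S p" "continuous_on S p1" for S
    unfolding p_def[abs_def] p1_def[abs_def] by (intro continuous_intros)+
  have Dp: "(p has_real_derivative p1 x) (at x)" for x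
    unfolding p_def[abs_def] p1_def ns(1) nz(1)[symmetric] by (intro DERIV_cmult dp)
  have P_eq: "P y = (\<Sum>r\<le>N. power_coeff \<mu> a N r * y ^ (2 * r) / fact (2 * r))" for y
  proof -
    have "(\<lambda>s. p (a * s + y)) = (\<lambda>s. (- 1) ^ N * (a * s + y) ^ (2 * N) / fact (2 * N))"
    proof -
      have n: "2 * M + 4 = 2 * N" by (simp add: N_def)
      show ?thesis unfolding p_def A_def n by simp
    qed
    thus ?thesis unfolding P_def by (simp only: poisson_avg_even_power_translate[OF \<mu>])
  qed
  have yP1: "y * P1 y = (\<Sum>r\<le>N. 2 * real r * power_coeff \<mu> a N r * y ^ (2 * r) / fact (2 * r))" for y
  proof -
    have "(P has_real_derivative P1 y) (at y)" unfolding P_def[abs_def] P1_def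
      by (rule DERIV_poisson_avg_translate[OF \<mu> Dp cp(2)])
    moreover have "(P has_real_derivative (\<Sum>r\<le>N. power_coeff \<mu> a N r * (real (2 * r) * y ^ (2 * r - 1)) / fact (2 * r))) (at y)"
      unfolding P_eq[abs_def]
      by (intro DERIV_sum DERIV_cdivide DERIV_cmult) (rule DERIV_cong[OF DERIV_pow], simp)
    ultimately have "P1 y = (\<Sum>r\<le>N. power_coeff \<mu> a N r * (real (2 * r) * y ^ (2 * r - 1)) / fact (2 * r))"
      by (rule DERIV_unique)
    hence "y * P1 y = (\<Sum>r\<le>N. y * (power_coeff \<mu> a N r * (real (2 * r) * y ^ (2 * r - 1)) / fact (2 * r)))"
      by (simp only: sum_distrib_left)
    also have "\<dots> = (\<Sum>r\<le>N. 2 * real r * power_coeff \<mu> a N r * y ^ (2 * r) / fact (2 * r))"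
    proof (rule sum.cong[OF refl])
      fix r
      show "y * (power_coeff \<mu> a N r * (real (2 * r) * y ^ (2 * r - 1)) / fact (2 * r)) =
          2 * real r * power_coeff \<mu> a N r * y ^ (2 * r) / fact (2 * r)"
        by (cases r) (simp_all add: mult_ac)
    qed
    finally show ?thesis .
  qed
  have ode: "(a\<^sup>2 - y\<^sup>2) * u2 y + (2 * z + 2 * \<mu> - 1) * y * u1 y - z * (z + 2 * \<mu>) * u y =
      2 * y * P1 y - (2 * z + 2 * \<mu>) * P y" for y
  proof -
    have "0 = - poisson_avg \<mu> (\<lambda>s. (2 * \<mu> + 1) * (a * s) * f1 (a * s + y) - a\<^sup>2 * (1 - s\<^sup>2) * f2 (a * s + y))"
      using poisson_avg_ibp[OF \<mu> Df1 c(3), of a y] by simp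
    also have "\<dots> = poisson_avg \<mu> (\<lambda>s. - ((2 * \<mu> + 1) * (a * s) * f1 (a * s + y) - a\<^sup>2 * (1 - s\<^sup>2) * f2 (a * s + y)))"
      by (rule poisson_avg_minus[symmetric])
    also have "\<dots> = poisson_avg \<mu> (\<lambda>s. ((a\<^sup>2 - y\<^sup>2) * f2 (a * s + y) + ((2 * z + 2 * \<mu> - 1) * y) * f1 (a * s + y)
          + (- (z * (z + 2 * \<mu>))) * f (a * s + y)) + ((- (2 * y)) * p1 (a * s + y) + (2 * z + 2 * \<mu>) * p (a * s + y) + 0 * p (a * s + y)))"
    proof (rule poisson_avg_cong)
      fix s :: real
      define x where "x = a * s + y"
      define w where "w = x ^ (2 * M + 2)"
      define L where "L = ln \<bar>x\<bar>"
      have pw: "x ^ (2 * M + 4) = w * x\<^sup>2" "x ^ (2 * M + 3) = w * x" "x ^ (2 * M + 2) = w"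
        by (simp_all add: w_def power_add power2_eq_square power3_eq_cube power4_eq_xxxx)
      have e: "f x = A * (H * (w * x\<^sup>2) - w * x\<^sup>2 * L)" "f1 x = A * (H * (z * (w * x)) - (z * (w * x * L) + w * x))"
        "f2 x = A * (H * (z * ((z - 1) * w)) - (z * ((z - 1) * (w * L) + w) + (z - 1) * w))"
        "p x = A * (w * x\<^sup>2)" "p1 x = A * (z * (w * x))"
        unfolding f_def f1_def f2_def p_def p1_def pw L_def by simp_all
      have s: "a * s = x - y" "a\<^sup>2 * (1 - s\<^sup>2) = a\<^sup>2 - (x - y)\<^sup>2"
        by (simp_all add: x_def algebra_simps power2_eq_square)
      show "- ((2 * \<mu> + 1) * (a * s) * f1 (a * s + y) - a\<^sup>2 * (1 - s\<^sup>2) * f2 (a * s + y)) =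
         ((a\<^sup>2 - y\<^sup>2) * f2 (a * s + y) + ((2 * z + 2 * \<mu> - 1) * y) * f1 (a * s + y)
          + (- (z * (z + 2 * \<mu>))) * f (a * s + y)) + ((- (2 * y)) * p1 (a * s + y) + (2 * z + 2 * \<mu>) * p (a * s + y) + 0 * p (a * s + y))"
        unfolding x_def[symmetric] unfolding e s by (simp add: algebra_simps power2_eq_square)
    qed
    also have "\<dots> = ((a\<^sup>2 - y\<^sup>2) * u2 y + ((2 * z + 2 * \<mu> - 1) * y) * u1 y + (- (z * (z + 2 * \<mu>))) * u y)
        + ((- (2 * y)) * P1 y + (2 * z + 2 * \<mu>) * P y + 0 * P y)"
    proof (subst poisson_avg_add[OF \<mu>])
      show "continuous_on {- 1..1} (\<lambda>s. (a\<^sup>2 - y\<^sup>2) * f2 (a * s + y) + ((2 * z + 2 * \<mu> - 1) * y) * f1 (a * s + y)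
          + (- (z * (z + 2 * \<mu>))) * f (a * s + y))"
        by (intro continuous_on_add continuous_on_mult continuous_on_const cc c)
      show "continuous_on {- 1..1} (\<lambda>s. (- (2 * y)) * p1 (a * s + y) + (2 * z + 2 * \<mu>) * p (a * s + y) + 0 * p (a * s + y))"
        by (intro continuous_on_add continuous_on_mult continuous_on_const cc cp)
    qed (simp only: u_def u1_def u2_def P_def P1_def poisson_avg_lin3[OF \<mu> cc cc cc] c cp)
    finally show ?thesis by simp
  qed
  have "u Y = even_series (sing_coeff \<mu> a (2 * N + 1)) Y"
  proof (rule gegenbauer_even_series[where g = "\<lambda>r. (4 * real r - 2 * z - 2 * \<mu>) * power_coeff \<mu> a N r" and z = z and \<mu> = \<mu> and a = a and ?u1.0 = u1 and ?u2.0 = u2])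
    fix y
    show "(u has_real_derivative u1 y) (at y)" unfolding u_def[abs_def] u1_def
      by (rule DERIV_poisson_avg_translate[OF \<mu> Df c(2)])
    show "(u1 has_real_derivative u2 y) (at y)" unfolding u1_def[abs_def] u2_def
      by (rule DERIV_poisson_avg_translate[OF \<mu> Df1 c(3)])
    have "(\<lambda>r. (4 * real r - 2 * z - 2 * \<mu>) * power_coeff \<mu> a N r * y ^ (2 * r) / fact (2 * r)) sums
       (\<Sum>r\<le>N. (4 * real r - 2 * z - 2 * \<mu>) * power_coeff \<mu> a N r * y ^ (2 * r) / fact (2 * r))"
      by (rule sums_finite) (auto simp: power_coeff_eq_0 not_le)
    also have "(\<Sum>r\<le>N. (4 * real r - 2 * z - 2 * \<mu>) * power_coeff \<mu> a N r * y ^ (2 * r) / fact (2 * r)) =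
       2 * (y * P1 y) - (2 * z + 2 * \<mu>) * P y"
      unfolding P_eq yP1 sum_distrib_left sum_subtractf[symmetric]
      by (rule sum.cong[OF refl]) (simp add: algebra_simps diff_divide_distrib add_divide_distrib)
    finally show "(\<lambda>r. (4 * real r - 2 * z - 2 * \<mu>) * power_coeff \<mu> a N r * y ^ (2 * r) / fact (2 * r)) sums
            ((a\<^sup>2 - y\<^sup>2) * u2 y + (2 * z + 2 * \<mu> - 1) * y * u1 y - z * (z + 2 * \<mu>) * u y)"
      unfolding ode by (simp add: mult.assoc)
  next
    fix r
    define k where "k = int N - int r"
    have k1: "int N - int (Suc r) = k - 1" by (simp add: k_def)
    have zz: "z - 2 * real r = 2 * of_int k" "z + 2 * \<mu> - 2 * real r = 2 * of_int k + 2 * \<mu>"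
      "4 * real r - 2 * z - 2 * \<mu> = - (4 * of_int k + 2 * \<mu>)"
      by (simp_all add: k_def z_def N_def)
    have d: "(2 * N + 1) div 2 = N" by simp
    have s: "sing_coeff \<mu> a (2 * N + 1) r = (- 1) ^ r * sing_odd \<mu> a k"
      "sing_coeff \<mu> a (2 * N + 1) (Suc r) = - ((- 1) ^ r) * sing_odd \<mu> a (k - 1)"
      "power_coeff \<mu> a N r = (- 1) ^ r * poly_coeff \<mu> a k"
      unfolding sing_coeff_def power_coeff_def d k1 k_def[symmetric] by simp_all
    have "a\<^sup>2 * sing_coeff \<mu> a (2 * N + 1) (Suc r) = - ((- 1) ^ r) * (a\<^sup>2 * sing_odd \<mu> a (k - 1))"
      unfolding s by simp
    thus "a\<^sup>2 * sing_coeff \<mu> a (2 * N + 1) (Suc r) =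
       (z - 2 * real r) * (z + 2 * \<mu> - 2 * real r) * sing_coeff \<mu> a (2 * N + 1) r
       + (4 * real r - 2 * z - 2 * \<mu>) * power_coeff \<mu> a N r"
      unfolding zz s(1,3) sing_odd_rec[OF a \<mu>, of k] by (simp add: algebra_simps)
  next
    have N1: "N \<ge> 1" by (simp add: N_def)
    have "u 0 = poisson_avg \<mu> (\<lambda>s. (A * a ^ (2 * N) * (H - ln a)) * s ^ (2 * N) + (- (A * a ^ (2 * N))) * (s ^ (2 * N) * ln \<bar>s\<bar>) + 0 * s)"
      unfolding u_def
    proof (rule poisson_avg_cong)
      fix s :: real
      show "f (a * s + 0) = (A * a ^ (2 * N) * (H - ln a)) * s ^ (2 * N) + (- (A * a ^ (2 * N))) * (s ^ (2 * N) * ln \<bar>s\<bar>) + 0 * s"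
      proof (cases "s = 0")
        case False
        have l: "ln \<bar>a * s\<bar> = ln a + ln \<bar>s\<bar>" using a False by (simp add: abs_mult ln_mult)
        have n: "2 * M + 4 = 2 * N" by (simp add: N_def)
        show ?thesis unfolding f_def n add_0_right l power_mult_distrib by (simp add: algebra_simps)
      qed (simp add: f_def N_def)
    qed
    also have "\<dots> = (A * a ^ (2 * N) * (H - ln a)) * sin_moment \<mu> N + (- (A * a ^ (2 * N))) *
         (sin_moment \<mu> N * (Digamma (real N + 1/2) / 2 - Digamma (real N + 1 + \<mu>) / 2))"
      unfolding poisson_avg_even_power[OF \<mu>, symmetric] poisson_avg_power_ln[OF \<mu> N1, unfolded poisson_avg_even_power[OF \<mu>, symmetric], symmetric]
      by (subst poisson_avg_lin3[OF \<mu>]) (use N1 in \<open>auto intro!: continuous_intros continuous_on_power_ln_abs\<close>)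
    also have "\<dots> = A * a ^ (2 * N) * sin_moment \<mu> N * Upsilon_hat \<mu> N a"
    proof -
      have "ln (a / 2) = ln a - ln 2" using a by (simp add: ln_div)
      hence U: "Upsilon_hat \<mu> N a = H - ln a - (Digamma (real N + 1/2) / 2 - Digamma (real N + 1 + \<mu>) / 2)"
        unfolding Upsilon_hat_eq H_def by simp
      show ?thesis unfolding U by (simp add: algebra_simps)
    qed
    also have "A * a ^ (2 * N) * sin_moment \<mu> N = poly_coeff \<mu> a (int N)"
    proof -
      have "(a / 2) ^ (2 * N) = a ^ (2 * N) / 4 ^ N" by (simp add: power_divide power_mult)
      thus ?thesis unfolding A_def sin_moment_def poly_coeff_def by (simp add: add_ac)
    qed
    finally show "u 0 = sing_coeff \<mu> a (2 * N + 1) 0" by (simp add: sing_coeff_def sing_odd_def)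
    show "u1 0 = 0" unfolding u1_def by (rule poisson_avg_odd) (simp add: f1_def algebra_simps)
  qed (use y even_conv_sing_coeff[OF a \<mu>] in auto)
  moreover have "sing_kernel (2 * N + 1) = f"
  proof -
    have n: "2 * M + 4 = 2 * N" by (simp add: N_def)
    show ?thesis unfolding sing_kernel_def f_def A_def H_def n by (simp add: fun_eq_iff)
  qed
  ultimately show ?thesis by (simp add: u_def)
qed

lemma poisson_avg_sing_kernel:
  assumes "\<mu> \<ge> 0" "a > 0" "\<bar>y\<bar> < a" "\<theta> \<ge> 4"
  shows "poisson_avg \<mu> (\<lambda>s. sing_kernel \<theta> (a * s + y)) = even_series (sing_coeff \<mu> a \<theta>) y"
proof (cases "even \<theta>")
  case True
  then obtain N where "\<theta> = 2 * N" by (elim evenE)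
  with assms(4) have "\<theta> = 2 * (N - 2 + 2)" by simp
  thus ?thesis using poisson_avg_sing_kernel_even[OF assms(1-3), of "N - 2"] by simp
next
  case False
  then obtain N where "\<theta> = 2 * N + 1" by (elim oddE)
  with assms(4) have "\<theta> = 2 * (N - 2 + 2) + 1" by simp
  thus ?thesis using poisson_avg_sing_kernel_odd[OF assms(1-3), of "N - 2"] by simp
qed

lemma continuous_on_sing_kernel:
  assumes "\<theta> \<ge> 2"
  shows "continuous_on A (sing_kernel \<theta>)"
proof -
  have "continuous_on A (\<lambda>x. x ^ (\<theta> - 1) * ln \<bar>x\<bar>)"
    by (rule continuous_on_power_ln_abs) (use assms in simp)
  thus ?thesis unfolding sing_kernel_def by (cases "even \<theta>") (auto intro!: continuous_intros)
qed

section \<open>Analytic continuation of the zeta function\<close>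

definition dirichlet_zeta :: "complex \<Rightarrow> complex" where
  "dirichlet_zeta s = (\<Sum>n. of_nat (Suc n) powr (- s))"

text \<open>The coefficients of the relation between \<open>\<zeta>(s)\<close> and \<open>\<zeta>(s + 2), \<zeta>(s + 4), \<dots>\<close> that results
from expanding \<open>(n - 1/2)^(1 - s) - (n + 1/2)^(1 - s)\<close> around \<open>n\<close>. In terms of \<open>Z(s) = (s - 1) \<zeta>(s)\<close> it reads
\<open>Z = zeta_step Z\<close>.\<close>

definition shift_coeff :: "nat \<Rightarrow> complex \<Rightarrow> complex" where
  "shift_coeff j s = pochhammer s (2 * j + 1) / (fact (2 * j + 3) * 4 ^ (j + 1))"

text \<open>The right-hand side involves \<open>Z\<close> only at \<open>s + 2, s + 4, \<dots>\<close>. One application therefore enlarges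
a half-plane of definition by \<open>2\<close>.\<close>

definition zeta_step :: "(complex \<Rightarrow> complex) \<Rightarrow> complex \<Rightarrow> complex" where
  "zeta_step Z s = 2 powr (s - 1) - (s - 1) * (\<Sum>j. shift_coeff j s * Z (s + of_nat (2 * j + 2)))"

primrec zeta_approx :: "nat \<Rightarrow> complex \<Rightarrow> complex" where
  "zeta_approx 0 = (\<lambda>s. (s - 1) * dirichlet_zeta s)"
| "zeta_approx (Suc K) = zeta_step (zeta_approx K)"

lemma holomorphic_on_suminf:
  fixes f :: "nat \<Rightarrow> complex \<Rightarrow> complex"
  assumes "open S" "\<And>n. f n holomorphic_on S"
    and "\<And>x r. cball x r \<subseteq> S \<Longrightarrow> r > 0 \<Longrightarrow>
           \<exists>M. summable M \<and> eventually (\<lambda>n. \<forall>y\<in>cball x r. norm (f n y) \<le> M n) sequentially"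
  shows "(\<lambda>s. \<Sum>n. f n s) holomorphic_on S"
proof (rule holomorphic_uniform_sequence[OF assms(1)])
  show "(\<lambda>s. \<Sum>i<n. f i s) holomorphic_on S" for n by (intro holomorphic_on_sum assms(2))
  fix x assume "x \<in> S"
  with assms(1) obtain r where r: "r > 0" "cball x r \<subseteq> S" by (meson open_contains_cball)
  with assms(3) obtain M where "summable M" "eventually (\<lambda>n. \<forall>y\<in>cball x r. norm (f n y) \<le> M n) sequentially"
    by blast
  with r show "\<exists>d>0. cball x d \<subseteq> S \<and> uniform_limit (cball x d) (\<lambda>n s. \<Sum>i<n. f i s) (\<lambda>s. \<Sum>n. f n s) sequentially"
    by (intro exI[of _ r] conjI Weierstrass_m_test_ev) auto
qed

lemma norm_nat_powr: "norm (of_nat (Suc n) powr (- s) :: complex) = real (Suc n) powr (- Re s)"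
  by (subst norm_powr_real_powr) (auto simp: Reals_of_nat)

lemma summable_nat_powr: "\<sigma> > 1 \<Longrightarrow> summable (\<lambda>n. real (Suc n) powr (- \<sigma>))"
  by (subst summable_Suc_iff) (simp add: summable_real_powr_iff)

lemma dirichlet_zeta_sums:
  assumes "Re s > 1"
  shows "(\<lambda>n. of_nat (Suc n) powr (- s)) sums dirichlet_zeta s"
  unfolding dirichlet_zeta_def
proof (rule summable_sums, rule summable_norm_cancel)
  show "summable (\<lambda>n. norm (of_nat (Suc n) powr (- s) :: complex))"
    unfolding norm_nat_powr by (rule summable_nat_powr[OF assms])
qed

lemma open_halfplane: "open {s. Re s > c}"
  by (rule open_halfspace_Re_gt)

lemma connected_halfplane: "connected {s. Re s > c}"
  by (intro convex_connected convex_halfspace_Re_gt)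

lemma dirichlet_zeta_holomorphic: "dirichlet_zeta holomorphic_on {s. Re s > 1}"
  unfolding dirichlet_zeta_def[abs_def]
proof (rule holomorphic_on_suminf[OF open_halfplane])
  fix x r assume xr: "cball x r \<subseteq> {s. Re s > 1}" and r: "r > (0::real)"
  have "x - of_real r \<in> cball x r" using r by (simp add: dist_norm)
  with xr have "x - of_real r \<in> {s. Re s > 1}" by blast
  hence x: "Re x - r > 1" by simp
  show "\<exists>M. summable M \<and> eventually (\<lambda>n. \<forall>y\<in>cball x r. norm (of_nat (Suc n) powr (- y) :: complex) \<le> M n) sequentially"
  proof (intro exI conjI always_eventually allI ballI)
    show "summable (\<lambda>n. real (Suc n) powr (- (Re x - r)))" by (rule summable_nat_powr[OF x])
    fix n y assume "y \<in> cball x r"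
    hence "\<bar>Re (x - y)\<bar> \<le> r" using abs_Re_le_cmod[of "x - y"] by (simp add: dist_norm)
    hence "Re y \<ge> Re x - r" by simp
    thus "norm (of_nat (Suc n) powr (- y) :: complex) \<le> real (Suc n) powr (- (Re x - r))"
      unfolding norm_nat_powr by (intro powr_mono) auto
  qed
qed (auto intro!: holomorphic_intros)

lemma dirichlet_zeta_bound:
  assumes "Re s \<ge> 2"
  shows "norm (dirichlet_zeta s) \<le> (\<Sum>n. real (Suc n) powr (- 2))"
  unfolding dirichlet_zeta_def
proof (rule norm_suminf_le)
  show "summable (\<lambda>n. real (Suc n) powr (- 2))" by (rule summable_nat_powr) simp
  show "norm (of_nat (Suc n) powr (- s) :: complex) \<le> real (Suc n) powr (- 2)" for n
    unfolding norm_nat_powr by (intro powr_mono) (use assms in auto)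
qed

lemma norm_pochhammer_le_real:
  fixes s :: complex
  assumes "norm s \<le> R" "R > 0"
  shows "norm (pochhammer s n) \<le> pochhammer R n"
proof (induction n)
  case (Suc n)
  have "norm (s + of_nat n) \<le> R + real n"
    using norm_triangle_ineq[of s "of_nat n"] assms by simp
  thus ?case unfolding pochhammer_Suc norm_mult by (intro mult_mono Suc pochhammer_nonneg) (use assms in auto)
qed simp

lemma summable_ratio_limit:
  fixes f q :: "nat \<Rightarrow> real"
  assumes "\<And>n. f (Suc n) = q n * f n" "q \<longlonglongrightarrow> l" "\<bar>l\<bar> < 1"
  shows "summable f"
proof -
  define c where "c = (\<bar>l\<bar> + 1) / 2"
  have c: "\<bar>l\<bar> < c" "c < 1" using assms(3) by (simp_all add: c_def)
  have "(\<lambda>n. \<bar>q n\<bar>) \<longlonglongrightarrow> \<bar>l\<bar>" using assms(2) by (rule tendsto_rabs)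
  hence "eventually (\<lambda>n. \<bar>q n\<bar> < c) sequentially" using c(1) by (rule order_tendstoD)
  then obtain N where N: "\<And>n. n \<ge> N \<Longrightarrow> \<bar>q n\<bar> < c" by (auto simp: eventually_sequentially)
  show ?thesis
  proof (rule summable_ratio_test[OF c(2)])
    fix n assume "n \<ge> N"
    from N[OF this] show "norm (f (Suc n)) \<le> c * norm (f n)"
      unfolding assms(1) by (simp add: abs_mult mult_right_mono)
  qed
qed

lemma summable_shift_bound:
  assumes R: "R > 0"
  shows "summable (\<lambda>j. pochhammer R (2 * j + 1) / (fact (2 * j + 3) * 4 ^ (j + 1)) * (R + 2 * real j + 3) :: real)"
proof (rule summable_ratio_limit)
  let ?q = "\<lambda>j. (R + 2 * real j + 1) * (R + 2 * real j + 2) / ((2 * real j + 4) * (2 * real j + 5) * 4) * ((R + 2 * real j + 5) / (R + 2 * real j + 3))"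
  show "?q \<longlonglongrightarrow> 1/4" by real_asymp
  fix j
  have p: "pochhammer R (2 * Suc j + 1) = pochhammer R (2 * j + 1) * (R + 2 * real j + 1) * (R + 2 * real j + 2)"
    by (simp add: pochhammer_Suc add_ac)
  have f: "fact (2 * Suc j + 3) = (fact (2 * j + 3) * (2 * real j + 4) * (2 * real j + 5) :: real)"
  proof -
    have "2 * Suc j + 3 = Suc (Suc (2 * j + 3))" by simp
    thus ?thesis by (simp only: fact_Suc) (simp add: algebra_simps)
  qed
  have "P * A * B / (F * C * D * (4 * T)) * E = A * B / (C * D * 4) * (E / G) * (P / (F * T) * G)"
    if "G \<noteq> 0" for P A B F C D T E G :: real using that by (simp add: mult_ac)
  from this[of "R + 2 * real j + 3" "pochhammer R (2 * j + 1)" "R + 2 * real j + 1" "R + 2 * real j + 2" "fact (2 * j + 3)" "2 * real j + 4" "2 * real j + 5" "4 ^ (j + 1)" "R + 2 * real j + 5"]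
  show "pochhammer R (2 * Suc j + 1) / (fact (2 * Suc j + 3) * 4 ^ (Suc j + 1)) * (R + 2 * real (Suc j) + 3) =
    ?q j * (pochhammer R (2 * j + 1) / (fact (2 * j + 3) * 4 ^ (j + 1)) * (R + 2 * real j + 3))"
    unfolding p f using R by (simp add: add_ac)
qed simp

lemma summable_central_bound:
  assumes R: "R > 0"
  shows "summable (\<lambda>j. pochhammer R (2 * j) / (fact (2 * j + 1) * 4 ^ j) :: real)"
proof (rule summable_ratio_limit)
  let ?q = "\<lambda>j. (R + 2 * real j) * (R + 2 * real j + 1) / ((2 * real j + 2) * (2 * real j + 3) * 4)"
  show "?q \<longlonglongrightarrow> 1/4" by real_asymp
  fix j
  have p: "pochhammer R (2 * Suc j) = pochhammer R (2 * j) * (R + 2 * real j) * (R + 2 * real j + 1)"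
    by (simp add: pochhammer_Suc add_ac)
  have f: "fact (2 * Suc j + 1) = (fact (2 * j + 1) * (2 * real j + 2) * (2 * real j + 3) :: real)"
  proof -
    have "2 * Suc j + 1 = Suc (Suc (2 * j + 1))" by simp
    thus ?thesis by (simp only: fact_Suc) (simp add: algebra_simps)
  qed
  have "P * A * B / (F * C * D * (4 * T)) = A * B / (C * D * 4) * (P / (F * T))"
    for P A B F C D T :: real by (simp add: mult_ac)
  thus "pochhammer R (2 * Suc j) / (fact (2 * Suc j + 1) * 4 ^ Suc j) =
    ?q j * (pochhammer R (2 * j) / (fact (2 * j + 1) * 4 ^ j))"
    unfolding p f power_Suc by blast
qed simp

text \<open>The binomial expansion of \<open>(n - 1/2)^(1 - s) - (n + 1/2)^(1 - s)\<close> around \<open>n\<close>; symmetric steps cancel every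
other term.\<close>

lemma half_step_expansion:
  fixes s :: complex
  assumes "s \<noteq> 1"
  shows "(\<lambda>j. pochhammer s (2 * j) / (fact (2 * j + 1) * 4 ^ j) * of_nat (Suc n) powr (- s - of_nat (2 * j))) sums
           ((of_real (real (Suc n) - 1/2) powr (1 - s) - of_real (real (Suc n) + 1/2) powr (1 - s)) / (s - 1))"
proof -
  let ?x = "real (Suc n)"
  let ?t = "\<lambda>j. pochhammer s (2 * j) / (fact (2 * j + 1) * 4 ^ j) * of_nat (Suc n) powr (- s - of_nat (2 * j)) :: complex"
  let ?g = "\<lambda>k. ((1 - s) gchoose k) * of_real ?x powr (1 - s - of_nat k)"
  have "(\<lambda>k. ?g k * of_real (1/2) ^ k - ?g k * of_real (- (1/2)) ^ k) sums
      (of_real (?x + 1/2) powr (1 - s) - of_real (?x + - (1/2)) powr (1 - s))"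
    by (intro sums_diff gen_binomial_complex'') auto
  moreover have "strict_mono (\<lambda>j::nat. 2 * j + 1)" by (simp add: strict_mono_def)
  moreover have "?g k * of_real (1/2) ^ k - ?g k * of_real (- (1/2)) ^ k = 0" if "k \<notin> range (\<lambda>j::nat. 2 * j + 1)" for k
  proof -
    have "even k" using that by (metis oddE rangeI)
    thus ?thesis by simp
  qed
  ultimately have "(\<lambda>j. ?g (2 * j + 1) * of_real (1/2) ^ (2 * j + 1) - ?g (2 * j + 1) * of_real (- (1/2)) ^ (2 * j + 1)) sums
      (of_real (?x + 1/2) powr (1 - s) - of_real (?x + - (1/2)) powr (1 - s))"
    using sums_mono_reindex[of "\<lambda>j::nat. 2 * j + 1" "\<lambda>k. ?g k * of_real (1/2) ^ k - ?g k * of_real (- (1/2)) ^ k"] by blast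
  also have "(\<lambda>j. ?g (2 * j + 1) * of_real (1/2) ^ (2 * j + 1) - ?g (2 * j + 1) * of_real (- (1/2)) ^ (2 * j + 1)) =
      (\<lambda>j. - (s - 1) * ?t j)"
  proof
    fix j
    have m: "- (1 - s) = s - 1" by simp
    have p: "pochhammer (s - 1) (2 * j + 1) = (s - 1) * pochhammer s (2 * j)"
      using pochhammer_rec[of "s - 1" "2 * j"] by simp
    have o: "(- 1 :: complex) ^ (2 * j + 1) = - 1" by simp
    have f1: "((1 - s) gchoose (2 * j + 1)) = - (s - 1) * pochhammer s (2 * j) / fact (2 * j + 1)"
      unfolding gbinomial_pochhammer m p o by (simp only: mult_minus1 mult_minus_left mult_1_left)
    have f2: "1 - s - of_nat (2 * j + 1) = - s - of_nat (2 * j)" by simp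
    have f3: "of_real (1/2) ^ (2 * j + 1) - of_real (- (1/2)) ^ (2 * j + 1) = (1 / 4 ^ j :: complex)"
      by (simp add: power_mult power_divide)
    have f4: "?g (2 * j + 1) * of_real (1/2) ^ (2 * j + 1) - ?g (2 * j + 1) * of_real (- (1/2)) ^ (2 * j + 1) =
       ?g (2 * j + 1) * (of_real (1/2) ^ (2 * j + 1) - of_real (- (1/2)) ^ (2 * j + 1))"
      by (rule right_diff_distrib[symmetric])
    have f5: "- (s - 1) * P / F * X * (1 / T) = - (s - 1) * (P / (F * T) * X)" for P F X T :: complex
      by simp
    show "?g (2 * j + 1) * of_real (1/2) ^ (2 * j + 1) - ?g (2 * j + 1) * of_real (- (1/2)) ^ (2 * j + 1) =
       - (s - 1) * ?t j"
      unfolding f4 unfolding f1 f2 f3 of_real_of_nat_eq by (rule f5)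
  qed
  finally have "(\<lambda>j. (- (s - 1) * ?t j) / (- (s - 1))) sums
     ((of_real (?x + 1/2) powr (1 - s) - of_real (?x + - (1/2)) powr (1 - s)) / (- (s - 1)))"
    by (rule sums_divide)
  moreover have "(- (s - 1) * ?t j) / (- (s - 1)) = ?t j" for j
    by (rule nonzero_mult_div_cancel_left) (use assms in simp)
  moreover have "(of_real (?x + 1/2) powr (1 - s) - of_real (?x + - (1/2)) powr (1 - s)) / (- (s - 1))
      = (of_real (?x - 1/2) powr (1 - s) - of_real (?x + 1/2) powr (1 - s)) / (s - 1)"
    unfolding divide_minus_right by (simp add: diff_divide_distrib)
  ultimately show ?thesis by simp
qed

text \<open>Summed over \<open>n\<close>, the left-hand sides of \<open>half_step_expansion\<close> become values of the zeta function and the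
right-hand sides telescope to \<open>(1/2)^(1 - s) / (s - 1)\<close>.\<close>

lemma dirichlet_zeta_half_step:
  assumes s: "Re s > 1"
  shows "(\<lambda>j. pochhammer s (2 * j) / (fact (2 * j + 1) * 4 ^ j) * dirichlet_zeta (s + of_nat (2 * j))) sums
           (2 powr (s - 1) / (s - 1))"
proof -
  have s1: "s \<noteq> 1" using s by auto
  define c where "c j = (pochhammer s (2 * j) / (fact (2 * j + 1) * 4 ^ j) :: complex)" for j
  define t where "t n j = c j * of_nat (Suc n) powr (- s - of_nat (2 * j))" for n j
  define h where "h n = of_real (real n + 1/2) powr (1 - s)" for n
  have row: "(\<lambda>j. t n j) sums ((h n - h (Suc n)) / (s - 1))" for n
    using half_step_expansion[OF s1, of n] by (simp add: t_def c_def h_def add_ac)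
  define M where "M j = pochhammer (norm s + 1) (2 * j) / (fact (2 * j + 1) * 4 ^ j) * (\<Sum>n. real (Suc n) powr (- Re s))" for j
  have tann: "((\<lambda>m. \<Sum>j. \<Sum>n<m. t n j) \<longlonglongrightarrow> (\<Sum>j. c j * dirichlet_zeta (s + of_nat (2 * j)))) \<and>
      summable (\<lambda>j. norm (c j * dirichlet_zeta (s + of_nat (2 * j))))"
  proof -
    have "(\<lambda>m. \<Sum>n<m. t n j) \<longlonglongrightarrow> c j * dirichlet_zeta (s + of_nat (2 * j))" for j
    proof -
      have "Re (s + of_nat (2 * j)) > 1" using s by (simp add: add_strict_increasing)
      from sums_mult[OF dirichlet_zeta_sums[OF this], of "c j"] show ?thesis
        by (simp add: sums_def t_def)
    qed
    moreover have "norm (\<Sum>n<m. t n j) \<le> M j" for j m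
    proof -
      have "norm (\<Sum>n<m. t n j) \<le> (\<Sum>n<m. norm (c j) * real (Suc n) powr (- Re s))"
      proof (rule sum_norm_le)
        fix n
        have "norm (of_nat (Suc n) powr (- (s + of_nat (2 * j))) :: complex) \<le> real (Suc n) powr (- Re s)"
          unfolding norm_nat_powr by (intro powr_mono) auto
        thus "norm (t n j) \<le> norm (c j) * real (Suc n) powr (- Re s)"
          unfolding t_def norm_mult by (intro mult_left_mono) (simp_all add: algebra_simps)
      qed
      also have "\<dots> = norm (c j) * (\<Sum>n<m. real (Suc n) powr (- Re s))" by (simp add: sum_distrib_left)
      also have "\<dots> \<le> norm (c j) * (\<Sum>n. real (Suc n) powr (- Re s))"
        by (intro mult_left_mono sum_le_suminf summable_nat_powr s) auto
      also have "\<dots> \<le> M j" unfolding M_def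
      proof (rule mult_right_mono)
        have "norm (pochhammer s (2 * j)) \<le> pochhammer (norm s + 1) (2 * j)"
          by (rule norm_pochhammer_le_real) (simp_all add: add_nonneg_pos)
        thus "norm (c j) \<le> pochhammer (norm s + 1) (2 * j) / (fact (2 * j + 1) * 4 ^ j)"
          unfolding c_def norm_divide norm_mult norm_power by (simp del: fact_Suc add: divide_right_mono)
        show "0 \<le> (\<Sum>n. real (Suc n) powr (- Re s))" by (intro suminf_nonneg summable_nat_powr s) auto
      qed
      finally show ?thesis .
    qed
    moreover have "summable M" unfolding M_def
      by (intro summable_mult2 summable_central_bound) (simp add: add_nonneg_pos)
    ultimately show ?thesis
      using tannerys_theorem[of "\<lambda>j m. \<Sum>n<m. t n j" "\<lambda>j. c j * dirichlet_zeta (s + of_nat (2 * j))" sequentially M]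
      by (simp add: case_prod_unfold)
  qed
  have "(\<Sum>j. \<Sum>n<m. t n j) = (h 0 - h m) / (s - 1)" for m
  proof -
    have "(\<Sum>j. \<Sum>n<m. t n j) = (\<Sum>n<m. \<Sum>j. t n j)"
      by (rule suminf_sum) (use row sums_summable in blast)
    also have "\<dots> = (\<Sum>n<m. (h n - h (Suc n)) / (s - 1))"
      using row by (intro sum.cong refl) (simp add: sums_iff)
    also have "\<dots> = (h 0 - h m) / (s - 1)"
      by (simp only: sum_divide_distrib[symmetric] sum_lessThan_telescope')
    finally show ?thesis .
  qed
  moreover have "(\<lambda>m. (h 0 - h m) / (s - 1)) \<longlonglongrightarrow> (h 0 - 0) / (s - 1)"
  proof (intro tendsto_intros)
    show "h \<longlonglongrightarrow> 0"
    proof (rule tendsto_norm_zero_cancel)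
      have "norm (h m) = (real m + 1/2) powr (1 - Re s)" for m
        unfolding h_def by (subst norm_powr_real_powr) (auto simp: Reals_of_real)
      moreover have "(\<lambda>m. (real m + 1/2) powr (1 - Re s)) \<longlonglongrightarrow> 0"
        using s by real_asymp
      ultimately show "(\<lambda>m. norm (h m)) \<longlonglongrightarrow> 0" by simp
    qed
  qed (use s1 in auto)
  ultimately have "(\<lambda>m. \<Sum>j. \<Sum>n<m. t n j) \<longlonglongrightarrow> h 0 / (s - 1)" by simp
  with tann have "(\<Sum>j. c j * dirichlet_zeta (s + of_nat (2 * j))) = h 0 / (s - 1)"
    by (meson LIMSEQ_unique)
  moreover have "h 0 = 2 powr (s - 1)"
  proof -
    have "Ln (1/2 :: complex) = - Ln 2"
      using Ln_inverse[of 2] by (simp add: inverse_eq_divide)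
    thus ?thesis by (simp add: h_def powr_def algebra_simps)
  qed
  moreover have "(\<lambda>j. c j * dirichlet_zeta (s + of_nat (2 * j))) sums (\<Sum>j. c j * dirichlet_zeta (s + of_nat (2 * j)))"
    by (rule summable_sums, rule summable_norm_cancel, rule conjunct2[OF tann])
  ultimately show ?thesis unfolding c_def by (simp only:)
qed

lemma zeta_step_dirichlet:
  assumes s: "Re s > 1"
  shows "zeta_step (\<lambda>s. (s - 1) * dirichlet_zeta s) s = (s - 1) * dirichlet_zeta s"
proof -
  let ?f = "\<lambda>j. pochhammer s (2 * j) / (fact (2 * j + 1) * 4 ^ j) * dirichlet_zeta (s + of_nat (2 * j))"
  have s1: "s \<noteq> 1" using s by auto
  have sums: "(\<lambda>j. ?f (Suc j)) sums (2 powr (s - 1) / (s - 1) - dirichlet_zeta s)"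
    using dirichlet_zeta_half_step[OF s] by (subst sums_Suc_iff) simp
  have "?f (Suc j) = shift_coeff j s * ((s + of_nat (2 * j + 2) - 1) * dirichlet_zeta (s + of_nat (2 * j + 2)))" for j
  proof -
    have e: "2 * Suc j = Suc (2 * j + 1)" "2 * Suc j + 1 = 2 * j + 3" "Suc j = j + 1" by simp_all
    have p: "pochhammer s (2 * Suc j) = pochhammer s (2 * j + 1) * (s + of_nat (2 * j + 1))"
      unfolding e(1) by (rule pochhammer_Suc)
    have q: "s + of_nat (2 * j + 1) = s + of_nat (2 * j + 2) - 1" "2 * Suc j = 2 * j + 2" by simp_all
    show ?thesis unfolding p e(2) shift_coeff_def q(1) unfolding q(2) unfolding e(3) by (simp only: mult_ac times_divide_eq_right times_divide_eq_left)
  qed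
  with sums have "(\<Sum>j. shift_coeff j s * ((s + of_nat (2 * j + 2) - 1) * dirichlet_zeta (s + of_nat (2 * j + 2)))) =
     2 powr (s - 1) / (s - 1) - dirichlet_zeta s"
    by (simp only: sums_unique[symmetric])
  thus ?thesis unfolding zeta_step_def using s1 by (simp add: right_diff_distrib)
qed

lemma shift_coeff_holomorphic: "shift_coeff j holomorphic_on S"
proof -
  have "(\<lambda>s. pochhammer s n) holomorphic_on S" for n
    by (induction n) (auto simp: pochhammer_Suc intro!: holomorphic_intros)
  thus ?thesis unfolding shift_coeff_def[abs_def] by (intro holomorphic_intros) auto
qed

lemma zeta_step_holomorphic:
  assumes hol: "Z holomorphic_on {s. Re s > 1 - 2 * real K}"
    and eq: "\<And>s. Re s > 1 \<Longrightarrow> Z s = (s - 1) * dirichlet_zeta s"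
  shows "zeta_step Z holomorphic_on {s. Re s > 1 - 2 * real (Suc K)}"
proof -
  let ?S = "{s. Re s > 1 - 2 * real (Suc K)}"
  have "(\<lambda>s. \<Sum>j. shift_coeff j s * Z (s + of_nat (2 * j + 2))) holomorphic_on ?S"
  proof (rule holomorphic_on_suminf[OF open_halfplane])
    fix j
    have "(Z \<circ> (\<lambda>s. s + of_nat (2 * j + 2))) holomorphic_on ?S"
      by (rule holomorphic_on_compose_gen[OF _ hol]) (auto intro!: holomorphic_intros)
    thus "(\<lambda>s. shift_coeff j s * Z (s + of_nat (2 * j + 2))) holomorphic_on ?S"
      unfolding o_def by (intro holomorphic_intros shift_coeff_holomorphic)
  next
    fix x r assume xr: "cball x r \<subseteq> ?S" and r: "r > (0::real)"
    define R where "R = norm x + r"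
    define C where "C = (\<Sum>n. real (Suc n) powr (- 2))"
    have C: "C \<ge> 0" unfolding C_def by (intro suminf_nonneg summable_nat_powr) auto
    let ?M = "\<lambda>j. (pochhammer R (2 * j + 1) / (fact (2 * j + 3) * 4 ^ (j + 1)) * (R + 2 * real j + 3)) * C"
    have R: "R > 0" using r norm_ge_zero[of x] unfolding R_def by linarith
    have "summable ?M" by (intro summable_mult2 summable_shift_bound R)
    moreover have "eventually (\<lambda>j. \<forall>y\<in>cball x r. norm (shift_coeff j y * Z (y + of_nat (2 * j + 2))) \<le> ?M j) sequentially"
      unfolding eventually_sequentially
    proof (intro exI[of _ "Suc K"] allI impI ballI)
      fix j y assume j: "j \<ge> Suc K" and y: "y \<in> cball x r"
      have yR: "norm y \<le> R" using y norm_triangle_ineq2[of y x] by (simp add: R_def dist_norm norm_minus_commute)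
      have "Re y > 1 - 2 * real (Suc K)" using xr y by auto
      moreover have "real j \<ge> real (Suc K)" using j by (simp only: of_nat_le_iff)
      ultimately have re: "Re (y + of_nat (2 * j + 2)) \<ge> 2" by simp
      hence Z: "Z (y + of_nat (2 * j + 2)) = (y + of_nat (2 * j + 2) - 1) * dirichlet_zeta (y + of_nat (2 * j + 2))"
        by (intro eq) linarith
      have "norm (y + of_nat (2 * j + 2) - 1) = norm (y + of_nat (2 * j + 1))" by (simp add: algebra_simps)
      also have "\<dots> \<le> norm y + real (2 * j + 1)" using norm_triangle_ineq[of y "of_nat (2 * j + 1)"] by (simp only: norm_of_nat)
      also have "\<dots> \<le> R + 2 * real j + 3" using yR by simp
      finally have "norm (Z (y + of_nat (2 * j + 2))) \<le> (R + 2 * real j + 3) * C"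
        unfolding Z norm_mult C_def by (intro mult_mono dirichlet_zeta_bound re) (use R in auto)
      moreover have "norm (shift_coeff j y) \<le> pochhammer R (2 * j + 1) / (fact (2 * j + 3) * 4 ^ (j + 1))"
        unfolding shift_coeff_def norm_divide norm_mult norm_power norm_fact norm_numeral
        by (intro divide_right_mono norm_pochhammer_le_real yR R) auto
      moreover have "0 \<le> pochhammer R (2 * j + 1)" using R by (intro pochhammer_nonneg)
      ultimately show "norm (shift_coeff j y * Z (y + of_nat (2 * j + 2))) \<le> ?M j"
        unfolding norm_mult mult.assoc by (intro mult_mono) auto
    qed
    ultimately show "\<exists>M. summable M \<and> eventually (\<lambda>j. \<forall>y\<in>cball x r. norm (shift_coeff j y * Z (y + of_nat (2 * j + 2))) \<le> M j) sequentially"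
      by blast
  qed
  thus ?thesis unfolding zeta_step_def[abs_def] by (intro holomorphic_intros) auto
qed

lemma zeta_approx:
  "zeta_approx K holomorphic_on {s. Re s > 1 - 2 * real K} \<and>
     (\<forall>s. Re s > 1 \<longrightarrow> zeta_approx K s = (s - 1) * dirichlet_zeta s)"
proof (induction K)
  case 0
  show ?case using dirichlet_zeta_holomorphic by (auto intro!: holomorphic_intros)
next
  case (Suc K)
  have "zeta_approx (Suc K) s = (s - 1) * dirichlet_zeta s" if s: "Re s > 1" for s
  proof -
    have "zeta_step (zeta_approx K) s = zeta_step (\<lambda>s. (s - 1) * dirichlet_zeta s) s"
      unfolding zeta_step_def using Suc s by simp
    thus ?thesis using zeta_step_dirichlet[OF s] by simp
  qed
  thus ?case using zeta_step_holomorphic Suc by (simp only: zeta_approx.simps) blast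
qed

lemma zeta_approx_Suc_eq:
  assumes "Re s > 1 - 2 * real K"
  shows "zeta_approx (Suc K) s = zeta_approx K s"
proof (rule analytic_continuation_open[where s = "{s. Re s > 1}" and s' = "{s. Re s > 1 - 2 * real K}" and f = "zeta_approx (Suc K)" and g = "zeta_approx K"])
  show "zeta_approx (Suc K) holomorphic_on {s. Re s > 1 - 2 * real K}"
    by (rule holomorphic_on_subset[OF conjunct1[OF zeta_approx[of "Suc K"]]]) auto
  show "zeta_approx K holomorphic_on {s. Re s > 1 - 2 * real K}" using zeta_approx by blast
  show "zeta_approx (Suc K) z = zeta_approx K z" if "z \<in> {s. Re s > 1}" for z
    using zeta_approx[of "Suc K"] zeta_approx[of K] that by auto
  show "{s. Re s > 1} \<noteq> {}" by (auto intro!: exI[of _ 2])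
qed (use assms in \<open>auto intro!: open_halfplane connected_halfplane\<close>)

lemma zeta_approx_mono_eq:
  assumes "K \<le> L" "Re s > 1 - 2 * real K"
  shows "zeta_approx L s = zeta_approx K s"
  using assms(1)
proof (induction rule: dec_induct)
  case (step m)
  have "Re s > 1 - 2 * real m" using assms(2) step(1) by linarith
  from zeta_approx_Suc_eq[OF this] step show ?case by simp
qed simp

text \<open>The entire function \<open>(s - 1) \<zeta>(s)\<close>, glued from the continuations to the half-planes
\<open>Re s > 1 - 2 K\<close>.\<close>

definition zeta_entire :: "complex \<Rightarrow> complex" where
  "zeta_entire s = zeta_approx (nat \<lceil>\<bar>Re s\<bar>\<rceil> + 1) s"

lemma zeta_entire_eq:
  assumes "Re s > 1 - 2 * real K"
  shows "zeta_entire s = zeta_approx K s"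
proof -
  define L where "L = nat \<lceil>\<bar>Re s\<bar>\<rceil> + 1"
  have "real L \<ge> \<bar>Re s\<bar> + 1" by (simp add: L_def real_nat_ceiling_ge)
  hence "Re s > 1 - 2 * real L" by linarith
  hence "zeta_approx (max K L) s = zeta_approx L s" by (intro zeta_approx_mono_eq) auto
  moreover have "zeta_approx (max K L) s = zeta_approx K s" using assms by (intro zeta_approx_mono_eq) auto
  ultimately show ?thesis by (simp add: zeta_entire_def L_def)
qed

lemma zeta_entire_holomorphic: "zeta_entire holomorphic_on S"
proof -
  have "zeta_entire holomorphic_on (\<Union>K\<in>UNIV. {s. Re s > 1 - 2 * real K})"
  proof (rule holomorphic_on_UN_open)
    fix K
    show "zeta_entire holomorphic_on {s. Re s > 1 - 2 * real K}"
      using conjunct1[OF zeta_approx[of K]] by (rule holomorphic_transform) (simp add: zeta_entire_eq)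
  qed (rule open_halfplane)
  moreover have "S \<subseteq> (\<Union>K\<in>UNIV. {s. Re s > 1 - 2 * real K})"
  proof
    fix s assume "s \<in> S"
    obtain n where "real n > \<bar>Re s\<bar> + 1" using reals_Archimedean2 by blast
    hence "Re s > 1 - 2 * real n" by linarith
    thus "s \<in> (\<Union>K\<in>UNIV. {s. Re s > 1 - 2 * real K})" by blast
  qed
  ultimately show ?thesis by (rule holomorphic_on_subset)
qed

lemma zeta_entire_step: "zeta_entire s = zeta_step zeta_entire s"
proof -
  obtain K where "real K > \<bar>Re s\<bar> + 1" using reals_Archimedean2 by blast
  hence K: "Re s > 1 - 2 * real K" by linarith
  have "zeta_entire s = zeta_approx (Suc K) s" by (rule zeta_entire_eq) (use K in simp)
  also have "\<dots> = zeta_step (zeta_approx K) s" by simp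
  also have "\<dots> = zeta_step zeta_entire s"
  proof -
    have "zeta_entire (s + of_nat (2 * j + 2)) = zeta_approx K (s + of_nat (2 * j + 2))" for j
      by (rule zeta_entire_eq) (use K in simp)
    thus ?thesis unfolding zeta_step_def by simp
  qed
  finally show ?thesis .
qed

lemma zeta_entire_1: "zeta_entire 1 = 1"
  by (subst zeta_entire_step) (simp add: zeta_step_def)

text \<open>The continuation just constructed is a witness for the property by which \<open>zeta\<close> was chosen.\<close>

lemma zeta_spec:
  "zeta holomorphic_on (- {1}) \<and> (\<forall>s. Re s > 1 \<longrightarrow> (\<lambda>n. of_nat (Suc n) powr (- s)) sums zeta s)"
proof -
  have "(\<lambda>n. of_nat (Suc n) powr (- s)) sums (zeta_entire s / (s - 1))" if s: "Re s > 1" for s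
  proof -
    have "zeta_entire s = (s - 1) * dirichlet_zeta s" using zeta_entire_eq[of 0 s] s by simp
    moreover have "s \<noteq> 1" using s by auto
    ultimately show ?thesis using dirichlet_zeta_sums[OF s] by simp
  qed
  moreover have "(\<lambda>s. zeta_entire s / (s - 1)) holomorphic_on - {1}"
    by (intro holomorphic_intros zeta_entire_holomorphic) auto
  ultimately have "\<exists>f. f holomorphic_on (- {1}) \<and> (\<forall>s. Re s > 1 \<longrightarrow> (\<lambda>n. of_nat (Suc n) powr (- s)) sums f s)"
    by (intro exI[of _ "\<lambda>s. zeta_entire s / (s - 1)"]) blast
  from someI_ex[OF this] show ?thesis unfolding zeta_def .
qed

text \<open>Identity theorem on the punctured plane.\<close>

lemma zeta_eq_entire:
  assumes "s \<noteq> 1"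
  shows "zeta s = zeta_entire s / (s - 1)"
proof (rule analytic_continuation_open[where s = "{s. Re s > 1}" and s' = "- {1}" and f = zeta and g = "\<lambda>s. zeta_entire s / (s - 1)"])
  show "zeta holomorphic_on - {1}" using zeta_spec by blast
  show "(\<lambda>s. zeta_entire s / (s - 1)) holomorphic_on - {1}"
    by (intro holomorphic_intros zeta_entire_holomorphic) auto
  show "connected (- {1 :: complex})" by (rule connected_punctured_universe) simp
  show "zeta z = zeta_entire z / (z - 1)" if "z \<in> {s. Re s > 1}" for z
  proof -
    have z: "Re z > 1" "z \<noteq> 1" using that by auto
    have "zeta_entire z = (z - 1) * dirichlet_zeta z" using zeta_entire_eq[of 0 z] z by simp
    moreover have "zeta z = dirichlet_zeta z"
      using zeta_spec dirichlet_zeta_sums[OF z(1)] z(1) sums_unique2 by blast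
    ultimately show ?thesis using z(2) by simp
  qed
  show "{s. Re s > 1} \<noteq> {}" by (auto intro!: exI[of _ 2])
qed (use assms in \<open>auto intro!: open_halfplane\<close>)

section \<open>Values of the zeta function at the integers\<close>

text \<open>Exponential generating function of the values at the non-positive integers; it is
the regular part of \<open>e^w / (1 - e^w)\<close> at \<open>0\<close>.\<close>

definition zeta_egf :: "complex fps" where
  "zeta_egf = Abs_fps (\<lambda>k. zeta (- of_nat k) / fact k)"

definition two_sinh_half :: "complex fps" where
  "two_sinh_half = fps_exp (1/2) - fps_exp (- (1/2))"

lemma two_sinh_half_nth: "fps_nth two_sinh_half m = ((1/2) ^ m - (- (1/2)) ^ m) / fact m"
  by (simp add: two_sinh_half_def diff_divide_distrib)

lemma two_sinh_half_nth_even: "even m \<Longrightarrow> fps_nth two_sinh_half m = 0"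
  by (simp add: two_sinh_half_nth)

lemma two_sinh_half_nth_odd: "fps_nth two_sinh_half (2 * j + 1) = 1 / (fact (2 * j + 1) * 4 ^ j)"
  by (simp add: two_sinh_half_nth power_mult power_divide del: fact_Suc)

lemma pochhammer_neg_nat:
  assumes "k \<le> n"
  shows "pochhammer (- of_nat n :: complex) k = (- 1) ^ k * fact n / fact (n - k)"
proof -
  have "of_nat n - of_nat k + 1 = (of_nat (n - k) + 1 :: complex)" using assms by (simp add: of_nat_diff)
  moreover have "pochhammer (of_nat (n - k) + 1 :: complex) k * fact (n - k) = fact n"
    using pochhammer_product[of "n - k" n "1 :: complex"] assms
    by (simp add: pochhammer_fact add.commute mult.commute)
  ultimately show ?thesis unfolding pochhammer_minus by (simp add: field_simps)
qed

lemma zeta_entire_neg: "zeta_entire (- of_nat n) = - (fact (n + 1) * fps_nth zeta_egf n)"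
proof -
  have ne: "- of_nat n \<noteq> (1 :: complex)"
  proof
    assume "- of_nat n = (1 :: complex)"
    hence "Re (- of_nat n) = 1" by simp
    thus False by simp
  qed
  have "zeta (- of_nat n) * (- of_nat n - 1) = zeta_entire (- of_nat n)"
    unfolding zeta_eq_entire[OF ne] using ne by simp
  thus ?thesis by (simp add: zeta_egf_def algebra_simps)
qed

text \<open>At a non-positive integer the step relation becomes a finite sum, as the Pochhammer symbols vanish
eventually. The term that meets the point \<open>s = 1\<close> contributes \<open>(s - 1) \<zeta>(s) = 1\<close>.\<close>

lemma shift_coeff_neg_nat:
  "shift_coeff j (- of_nat n) * zeta_entire (- of_nat n + of_nat (2 * j + 2)) =
     fact n * fps_nth two_sinh_half (2 * j + 3) *
       (if 2 * j + 3 \<le> n + 1 then fps_nth zeta_egf (n + 1 - (2 * j + 3)) else if 2 * j + 3 = n + 2 then - 1 else 0)"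
proof -
  have S: "fps_nth two_sinh_half (2 * j + 3) = 1 / (fact (2 * j + 3) * 4 ^ (j + 1))"
    using two_sinh_half_nth_odd[of "j + 1"] by (simp add: numeral_3_eq_3 del: fact_Suc)
  consider "2 * j + 3 \<le> n + 1" | "2 * j + 3 = n + 2" | "2 * j + 3 > n + 2" by linarith
  thus ?thesis
  proof cases
    case 1
    define m where "m = n + 1 - (2 * j + 3)"
    have n: "n = m + (2 * j + 2)" using 1 by (simp add: m_def)
    have "pochhammer (- of_nat n :: complex) (2 * j + 1) = - (fact n / fact (m + 1))"
      by (subst pochhammer_neg_nat) (simp_all add: n)
    moreover have "- of_nat n + of_nat (2 * j + 2) = (- of_nat m :: complex)" by (simp add: n)
    ultimately have "shift_coeff j (- of_nat n) * zeta_entire (- of_nat n + of_nat (2 * j + 2)) =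
        - (fact n / fact (m + 1)) / (fact (2 * j + 3) * 4 ^ (j + 1)) * (- (fact (m + 1) * fps_nth zeta_egf m))"
      unfolding shift_coeff_def by (simp only: zeta_entire_neg)
    also have "\<dots> = fact n * (1 / (fact (2 * j + 3) * 4 ^ (j + 1))) * fps_nth zeta_egf m"
      by (simp del: fact_Suc)
    finally show ?thesis unfolding S using 1 by (simp add: m_def)
  next
    case 2
    hence n: "n = 2 * j + 1" by simp
    have "pochhammer (- of_nat n :: complex) (2 * j + 1) = - fact n"
      by (subst pochhammer_neg_nat) (simp_all add: n)
    moreover have "- of_nat n + of_nat (2 * j + 2) = (1 :: complex)" by (simp add: n)
    ultimately show ?thesis using 2 unfolding shift_coeff_def S
      by (simp only: zeta_entire_1) (simp del: fact_Suc)
  next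
    case 3
    hence "pochhammer (- of_nat n :: complex) (2 * j + 1) = 0"
      by (subst pochhammer_of_nat_eq_0_iff) simp
    thus ?thesis using 3 by (simp add: shift_coeff_def)
  qed
qed

text \<open>The step relation at \<open>s = -n\<close>, read as an identity between coefficients of a product of power series.\<close>

lemma zeta_egf_recursion:
  "(\<Sum>m=0..n+1. fps_nth two_sinh_half m * fps_nth zeta_egf (n + 1 - m)) =
     fps_nth two_sinh_half (n + 2) - (1/2) ^ (n + 1) / fact (n + 1)"
proof -
  define D where "D = fps_nth two_sinh_half"
  define r where "r = fps_nth zeta_egf"
  define G where "G m = D m * (if m \<le> n + 1 then r (n + 1 - m) else if m = n + 2 then - 1 else 0)" for m
  define f where "f m = (if m = 1 then 0 else G m)" for m
  have D0: "D 0 = 0" "D 1 = 1" by (simp_all add: D_def two_sinh_half_nth)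
  have tm: "shift_coeff j (- of_nat n) * zeta_entire (- of_nat n + of_nat (2 * j + 2)) = fact n * f (2 * j + 3)" for j
    unfolding shift_coeff_neg_nat f_def G_def D_def r_def by simp
  have "f sums (\<Sum>m=0..n+2. f m)" by (rule sums_finite) (auto simp: f_def G_def)
  moreover have "strict_mono (\<lambda>j::nat. 2 * j + 3)" by (simp add: strict_mono_def)
  moreover have "f m = 0" if "m \<notin> range (\<lambda>j::nat. 2 * j + 3)" for m
  proof (cases "even m \<or> m = 1")
    case True
    thus ?thesis by (auto simp: f_def G_def D_def two_sinh_half_nth_even)
  next
    case False
    then obtain k where k: "m = 2 * k + 1" "k \<noteq> 0" by (auto elim!: oddE)
    then obtain j where "k = Suc j" by (cases k) auto
    hence "m = 2 * j + 3" using k by simp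
    thus ?thesis using that by blast
  qed
  ultimately have "(\<lambda>j. f (2 * j + 3)) sums (\<Sum>m=0..n+2. f m)"
    using sums_mono_reindex[of "\<lambda>j::nat. 2 * j + 3" f] by blast
  hence "(\<lambda>j. fact n * f (2 * j + 3)) sums (fact n * (\<Sum>m=0..n+2. f m))" by (rule sums_mult)
  hence "(\<Sum>j. shift_coeff j (- of_nat n) * zeta_entire (- of_nat n + of_nat (2 * j + 2))) = fact n * (\<Sum>m=0..n+2. f m)"
    unfolding tm by (simp only: sums_unique[symmetric])
  moreover have "zeta_entire (- of_nat n) = zeta_step zeta_entire (- of_nat n)" by (rule zeta_entire_step)
  ultimately have "- (fact (n + 1) * r n) = 2 powr (- of_nat n - 1) - (- of_nat n - 1) * (fact n * (\<Sum>m=0..n+2. f m))"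
    unfolding zeta_entire_neg zeta_step_def r_def by simp
  also have "2 powr (- of_nat n - 1 :: complex) = (1/2) ^ (n + 1)"
  proof -
    have "- of_nat n - 1 = - (of_nat (n + 1) :: complex)" by simp
    hence "2 powr (- of_nat n - 1 :: complex) = inverse (2 powr of_nat (n + 1))"
      by (simp only: powr_minus)
    also have "2 powr of_nat (n + 1) = (2 :: complex) ^ (n + 1)" by (rule powr_nat') simp
    finally show ?thesis by (simp add: power_one_over inverse_eq_divide)
  qed
  also have "(- of_nat n - 1) * (fact n * (\<Sum>m=0..n+2. f m)) = - (fact (n + 1) * (\<Sum>m=0..n+2. f m))"
    by (simp add: algebra_simps)
  finally have "fact (n + 1) * (r n + (\<Sum>m=0..n+2. f m)) = - ((1/2) ^ (n + 1))"
  proof -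
    have aux: "x + y = - h" if "- x = h - - y" for x y h :: complex
      using arg_cong[OF that, of "\<lambda>t. - t + y"] by simp
    assume "- (fact (n + 1) * r n) = (1/2) ^ (n + 1) - - (fact (n + 1) * (\<Sum>m=0..n+2. f m))"
    from aux[OF this] show ?thesis by (simp only: distrib_left)
  qed
  hence "(r n + (\<Sum>m=0..n+2. f m)) * fact (n + 1) = - ((1/2) ^ (n + 1))"
    by (simp only: mult.commute)
  moreover have "(fact (n + 1) :: complex) \<noteq> 0" by (rule fact_nonzero)
  ultimately have A: "r n + (\<Sum>m=0..n+2. f m) = - ((1/2) ^ (n + 1)) / fact (n + 1)"
    by (simp only: eq_divide_eq if_True not_False_eq_True)
  have B: "(\<Sum>m=0..n+2. f m) = (\<Sum>m=0..n+1. D m * r (n + 1 - m)) - r n - D (n + 2)"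
  proof -
    have "(\<Sum>m=0..n+2. f m) = (\<Sum>m=0..n+1. f m) + f (n + 2)" by (simp add: numeral_2_eq_2)
    also have "f (n + 2) = - D (n + 2)" by (simp add: f_def G_def)
    also have "(\<Sum>m=0..n+1. f m) = (\<Sum>m=0..n+1. D m * r (n + 1 - m) - (if m = 1 then r n else 0))"
      by (rule sum.cong[OF refl]) (auto simp: f_def G_def D0[unfolded One_nat_def])
    also have "\<dots> = (\<Sum>m=0..n+1. D m * r (n + 1 - m)) - r n"
      by (simp add: sum_subtractf sum.delta)
    finally show ?thesis by simp
  qed
  have aux2: "T = d - p" if "x + S = - p" "S = T - x - d" for T d p x S :: complex
  proof -
    have "T - d = - p" using that by simp
    thus ?thesis by (simp add: algebra_simps)
  qed
  from aux2[OF A[folded minus_divide_left] B] show ?thesis unfolding D_def r_def .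
qed

lemma zeta_egf_fps:
  "fps_X * zeta_egf * (fps_exp 1 - 1) = (fps_exp 1 - 1) - fps_X * fps_exp 1"
proof -
  have "fps_X * (two_sinh_half * zeta_egf) = two_sinh_half - fps_X * fps_exp (1/2)"
  proof (rule fps_ext)
    fix k :: nat
    show "fps_nth (fps_X * (two_sinh_half * zeta_egf)) k = fps_nth (two_sinh_half - fps_X * fps_exp (1/2)) k"
    proof (cases "k \<ge> 2")
      case True
      define n where "n = k - 2"
      have k: "k = n + 2" using True by (simp add: n_def)
      have "fps_nth (fps_X * (two_sinh_half * zeta_egf)) k = fps_nth (two_sinh_half * zeta_egf) (n + 1)"
        unfolding k by simp
      also have "\<dots> = fps_nth two_sinh_half (n + 2) - (1/2) ^ (n + 1) / fact (n + 1)"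
        unfolding fps_mult_nth by (rule zeta_egf_recursion)
      also have "\<dots> = fps_nth (two_sinh_half - fps_X * fps_exp (1/2)) k"
        unfolding k by (simp add: algebra_simps)
      finally show ?thesis .
    next
      case False
      hence "k = 0 \<or> k = 1" by linarith
      thus ?thesis by (auto simp: two_sinh_half_nth fps_mult_nth)
    qed
  qed
  hence 1: "fps_X * (two_sinh_half * zeta_egf) * fps_exp (1/2) = (two_sinh_half - fps_X * fps_exp (1/2)) * fps_exp (1/2)"
    by simp
  have 2: "two_sinh_half * fps_exp (1/2) = fps_exp 1 - 1"
    by (simp add: two_sinh_half_def left_diff_distrib flip: fps_exp_add_mult)
  have 3: "fps_exp (1/2) * fps_exp (1/2) = (fps_exp 1 :: complex fps)"
    by (simp flip: fps_exp_add_mult)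
  have "fps_X * zeta_egf * (fps_exp 1 - 1) = fps_X * (two_sinh_half * zeta_egf) * fps_exp (1/2)"
    unfolding 2[symmetric] by (simp only: mult_ac)
  also have "\<dots> = two_sinh_half * fps_exp (1/2) - fps_X * (fps_exp (1/2) * fps_exp (1/2))"
    unfolding 1 by (simp only: left_diff_distrib mult.assoc)
  finally show ?thesis unfolding 2 3 .
qed

lemma exp_neq_1: "norm w < 2 * pi \<Longrightarrow> w \<noteq> 0 \<Longrightarrow> exp w \<noteq> (1 :: complex)"
proof
  assume w: "norm w < 2 * pi" "w \<noteq> 0" "exp w = 1"
  then obtain n where n: "Re w = 0" "Im w = of_int (2 * n) * pi" by (auto simp: exp_eq_1)
  have "\<bar>Im w\<bar> < 2 * pi" using w(1) abs_Im_le_cmod[of w] by linarith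
  hence "\<bar>of_int n :: real\<bar> < 1" unfolding n by (simp add: abs_mult)
  hence "n = 0" by linarith
  with n w(2) show False by (simp add: complex_eq_iff)
qed

text \<open>The nearest non-zero points with \<open>e^w = 1\<close> are \<open>w = \<plusminus> 2 \<pi> i\<close>.\<close>

lemma zeta_egf_conv_radius: "fps_conv_radius zeta_egf \<ge> ereal (2 * pi)"
proof -
  define G where "G = fps_shift 1 (fps_exp 1 - 1 :: complex fps)"
  have radE: "fps_conv_radius (fps_exp 1 - 1 :: complex fps) = \<infinity>"
    using fps_conv_radius_diff[of "fps_exp 1 :: complex fps" 1] by simp
  hence radG: "fps_conv_radius G = \<infinity>" by (simp add: G_def)
  have XG: "fps_X * G = fps_exp 1 - 1"
    unfolding G_def by (rule fps_ext) (simp split: nat.split)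
  have G0: "fps_nth G 0 = 1" by (simp add: G_def)
  have evG: "eval_fps G w = (exp w - 1) / w" if "w \<noteq> 0" for w
  proof -
    have "w * eval_fps G w = eval_fps (fps_X * G) w" by (subst eval_fps_mult) (auto simp: radG)
    also have "\<dots> = exp w - 1" unfolding XG by (subst eval_fps_diff) auto
    finally show ?thesis using that by (simp add: field_simps)
  qed
  have nz: "eval_fps G w \<noteq> 0" if "norm w < 2 * pi" for w
    using exp_neq_1[OF that] by (cases "w = 0") (auto simp: evG eval_fps_at_0 G0)
  have radI: "fps_conv_radius (inverse G) \<ge> ereal (2 * pi)"
  proof (rule holomorphic_on_imp_fps_conv_radius_ge)
    show "(\<lambda>w. inverse (eval_fps G w)) has_fps_expansion inverse G"
      by (intro has_fps_expansion_inverse eval_fps_has_fps_expansion) (auto simp: radG G0)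
    show "(\<lambda>w. inverse (eval_fps G w)) holomorphic_on eball 0 (ereal (2 * pi))"
      by (intro holomorphic_intros holomorphic_on_eval_fps) (auto simp: radG nz)
  qed
  define Q where "Q = fps_shift 1 (G - fps_exp 1)"
  have radQ: "fps_conv_radius Q = \<infinity>"
    using fps_conv_radius_diff[of G "fps_exp 1 :: complex fps"] by (simp add: Q_def radG)
  have XQ: "fps_X * Q = G - fps_exp 1"
    unfolding Q_def by (rule fps_ext) (simp add: G0 split: nat.split)
  have "fps_X * (fps_X * (zeta_egf * G)) = fps_X * zeta_egf * (fps_X * G)" by (simp add: mult_ac)
  also have "\<dots> = fps_X * G - fps_X * fps_exp 1" unfolding XG by (rule zeta_egf_fps)
  also have "\<dots> = fps_X * (fps_X * Q)" unfolding XQ by (simp add: right_diff_distrib)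
  finally have "zeta_egf * G = Q" by simp
  hence "zeta_egf * (G * inverse G) = Q * inverse G" by (simp add: mult.assoc)
  moreover have "G * inverse G = 1" using inverse_mult_eq_1'[of G] G0 by simp
  ultimately have "zeta_egf = Q * inverse G" by simp
  moreover have "fps_conv_radius (Q * inverse G) \<ge> ereal (2 * pi)"
    by (rule fps_conv_radius_mult_ge) (simp_all add: radI radQ)
  ultimately show ?thesis by (simp only:)
qed

lemma zeta_egf_eval:
  assumes "norm w < 2 * pi" "w \<noteq> 0"
  shows "eval_fps zeta_egf w = 1 / w + exp w / (1 - exp w)"
proof -
  have rad: "ereal (norm w) < fps_conv_radius zeta_egf"
    by (rule less_le_trans[OF _ zeta_egf_conv_radius]) (use assms(1) in simp)
  have radE: "fps_conv_radius (fps_exp 1 - 1 :: complex fps) = \<infinity>"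
    using fps_conv_radius_diff[of "fps_exp 1 :: complex fps" 1] by simp
  have radX: "ereal (norm w) < fps_conv_radius (fps_X * zeta_egf)"
    by (rule less_le_trans[OF _ fps_conv_radius_mult]) (use rad in simp)
  have radXE: "ereal (norm w) < fps_conv_radius (fps_X * fps_exp 1 :: complex fps)"
    by (rule less_le_trans[OF _ fps_conv_radius_mult]) simp
  have e1: "eval_fps (fps_exp 1 - 1) w = exp w - 1" by (subst eval_fps_diff) auto
  have e2: "eval_fps (fps_X * zeta_egf) w = w * eval_fps zeta_egf w" by (subst eval_fps_mult) (use rad in auto)
  have e3: "eval_fps (fps_X * zeta_egf * (fps_exp 1 - 1)) w = w * eval_fps zeta_egf w * (exp w - 1)"
    unfolding e2[symmetric] e1[symmetric] by (rule eval_fps_mult) (use radX radE in auto)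
  have e4: "eval_fps (fps_X * fps_exp 1) w = w * exp w" by (subst eval_fps_mult) auto
  have "eval_fps ((fps_exp 1 - 1) - fps_X * fps_exp 1) w = (exp w - 1) - w * exp w"
    unfolding e1[symmetric] e4[symmetric] by (rule eval_fps_diff) (use radE radXE in auto)
  hence "w * eval_fps zeta_egf w * (exp w - 1) = (exp w - 1) - w * exp w"
    unfolding e3[symmetric] zeta_egf_fps .
  hence "eval_fps zeta_egf w = ((exp w - 1) - w * exp w) / (w * (exp w - 1))"
    using assms exp_neq_1[OF assms] by (simp add: eq_divide_eq mult_ac)
  also have "\<dots> = 1 / w - exp w / (exp w - 1)"
  proof -
    have "exp w - 1 \<noteq> 0" using exp_neq_1[OF assms] by simp
    thus ?thesis unfolding diff_divide_distrib[of "exp w - 1"] using assms(2) by simp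
  qed
  also have "\<dots> = 1 / w + exp w / (1 - exp w)"
    by (metis add_uminus_conv_diff minus_diff_eq minus_divide_right)
  finally show ?thesis .
qed

text \<open>\<open>Y = w e^w / (1 - e^w)\<close> satisfies \<open>w Y' = Y\<^sup>2 + (1 + w) Y\<close>. All coefficients of the nonlinearity are
positive, which is why this form is suited for determining signs.\<close>

lemma zeta_egf_riccati:
  defines "Y \<equiv> fps_X * zeta_egf - 1"
  shows "fps_X * fps_deriv Y = Y * Y + (1 + fps_X) * Y"
proof -
  let ?E = "fps_exp 1 :: complex fps"
  have Y: "Y * (?E - 1) = - (fps_X * ?E)"
    unfolding Y_def left_diff_distrib zeta_egf_fps by simp
  have "fps_deriv (Y * (?E - 1)) = fps_deriv (- (fps_X * ?E))" unfolding Y ..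
  hence d: "fps_deriv Y * (?E - 1) + Y * ?E = - ?E - fps_X * ?E" by (simp add: algebra_simps)
  have "fps_X * fps_deriv Y * (?E - 1) = fps_X * (fps_deriv Y * (?E - 1) + Y * ?E) - fps_X * (Y * ?E)"
    by (simp add: algebra_simps)
  also have "\<dots> = Y * (- (fps_X * ?E)) + (1 + fps_X) * (- (fps_X * ?E))"
    unfolding d by (simp add: algebra_simps)
  also have "\<dots> = (Y * Y + (1 + fps_X) * Y) * (?E - 1)"
    unfolding Y[symmetric] by (simp add: algebra_simps)
  finally have "fps_X * fps_deriv Y * (?E - 1) = (Y * Y + (1 + fps_X) * Y) * (?E - 1)" .
  moreover have "?E - 1 \<noteq> 0"
  proof
    assume "?E - 1 = 0"
    hence "fps_nth (?E - 1) 1 = 0" by simp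
    thus False by simp
  qed
  ultimately show ?thesis by simp
qed

text \<open>By the Riccati equation each coefficient of \<open>Y\<close> is a sum of products of earlier ones, so that vanishing at odd
and the alternating sign at even indices are inherited. At odd indices the products with the coefficient \<open>-1/2\<close> of index
\<open>1\<close> cancel against the linear term.\<close>

lemma zeta_egf_sign_aux:
  fixes y :: "nat \<Rightarrow> complex"
  defines "y \<equiv> fps_nth (fps_X * zeta_egf - 1)"
  assumes "n \<ge> 2"
  shows "(odd n \<longrightarrow> y n = 0) \<and> (even n \<longrightarrow> Im (y n) = 0 \<and> (- 1) ^ (n div 2) * Re (y n) \<ge> 0)"
proof -
  define Y where "Y = fps_X * zeta_egf - 1"
  have yY: "y = fps_nth Y" by (simp add: y_def Y_def)
  have ric: "fps_X * fps_deriv Y = Y * Y + (1 + fps_X) * Y"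
    unfolding Y_def by (rule zeta_egf_riccati)
  have y0: "y 0 = - 1" by (simp add: y_def)
  have rec: "of_nat (n + 1) * y n = (\<Sum>i=1..<n. y i * y (n - i)) + y (n - 1)" if n1: "n \<ge> 1" for n
  proof -
    have "of_nat n * y n = (\<Sum>i=0..n. y i * y (n - i)) + y n + y (n - 1)"
    proof -
      obtain k where k: "n = Suc k" using n1 by (cases n) auto
      have "fps_nth (fps_X * fps_deriv Y) n = of_nat n * y n" by (simp add: k yY)
      moreover have "fps_nth (Y * Y + (1 + fps_X) * Y) n = (\<Sum>i=0..n. y i * y (n - i)) + (y n + y (n - 1))"
        by (simp add: k yY distrib_right fps_mult_nth[of Y Y])
      ultimately show ?thesis unfolding ric by (simp only: add.assoc)
    qed
    moreover have "(\<Sum>i=0..n. y i * y (n - i)) = y 0 * y n + (\<Sum>i=1..<n. y i * y (n - i)) + y n * y 0"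
    proof -
      have "{0..n} = insert 0 (insert n {1..<n})" using n1 by auto
      thus ?thesis using n1 by (simp add: add_ac)
    qed
    ultimately show ?thesis by (simp add: y0 algebra_simps)
  qed
  have "2 * y 1 = - 1" using rec[of 1] y0 by simp
  hence "2 * y 1 / 2 = - 1 / 2" by (simp only:)
  hence y1: "y 1 = - (1/2)" by simp
  show ?thesis using assms(2)
  proof (induction n rule: less_induct)
    case (less n)
    have odd0: "y i = 0" if "odd i" "3 \<le> i" "i < n" for i using less.IH[of i] that by auto
    have ev: "Im (y i) = 0" "(- 1) ^ (i div 2) * Re (y i) \<ge> 0" if "even i" "2 \<le> i" "i < n" for i
      using less.IH[of i] that by auto
    show ?case
    proof (intro conjI impI)
      assume n: "odd n"
      hence n3: "n \<ge> 3" using less.prems by (auto elim!: oddE)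
      have "(\<Sum>i=1..<n. y i * y (n - i)) = (\<Sum>i\<in>{1, n - 1}. y i * y (n - i))"
      proof (rule sum.mono_neutral_right)
        show "\<forall>i\<in>{1..<n} - {1, n - 1}. y i * y (n - i) = 0"
        proof
          fix i assume i: "i \<in> {1..<n} - {1, n - 1}"
          show "y i * y (n - i) = 0"
          proof (cases "odd i")
            case True
            hence "i \<noteq> 2" by auto
            moreover have "i \<noteq> 0" "i \<noteq> 1" using i by auto
            ultimately have "i \<ge> 3" by linarith
            thus ?thesis using odd0[of i] True i by simp
          next
            case False
            hence o: "odd (n - i)" using n i by simp
            have "n - i \<noteq> 2"
            proof
              assume e: "n - i = 2"
              show False using o[unfolded e] by simp
            qed
            moreover have "n - i \<noteq> 0" "n - i \<noteq> 1" using i by auto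
            ultimately have "n - i \<ge> 3" by linarith
            with o show ?thesis using odd0[of "n - i"] i by simp
          qed
        qed
      qed (use n3 in auto)
      also have "\<dots> = - y (n - 1)" using n3 y1 by simp
      finally have "of_nat (n + 1) * y n = 0" using rec[of n] n3 by simp
      thus "y n = 0" by (simp del: of_nat_Suc of_nat_add)
    next
      assume n: "even n"
      have "Im (of_nat (n + 1) * y n) = 0 \<and> (- 1) ^ (n div 2) * Re (of_nat (n + 1) * y n) \<ge> 0"
      proof (cases "n = 2")
        case True
        have "{1..<2::nat} = {1}" by auto
        hence "of_nat (n + 1) * y n = - (1/4)" using rec[of 2] y1 True by simp
        thus ?thesis using True by simp
      next
        case False
        hence n4: "n \<ge> 4" using less.prems n by (auto elim!: evenE)
        have "y (n - 1) = 0" using n4 n by (intro odd0) auto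
        hence r: "of_nat (n + 1) * y n = (\<Sum>i=1..<n. y i * y (n - i))" using rec[of n] n4 by simp
        have t: "Im (y i * y (n - i)) = 0 \<and> (- 1) ^ (n div 2) * Re (y i * y (n - i)) \<ge> 0" if i: "i \<in> {1..<n}" for i
        proof (cases "even i")
          case False
          have "i \<noteq> 2" using False by auto
          moreover have "1 \<le> i" "i < n" using i by auto
          ultimately have "i \<ge> 3 \<or> n - i \<ge> 3" using n4 by linarith
          moreover have "odd (n - i)" using False n i by simp
          moreover have "n - i < n" using \<open>1 \<le> i\<close> \<open>i < n\<close> by linarith
          ultimately have "y i = 0 \<or> y (n - i) = 0" using odd0[of i] odd0[of "n - i"] False \<open>i < n\<close> by blast
          thus ?thesis by auto
        next
          case True
          then obtain k where k: "i = 2 * k" by (elim evenE)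
          have "even (n - i)" using True n i by simp
          then obtain l where l: "n - i = 2 * l" by (elim evenE)
          have kl: "k \<ge> 1" "l \<ge> 1" "n = 2 * (k + l)" using i k l by auto
          have 1: "Im (y i) = 0" "(- 1) ^ k * Re (y i) \<ge> 0" using ev[of i] True i k kl by auto
          have "2 \<le> 2 * l" "2 * l < n" using kl by auto
          hence 2: "Im (y (n - i)) = 0" "(- 1) ^ l * Re (y (n - i)) \<ge> 0"
            unfolding l using ev[of "2 * l"] by simp_all
          have h: "n div 2 = k + l" using kl(3) by simp
          have "(- 1) ^ (n div 2) * Re (y i * y (n - i)) = ((- 1) ^ k * Re (y i)) * ((- 1) ^ l * Re (y (n - i)))"
            unfolding h power_add using 1(1) 2(1) by simp
          also have "\<dots> \<ge> 0" by (rule mult_nonneg_nonneg[OF 1(2) 2(2)])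
          finally show ?thesis using 1(1) 2(1) by simp
        qed
        have "(- 1) ^ (n div 2) * Re (\<Sum>i=1..<n. y i * y (n - i)) = (\<Sum>i=1..<n. (- 1) ^ (n div 2) * Re (y i * y (n - i)))"
          by (simp only: Re_sum sum_distrib_left)
        also have "\<dots> \<ge> 0" by (rule sum_nonneg) (use t in blast)
        finally show ?thesis unfolding r using t by (simp add: Im_sum)
      qed
      moreover have "Im (of_nat (n + 1) * y n) = real (n + 1) * Im (y n)" "Re (of_nat (n + 1) * y n) = real (n + 1) * Re (y n)"
        by simp_all
      ultimately have *: "real (n + 1) * Im (y n) = 0" "real (n + 1) * ((- 1) ^ (n div 2) * Re (y n)) \<ge> 0"
        by (simp_all only: mult.left_commute)
      show "Im (y n) = 0" "(- 1) ^ (n div 2) * Re (y n) \<ge> 0"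
        using * by (simp_all add: zero_le_mult_iff del: of_nat_Suc of_nat_add)
    qed
  qed
qed

lemma zeta_egf_0: "fps_nth zeta_egf 0 = - (1/2)"
  using zeta_egf_recursion[of 0]
  by (simp add: two_sinh_half_nth numeral_2_eq_2)

lemma zeta_neg_real: "zeta (- of_nat k) = of_real (zeta_real (- real k))"
proof -
  have "Im (fps_nth zeta_egf k) = 0"
    using zeta_egf_sign_aux[of "k + 1"] zeta_egf_0 by (cases "k = 0") auto
  moreover have "zeta (- of_nat k) = of_real (fact k) * fps_nth zeta_egf k"
    by (simp add: zeta_egf_def)
  ultimately have "Im (zeta (- of_nat k)) = 0" by (simp only: times_complex.simps Im_complex_of_real mult_zero_right mult_zero_left add_0)
  thus ?thesis by (simp add: zeta_real_def complex_eq_iff)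
qed

lemma zeta_egf_nth: "fps_nth zeta_egf k = of_real (zeta_real (- real k) / fact k)"
  by (simp add: zeta_egf_def zeta_neg_real)

lemma zeta_real_neg_even: "k \<ge> 1 \<Longrightarrow> zeta_real (- real (2 * k)) = 0"
  using zeta_egf_sign_aux[of "2 * k + 1"] zeta_egf_nth[of "2 * k"] by simp

lemma zeta_real_neg_odd_sign: "k \<ge> 1 \<Longrightarrow> (- 1) ^ k * zeta_real (- real (2 * k - 1)) \<ge> 0"
proof -
  assume k: "k \<ge> 1"
  then obtain j where j: "k = Suc j" by (cases k) auto
  have e: "fps_nth (fps_X * zeta_egf - 1) (2 * k) = of_real (zeta_real (- real (2 * k - 1)) / fact (2 * k - 1))"
    using zeta_egf_nth[of "2 * k - 1"] k by simp
  have "even (2 * k)" "2 * k div 2 = k" "2 * k \<ge> 2" using k by simp_all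
  with zeta_egf_sign_aux[of "2 * k"] have "(- 1) ^ k * Re (fps_nth (fps_X * zeta_egf - 1) (2 * k)) \<ge> 0"
    by (simp only: simp_thms)
  hence "(- 1) ^ k * (zeta_real (- real (2 * k - 1)) / fact (2 * k - 1)) \<ge> 0"
    unfolding e Re_complex_of_real .
  from mult_nonneg_nonneg[OF this fact_ge_zero[of "2 * k - 1"]] show ?thesis by simp
qed

lemma zeta_real_nat_sums:
  assumes "\<theta> \<ge> 2"
  shows "(\<lambda>n. 1 / real (Suc n) ^ \<theta>) sums zeta_real (real \<theta>)" "zeta (of_nat \<theta>) = of_real (zeta_real (real \<theta>))"
proof -
  have "(\<lambda>n. of_nat (Suc n) powr (- of_nat \<theta> :: complex)) sums zeta (of_nat \<theta>)"
    using zeta_spec assms by auto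
  moreover have "of_nat (Suc n) powr (- of_nat \<theta> :: complex) = of_real (1 / real (Suc n) ^ \<theta>)" for n
    by (simp add: powr_minus powr_nat' field_simps del: of_nat_Suc)
  ultimately have s: "(\<lambda>n. of_real (1 / real (Suc n) ^ \<theta>)) sums zeta (of_nat \<theta>)" by (simp only:)
  from sums_Re[OF this] show 1: "(\<lambda>n. 1 / real (Suc n) ^ \<theta>) sums zeta_real (real \<theta>)"
    by (simp add: zeta_real_def del: of_nat_Suc)
  have "(\<lambda>n. of_real (1 / real (Suc n) ^ \<theta>)) sums (of_real (zeta_real (real \<theta>)) :: complex)"
    using 1 by (rule sums_of_real)
  with s show "zeta (of_nat \<theta>) = of_real (zeta_real (real \<theta>))" by (rule sums_unique2)
qed

lemma zeta_egf_sums: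
  fixes w :: complex
  assumes "norm w < 2 * pi" "w \<noteq> 0"
  shows "(\<lambda>k. of_real (zeta_real (- real k)) / fact k * w ^ k) sums (1 / w + exp w / (1 - exp w))"
proof -
  have rad: "ereal (norm w) < fps_conv_radius zeta_egf"
    by (rule less_le_trans[OF _ zeta_egf_conv_radius]) (use assms(1) in simp)
  from sums_eval_fps[OF this] show ?thesis unfolding zeta_egf_eval[OF assms] by (simp add: zeta_egf_nth)
qed

section \<open>Cosine series\<close>

definition polylog_coeff :: "nat \<Rightarrow> nat \<Rightarrow> complex" where
  "polylog_coeff \<theta> n = (if n = 0 then 0 else 1 / of_nat n ^ \<theta>)"

text \<open>The polylogarithm of order \<open>\<theta>\<close> at \<open>e^w\<close>, for \<open>Re w < 0\<close>, and on the imaginary axis if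
\<open>\<theta> \<ge> 2\<close>.\<close>

definition exp_series :: "nat \<Rightarrow> complex \<Rightarrow> complex" where
  "exp_series \<theta> w = (\<Sum>n. polylog_coeff \<theta> n * exp w ^ n)"

text \<open>The coefficient that would be \<open>\<zeta>(1)\<close> is left out; \<open>log_part\<close> replaces it.\<close>

definition zeta_coeff :: "nat \<Rightarrow> nat \<Rightarrow> complex" where
  "zeta_coeff \<theta> k = (if Suc k = \<theta> then 0 else of_real (zeta_real (real \<theta> - real k))) / fact k"

definition zeta_power_series :: "nat \<Rightarrow> complex \<Rightarrow> complex" where
  "zeta_power_series \<theta> w = (\<Sum>k. zeta_coeff \<theta> k * w ^ k)"

text \<open>Every function of this family is the derivative of the next; the family starts with the pole \<open>- 1 / w\<close> of
\<open>e^w / (1 - e^w)\<close>, and the harmonic numbers are the constants of integration that keep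
\<open>w^(\<theta> - 1) (H - Ln (- w))\<close> in this form.\<close>

definition log_part :: "nat \<Rightarrow> complex \<Rightarrow> complex" where
  "log_part \<theta> w = (if \<theta> = 0 then - 1 / w
     else w ^ (\<theta> - 1) / fact (\<theta> - 1) * (of_real (harm (\<theta> - 1)) - Ln (- w)))"

lemma diffs_zeta_coeff: "diffs (zeta_coeff (Suc \<theta>)) = zeta_coeff \<theta>"
proof
  fix k
  have "of_nat (Suc k) * (X / fact (Suc k)) = X / fact k" for X :: complex
    by (simp del: of_nat_Suc)
  moreover have "real (Suc \<theta>) - real (Suc k) = real \<theta> - real k" by simp
  ultimately show "diffs (zeta_coeff (Suc \<theta>)) k = zeta_coeff \<theta> k"
    unfolding diffs_def zeta_coeff_def by (simp only: nat.inject)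
qed

lemma summable_zeta_coeff_norm:
  assumes "norm w < 2 * pi"
  shows "summable (\<lambda>k. norm (zeta_coeff \<theta> k * w ^ k))"
  using assms
proof (induction \<theta> arbitrary: w)
  case 0
  define v where "v = (complex_of_real ((norm w + 2 * pi) / 2))"
  have "norm v = (norm w + 2 * pi) / 2" unfolding v_def norm_of_real by (simp add: add_nonneg_nonneg)
  hence v: "norm w < norm v" "norm v < 2 * pi" using 0 by simp_all
  hence "v \<noteq> 0" by auto
  from zeta_egf_sums[OF v(2) this] have "summable (\<lambda>k. zeta_coeff 0 k * v ^ k)"
    by (simp add: zeta_coeff_def sums_iff)
  thus ?case using v(1) by (rule powser_insidea)
next
  case (Suc \<theta>)
  have "summable (\<lambda>k. norm (zeta_coeff (Suc \<theta>) (Suc k) * w ^ Suc k))"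
  proof (rule summable_comparison_test'[of "\<lambda>k. norm w * norm (zeta_coeff \<theta> k * w ^ k)" 0])
    show "summable (\<lambda>k. norm w * norm (zeta_coeff \<theta> k * w ^ k))" by (intro summable_mult Suc)
    fix k
    have eq: "zeta_coeff \<theta> k = of_nat (Suc k) * zeta_coeff (Suc \<theta>) (Suc k)"
      using fun_cong[OF diffs_zeta_coeff[of \<theta>], of k] unfolding diffs_def by (rule sym)
    have "norm (zeta_coeff \<theta> k) = real (Suc k) * norm (zeta_coeff (Suc \<theta>) (Suc k))"
      by (subst eq) (simp only: norm_mult norm_of_nat)
    moreover have "1 * norm (zeta_coeff (Suc \<theta>) (Suc k)) \<le> real (Suc k) * norm (zeta_coeff (Suc \<theta>) (Suc k))"
      by (rule mult_right_mono) auto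
    ultimately have "norm (zeta_coeff (Suc \<theta>) (Suc k)) \<le> norm (zeta_coeff \<theta> k)"
      by linarith
    hence "norm (zeta_coeff (Suc \<theta>) (Suc k)) * norm (w ^ Suc k) \<le> norm (zeta_coeff \<theta> k) * norm (w ^ Suc k)"
      by (rule mult_right_mono) simp
    thus "norm (norm (zeta_coeff (Suc \<theta>) (Suc k) * w ^ Suc k)) \<le> norm w * norm (zeta_coeff \<theta> k * w ^ k)"
      by (simp add: norm_mult mult_ac)
  qed
  thus ?case by (subst (asm) summable_Suc_iff)
qed

lemma zeta_power_series_sums:
  "norm w < 2 * pi \<Longrightarrow> (\<lambda>k. zeta_coeff \<theta> k * w ^ k) sums zeta_power_series \<theta> w"
  unfolding zeta_power_series_def
  by (rule summable_sums, rule summable_norm_cancel, rule summable_zeta_coeff_norm)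

lemma DERIV_zeta_power_series:
  assumes "norm w < 2 * pi"
  shows "(zeta_power_series (Suc \<theta>) has_field_derivative zeta_power_series \<theta> w) (at w)"
proof -
  have "summable (\<lambda>k. zeta_coeff (Suc \<theta>) k * z ^ k)" if "norm z < 2 * pi" for z
    by (rule sums_summable[OF zeta_power_series_sums[OF that]])
  from termdiffs_strong'[OF this assms] show ?thesis
    unfolding zeta_power_series_def[abs_def] diffs_zeta_coeff .
qed

lemma zeta_power_series_0: "zeta_power_series \<theta> 0 = zeta_coeff \<theta> 0"
  unfolding zeta_power_series_def using powser_zero[of "zeta_coeff \<theta>"] by simp

lemma neg_not_nonpos: "Re w \<le> 0 \<Longrightarrow> w \<noteq> 0 \<Longrightarrow> - w \<notin> \<real>\<^sub>\<le>\<^sub>0"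
  by (auto simp: complex_nonpos_Reals_iff complex_eq_iff)

lemma DERIV_log_part:
  assumes "Re w \<le> 0" "w \<noteq> 0"
  shows "(log_part (Suc \<theta>) has_field_derivative log_part \<theta> w) (at w)"
proof -
  have l: "((\<lambda>w. Ln (- w)) has_field_derivative 1 / w) (at w)"
    by (rule derivative_eq_intros refl neg_not_nonpos assms)+ (use assms in \<open>simp add: field_simps\<close>)
  show ?thesis
  proof (cases \<theta>)
    case 0
    have "((\<lambda>w. 0 - Ln (- w)) has_field_derivative 0 - 1 / w) (at w)"
      by (intro DERIV_diff l DERIV_const)
    thus ?thesis by (simp add: log_part_def[abs_def] 0 harm_def)
  next
    case (Suc n)
    let ?H = "complex_of_real (harm (Suc n))"
    have p: "((\<lambda>w. w ^ Suc n / fact (Suc n)) has_field_derivative w ^ n / fact n) (at w)"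
    proof -
      have "((\<lambda>w. w ^ Suc n / fact (Suc n)) has_field_derivative (of_nat (Suc n) * w ^ n) / fact (Suc n)) (at w)"
        by (rule DERIV_cdivide, rule DERIV_cong[OF DERIV_power[OF DERIV_ident]]) (simp del: of_nat_Suc)
      moreover have "(of_nat (Suc n) * w ^ n) / fact (Suc n) = w ^ n / (fact n :: complex)"
        by (simp del: of_nat_Suc)
      ultimately show ?thesis by (simp only:)
    qed
    have "((\<lambda>w. w ^ Suc n / fact (Suc n) * (?H - Ln (- w))) has_field_derivative
        (w ^ n / fact n) * (?H - Ln (- w)) + (0 - 1 / w) * (w ^ Suc n / fact (Suc n))) (at w)"
      by (rule DERIV_mult[OF p DERIV_diff[OF DERIV_const l]])
    also have "(w ^ n / fact n) * (?H - Ln (- w)) + (0 - 1 / w) * (w ^ Suc n / fact (Suc n)) =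
        w ^ n / fact n * (of_real (harm n) - Ln (- w))"
    proof -
      have h: "?H = of_real (harm n) + 1 / of_nat (Suc n)" by (simp add: harm_Suc inverse_eq_divide)
      have "(0 - 1 / w) * (w ^ Suc n / fact (Suc n)) = - (w ^ n / fact n) * (1 / of_nat (Suc n))"
        using assms(2) by simp
      thus ?thesis unfolding h by (simp only: algebra_simps) simp
    qed
    finally show ?thesis by (simp add: log_part_def[abs_def] Suc)
  qed
qed

lemma exp_series_sums_inside:
  assumes "Re w < 0"
  shows "(\<lambda>n. polylog_coeff \<theta> n * exp w ^ n) sums exp_series \<theta> w"
  unfolding exp_series_def
proof (rule summable_sums, rule summable_norm_cancel, rule summable_comparison_test'[of "\<lambda>n. norm (exp w) ^ n" 0])
  show "summable (\<lambda>n. norm (exp w) ^ n)" using assms by (intro summable_geometric) simp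
  fix n
  have "norm (polylog_coeff \<theta> n) \<le> 1"
    by (auto simp: polylog_coeff_def norm_divide norm_power)
  thus "norm (norm (polylog_coeff \<theta> n * exp w ^ n)) \<le> norm (exp w) ^ n"
    by (simp add: norm_mult norm_power mult_left_le_one_le)
qed

lemma summable_polylog_inside:
  assumes "norm z < 1"
  shows "summable (\<lambda>n. polylog_coeff \<theta> n * z ^ n)"
proof (rule summable_norm_cancel, rule summable_comparison_test'[of "\<lambda>n. norm z ^ n" 0])
  show "summable (\<lambda>n. norm z ^ n)" using assms by (intro summable_geometric) simp
  fix n
  have "norm (polylog_coeff \<theta> n) \<le> 1"
    by (auto simp: polylog_coeff_def norm_divide norm_power)
  thus "norm (norm (polylog_coeff \<theta> n * z ^ n)) \<le> norm z ^ n"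
    by (simp add: norm_mult norm_power mult_left_le_one_le)
qed

lemma DERIV_exp_series:
  assumes "Re w < 0"
  shows "(exp_series (Suc \<theta>) has_field_derivative exp_series \<theta> w) (at w)"
proof -
  have e: "norm (exp w) < 1" using assms by simp
  have "((\<lambda>z. \<Sum>n. polylog_coeff (Suc \<theta>) n * z ^ n) has_field_derivative
      (\<Sum>n. diffs (polylog_coeff (Suc \<theta>)) n * exp w ^ n)) (at (exp w))"
    by (rule termdiffs_strong'[OF summable_polylog_inside e])
  from DERIV_chain2[OF this DERIV_exp]
  have d: "(exp_series (Suc \<theta>) has_field_derivative (\<Sum>n. diffs (polylog_coeff (Suc \<theta>)) n * exp w ^ n) * exp w) (at w)"
    unfolding exp_series_def[abs_def] .
  have "diffs (polylog_coeff (Suc \<theta>)) n * exp w ^ n * exp w = polylog_coeff \<theta> (Suc n) * exp w ^ Suc n" for n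
  proof -
    have "of_nat (Suc n) * (1 / of_nat (Suc n) ^ Suc \<theta>) = (1 / of_nat (Suc n) ^ \<theta> :: complex)"
      by (simp del: of_nat_Suc)
    thus ?thesis by (simp add: diffs_def polylog_coeff_def mult_ac del: of_nat_Suc power_Suc of_nat_add) (simp add: mult_ac)
  qed
  moreover have "(\<lambda>n. polylog_coeff \<theta> (Suc n) * exp w ^ Suc n) sums exp_series \<theta> w"
    using exp_series_sums_inside[OF assms, of \<theta>] by (subst sums_Suc_iff) (simp add: polylog_coeff_def)
  ultimately have "(\<lambda>n. diffs (polylog_coeff (Suc \<theta>)) n * exp w ^ n * exp w) sums exp_series \<theta> w"
    by (simp only:)
  moreover have "summable (\<lambda>n. diffs (polylog_coeff (Suc \<theta>)) n * exp w ^ n)"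
    by (rule termdiff_converges[OF e summable_polylog_inside])
  ultimately have "(\<Sum>n. diffs (polylog_coeff (Suc \<theta>)) n * exp w ^ n) * exp w = exp_series \<theta> w"
    by (simp only: suminf_mult2 sums_iff)
  with d show ?thesis by simp
qed

lemma norm_exp_series_term:
  assumes "Re w \<le> 0"
  shows "norm (polylog_coeff \<theta> n * exp w ^ n) \<le> 1 / real n ^ \<theta>"
proof (cases "n = 0")
  case False
  have "norm (exp w ^ n) \<le> 1" using assms by (simp add: norm_power power_le_one)
  thus ?thesis using False
    by (simp add: polylog_coeff_def norm_mult norm_divide norm_power divide_right_mono)
qed (simp add: polylog_coeff_def)

lemma summable_inverse_power: "\<theta> \<ge> 2 \<Longrightarrow> summable (\<lambda>n. 1 / real n ^ \<theta>)"
  using inverse_power_summable[of \<theta>, where ?'a = real] by (simp add: inverse_eq_divide)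

lemma continuous_on_exp_series:
  assumes "\<theta> \<ge> 2"
  shows "continuous_on {w. Re w \<le> 0} (exp_series \<theta>)"
proof -
  have "uniform_limit {w. Re w \<le> 0} (\<lambda>m w. \<Sum>n<m. polylog_coeff \<theta> n * exp w ^ n) (exp_series \<theta>) sequentially"
    unfolding exp_series_def[abs_def]
    by (rule Weierstrass_m_test[OF _ summable_inverse_power[OF assms]]) (use norm_exp_series_term in auto)
  thus ?thesis
    by (rule uniform_limit_theorem[rotated]) (auto intro!: always_eventually continuous_intros)
qed

lemma exp_series_sums_boundary:
  assumes "\<theta> \<ge> 2" "Re w \<le> 0"
  shows "(\<lambda>n. polylog_coeff \<theta> n * exp w ^ n) sums exp_series \<theta> w"
  unfolding exp_series_def
  by (rule summable_sums, rule summable_norm_cancel,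
      rule summable_comparison_test'[OF summable_inverse_power[OF assms(1)], of 0])
     (use norm_exp_series_term[OF assms(2)] in simp)

lemma exp_series_0:
  assumes "\<theta> \<ge> 2"
  shows "exp_series \<theta> 0 = zeta_coeff \<theta> 0"
proof -
  have "(\<lambda>n. of_real (1 / real (Suc n) ^ \<theta>)) sums (of_real (zeta_real (real \<theta>)) :: complex)"
    by (rule sums_of_real[OF zeta_real_nat_sums(1)[OF assms]])
  hence "(\<lambda>n. polylog_coeff \<theta> (Suc n) * exp 0 ^ Suc n) sums of_real (zeta_real (real \<theta>))"
    by (simp add: polylog_coeff_def)
  hence "(\<lambda>n. polylog_coeff \<theta> n * exp 0 ^ n) sums of_real (zeta_real (real \<theta>))"
    by (subst (asm) sums_Suc_iff) (simp add: polylog_coeff_def)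
  with exp_series_sums_boundary[OF assms, of 0] have "exp_series \<theta> 0 = of_real (zeta_real (real \<theta>))"
    by (intro sums_unique2) simp_all
  thus ?thesis using assms by (simp add: zeta_coeff_def)
qed

lemma exp_series_geometric:
  assumes "Re w < 0" "norm w < 2 * pi"
  shows "exp_series 0 w = zeta_power_series 0 w + log_part 0 w"
proof -
  have e: "norm (exp w) < 1" using assms by simp
  have w: "w \<noteq> 0" using assms by auto
  have "(\<lambda>n. exp w * exp w ^ n) sums (exp w * (1 / (1 - exp w)))"
    by (intro sums_mult geometric_sums e)
  hence "(\<lambda>n. polylog_coeff 0 (Suc n) * exp w ^ Suc n) sums (exp w / (1 - exp w))"
    by (simp add: polylog_coeff_def)
  hence "(\<lambda>n. polylog_coeff 0 n * exp w ^ n) sums (exp w / (1 - exp w))"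
    by (subst (asm) sums_Suc_iff) (simp add: polylog_coeff_def)
  hence "exp_series 0 w = exp w / (1 - exp w)" using exp_series_sums_inside[OF assms(1)] sums_unique2 by blast
  moreover have "zeta_power_series 0 w = 1 / w + exp w / (1 - exp w)"
  proof -
    have "(\<lambda>k. zeta_coeff 0 k * w ^ k) sums (1 / w + exp w / (1 - exp w))"
      using zeta_egf_sums[OF assms(2) w] by (simp add: zeta_coeff_def)
    thus ?thesis using zeta_power_series_sums[OF assms(2)] sums_unique2 by blast
  qed
  ultimately show ?thesis by (simp add: log_part_def)
qed

lemma exp_series_1:
  assumes "Re w < 0"
  shows "exp_series 1 w = - Ln (1 - exp w)"
proof -
  have "norm (- exp w) < 1" using assms by simp
  from sums_minus[OF Ln_series[OF this]]
  have "(\<lambda>n. - ((- 1) ^ Suc n / of_nat n * (- exp w) ^ n)) sums (- Ln (1 - exp w))" by simp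
  also have "(\<lambda>n. - ((- 1) ^ Suc n / of_nat n * (- exp w) ^ n)) = (\<lambda>n. polylog_coeff 1 n * exp w ^ n)"
  proof
    fix n
    have "(- exp w) ^ n = (- 1) ^ n * exp w ^ n" by (rule power_minus)
    moreover have "(- 1 :: complex) ^ n * (- 1) ^ n = 1" by (simp flip: power_mult_distrib)
    hence "- ((- 1) ^ Suc n / of_nat n * ((- 1) ^ n * E)) = E / of_nat n" for E :: complex
      by (simp add: mult.assoc[symmetric])
    ultimately show "- ((- 1) ^ Suc n / of_nat n * (- exp w) ^ n) = polylog_coeff 1 n * exp w ^ n"
      by (simp add: polylog_coeff_def)
  qed
  finally show ?thesis using exp_series_sums_inside[OF assms] sums_unique2 by blast
qed

text \<open>This fixes the constant of integration. For order at least \<open>2\<close> both sides tend to a zeta value; for order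
\<open>1\<close> the logarithms cancel in the limit and \<open>\<zeta>(1)\<close> has been left out.\<close>

lemma tendsto_exp_series_diff_0:
  "((\<lambda>t. exp_series (Suc \<theta>) (of_real (- t)) - (zeta_power_series (Suc \<theta>) (of_real (- t)) + log_part (Suc \<theta>) (of_real (- t))))
      \<longlongrightarrow> 0) (at_right (0::real))"
proof -
  have P: "((\<lambda>t. zeta_power_series (Suc \<theta>) (of_real (- t))) \<longlongrightarrow> zeta_coeff (Suc \<theta>) 0) (at_right (0::real))"
  proof -
    have "isCont (zeta_power_series (Suc \<theta>)) 0"
      by (rule DERIV_isCont[OF DERIV_zeta_power_series]) simp
    moreover have "((\<lambda>t. complex_of_real (- t)) \<longlongrightarrow> 0) (at_right (0::real))"
      by (rule tendsto_eq_intros refl)+ simp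
    ultimately show ?thesis unfolding zeta_power_series_0[symmetric] by (rule isCont_tendsto_compose)
  qed
  show ?thesis
  proof (cases "\<theta> = 0")
    case True
    have "((\<lambda>t::real. - ln (1 - exp (- t)) + ln t) \<longlongrightarrow> 0) (at_right 0)" by real_asymp
    hence "((\<lambda>t::real. complex_of_real (- ln (1 - exp (- t)) + ln t)) \<longlongrightarrow> of_real 0) (at_right 0)"
      by (rule tendsto_of_real)
    from tendsto_diff[OF this P] have "((\<lambda>t::real. complex_of_real (- ln (1 - exp (- t)) + ln t) - zeta_power_series (Suc \<theta>) (of_real (- t))) \<longlongrightarrow> 0) (at_right 0)"
      by (simp add: True zeta_coeff_def)
    moreover have "eventually (\<lambda>t::real. complex_of_real (- ln (1 - exp (- t)) + ln t) - zeta_power_series (Suc \<theta>) (of_real (- t)) =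
       exp_series (Suc \<theta>) (of_real (- t)) - (zeta_power_series (Suc \<theta>) (of_real (- t)) + log_part (Suc \<theta>) (of_real (- t)))) (at_right 0)"
      using eventually_at_right_less[of "0::real"]
    proof eventually_elim
      case (elim t)
      have "exp_series 1 (of_real (- t)) = - Ln (1 - exp (of_real (- t)))"
        by (rule exp_series_1) (use elim in simp)
      also have "1 - exp (of_real (- t)) = complex_of_real (1 - exp (- t))"
        by (simp only: exp_of_real of_real_diff of_real_1)
      also have "Ln \<dots> = of_real (ln (1 - exp (- t)))" by (rule Ln_of_real) (use elim in simp)
      finally have "exp_series 1 (of_real (- t)) = - of_real (ln (1 - exp (- t)))" .
      moreover have "log_part 1 (of_real (- t)) = - of_real (ln t)"
        using elim by (simp add: log_part_def harm_def Ln_of_real)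
      ultimately show ?case by (simp add: True)
    qed
    ultimately show ?thesis by (rule Lim_transform_eventually)
  next
    case False
    then obtain n where n: "\<theta> = Suc n" by (cases \<theta>) auto
    have E: "((\<lambda>t. exp_series (Suc \<theta>) (of_real (- t))) \<longlongrightarrow> zeta_coeff (Suc \<theta>) 0) (at_right (0::real))"
    proof -
      have "((\<lambda>t. exp_series (Suc \<theta>) (of_real (- t))) \<longlongrightarrow> exp_series (Suc \<theta>) 0) (at_right (0::real))"
      proof (rule continuous_on_tendsto_compose[OF continuous_on_exp_series])
        show "((\<lambda>t. complex_of_real (- t)) \<longlongrightarrow> 0) (at_right (0::real))"
          by (rule tendsto_eq_intros refl)+ simp
        show "eventually (\<lambda>t. complex_of_real (- t) \<in> {w. Re w \<le> 0}) (at_right (0::real))"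
          using eventually_at_right_less[of "0::real"] by eventually_elim simp
      qed (use n in auto)
      thus ?thesis using exp_series_0[of "Suc \<theta>"] n by simp
    qed
    have L: "((\<lambda>t. log_part (Suc \<theta>) (of_real (- t))) \<longlongrightarrow> 0) (at_right (0::real))"
    proof -
      have "((\<lambda>t::real. (- t) ^ n / fact (Suc n) * ((- t) * (harm (Suc n) - ln t))) \<longlongrightarrow> (- 0) ^ n / fact (Suc n) * 0) (at_right 0)"
      proof (intro tendsto_intros)
        show "((\<lambda>t::real. (- t) * (harm (Suc n) - ln t)) \<longlongrightarrow> 0) (at_right 0)" by real_asymp
      qed auto
      hence "((\<lambda>t::real. complex_of_real ((- t) ^ n / fact (Suc n) * ((- t) * (harm (Suc n) - ln t)))) \<longlongrightarrow> of_real 0) (at_right 0)"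
        by (intro tendsto_of_real) simp
      moreover have "eventually (\<lambda>t::real. complex_of_real ((- t) ^ n / fact (Suc n) * ((- t) * (harm (Suc n) - ln t))) = log_part (Suc \<theta>) (of_real (- t))) (at_right 0)"
        using eventually_at_right_less[of "0::real"]
      proof eventually_elim
        case (elim t)
        have "Ln (- complex_of_real (- t)) = of_real (ln t)" using elim by (simp add: Ln_of_real)
        thus ?case by (simp add: log_part_def n mult_ac del: fact_Suc)
      qed
      ultimately show ?thesis unfolding of_real_0 by (rule Lim_transform_eventually)
    qed
    from tendsto_diff[OF E tendsto_add[OF P L]] show ?thesis by simp
  qed
qed

text \<open>Induction on the order: the derivative of either side is the same expression of the previous order, the
case of order \<open>0\<close> is the generating function of the zeta values, and the limit at \<open>0\<close> determines
the constant.\<close>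

lemma exp_series_expansion:
  assumes "Re w < 0" "norm w < 2 * pi"
  shows "exp_series \<theta> w = zeta_power_series \<theta> w + log_part \<theta> w"
  using assms
proof (induction \<theta> arbitrary: w)
  case 0 thus ?case by (rule exp_series_geometric)
next
  case (Suc \<theta>)
  let ?D = "{w. Re w < 0} \<inter> ball 0 (2 * pi)"
  let ?f = "\<lambda>w. exp_series (Suc \<theta>) w - (zeta_power_series (Suc \<theta>) w + log_part (Suc \<theta>) w)"
  have "\<exists>c. \<forall>w\<in>?D. ?f w = c"
  proof (rule has_field_derivative_zero_constant)
    show "convex ?D" by (intro convex_Int convex_halfspace_Re_lt convex_ball)
    fix w assume w: "w \<in> ?D"
    have "(?f has_field_derivative exp_series \<theta> w - (zeta_power_series \<theta> w + log_part \<theta> w)) (at w)"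
      by (intro DERIV_diff DERIV_add DERIV_exp_series DERIV_zeta_power_series DERIV_log_part) (use w in auto)
    thus "(?f has_field_derivative 0) (at w within ?D)"
      using Suc.IH[of w] w by (simp add: has_field_derivative_at_within)
  qed
  then obtain c where c: "\<And>w. w \<in> ?D \<Longrightarrow> ?f w = c" by blast
  have "eventually (\<lambda>t. t \<in> {0<..<2 * pi}) (at_right (0::real))"
    by (rule eventually_at_right_real) simp
  hence "eventually (\<lambda>t. ?f (of_real (- t)) = c) (at_right (0::real))"
    by eventually_elim (rule c, simp)
  hence "((\<lambda>t. ?f (of_real (- t))) \<longlongrightarrow> c) (at_right (0::real))"
    by (rule tendsto_eventually)
  with tendsto_exp_series_diff_0[of \<theta>] have "c = 0"
    by (intro tendsto_unique[of "at_right (0::real)"]) auto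
  with c[of w] Suc.prems show ?case by simp
qed

text \<open>Continuity up to the imaginary axis, approached from the left half-plane.\<close>

lemma exp_series_expansion_boundary:
  assumes "\<theta> \<ge> 2" "0 < x" "x < 2 * pi"
  shows "exp_series \<theta> (\<i> * of_real x) = zeta_power_series \<theta> (\<i> * of_real x) + log_part \<theta> (\<i> * of_real x)"
proof -
  let ?w = "\<i> * complex_of_real x"
  let ?g = "\<lambda>t::real. ?w - of_real t"
  obtain n where n: "\<theta> = Suc n" using assms(1) by (cases \<theta>) auto
  have w: "norm ?w < 2 * pi" "?w \<noteq> 0" "Re ?w \<le> 0" using assms by (auto simp: norm_mult)
  have g: "(?g \<longlongrightarrow> ?w) (at_right 0)" by (rule tendsto_eq_intros refl)+ simp
  have "((\<lambda>t. exp_series \<theta> (?g t)) \<longlongrightarrow> exp_series \<theta> ?w) (at_right 0)"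
  proof (rule continuous_on_tendsto_compose[OF continuous_on_exp_series[OF assms(1)] g])
    show "eventually (\<lambda>t. ?g t \<in> {w. Re w \<le> 0}) (at_right 0)"
      using eventually_at_right_less[of "0::real"] by eventually_elim simp
  qed simp
  moreover have "((\<lambda>t. zeta_power_series \<theta> (?g t) + log_part \<theta> (?g t)) \<longlongrightarrow> zeta_power_series \<theta> ?w + log_part \<theta> ?w) (at_right 0)"
    unfolding n
    by (intro tendsto_add isCont_tendsto_compose[OF _ g] DERIV_isCont[OF DERIV_zeta_power_series] DERIV_isCont[OF DERIV_log_part] w)
  moreover have "eventually (\<lambda>t. exp_series \<theta> (?g t) = zeta_power_series \<theta> (?g t) + log_part \<theta> (?g t)) (at_right 0)"
  proof -
    have "eventually (\<lambda>t. norm (?g t) < 2 * pi) (at_right 0)"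
      by (rule order_tendstoD(2)[OF tendsto_norm[OF g] w(1)])
    thus ?thesis using eventually_at_right_less[of "0::real"]
      by eventually_elim (rule exp_series_expansion, simp_all)
  qed
  ultimately have "((\<lambda>t. exp_series \<theta> (?g t)) \<longlongrightarrow> zeta_power_series \<theta> ?w + log_part \<theta> ?w) (at_right 0)"
    by (subst tendsto_cong) auto
  with \<open>((\<lambda>t. exp_series \<theta> (?g t)) \<longlongrightarrow> exp_series \<theta> ?w) (at_right 0)\<close>
  show ?thesis by (intro tendsto_unique[of "at_right (0::real)"]) auto
qed

text \<open>The case distinction removes \<open>\<zeta>(1)\<close>.\<close>

definition zeta_cos_coeff :: "nat \<Rightarrow> nat \<Rightarrow> real" where
  "zeta_cos_coeff \<theta> m = (if 2 * m + 1 = \<theta> then 0 else zeta_real (real \<theta> - 2 * real m))"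

lemma i_power_even: "(\<i> * of_real x) ^ (2 * m) = of_real ((- 1) ^ m * x ^ (2 * m))"
proof -
  have "(\<i>::complex) ^ (2 * m) = (- 1) ^ m" by (simp only: power_mult power2_i)
  thus ?thesis by (simp add: power_mult_distrib)
qed

lemma Re_zeta_power_series_sums:
  assumes "\<bar>x\<bar> < 2 * pi"
  shows "(\<lambda>m. zeta_cos_coeff \<theta> m * ((- 1) ^ m * x ^ (2 * m) / fact (2 * m))) sums Re (zeta_power_series \<theta> (\<i> * of_real x))"
proof -
  let ?w = "\<i> * complex_of_real x"
  have c: "zeta_coeff \<theta> k = of_real ((if Suc k = \<theta> then 0 else zeta_real (real \<theta> - real k)) / fact k)" for k
    by (simp add: zeta_coeff_def)
  have "norm ?w < 2 * pi" using assms by (simp add: norm_mult)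
  from sums_Re[OF zeta_power_series_sums[OF this, of \<theta>]]
  have "(\<lambda>k. Re (zeta_coeff \<theta> k * ?w ^ k)) sums Re (zeta_power_series \<theta> ?w)" .
  moreover have "strict_mono (\<lambda>m::nat. 2 * m)" by (simp add: strict_mono_def)
  moreover have "Re (zeta_coeff \<theta> k * ?w ^ k) = 0" if "k \<notin> range (\<lambda>m::nat. 2 * m)" for k
  proof -
    have "odd k" using that by (metis evenE rangeI)
    then obtain m where "k = 2 * m + 1" by (elim oddE)
    hence "?w ^ k = \<i> * of_real ((- 1) ^ m * x ^ (2 * m) * x)"
      by (simp only: power_add i_power_even power_one_right of_real_mult mult.assoc mult.left_commute[of \<i>])
    moreover have "Re (of_real p * (\<i> * of_real q)) = 0" for p q :: real by simp
    ultimately show ?thesis unfolding c by (simp only:)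
  qed
  ultimately have "(\<lambda>m. Re (zeta_coeff \<theta> (2 * m) * ?w ^ (2 * m))) sums Re (zeta_power_series \<theta> ?w)"
    using sums_mono_reindex[of "\<lambda>m::nat. 2 * m" "\<lambda>k. Re (zeta_coeff \<theta> k * ?w ^ k)"] by blast
  moreover have "Re (zeta_coeff \<theta> (2 * m) * ?w ^ (2 * m)) = zeta_cos_coeff \<theta> m * ((- 1) ^ m * x ^ (2 * m) / fact (2 * m))" for m
    unfolding c i_power_even of_real_mult[symmetric] Re_complex_of_real by (simp add: zeta_cos_coeff_def)
  ultimately show ?thesis by simp
qed

lemma summable_zeta_cos_coeff:
  assumes "\<bar>x\<bar> < 2 * pi"
  shows "summable (\<lambda>m. \<bar>zeta_cos_coeff \<theta> m\<bar> * x ^ (2 * m) / fact (2 * m))"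
proof -
  let ?f = "\<lambda>k. norm (zeta_coeff \<theta> k * complex_of_real x ^ k)"
  have "summable ?f" by (rule summable_zeta_coeff_norm) (use assms in simp)
  from summable_reindex[OF this, of "\<lambda>m. 2 * m"] have "summable (\<lambda>m. ?f (2 * m))"
    by (simp add: o_def inj_on_def)
  moreover have "?f (2 * m) = \<bar>zeta_cos_coeff \<theta> m\<bar> * x ^ (2 * m) / fact (2 * m)" for m
    by (simp add: zeta_coeff_def zeta_cos_coeff_def norm_mult norm_divide norm_power power_even_abs flip: of_nat_Suc)
  ultimately show ?thesis by simp
qed

lemma Re_log_part:
  assumes "x > 0" "\<theta> \<ge> 1"
  shows "Re (log_part \<theta> (\<i> * of_real x)) =
    (if even \<theta> then (- 1) ^ (\<theta> div 2) * (pi / 2) / fact (\<theta> - 1) * x ^ (\<theta> - 1)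
     else (- 1) ^ (\<theta> div 2) / fact (\<theta> - 1) * (harm (\<theta> - 1) * x ^ (\<theta> - 1) - x ^ (\<theta> - 1) * ln x))"
proof -
  have L: "Ln (- (\<i> * of_real x)) = of_real (ln x) - \<i> * of_real (pi / 2)"
  proof -
    have "- (\<i> * of_real x) = of_real x * (- \<i>)" by simp
    also have "Ln \<dots> = of_real (ln x) + Ln (- \<i>)" using assms Ln_times_of_real[of x "- \<i>"] Ln_of_real[of x] by simp
    finally show ?thesis by simp
  qed
  show ?thesis
  proof (cases "even \<theta>")
    case True
    then obtain N where N: "\<theta> = 2 * N" by (elim evenE)
    then obtain M where M: "N = Suc M" using assms(2) by (cases N) auto
    have t: "\<theta> - 1 = 2 * M + 1" "\<theta> div 2 = Suc M" "\<theta> \<noteq> 0" by (simp_all add: N M)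
    have p: "(\<i> * of_real x) ^ (2 * M + 1) = \<i> * of_real ((- 1) ^ M * x ^ (2 * M + 1))"
      unfolding power_add i_power_even power_one_right by (simp only: of_real_mult mult_ac)
    have "log_part \<theta> (\<i> * of_real x) = \<i> * of_real ((- 1) ^ M * x ^ (2 * M + 1) / fact (2 * M + 1)) *
        (of_real (harm (2 * M + 1) - ln x) + \<i> * of_real (pi / 2))"
      using t(3) unfolding log_part_def t L p by simp
    moreover have "Re (\<i> * of_real c * (of_real p + \<i> * of_real q)) = - (c * q)" for c p q :: real by simp
    ultimately have "Re (log_part \<theta> (\<i> * of_real x)) = - ((- 1) ^ M * x ^ (2 * M + 1) / fact (2 * M + 1) * (pi / 2))" by (simp only:)
    thus ?thesis using True unfolding t by (simp add: mult_ac del: fact_Suc)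
  next
    case False
    then obtain N where N: "\<theta> = 2 * N + 1" by (elim oddE)
    have t: "\<theta> - 1 = 2 * N" "\<theta> div 2 = N" "\<theta> \<noteq> 0" by (simp_all add: N)
    have "log_part \<theta> (\<i> * of_real x) = of_real ((- 1) ^ N * x ^ (2 * N) / fact (2 * N)) *
        (of_real (harm (2 * N) - ln x) + \<i> * of_real (pi / 2))"
      using t(3) unfolding log_part_def t L i_power_even by simp
    moreover have "Re (of_real c * (of_real p + \<i> * of_real q)) = c * p" for c p q :: real by simp
    ultimately have "Re (log_part \<theta> (\<i> * of_real x)) = (- 1) ^ N * x ^ (2 * N) / fact (2 * N) * (harm (2 * N) - ln x)" by (simp only:)
    thus ?thesis using False unfolding t by (simp add: algebra_simps diff_divide_distrib)
  qed
qed

lemma Re_exp_series: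
  assumes "\<theta> \<ge> 2"
  shows "(\<lambda>n. cos (real (Suc n) * x) / real (Suc n) ^ \<theta>) sums Re (exp_series \<theta> (\<i> * of_real x))"
proof -
  have "(\<lambda>n. polylog_coeff \<theta> n * exp (\<i> * of_real x) ^ n) sums exp_series \<theta> (\<i> * of_real x)"
    by (rule exp_series_sums_boundary[OF assms]) simp
  hence "(\<lambda>n. polylog_coeff \<theta> (Suc n) * exp (\<i> * of_real x) ^ Suc n) sums exp_series \<theta> (\<i> * of_real x)"
    by (subst sums_Suc_iff) (simp add: polylog_coeff_def)
  from sums_Re[OF this]
  have "(\<lambda>n. Re (polylog_coeff \<theta> (Suc n) * exp (\<i> * of_real x) ^ Suc n)) sums Re (exp_series \<theta> (\<i> * of_real x))" .
  moreover have "Re (polylog_coeff \<theta> (Suc n) * exp (\<i> * of_real x) ^ Suc n) = cos (real (Suc n) * x) / real (Suc n) ^ \<theta>" for n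
  proof -
    have "exp (\<i> * of_real x) ^ Suc n = exp (of_nat (Suc n) * (\<i> * of_real x))" by (rule exp_of_nat_mult[symmetric])
    also have "\<dots> = cis (real (Suc n) * x)" by (simp add: cis_conv_exp mult_ac del: of_nat_Suc)
    moreover have "polylog_coeff \<theta> (Suc n) = of_real (1 / real (Suc n) ^ \<theta>)" by (simp add: polylog_coeff_def)
    ultimately show ?thesis by (simp del: of_nat_Suc power_Suc)
  qed
  ultimately show ?thesis by (simp only:)
qed

lemma cos_series_expansion:
  assumes "\<theta> \<ge> 2" "0 < x" "x < 2 * pi"
  shows "(\<Sum>n. cos (real (Suc n) * x) / real (Suc n) ^ \<theta>) =
    (if even \<theta> then (- 1) ^ (\<theta> div 2) * (pi / 2) / fact (\<theta> - 1) * x ^ (\<theta> - 1)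
     else (- 1) ^ (\<theta> div 2) / fact (\<theta> - 1) * (harm (\<theta> - 1) * x ^ (\<theta> - 1) - x ^ (\<theta> - 1) * ln x))
    + (\<Sum>m. zeta_cos_coeff \<theta> m * ((- 1) ^ m * x ^ (2 * m) / fact (2 * m)))"
proof -
  have "(\<Sum>n. cos (real (Suc n) * x) / real (Suc n) ^ \<theta>) = Re (zeta_power_series \<theta> (\<i> * of_real x) + log_part \<theta> (\<i> * of_real x))"
    unfolding exp_series_expansion_boundary[OF assms, symmetric]
    using Re_exp_series[OF assms(1)] by (rule sums_unique[symmetric])
  moreover have "Re (zeta_power_series \<theta> (\<i> * of_real x)) = (\<Sum>m. zeta_cos_coeff \<theta> m * ((- 1) ^ m * x ^ (2 * m) / fact (2 * m)))"
    by (rule sums_unique[OF Re_zeta_power_series_sums]) (use assms in simp)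
  moreover have "\<theta> \<ge> 1" using assms(1) by simp
  ultimately show ?thesis using Re_log_part[OF assms(2), of \<theta>] by simp
qed

section \<open>Interchanging averages and power series\<close>

lemma double_series_swap:
  fixes f :: "nat \<Rightarrow> nat \<Rightarrow> real"
  assumes "\<And>m. summable (\<lambda>r. \<bar>f m r\<bar>)" "summable (\<lambda>m. \<Sum>r. \<bar>f m r\<bar>)"
  shows "summable (\<lambda>m. \<bar>f m r\<bar>)" "summable (\<lambda>r. \<Sum>m. \<bar>f m r\<bar>)"
    "(\<lambda>m. \<Sum>r. f m r) sums (\<Sum>r. \<Sum>m. f m r)"
proof -
  have inf: "infsum g UNIV = suminf g" if "summable (\<lambda>k. \<bar>g k\<bar>)" for g :: "nat \<Rightarrow> real"
    using norm_summable_imp_has_sum[of g "suminf g"] that summable_rabs_cancel[OF that]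
    by (auto intro: infsumI summable_sums)
  have on: "(\<lambda>k. \<bar>g k\<bar>) summable_on UNIV \<longleftrightarrow> summable (\<lambda>k. \<bar>g k\<bar>)" for g :: "nat \<Rightarrow> real"
    by (rule summable_on_UNIV_nonneg_real_iff) simp
  have nn: "\<bar>\<Sum>r. \<bar>f m r\<bar>\<bar> = (\<Sum>r. \<bar>f m r\<bar>)" for m
    using assms(1)[of m] by (simp add: suminf_nonneg)
  have i1: "(\<Sum>\<^sub>\<infinity>r. \<bar>f m r\<bar>) = (\<Sum>r. \<bar>f m r\<bar>)" for m
    using inf[of "\<lambda>r. \<bar>f m r\<bar>"] assms(1)[of m] by simp
  have A: "(\<lambda>p. norm (case p of (m, r) \<Rightarrow> f m r)) summable_on UNIV \<times> UNIV"
  proof (rule iffD2[OF Infinite_Sum.abs_summable_on_Sigma_iff[where f = "\<lambda>(m, r). f m r" and A = UNIV and B = "\<lambda>_. UNIV"]], intro conjI ballI)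
    show "(\<lambda>r. norm (case (m, r) of (m, r) \<Rightarrow> f m r)) summable_on UNIV" for m using assms(1) by (simp add: on)
    show "(\<lambda>m. norm (\<Sum>\<^sub>\<infinity>r. norm (case (m, r) of (m, r) \<Rightarrow> f m r))) summable_on UNIV"
      using assms(2) on[of "\<lambda>m. \<Sum>r. \<bar>f m r\<bar>"] by (simp add: i1 nn)
  qed
  hence A': "(\<lambda>p. norm (case p of (r, m) \<Rightarrow> f m r)) summable_on UNIV \<times> UNIV"
    using summable_on_swap[of "\<lambda>p. norm (case p of (m, r) \<Rightarrow> f m r)" UNIV UNIV]
    by (simp add: case_prod_unfold)
  hence B: "(\<forall>r. (\<lambda>m. \<bar>f m r\<bar>) summable_on UNIV) \<and> (\<lambda>r. \<bar>\<Sum>\<^sub>\<infinity>m. \<bar>f m r\<bar>\<bar>) summable_on UNIV"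
    using iffD1[OF Infinite_Sum.abs_summable_on_Sigma_iff[where f = "\<lambda>(r, m). f m r" and A = UNIV and B = "\<lambda>_. UNIV"]] by simp
  show s: "summable (\<lambda>m. \<bar>f m r\<bar>)" for r using B by (simp add: on)
  have i2: "(\<Sum>\<^sub>\<infinity>m. \<bar>f m r\<bar>) = (\<Sum>m. \<bar>f m r\<bar>)" for r
    using inf[of "\<lambda>m. \<bar>f m r\<bar>"] s[of r] by simp
  have nn2: "\<bar>\<Sum>m. \<bar>f m r\<bar>\<bar> = (\<Sum>m. \<bar>f m r\<bar>)" for r
    using s[of r] by (simp add: suminf_nonneg)
  show s2: "summable (\<lambda>r. \<Sum>m. \<bar>f m r\<bar>)"
    using B on[of "\<lambda>r. \<Sum>m. \<bar>f m r\<bar>"] by (simp add: i2 nn2)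
  have s3: "summable (\<lambda>r. \<bar>\<Sum>m. f m r\<bar>)"
    by (rule summable_comparison_test'[OF s2, of 0]) (use s in \<open>simp add: summable_rabs\<close>)
  have s4: "summable (\<lambda>m. \<bar>\<Sum>r. f m r\<bar>)"
    by (rule summable_comparison_test'[OF assms(2), of 0]) (use assms(1) in \<open>simp add: summable_rabs\<close>)
  have "(\<Sum>\<^sub>\<infinity>m. \<Sum>\<^sub>\<infinity>r. f m r) = (\<Sum>\<^sub>\<infinity>r. \<Sum>\<^sub>\<infinity>m. f m r)"
    by (rule infsum_swap_banach) (use Infinite_Sum.abs_summable_summable[OF A] in \<open>simp add: case_prod_unfold\<close>)
  hence "(\<Sum>m. \<Sum>r. f m r) = (\<Sum>r. \<Sum>m. f m r)"
    using inf[OF s3] inf[OF s4] by (simp add: inf[OF s] inf[OF assms(1)])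
  thus "(\<lambda>m. \<Sum>r. f m r) sums (\<Sum>r. \<Sum>m. f m r)"
    using summable_sums[OF summable_rabs_cancel[OF s4]] by simp
qed

text \<open>Coefficients, with respect to \<open>y\<close>, of the average of the power series part; each is itself a series
over \<open>m\<close>.\<close>

definition zeta_part :: "real \<Rightarrow> real \<Rightarrow> nat \<Rightarrow> nat \<Rightarrow> real" where
  "zeta_part \<mu> a \<theta> r = (\<Sum>m. zeta_cos_coeff \<theta> m * power_coeff \<mu> a m r)"

text \<open>All coefficients that belong to the same \<open>m\<close> have the same sign, so that absolute values do not destroy
the closed form of their sum.\<close>

lemma power_coeff_abs: "\<mu> \<ge> 0 \<Longrightarrow> \<bar>power_coeff \<mu> a m r\<bar> = (- 1) ^ m * power_coeff \<mu> a m r"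
proof (cases "r \<le> m")
  case True
  assume "\<mu> \<ge> 0"
  hence "rGamma (real (m - r) + 1 + \<mu>) > 0" by (intro rGamma_pos_real) simp
  moreover have "(a / 2) ^ (2 * (m - r)) \<ge> 0" by (simp add: power_mult)
  ultimately show ?thesis
    unfolding power_coeff_le[OF True] by (simp add: abs_mult flip: mult.assoc power_mult_distrib)
qed (simp add: power_coeff_eq_0)

text \<open>The sum is again the average of \<open>(a s + y)^(2 m) / (2 m)!\<close>. This bound is what limits the
interchange of summations to \<open>a + y < 2 \<pi>\<close>.\<close>

lemma power_coeff_sum_bound:
  assumes "\<mu> \<ge> 0" "a \<ge> 0" "y \<ge> 0"
  shows "(\<Sum>r\<le>m. \<bar>power_coeff \<mu> a m r\<bar> * y ^ (2 * r) / fact (2 * r)) \<le> poisson_mass \<mu> * ((a + y) ^ (2 * m) / fact (2 * m))"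
proof -
  have "(\<Sum>r\<le>m. \<bar>power_coeff \<mu> a m r\<bar> * y ^ (2 * r) / fact (2 * r)) =
      (- 1) ^ m * poisson_avg \<mu> (\<lambda>s. (- 1) ^ m * (a * s + y) ^ (2 * m) / fact (2 * m))"
    unfolding poisson_avg_even_power_translate[OF assms(1)] sum_distrib_left
    by (simp add: power_coeff_abs[OF assms(1)] mult.assoc)
  also have "\<dots> \<le> \<bar>poisson_avg \<mu> (\<lambda>s. (- 1) ^ m * (a * s + y) ^ (2 * m) / fact (2 * m))\<bar>"
    by (rule order_trans[OF abs_ge_self]) (simp add: abs_mult power_abs)
  also have "\<dots> \<le> poisson_mass \<mu> * ((a + y) ^ (2 * m) / fact (2 * m))"
  proof (rule poisson_avg_bound[OF assms(1)])
    fix s :: real assume s: "s \<in> {-1..1}"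
    have "\<bar>a * s\<bar> \<le> a * 1" unfolding abs_mult using s assms by (intro mult_mono) auto
    hence "\<bar>a * s + y\<bar> \<le> a + y" using assms by linarith
    hence "\<bar>a * s + y\<bar> ^ (2 * m) \<le> (a + y) ^ (2 * m)" by (intro power_mono) auto
    thus "\<bar>(- 1) ^ m * (a * s + y) ^ (2 * m) / fact (2 * m)\<bar> \<le> (a + y) ^ (2 * m) / fact (2 * m)"
      by (simp add: abs_mult divide_right_mono power_abs)
  qed (auto intro!: continuous_intros)
  finally show ?thesis .
qed

text \<open>The weights allow the same interchange to be used before (\<open>w = 1\<close>) and after
(\<open>w r = sin_moment \<nu> r\<close>) the average over \<open>t\<close>.\<close>

lemma zeta_power_series_swap:
  fixes w :: "nat \<Rightarrow> real" and \<theta> :: nat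
  assumes \<mu>: "\<mu> \<ge> 0" and a: "a \<ge> 0" and y: "y \<ge> 0" "a + y < 2 * pi" and w: "\<And>r. 0 \<le> w r" "\<And>r. w r \<le> W"
  defines "f \<equiv> \<lambda>m r. zeta_cos_coeff \<theta> m * (w r * (power_coeff \<mu> a m r * y ^ (2 * r) / fact (2 * r)))"
  shows "summable (\<lambda>m. \<bar>f m r\<bar>)" "summable (\<lambda>r. \<Sum>m. \<bar>f m r\<bar>)"
    "(\<lambda>m. zeta_cos_coeff \<theta> m * (\<Sum>r\<le>m. w r * (power_coeff \<mu> a m r * y ^ (2 * r) / fact (2 * r)))) sums (\<Sum>r. \<Sum>m. f m r)"
proof -
  have fin: "\<And>r. r \<notin> {..m} \<Longrightarrow> f m r = 0" for m by (simp add: f_def power_coeff_eq_0)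
  have 1: "summable (\<lambda>r. \<bar>f m r\<bar>)" for m
    by (rule summable_finite[of "{..m}"]) (use fin in auto)
  have W: "0 \<le> W" using w[of 0] by linarith
  have s1: "(\<Sum>r. \<bar>f m r\<bar>) = (\<Sum>r\<le>m. \<bar>f m r\<bar>)" for m
    by (rule suminf_finite) (use fin in auto)
  have b: "(\<Sum>r. \<bar>f m r\<bar>) \<le> (W * poisson_mass \<mu>) * (\<bar>zeta_cos_coeff \<theta> m\<bar> * (a + y) ^ (2 * m) / fact (2 * m))" for m
  proof -
    have "(\<Sum>r\<le>m. \<bar>f m r\<bar>) \<le> (\<Sum>r\<le>m. \<bar>zeta_cos_coeff \<theta> m\<bar> * (W * (\<bar>power_coeff \<mu> a m r\<bar> * y ^ (2 * r) / fact (2 * r))))"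
      unfolding f_def abs_mult
      by (intro sum_mono mult_left_mono mult_mono) (use w y W in \<open>auto simp: abs_mult\<close>)
    also have "\<dots> = \<bar>zeta_cos_coeff \<theta> m\<bar> * (W * (\<Sum>r\<le>m. \<bar>power_coeff \<mu> a m r\<bar> * y ^ (2 * r) / fact (2 * r)))"
      by (simp add: sum_distrib_left)
    also have "\<dots> \<le> \<bar>zeta_cos_coeff \<theta> m\<bar> * (W * (poisson_mass \<mu> * ((a + y) ^ (2 * m) / fact (2 * m))))"
      by (intro mult_left_mono power_coeff_sum_bound) (use \<mu> a y W in auto)
    finally show ?thesis unfolding s1 by (simp add: mult_ac)
  qed
  have 2: "summable (\<lambda>m. \<Sum>r. \<bar>f m r\<bar>)"
  proof (rule summable_comparison_test'[of _ 0])
    show "summable (\<lambda>m. (W * poisson_mass \<mu>) * (\<bar>zeta_cos_coeff \<theta> m\<bar> * (a + y) ^ (2 * m) / fact (2 * m)))"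
      by (rule summable_mult, rule summable_zeta_cos_coeff) (use a y in auto)
  qed (use b in \<open>simp add: s1 sum_nonneg\<close>)
  note * = double_series_swap[OF 1 2]
  show "summable (\<lambda>m. \<bar>f m r\<bar>)" "summable (\<lambda>r. \<Sum>m. \<bar>f m r\<bar>)" by (rule *)+
  have "(\<Sum>r. f m r) = zeta_cos_coeff \<theta> m * (\<Sum>r\<le>m. w r * (power_coeff \<mu> a m r * y ^ (2 * r) / fact (2 * r)))" for m
  proof -
    have "(\<Sum>r. f m r) = (\<Sum>r\<le>m. f m r)" by (rule suminf_finite) (use fin in auto)
    thus ?thesis by (simp add: f_def sum_distrib_left)
  qed
  with *(3) show "(\<lambda>m. zeta_cos_coeff \<theta> m * (\<Sum>r\<le>m. w r * (power_coeff \<mu> a m r * y ^ (2 * r) / fact (2 * r)))) sums (\<Sum>r. \<Sum>m. f m r)"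
    by simp
qed

lemma summable_zeta_part:
  assumes "\<mu> \<ge> 0" "0 \<le> a" "a < 2 * pi"
  shows "summable (\<lambda>m. \<bar>zeta_cos_coeff \<theta> m * power_coeff \<mu> a m r\<bar>)"
proof -
  (* any positive y with a + y < 2 pi would do *)
  define y where "y = (2 * pi - a) / 2"
  have y: "y > 0" "a + y < 2 * pi" using assms(3) by (auto simp: y_def field_simps)
  have "summable (\<lambda>m. (fact (2 * r) / y ^ (2 * r)) * \<bar>zeta_cos_coeff \<theta> m * (1 * (power_coeff \<mu> a m r * y ^ (2 * r) / fact (2 * r)))\<bar>)"
    by (rule summable_mult, rule zeta_power_series_swap(1)[where W = 1]) (use assms y in auto)
  thus ?thesis using y by (simp add: abs_mult)
qed

lemma even_conv_zeta_part:
  assumes "\<mu> \<ge> 0" "0 \<le> a" "a < 2 * pi"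
  shows "even_conv (2 * pi - a) (zeta_part \<mu> a \<theta>)"
  unfolding even_conv_def
proof (intro allI impI)
  fix x assume x: "0 \<le> x" "x < 2 * pi - a"
  show "summable (\<lambda>r. \<bar>zeta_part \<mu> a \<theta> r\<bar> * x ^ (2 * r) / fact (2 * r))"
  proof (rule summable_comparison_test'[of _ 0])
    show "summable (\<lambda>r. \<Sum>m. \<bar>zeta_cos_coeff \<theta> m * (1 * (power_coeff \<mu> a m r * x ^ (2 * r) / fact (2 * r)))\<bar>)"
      by (rule zeta_power_series_swap(2)[where W = 1]) (use assms x in auto)
    fix r
    have "(\<Sum>m. \<bar>zeta_cos_coeff \<theta> m * (1 * (power_coeff \<mu> a m r * x ^ (2 * r) / fact (2 * r)))\<bar>) =
      (\<Sum>m. \<bar>zeta_cos_coeff \<theta> m * power_coeff \<mu> a m r\<bar>) * (x ^ (2 * r) / fact (2 * r))"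
      using x by (subst suminf_mult2[OF summable_zeta_part[OF assms]]) (simp add: abs_mult mult.assoc)
    moreover have "\<bar>zeta_part \<mu> a \<theta> r\<bar> \<le> (\<Sum>m. \<bar>zeta_cos_coeff \<theta> m * power_coeff \<mu> a m r\<bar>)"
      unfolding zeta_part_def by (rule summable_rabs[OF summable_zeta_part[OF assms]])
    moreover have "x ^ (2 * r) / fact (2 * r) \<ge> 0" using x by simp
    ultimately show "norm (\<bar>zeta_part \<mu> a \<theta> r\<bar> * x ^ (2 * r) / fact (2 * r)) \<le>
        (\<Sum>m. \<bar>zeta_cos_coeff \<theta> m * (1 * (power_coeff \<mu> a m r * x ^ (2 * r) / fact (2 * r)))\<bar>)"
      using mult_right_mono[of "\<bar>zeta_part \<mu> a \<theta> r\<bar>" _ "x ^ (2 * r) / fact (2 * r)"] x by simp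
  qed
qed

lemma zeta_part_sums:
  assumes "\<mu> \<ge> 0" "0 \<le> a" "\<bar>y\<bar> < 2 * pi - a" "\<And>r. 0 \<le> w r" "\<And>r. w r \<le> (W::real)"
  shows "(\<lambda>m. zeta_cos_coeff \<theta> m * (\<Sum>r\<le>m. w r * (power_coeff \<mu> a m r * y ^ (2 * r) / fact (2 * r))))
    sums (\<Sum>r. w r * (zeta_part \<mu> a \<theta> r * y ^ (2 * r) / fact (2 * r)))"
proof -
  have a: "a < 2 * pi" using assms by linarith
  have "(\<lambda>m. zeta_cos_coeff \<theta> m * (\<Sum>r\<le>m. w r * (power_coeff \<mu> a m r * \<bar>y\<bar> ^ (2 * r) / fact (2 * r)))) sums
     (\<Sum>r. \<Sum>m. zeta_cos_coeff \<theta> m * (w r * (power_coeff \<mu> a m r * \<bar>y\<bar> ^ (2 * r) / fact (2 * r))))"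
    by (rule zeta_power_series_swap(3)[where W = W]) (use assms in auto)
  moreover have "(\<Sum>m. zeta_cos_coeff \<theta> m * (w r * (power_coeff \<mu> a m r * \<bar>y\<bar> ^ (2 * r) / fact (2 * r)))) =
      w r * (zeta_part \<mu> a \<theta> r * \<bar>y\<bar> ^ (2 * r) / fact (2 * r))" for r
  proof -
    have "(\<Sum>m. zeta_cos_coeff \<theta> m * power_coeff \<mu> a m r * (w r * (\<bar>y\<bar> ^ (2 * r) / fact (2 * r)))) =
        zeta_part \<mu> a \<theta> r * (w r * (\<bar>y\<bar> ^ (2 * r) / fact (2 * r)))"
      unfolding zeta_part_def
      by (rule suminf_mult2[symmetric, OF summable_rabs_cancel[OF summable_zeta_part]]) (use assms a in auto)
    thus ?thesis by (simp add: mult_ac)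
  qed
  ultimately show ?thesis by (simp add: power_even_abs)
qed

lemma zeta_cos_coeff_shift: "zeta_cos_coeff (\<theta> + 2) (Suc m) = zeta_cos_coeff \<theta> m"
  by (auto simp: zeta_cos_coeff_def algebra_simps)

text \<open>Lowering \<open>\<theta>\<close> by \<open>2\<close> has the same effect as moving both \<open>m\<close> and \<open>r\<close> by one place.\<close>

lemma zeta_part_shift:
  assumes "\<mu> \<ge> 0" "0 \<le> a" "a < 2 * pi"
  shows "zeta_part \<mu> a (\<theta> + 2) (Suc r) = - zeta_part \<mu> a \<theta> r"
proof -
  let ?f = "\<lambda>m. zeta_cos_coeff (\<theta> + 2) m * power_coeff \<mu> a m (Suc r)"
  have s: "summable (\<lambda>m. zeta_cos_coeff \<theta> m * power_coeff \<mu> a m r)"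
    by (rule summable_rabs_cancel[OF summable_zeta_part[OF assms]])
  have "zeta_part \<mu> a (\<theta> + 2) (Suc r) = (\<Sum>m. ?f (Suc m)) + ?f 0"
    using suminf_split_head[OF summable_rabs_cancel[OF summable_zeta_part[OF assms, of "\<theta> + 2" "Suc r"]]]
    by (simp add: zeta_part_def)
  also have "(\<Sum>m. ?f (Suc m)) = (\<Sum>m. - (zeta_cos_coeff \<theta> m * power_coeff \<mu> a m r))"
    by (simp only: zeta_cos_coeff_shift power_coeff_shift mult_minus_right)
  also have "\<dots> = - zeta_part \<mu> a \<theta> r" unfolding zeta_part_def by (rule suminf_minus[OF s])
  finally show ?thesis by (simp add: power_coeff_0_Suc)
qed

section \<open>The Schlomilch series for large exponents\<close>

text \<open>One coefficient sequence for the whole right-hand side: in this form the descent in \<open>\<theta>\<close> only uses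
the differentiation rules for \<open>bessel_series\<close>.\<close>

definition schlomilch_coeff :: "real \<Rightarrow> real \<Rightarrow> nat \<Rightarrow> nat \<Rightarrow> real" where
  "schlomilch_coeff \<mu> a \<theta> r = sing_coeff \<mu> a \<theta> r + zeta_part \<mu> a \<theta> r"

lemma even_conv_mono: "even_conv B s \<Longrightarrow> B' \<le> B \<Longrightarrow> even_conv B' s"
  unfolding even_conv_def by auto

lemma even_conv_add: "even_conv B s \<Longrightarrow> even_conv B t \<Longrightarrow> even_conv B (\<lambda>r. s r + t r)"
  unfolding even_conv_def
proof (intro allI impI)
  fix x assume h: "\<forall>x. 0 \<le> x \<longrightarrow> x < B \<longrightarrow> summable (\<lambda>r. \<bar>s r\<bar> * x ^ (2 * r) / fact (2 * r))"
    "\<forall>x. 0 \<le> x \<longrightarrow> x < B \<longrightarrow> summable (\<lambda>r. \<bar>t r\<bar> * x ^ (2 * r) / fact (2 * r))" and x: "0 \<le> x" "x < B"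
  have "summable (\<lambda>r. \<bar>s r\<bar> * x ^ (2 * r) / fact (2 * r) + \<bar>t r\<bar> * x ^ (2 * r) / fact (2 * r))"
    by (intro summable_add) (use h x in auto)
  thus "summable (\<lambda>r. \<bar>s r + t r\<bar> * x ^ (2 * r) / fact (2 * r))"
  proof (rule summable_comparison_test'[of _ 0])
    fix r
    have "\<bar>s r + t r\<bar> * (x ^ (2 * r) / fact (2 * r)) \<le> (\<bar>s r\<bar> + \<bar>t r\<bar>) * (x ^ (2 * r) / fact (2 * r))"
      by (intro mult_right_mono) (use x in auto)
    thus "norm (\<bar>s r + t r\<bar> * x ^ (2 * r) / fact (2 * r)) \<le> \<bar>s r\<bar> * x ^ (2 * r) / fact (2 * r) + \<bar>t r\<bar> * x ^ (2 * r) / fact (2 * r)"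
      using x by (simp add: distrib_right add_divide_distrib)
  qed
qed

lemma even_conv_schlomilch_coeff:
  assumes "\<mu> \<ge> 0" "0 < a" "a < 2 * pi"
  shows "even_conv (min a (2 * pi - a)) (schlomilch_coeff \<mu> a \<theta>)"
  unfolding schlomilch_coeff_def
  by (intro even_conv_add even_conv_mono[OF even_conv_sing_coeff] even_conv_mono[OF even_conv_zeta_part]) (use assms in auto)

lemma schlomilch_coeff_shift:
  assumes "\<mu> \<ge> 0" "0 < a" "a < 2 * pi"
  shows "schlomilch_coeff \<mu> a (\<theta> + 2) (Suc r) = - schlomilch_coeff \<mu> a \<theta> r"
  using assms unfolding schlomilch_coeff_def sing_coeff_shift by (simp only: zeta_part_shift less_imp_le minus_add_distrib)

text \<open>The expansion on the imaginary axis, extended to \<open>x = 0\<close>, where it is a zeta value, and to negative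
\<open>x\<close> by evenness.\<close>

lemma cos_series_kernel:
  assumes \<theta>: "\<theta> \<ge> 2" and x: "\<bar>x\<bar> < 2 * pi"
  shows "(\<Sum>n. cos (real (Suc n) * x) / real (Suc n) ^ \<theta>) =
    sing_kernel \<theta> x + (\<Sum>m. zeta_cos_coeff \<theta> m * ((- 1) ^ m * x ^ (2 * m) / fact (2 * m)))"
proof -
  let ?P = "\<lambda>x. (\<Sum>n. cos (real (Suc n) * x) / real (Suc n) ^ \<theta>) =
    sing_kernel \<theta> x + (\<Sum>m. zeta_cos_coeff \<theta> m * ((- 1) ^ m * x ^ (2 * m) / fact (2 * m)))"
  have pos: "?P x" if "0 < x" "x < 2 * pi" for x
  proof -
    have "\<bar>x\<bar> * x ^ (\<theta> - 2) = x ^ (\<theta> - 1)"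
      using that \<theta> by (simp flip: power_Suc add: Suc_diff_Suc numeral_2_eq_2)
    thus ?thesis using cos_series_expansion[OF \<theta> that] that(1) by (simp add: sing_kernel_def mult.assoc)
  qed
  have zero: "?P 0"
  proof -
    have "(\<Sum>m. zeta_cos_coeff \<theta> m * ((- 1) ^ m * 0 ^ (2 * m) / fact (2 * m))) =
        (\<Sum>m\<in>{0}. zeta_cos_coeff \<theta> m * ((- 1) ^ m * 0 ^ (2 * m) / fact (2 * m)))"
      by (rule suminf_finite) auto
    moreover have "sing_kernel \<theta> 0 = 0" using \<theta> by (simp add: sing_kernel_def)
    moreover have "(\<Sum>n. 1 / real (Suc n) ^ \<theta>) = zeta_real (real \<theta>)"
      by (rule sums_unique[symmetric, OF zeta_real_nat_sums(1)[OF \<theta>]])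
    ultimately show ?thesis using \<theta> by (simp add: zeta_cos_coeff_def)
  qed
  have even: "sing_kernel \<theta> (- x) = sing_kernel \<theta> x"
    using \<theta> by (auto simp: sing_kernel_def elim!: evenE oddE)
  have ev2: "(- x) ^ (2 * m) = x ^ (2 * m)" for m by simp
  consider "x > 0" | "x = 0" | "- x > 0" by linarith
  thus ?thesis
  proof cases
    case 3
    have "?P (- x)" by (rule pos) (use 3 x in auto)
    thus ?thesis unfolding even ev2 by simp
  qed (use pos zero x in auto)
qed

text \<open>The average over \<open>s\<close>. On the left, the sine part of the addition theorem is odd in \<open>s\<close> and disappears.\<close>

lemma bessel_cos_series:
  assumes \<mu>: "\<mu> \<ge> 0" and a: "0 < a" and y: "\<bar>y\<bar> < min a (2 * pi - a)" and \<theta>: "\<theta> \<ge> 4"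
  shows "(\<lambda>n. bessel_even \<mu> (real (Suc n) * a) * cos (real (Suc n) * y) / real (Suc n) ^ \<theta>) sums
     even_series (schlomilch_coeff \<mu> a \<theta>) y"
proof -
  have a2: "a < 2 * pi" and y1: "\<bar>y\<bar> < a" "\<bar>y\<bar> < 2 * pi - a" using y by linarith+
  have rng: "\<bar>a * s + y\<bar> < 2 * pi" "\<bar>a * s + y\<bar> \<le> a + \<bar>y\<bar>" if "s \<in> {-1..1}" for s
  proof -
    have "\<bar>a * s\<bar> \<le> a * 1" unfolding abs_mult using that a by (intro mult_mono) auto
    thus "\<bar>a * s + y\<bar> < 2 * pi" "\<bar>a * s + y\<bar> \<le> a + \<bar>y\<bar>" using y1 by linarith+
  qed
  let ?f = "\<lambda>n s. cos (real (Suc n) * (a * s + y)) / real (Suc n) ^ \<theta>"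
  have "(\<lambda>n. poisson_avg \<mu> (?f n)) sums poisson_avg \<mu> (\<lambda>s. \<Sum>n. ?f n s)"
  proof (rule poisson_avg_sums(1)[OF \<mu>])
    show "summable (\<lambda>n. 1 / real (Suc n) ^ \<theta>)"
      using zeta_real_nat_sums[of \<theta>] \<theta> by (simp add: sums_iff)
    show "\<bar>?f n s\<bar> \<le> 1 / real (Suc n) ^ \<theta>" for n s
      by (simp add: abs_divide divide_right_mono del: of_nat_Suc)
  qed (intro continuous_intros, simp_all)
  moreover have "poisson_avg \<mu> (?f n) = bessel_even \<mu> (real (Suc n) * a) * cos (real (Suc n) * y) / real (Suc n) ^ \<theta>" for n
  proof -
    let ?c = "1 / real (Suc n) ^ \<theta>" and ?k = "real (Suc n)"
    have "poisson_avg \<mu> (?f n) = poisson_avg \<mu> (\<lambda>s. (?c * cos (?k * y)) * cos (?k * a * s) - (?c * sin (?k * y)) * sin (?k * a * s))"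
      by (rule poisson_avg_cong) (simp add: distrib_left cos_add diff_divide_distrib mult_ac del: of_nat_Suc)
    also have "\<dots> = poisson_avg \<mu> (\<lambda>s. (?c * cos (?k * y)) * cos (?k * a * s)) - poisson_avg \<mu> (\<lambda>s. (?c * sin (?k * y)) * sin (?k * a * s))"
      by (rule poisson_avg_diff[OF \<mu>]) (intro continuous_intros)+
    also have "poisson_avg \<mu> (\<lambda>s. (?c * sin (?k * y)) * sin (?k * a * s)) = 0"
      by (rule poisson_avg_odd) simp
    also have "poisson_avg \<mu> (\<lambda>s. (?c * cos (?k * y)) * cos (?k * a * s)) = (?c * cos (?k * y)) * bessel_even \<mu> (?k * a)"
      by (simp only: poisson_avg_cmult poisson_avg_cos[OF \<mu>])
    finally show ?thesis by simp
  qed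
  moreover have "poisson_avg \<mu> (\<lambda>s. \<Sum>n. ?f n s) = even_series (schlomilch_coeff \<mu> a \<theta>) y"
  proof -
    let ?g = "\<lambda>m s. zeta_cos_coeff \<theta> m * ((- 1) ^ m * (a * s + y) ^ (2 * m) / fact (2 * m))"
    have g: "\<bar>?g m s\<bar> \<le> \<bar>zeta_cos_coeff \<theta> m\<bar> * (a + \<bar>y\<bar>) ^ (2 * m) / fact (2 * m)" if "s \<in> {-1..1}" for m s
    proof -
      have "\<bar>a * s + y\<bar> ^ (2 * m) \<le> (a + \<bar>y\<bar>) ^ (2 * m)" by (intro power_mono rng(2)[OF that]) auto
      hence "\<bar>zeta_cos_coeff \<theta> m\<bar> * (\<bar>a * s + y\<bar> ^ (2 * m) / fact (2 * m)) \<le> \<bar>zeta_cos_coeff \<theta> m\<bar> * ((a + \<bar>y\<bar>) ^ (2 * m) / fact (2 * m))"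
        by (intro mult_left_mono divide_right_mono) auto
      thus ?thesis by (simp add: abs_mult power_abs)
    qed
    have sm: "summable (\<lambda>m. \<bar>zeta_cos_coeff \<theta> m\<bar> * (a + \<bar>y\<bar>) ^ (2 * m) / fact (2 * m))"
      by (rule summable_zeta_cos_coeff) (use a y1 in auto)
    have cg: "continuous_on {-1..1} (?g m)" for m by (intro continuous_intros) auto
    note ps = poisson_avg_sums[OF \<mu>, of ?g, OF cg g sm]
    have "poisson_avg \<mu> (\<lambda>s. \<Sum>n. ?f n s) = poisson_avg \<mu> (\<lambda>s. sing_kernel \<theta> (a * s + y) + (\<Sum>m. ?g m s))"
      by (rule poisson_avg_cong, rule cos_series_kernel) (use \<theta> rng(1) in auto)
    also have "\<dots> = poisson_avg \<mu> (\<lambda>s. sing_kernel \<theta> (a * s + y)) + poisson_avg \<mu> (\<lambda>s. \<Sum>m. ?g m s)"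
    proof (rule poisson_avg_add[OF \<mu>])
      show "continuous_on {-1..1} (\<lambda>s. sing_kernel \<theta> (a * s + y))"
        by (rule continuous_on_compose2[OF continuous_on_sing_kernel[of \<theta> UNIV]]) (use \<theta> in \<open>auto intro!: continuous_intros\<close>)
      show "continuous_on {-1..1} (\<lambda>s. \<Sum>m. ?g m s)" by (rule ps(2))
    qed
    also have "poisson_avg \<mu> (\<lambda>s. \<Sum>m. ?g m s) = even_series (zeta_part \<mu> a \<theta>) y"
    proof -
      have "poisson_avg \<mu> (?g m) = zeta_cos_coeff \<theta> m * (\<Sum>r\<le>m. 1 * (power_coeff \<mu> a m r * y ^ (2 * r) / fact (2 * r)))" for m
        unfolding poisson_avg_cmult poisson_avg_even_power_translate[OF \<mu>] by simp
      hence "(\<lambda>m. zeta_cos_coeff \<theta> m * (\<Sum>r\<le>m. 1 * (power_coeff \<mu> a m r * y ^ (2 * r) / fact (2 * r)))) sums poisson_avg \<mu> (\<lambda>s. \<Sum>m. ?g m s)"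
        using ps(1) by simp
      moreover have "(\<lambda>m. zeta_cos_coeff \<theta> m * (\<Sum>r\<le>m. 1 * (power_coeff \<mu> a m r * y ^ (2 * r) / fact (2 * r)))) sums
          (\<Sum>r. 1 * (zeta_part \<mu> a \<theta> r * y ^ (2 * r) / fact (2 * r)))"
        by (rule zeta_part_sums[where W = 1]) (use \<mu> a y1 in auto)
      ultimately show ?thesis unfolding even_series_def by (metis (no_types, lifting) mult_1 sums_unique2 suminf_cong)
    qed
    also have "poisson_avg \<mu> (\<lambda>s. sing_kernel \<theta> (a * s + y)) = even_series (sing_coeff \<mu> a \<theta>) y"
      by (rule poisson_avg_sing_kernel[OF \<mu> a y1(1) \<theta>])
    also have "even_series (sing_coeff \<mu> a \<theta>) y + even_series (zeta_part \<mu> a \<theta>) y = even_series (schlomilch_coeff \<mu> a \<theta>) y"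
    proof -
      have "(\<lambda>r. sing_coeff \<mu> a \<theta> r * y ^ (2 * r) / fact (2 * r) + zeta_part \<mu> a \<theta> r * y ^ (2 * r) / fact (2 * r)) sums
          (even_series (sing_coeff \<mu> a \<theta>) y + even_series (zeta_part \<mu> a \<theta>) y)"
        by (intro sums_add even_series_sums[OF even_conv_sing_coeff] even_series_sums[OF even_conv_zeta_part]) (use \<mu> a a2 y1 in auto)
      hence "(\<lambda>r. schlomilch_coeff \<mu> a \<theta> r * y ^ (2 * r) / fact (2 * r)) sums
          (even_series (sing_coeff \<mu> a \<theta>) y + even_series (zeta_part \<mu> a \<theta>) y)"
        by (simp add: schlomilch_coeff_def distrib_right add_divide_distrib)
      thus ?thesis unfolding even_series_def by (rule sums_unique)
    qed
    finally show ?thesis .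
  qed
  ultimately show ?thesis by simp
qed

abbreviation schlomilch_term :: "real \<Rightarrow> real \<Rightarrow> nat \<Rightarrow> real \<Rightarrow> real \<Rightarrow> nat \<Rightarrow> real" where
  "schlomilch_term \<mu> \<nu> \<theta> a b n \<equiv> bessel_even \<mu> (real (Suc n) * a) * bessel_even \<nu> (real (Suc n) * b) / real (Suc n) ^ \<theta>"

lemma bessel_even_bounded: 
  assumes "\<nu> \<ge> 0" shows "\<bar>bessel_even \<nu> x\<bar> \<le> poisson_mass \<nu>"
  using poisson_avg_bound[OF assms, of "\<lambda>t. cos (x * t)" 1] 
  by (simp add: poisson_avg_cos[OF assms] continuous_intros)

text \<open>The average over \<open>t\<close> of the previous result.\<close>

lemma schlomilch_sum_base:
  assumes \<mu>: "\<mu> \<ge> 0" and \<nu>: "\<nu> \<ge> 0" and a: "0 < a" and b: "\<bar>b\<bar> < min a (2 * pi - a)" and \<theta>: "\<theta> \<ge> 4"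
  shows "schlomilch_term \<mu> \<nu> \<theta> a b sums bessel_series \<nu> (schlomilch_coeff \<mu> a \<theta>) b"
proof -
  let ?f = "\<lambda>n t. bessel_even \<mu> (real (Suc n) * a) * cos (real (Suc n) * (b * t)) / real (Suc n) ^ \<theta>"
  have "(\<lambda>n. poisson_avg \<nu> (?f n)) sums poisson_avg \<nu> (\<lambda>t. \<Sum>n. ?f n t)"
  proof (rule poisson_avg_sums(1)[OF \<nu>])
    show "summable (\<lambda>n. poisson_mass \<mu> * (1 / real (Suc n) ^ \<theta>))"
      by (rule summable_mult) (use zeta_real_nat_sums[of \<theta>] \<theta> in \<open>simp add: sums_iff\<close>)
    show "\<bar>?f n t\<bar> \<le> poisson_mass \<mu> * (1 / real (Suc n) ^ \<theta>)" for n t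
    proof -
      have "\<bar>bessel_even \<mu> (real (Suc n) * a)\<bar> * \<bar>cos (real (Suc n) * (b * t))\<bar> \<le> poisson_mass \<mu> * 1"
        by (intro mult_mono bessel_even_bounded \<mu>) (auto simp: poisson_mass_pos[OF \<mu>] less_imp_le)
      thus ?thesis by (simp add: abs_mult abs_divide divide_right_mono del: of_nat_Suc)
    qed
  qed (intro continuous_intros, simp_all)
  moreover have "poisson_avg \<nu> (?f n) = schlomilch_term \<mu> \<nu> \<theta> a b n" for n
  proof -
    have "poisson_avg \<nu> (?f n) = poisson_avg \<nu> (\<lambda>t. bessel_even \<mu> (real (Suc n) * a) / real (Suc n) ^ \<theta> * cos ((real (Suc n) * b) * t))"
      by (rule poisson_avg_cong) (simp add: mult_ac)
    also have "\<dots> = schlomilch_term \<mu> \<nu> \<theta> a b n"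
      unfolding poisson_avg_cmult poisson_avg_cos[OF \<nu>] by simp
    finally show ?thesis .
  qed
  moreover have "poisson_avg \<nu> (\<lambda>t. \<Sum>n. ?f n t) = bessel_series \<nu> (schlomilch_coeff \<mu> a \<theta>) b"
  proof -
    have "poisson_avg \<nu> (\<lambda>t. \<Sum>n. ?f n t) = poisson_avg \<nu> (\<lambda>t. even_series (schlomilch_coeff \<mu> a \<theta>) (b * t))"
    proof (rule poisson_avg_cong, rule sums_unique[symmetric], rule bessel_cos_series[OF \<mu> a _ \<theta>])
      fix t :: real assume "t \<in> {-1..1}"
      hence "\<bar>b * t\<bar> \<le> \<bar>b\<bar> * 1" unfolding abs_mult by (intro mult_left_mono) auto
      thus "\<bar>b * t\<bar> < min a (2 * pi - a)" using b by linarith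
    qed
    also have "\<dots> = bessel_series \<nu> (schlomilch_coeff \<mu> a \<theta>) b"
      by (rule poisson_avg_even_series[OF \<nu> even_conv_schlomilch_coeff b]) (use \<mu> a b in linarith)+
    finally show ?thesis .
  qed
  ultimately show ?thesis by simp
qed

section \<open>Descent to small exponents\<close>

lemma summable_powr_Suc: "p < - 1 \<Longrightarrow> summable (\<lambda>n. real (Suc n) powr p)"
  using summable_real_powr_iff[of p] by (subst summable_Suc_iff) (simp add: powr_minus)

text \<open>The exponent is \<open>- 1 - \<alpha>\<close>, which is where the hypothesis \<open>\<alpha> > 0\<close> enters.\<close>

lemma schlomilch_term_bound:
  assumes "\<mu> \<ge> - 1/2" "\<nu> \<ge> - 1/2" "0 < a" "0 < c"
  obtains K where "K > 0" "\<And>n b. c \<le> b \<Longrightarrow> \<bar>schlomilch_term \<mu> \<nu> \<theta> a b n\<bar> \<le> K * real (Suc n) powr (- 1 - (\<mu> + \<nu> + real \<theta>))"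
proof -
  obtain C where C: "C > 0" "\<And>x. x > 0 \<Longrightarrow> \<bar>bessel_even \<mu> x\<bar> \<le> C * x powr (- \<mu> - 1/2)"
    using bessel_even_bound[OF assms(1)] by blast
  obtain D where D: "D > 0" "\<And>x. x > 0 \<Longrightarrow> \<bar>bessel_even \<nu> x\<bar> \<le> D * x powr (- \<nu> - 1/2)"
    using bessel_even_bound[OF assms(2)] by blast
  show thesis
  proof (rule that[of "(C * a powr (- \<mu> - 1/2)) * (D * c powr (- \<nu> - 1/2))"])
    show "0 < (C * a powr (- \<mu> - 1/2)) * (D * c powr (- \<nu> - 1/2))" using C(1) D(1) assms by simp
  next
    fix n and b :: real assume b: "c \<le> b"
    let ?k = "real (Suc n)"
    have k: "?k > 0" by simp
    have "\<bar>bessel_even \<mu> (?k * a)\<bar> \<le> C * (?k powr (- \<mu> - 1/2) * a powr (- \<mu> - 1/2))"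
      using C(2)[of "?k * a"] assms(3) k by (simp add: powr_mult del: of_nat_Suc)
    moreover have "\<bar>bessel_even \<nu> (?k * b)\<bar> \<le> D * (?k powr (- \<nu> - 1/2) * c powr (- \<nu> - 1/2))"
    proof -
      have "\<bar>bessel_even \<nu> (?k * b)\<bar> \<le> D * (?k * b) powr (- \<nu> - 1/2)"
        using D(2)[of "?k * b"] assms(4) b k by (simp del: of_nat_Suc)
      also have "\<dots> \<le> D * (?k * c) powr (- \<nu> - 1/2)"
        using D(1) assms b k by (intro mult_left_mono powr_mono2') (auto intro!: mult_left_mono simp del: of_nat_Suc)
      finally show ?thesis using assms(4) k by (simp add: powr_mult del: of_nat_Suc)
    qed
    ultimately have "\<bar>bessel_even \<mu> (?k * a)\<bar> * \<bar>bessel_even \<nu> (?k * b)\<bar> \<le>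
        (C * (?k powr (- \<mu> - 1/2) * a powr (- \<mu> - 1/2))) * (D * (?k powr (- \<nu> - 1/2) * c powr (- \<nu> - 1/2)))"
      using C(1) by (intro mult_mono) auto
    hence "\<bar>bessel_even \<mu> (?k * a)\<bar> * \<bar>bessel_even \<nu> (?k * b)\<bar> * ?k powr (- real \<theta>) \<le>
        (C * (?k powr (- \<mu> - 1/2) * a powr (- \<mu> - 1/2))) * (D * (?k powr (- \<nu> - 1/2) * c powr (- \<nu> - 1/2))) * ?k powr (- real \<theta>)"
      by (rule mult_right_mono) simp
    moreover have "?k powr (- 1 - (\<mu> + \<nu> + real \<theta>)) = ?k powr (- \<mu> - 1/2) * ?k powr (- \<nu> - 1/2) * ?k powr (- real \<theta>)"
    proof -
      have "- 1 - (\<mu> + \<nu> + real \<theta>) = (- \<mu> - 1/2) + (- \<nu> - 1/2) + - real \<theta>" by simp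
      thus ?thesis by (simp only: powr_add)
    qed
    moreover have "\<bar>schlomilch_term \<mu> \<nu> \<theta> a b n\<bar> = \<bar>bessel_even \<mu> (?k * a)\<bar> * \<bar>bessel_even \<nu> (?k * b)\<bar> * ?k powr (- real \<theta>)"
      using k by (simp add: abs_mult powr_minus powr_realpow divide_inverse del: of_nat_Suc)
    ultimately show "\<bar>schlomilch_term \<mu> \<nu> \<theta> a b n\<bar> \<le> (C * a powr (- \<mu> - 1/2)) * (D * c powr (- \<nu> - 1/2)) * ?k powr (- 1 - (\<mu> + \<nu> + real \<theta>))"
      by (simp only: mult_ac)
  qed
qed

lemma termwise_derivative:
  fixes f f' :: "nat \<Rightarrow> real \<Rightarrow> real"
  assumes b: "0 < b" "b < B"
    and D: "\<And>n x. 0 < x \<Longrightarrow> x < B \<Longrightarrow> (f n has_real_derivative f' n x) (at x)"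
    and M: "\<And>c d. 0 < c \<Longrightarrow> d < B \<Longrightarrow> \<exists>M. summable M \<and> (\<forall>n. \<forall>x\<in>{c..d}. \<bar>f' n x\<bar> \<le> M n)"
    and g: "\<And>x. 0 < x \<Longrightarrow> x < B \<Longrightarrow> (\<lambda>n. f n x) sums g x"
    and g': "(g has_real_derivative g') (at b)"
  shows "(\<lambda>n. f' n b) sums g'"
proof -
  (* a compact interval around b inside (0, B), on which the derivatives are summable uniformly *)
  define c d where "c = b / 2" and "d = (b + B) / 2"
  have cd: "0 < c" "c < b" "b < d" "d < B" using b by (auto simp: c_def d_def)
  obtain M where M: "summable M" "\<And>n x. x \<in> {c..d} \<Longrightarrow> \<bar>f' n x\<bar> \<le> M n"
    using M[OF cd(1,4)] by blast
  have "uniformly_convergent_on {c..d} (\<lambda>n x. \<Sum>i<n. f' i x)"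
    by (rule Weierstrass_m_test'[OF _ M(1)]) (use M(2) in simp)
  moreover have "(f n has_field_derivative f' n x) (at x within {c..d})" if "x \<in> {c..d}" for n x
    by (rule has_field_derivative_at_within[OF D]) (use that cd in auto)
  moreover have "summable (\<lambda>n. f n b)" using g[OF b] by (rule sums_summable)
  ultimately have "((\<lambda>x. \<Sum>n. f n x) has_field_derivative (\<Sum>n. f' n b)) (at b)"
    using cd by (intro has_field_derivative_series'(2)[of "{c..d}" f f' b]) auto
  hence "(g has_real_derivative (\<Sum>n. f' n b)) (at b)"
    by (rule has_field_derivative_transform_within_open[of _ _ _ "{0<..<B}"]) (use b g in \<open>auto simp: sums_iff\<close>)
  hence "(\<Sum>n. f' n b) = g'" using g' by (rule DERIV_unique)
  moreover have "summable (\<lambda>n. f' n b)"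
    by (rule summable_comparison_test'[OF M(1), of 0]) (use M(2)[of b] cd in auto)
  ultimately show ?thesis by (simp add: sums_iff)
qed

text \<open>Differentiation with respect to \<open>b\<close> passes from \<open>(\<nu>, \<theta> + 2)\<close> to \<open>(\<nu> + 1, \<theta>)\<close>, at the cost of one power of \<open>n\<close>
in the convergence; \<open>\<theta> + 2\<close> leaves room for two such steps.\<close>

lemma schlomilch_sum_descent_order:
  assumes \<mu>: "\<mu> \<ge> 0" and \<nu>: "\<nu> \<ge> 0" and a: "0 < a" "a < 2 * pi" and b: "0 < b" "b < min a (2 * pi - a)"
    and IH: "\<And>b. 0 < b \<Longrightarrow> b < min a (2 * pi - a) \<Longrightarrow> schlomilch_term \<mu> \<nu> (\<theta> + 2) a b sums bessel_series \<nu> (schlomilch_coeff \<mu> a (\<theta> + 2)) b"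
  shows "schlomilch_term \<mu> (\<nu> + 1) \<theta> a b sums bessel_series (\<nu> + 1) (schlomilch_coeff \<mu> a \<theta>) b"
proof -
  note ec = even_conv_schlomilch_coeff[OF \<mu> a]
  have "(\<lambda>n. - (b / 2) * schlomilch_term \<mu> (\<nu> + 1) \<theta> a b n) sums ((b / 2) * bessel_series (\<nu> + 1) (\<lambda>r. schlomilch_coeff \<mu> a (\<theta> + 2) (Suc r)) b)"
  proof (rule termwise_derivative[OF b _ _ IH DERIV_bessel_series[OF ec]])
    fix n and x :: real
    let ?k = "real (Suc n)"
    have "((\<lambda>x. bessel_even \<nu> (?k * x)) has_real_derivative - ((?k * x) / 2) * bessel_even (\<nu> + 1) (?k * x) * ?k) (at x)"
      by (rule DERIV_chain2[OF DERIV_bessel_even]) (use \<nu> in \<open>auto intro!: derivative_eq_intros simp del: of_nat_Suc\<close>)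
    from DERIV_cmult[OF this, of "bessel_even \<mu> (?k * a) / ?k ^ (\<theta> + 2)"]
    show "((\<lambda>x. schlomilch_term \<mu> \<nu> (\<theta> + 2) a x n) has_real_derivative - (x / 2) * schlomilch_term \<mu> (\<nu> + 1) \<theta> a x n) (at x)"
      by (simp add: power_add power2_eq_square mult_ac del: of_nat_Suc)
  next
    fix c d :: real assume c: "0 < c" "d < min a (2 * pi - a)"
    obtain K where K: "K > 0" "\<And>n b. c \<le> b \<Longrightarrow> \<bar>schlomilch_term \<mu> (\<nu> + 1) \<theta> a b n\<bar> \<le> K * real (Suc n) powr (- 1 - (\<mu> + (\<nu> + 1) + real \<theta>))"
      using schlomilch_term_bound[of \<mu> "\<nu> + 1" a c \<theta>] \<mu> \<nu> a c by auto
    show "\<exists>M. summable M \<and> (\<forall>n. \<forall>x\<in>{c..d}. \<bar>- (x / 2) * schlomilch_term \<mu> (\<nu> + 1) \<theta> a x n\<bar> \<le> M n)"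
    proof (intro exI conjI allI ballI)
      show "summable (\<lambda>n. \<bar>d\<bar> / 2 * (K * real (Suc n) powr (- 1 - (\<mu> + (\<nu> + 1) + real \<theta>))))"
        by (intro summable_mult summable_powr_Suc) (use \<mu> \<nu> in simp)
      fix n x assume x: "x \<in> {c..d}"
      have "\<bar>x / 2\<bar> * \<bar>schlomilch_term \<mu> (\<nu> + 1) \<theta> a x n\<bar> \<le> \<bar>d\<bar> / 2 * (K * real (Suc n) powr (- 1 - (\<mu> + (\<nu> + 1) + real \<theta>)))"
        using x c K by (intro mult_mono) auto
      thus "\<bar>- (x / 2) * schlomilch_term \<mu> (\<nu> + 1) \<theta> a x n\<bar> \<le> \<bar>d\<bar> / 2 * (K * real (Suc n) powr (- 1 - (\<mu> + (\<nu> + 1) + real \<theta>)))"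
        by (simp only: abs_mult abs_minus_cancel)
    qed
  qed (use b \<nu> in auto)
  moreover have "bessel_series (\<nu> + 1) (\<lambda>r. schlomilch_coeff \<mu> a (\<theta> + 2) (Suc r)) b = - bessel_series (\<nu> + 1) (schlomilch_coeff \<mu> a \<theta>) b"
    unfolding schlomilch_coeff_shift[OF \<mu> a] by (rule bessel_series_minus[OF ec]) (use b \<nu> in auto)
  ultimately have "(\<lambda>n. - (b / 2) * schlomilch_term \<mu> (\<nu> + 1) \<theta> a b n) sums (- (b / 2) * bessel_series (\<nu> + 1) (schlomilch_coeff \<mu> a \<theta>) b)"
    by simp
  moreover have "- (b / 2) \<noteq> 0" using b by simp
  ultimately show ?thesis using sums_mult_iff by blast
qed

text \<open>After multiplication by \<open>b^(2 \<nu> + 2)\<close> a second differentiation passes from \<open>(\<nu> + 1, \<theta>)\<close> to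
\<open>(\<nu>, \<theta>)\<close>.\<close>

lemma schlomilch_sum_descent:
  assumes \<mu>: "\<mu> \<ge> 0" and \<nu>: "\<nu> \<ge> 0" and a: "0 < a" "a < 2 * pi" and b: "0 < b" "b < min a (2 * pi - a)"
    and pos: "\<mu> + \<nu> + real \<theta> > 0"
    and IH: "\<And>b. 0 < b \<Longrightarrow> b < min a (2 * pi - a) \<Longrightarrow> schlomilch_term \<mu> \<nu> (\<theta> + 2) a b sums bessel_series \<nu> (schlomilch_coeff \<mu> a (\<theta> + 2)) b"
  shows "schlomilch_term \<mu> \<nu> \<theta> a b sums bessel_series \<nu> (schlomilch_coeff \<mu> a \<theta>) b"
proof -
  note ec = even_conv_schlomilch_coeff[OF \<mu> a]
  have "(\<lambda>n. 2 * b powr (2 * \<nu> + 1) * schlomilch_term \<mu> \<nu> \<theta> a b n) sums (2 * b powr (2 * \<nu> + 1) * bessel_series \<nu> (schlomilch_coeff \<mu> a \<theta>) b)"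
  proof (rule termwise_derivative[OF b _ _ _ DERIV_powr_bessel_series[OF ec]])
    fix n and x :: real assume x: "0 < x"
    let ?k = "real (Suc n)"
    have k: "?k > 0" by simp
    have "even_conv (?k * x + 1) (\<lambda>r. (-1) ^ r)" by (rule even_conv_alt)
    hence "((\<lambda>z. z powr (2 * \<nu> + 2) * bessel_even (\<nu> + 1) z) has_real_derivative
            2 * (?k * x) powr (2 * \<nu> + 1) * bessel_even \<nu> (?k * x)) (at (?k * x))"
      by (rule DERIV_powr_bessel_series) (use x k \<nu> in \<open>auto simp del: of_nat_Suc\<close>)
    moreover have "((*) ?k has_real_derivative ?k) (at x)"
      by (auto intro!: derivative_eq_intros simp del: of_nat_Suc)
    ultimately have "((\<lambda>x. (?k * x) powr (2 * \<nu> + 2) * bessel_even (\<nu> + 1) (?k * x)) has_real_derivative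
            2 * (?k * x) powr (2 * \<nu> + 1) * bessel_even \<nu> (?k * x) * ?k) (at x)"
      by (rule DERIV_chain2)
    from DERIV_cmult[OF this, of "bessel_even \<mu> (?k * a) / ?k ^ \<theta> / ?k powr (2 * \<nu> + 2)"]
    have "((\<lambda>x. bessel_even \<mu> (?k * a) / ?k ^ \<theta> / ?k powr (2 * \<nu> + 2) * ((?k * x) powr (2 * \<nu> + 2) * bessel_even (\<nu> + 1) (?k * x))) has_real_derivative
       bessel_even \<mu> (?k * a) / ?k ^ \<theta> / ?k powr (2 * \<nu> + 2) * (2 * (?k * x) powr (2 * \<nu> + 1) * bessel_even \<nu> (?k * x) * ?k)) (at x)" .
    moreover have "?k powr (2 * \<nu> + 2) = ?k powr (2 * \<nu> + 1) * ?k"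
      using k powr_add[of ?k "2 * \<nu> + 1" 1] by (simp add: add.assoc del: of_nat_Suc)
    hence "bessel_even \<mu> (?k * a) / ?k ^ \<theta> / ?k powr (2 * \<nu> + 2) * (2 * (?k * x) powr (2 * \<nu> + 1) * bessel_even \<nu> (?k * x) * ?k)
        = 2 * x powr (2 * \<nu> + 1) * schlomilch_term \<mu> \<nu> \<theta> a x n"
      using k x by (simp add: powr_mult mult_ac del: of_nat_Suc)
    ultimately have "((\<lambda>x. bessel_even \<mu> (?k * a) / ?k ^ \<theta> / ?k powr (2 * \<nu> + 2) * ((?k * x) powr (2 * \<nu> + 2) * bessel_even (\<nu> + 1) (?k * x))) has_real_derivative
       2 * x powr (2 * \<nu> + 1) * schlomilch_term \<mu> \<nu> \<theta> a x n) (at x)" by (simp only:)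
    thus "((\<lambda>x. x powr (2 * \<nu> + 2) * schlomilch_term \<mu> (\<nu> + 1) \<theta> a x n) has_real_derivative
       2 * x powr (2 * \<nu> + 1) * schlomilch_term \<mu> \<nu> \<theta> a x n) (at x)"
      by (rule has_field_derivative_transform_within_open[of _ _ _ "{0<..}"])
        (use k x in \<open>auto simp: powr_mult mult_ac simp del: of_nat_Suc\<close>)
  next
    fix c d :: real assume c: "0 < c" "d < min a (2 * pi - a)"
    obtain K where K: "K > 0" "\<And>n b. c \<le> b \<Longrightarrow> \<bar>schlomilch_term \<mu> \<nu> \<theta> a b n\<bar> \<le> K * real (Suc n) powr (- 1 - (\<mu> + \<nu> + real \<theta>))"
      using schlomilch_term_bound[of \<mu> \<nu> a c \<theta>] \<mu> \<nu> a c by auto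
    show "\<exists>M. summable M \<and> (\<forall>n. \<forall>x\<in>{c..d}. \<bar>2 * x powr (2 * \<nu> + 1) * schlomilch_term \<mu> \<nu> \<theta> a x n\<bar> \<le> M n)"
    proof (intro exI conjI allI ballI)
      show "summable (\<lambda>n. 2 * d powr (2 * \<nu> + 1) * (K * real (Suc n) powr (- 1 - (\<mu> + \<nu> + real \<theta>))))"
        by (intro summable_mult summable_powr_Suc) (use pos in simp)
      fix n x assume x: "x \<in> {c..d}"
      have "x powr (2 * \<nu> + 1) \<le> d powr (2 * \<nu> + 1)" using x c \<nu> by (intro powr_mono2) auto
      hence "2 * x powr (2 * \<nu> + 1) * \<bar>schlomilch_term \<mu> \<nu> \<theta> a x n\<bar> \<le> 2 * d powr (2 * \<nu> + 1) * (K * real (Suc n) powr (- 1 - (\<mu> + \<nu> + real \<theta>)))"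
        using x K by (intro mult_mono) auto
      thus "\<bar>2 * x powr (2 * \<nu> + 1) * schlomilch_term \<mu> \<nu> \<theta> a x n\<bar> \<le> 2 * d powr (2 * \<nu> + 1) * (K * real (Suc n) powr (- 1 - (\<mu> + \<nu> + real \<theta>)))"
        by (simp add: abs_mult)
    qed
  next
    fix x assume x: "0 < x" "x < min a (2 * pi - a)"
    show "(\<lambda>n. x powr (2 * \<nu> + 2) * schlomilch_term \<mu> (\<nu> + 1) \<theta> a x n) sums (x powr (2 * \<nu> + 2) * bessel_series (\<nu> + 1) (schlomilch_coeff \<mu> a \<theta>) x)"
      by (rule sums_mult, rule schlomilch_sum_descent_order[OF \<mu> \<nu> a x IH])
  qed (use b \<nu> in auto)
  moreover have "2 * b powr (2 * \<nu> + 1) \<noteq> 0" using b by simp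
  ultimately show ?thesis using sums_mult_iff by blast
qed

text \<open>Two descents from \<open>\<theta> + 4 \<ge> 4\<close>.\<close>

lemma schlomilch_sum_interior:
  assumes \<mu>: "\<mu> \<ge> 0" and \<nu>: "\<nu> \<ge> 0" and a: "0 < a" "a < 2 * pi" and b: "0 < b" "b < min a (2 * pi - a)"
    and pos: "\<mu> + \<nu> + real \<theta> > 0"
  shows "schlomilch_term \<mu> \<nu> \<theta> a b sums bessel_series \<nu> (schlomilch_coeff \<mu> a \<theta>) b"
proof -
  have "schlomilch_term \<mu> \<nu> (\<theta> + 2) a b sums bessel_series \<nu> (schlomilch_coeff \<mu> a (\<theta> + 2)) b"
    if b: "0 < b" "b < min a (2 * pi - a)" for b
    by (rule schlomilch_sum_descent[OF \<mu> \<nu> a b _ schlomilch_sum_base[OF \<mu> \<nu> a(1)]]) (use \<mu> \<nu> in auto)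
  thus ?thesis by (rule schlomilch_sum_descent[OF \<mu> \<nu> a b pos])
qed

section \<open>The boundary case\<close>

text \<open>A form of monotone convergence: partial sums at \<open>b\<close> are limits of partial sums at \<open>x < b\<close>, hence at most
\<open>L\<close>, while every \<open>G x\<close> is at most the full sum at \<open>b\<close>.\<close>

lemma monotone_series_left_limit:
  fixes f :: "nat \<Rightarrow> real \<Rightarrow> real"
  assumes cb: "c < b"
    and nn: "\<And>m x. c \<le> x \<Longrightarrow> x \<le> b \<Longrightarrow> 0 \<le> f m x"
    and mono: "\<And>m x. c \<le> x \<Longrightarrow> x \<le> b \<Longrightarrow> f m x \<le> f m b"
    and cont: "\<And>m. (f m \<longlongrightarrow> f m b) (at_left b)"
    and G: "\<And>x. c \<le> x \<Longrightarrow> x < b \<Longrightarrow> (\<lambda>m. f m x) sums G x"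
    and lim: "(G \<longlongrightarrow> L) (at_left b)"
  shows "(\<lambda>m. f m b) sums L"
proof -
  have ev: "eventually (\<lambda>x. c \<le> x \<and> x < b) (at_left b)"
    using eventually_at_left_real[OF cb] by eventually_elim auto
  have part: "(\<Sum>m<M. f m b) \<le> L" for M
  proof (rule tendsto_le[OF _ lim tendsto_sum[OF cont]])
    show "eventually (\<lambda>x. (\<Sum>m<M. f m x) \<le> G x) (at_left b)" using ev
    proof eventually_elim
      case (elim x)
      show ?case unfolding sums_unique[OF G[OF conjunct1[OF elim] conjunct2[OF elim]]]
        by (rule sum_le_suminf[OF sums_summable[OF G]]) (use elim nn in auto)
    qed
  qed simp
  have s: "summable (\<lambda>m. f m b)"
    by (rule summableI_nonneg_bounded[of _ L]) (use part nn cb in auto)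
  have "suminf (\<lambda>m. f m b) \<le> L" by (rule suminf_le_const[OF s part])
  moreover have "L \<le> suminf (\<lambda>m. f m b)"
  proof (rule tendsto_upperbound[OF lim])
    show "eventually (\<lambda>x. G x \<le> suminf (\<lambda>m. f m b)) (at_left b)" using ev
    proof eventually_elim
      case (elim x)
      show ?case unfolding sums_unique[OF G[OF conjunct1[OF elim] conjunct2[OF elim]]]
        by (rule suminf_le[OF _ sums_summable[OF G] s]) (use elim mono in auto)
    qed
  qed simp
  ultimately show ?thesis using s by (simp add: sums_iff)
qed

text \<open>The double average of \<open>(-1)^m (a s + b t)^(2 m) / (2 m)!\<close>.\<close>

definition mean_power :: "real \<Rightarrow> real \<Rightarrow> real \<Rightarrow> nat \<Rightarrow> real \<Rightarrow> real" where
  "mean_power \<mu> \<nu> a m b = bessel_series \<nu> (power_coeff \<mu> a m) b"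

lemma mean_power_finite:
  "mean_power \<mu> \<nu> a m b = (\<Sum>r\<le>m. sin_moment \<nu> r * (power_coeff \<mu> a m r * b ^ (2 * r) / fact (2 * r)))"
  unfolding mean_power_def bessel_series_def bessel_series_term
  by (rule suminf_finite) (auto simp: power_coeff_eq_0)

lemma mean_power_abs:
  assumes "\<mu> \<ge> 0"
  shows "(- 1) ^ m * mean_power \<mu> \<nu> a m b = (\<Sum>r\<le>m. sin_moment \<nu> r * (\<bar>power_coeff \<mu> a m r\<bar> * b ^ (2 * r) / fact (2 * r)))"
  unfolding mean_power_finite power_coeff_abs[OF assms] sum_distrib_left by (simp add: mult_ac)

lemma zeta_cos_coeff_sign:
  assumes "m > \<theta> div 2"
  shows "0 \<le> (- 1) ^ (\<theta> div 2) * ((- 1) ^ m * zeta_cos_coeff \<theta> m)"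
proof (cases "even \<theta>")
  case True
  then obtain N where N: "\<theta> = 2 * N" by (elim evenE)
  have "real \<theta> - 2 * real m = - real (2 * (m - N))" using assms by (simp add: N of_nat_diff)
  moreover have "zeta_real (- real (2 * (m - N))) = 0" by (rule zeta_real_neg_even) (use assms in \<open>simp add: N\<close>)
  ultimately show ?thesis by (simp add: zeta_cos_coeff_def)
next
  case False
  then obtain N where N: "\<theta> = 2 * N + 1" by (elim oddE)
  define k where "k = m - N"
  have k: "k \<ge> 1" "m = N + k" using assms by (simp_all add: N k_def)
  have e: "real \<theta> - 2 * real m = - real (2 * k - 1)" using k by (simp add: N of_nat_diff)
  have "0 \<le> (- 1) ^ k * zeta_real (- real (2 * k - 1))" by (rule zeta_real_neg_odd_sign[OF k(1)])
  moreover have "(- 1 :: real) ^ N * ((- 1) ^ (N + k) * z) = (- 1) ^ k * z" for z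
    by (simp add: power_add flip: mult.assoc power_mult_distrib)
  moreover have "\<theta> div 2 = N" "zeta_cos_coeff \<theta> m = zeta_real (- real (2 * k - 1))"
    using k unfolding zeta_cos_coeff_def e by (simp_all add: N)
  ultimately show ?thesis unfolding k(2) by (simp only:)
qed

text \<open>The identity in its final form, including \<open>a + b = 2 \<pi>\<close>. The limit from the interior applies to all
\<open>b\<close> alike, so the two cases are not distinguished.\<close>

theorem schlomilch_sum:
  assumes \<mu>: "\<mu> \<ge> 0" and \<nu>: "\<nu> \<ge> 0" and ab: "0 < b" "b < a" "a + b \<le> 2 * pi"
    and pos: "\<mu> + \<nu> + real \<theta> > 0"
  shows "summable (schlomilch_term \<mu> \<nu> \<theta> a b)"
    "(\<lambda>m. zeta_cos_coeff \<theta> m * mean_power \<mu> \<nu> a m b) sums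
       ((\<Sum>n. schlomilch_term \<mu> \<nu> \<theta> a b n) - bessel_series \<nu> (sing_coeff \<mu> a \<theta>) b)"
proof -
  have a: "0 < a" "a < 2 * pi" using ab by linarith+
  define T where "T = (\<lambda>x. \<Sum>n. schlomilch_term \<mu> \<nu> \<theta> a x n)"
  obtain K where K: "K > 0" "\<And>n x. b / 2 \<le> x \<Longrightarrow> \<bar>schlomilch_term \<mu> \<nu> \<theta> a x n\<bar> \<le> K * real (Suc n) powr (- 1 - (\<mu> + \<nu> + real \<theta>))"
    using schlomilch_term_bound[of \<mu> \<nu> a "b / 2" \<theta>] \<mu> \<nu> a ab by auto
  have sK: "summable (\<lambda>n. K * real (Suc n) powr (- 1 - (\<mu> + \<nu> + real \<theta>)))"
    by (intro summable_mult summable_powr_Suc) (use pos in simp)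
  show "summable (schlomilch_term \<mu> \<nu> \<theta> a b)"
    by (rule summable_comparison_test'[OF sK, of 0]) (use K(2)[of b] ab in simp)
  have "continuous_on {b / 2..b} T" unfolding T_def
  proof (rule uniform_limit_theorem)
    show "uniform_limit {b / 2..b} (\<lambda>n x. \<Sum>i<n. schlomilch_term \<mu> \<nu> \<theta> a x i) (\<lambda>x. \<Sum>n. schlomilch_term \<mu> \<nu> \<theta> a x n) sequentially"
      by (rule Weierstrass_m_test[OF _ sK]) (use K(2) in auto)
    have "continuous_on {b / 2..b} (\<lambda>x. bessel_even \<nu> (real (Suc i) * x))" for i
      by (rule continuous_on_compose2[OF continuous_on_bessel_even[of \<nu> UNIV]]) (use \<nu> in \<open>auto intro!: continuous_intros\<close>)
    thus "eventually (\<lambda>n. continuous_on {b / 2..b} (\<lambda>x. \<Sum>i<n. schlomilch_term \<mu> \<nu> \<theta> a x i)) sequentially"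
      by (intro always_eventually allI continuous_intros) simp_all
  qed simp
  hence "(T \<longlongrightarrow> T b) (at b within {b / 2..b})" using ab by (simp add: continuous_on_def)
  hence Tlim: "(T \<longlongrightarrow> T b) (at_left b)"
    using ab by (simp add: at_within_Icc_at_left)
  define S where "S = bessel_series \<nu> (sing_coeff \<mu> a \<theta>)"
  have "isCont S b" unfolding S_def
    by (rule isCont_bessel_series[OF even_conv_sing_coeff[OF a(1) \<mu>]]) (use ab \<nu> in auto)
  hence Slim: "(S \<longlongrightarrow> S b) (at_left b)" by (auto simp: isCont_def filterlim_at_split)
  let ?\<Phi> = "\<lambda>m x. zeta_cos_coeff \<theta> m * mean_power \<mu> \<nu> a m x"
  have contP: "(?\<Phi> m \<longlongrightarrow> ?\<Phi> m b) (at_left b)" for m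
    unfolding mean_power_finite by (intro tendsto_intros) auto
  have inner: "(\<lambda>m. ?\<Phi> m x) sums (T x - S x)" if x: "b / 2 \<le> x" "x < b" for x
  proof -
    have x': "0 < x" "x < min a (2 * pi - a)" "\<bar>x\<bar> < a" "\<bar>x\<bar> < 2 * pi - a" using x ab by auto
    have "(\<lambda>m. ?\<Phi> m x) sums (\<Sum>r. sin_moment \<nu> r * (zeta_part \<mu> a \<theta> r * x ^ (2 * r) / fact (2 * r)))"
      unfolding mean_power_finite
      by (rule zeta_part_sums[where W = "rGamma (\<nu> + 1)"])
        (use \<mu> \<nu> a x' in \<open>auto intro!: sin_moment_nonneg sin_moment_le\<close>)
    hence "(\<lambda>m. ?\<Phi> m x) sums bessel_series \<nu> (zeta_part \<mu> a \<theta>) x"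
      unfolding bessel_series_def bessel_series_term .
    moreover have "T x = S x + bessel_series \<nu> (zeta_part \<mu> a \<theta>) x"
    proof -
      have "(\<lambda>r. sing_coeff \<mu> a \<theta> r / fact r * rGamma (\<nu> + real r + 1) * (x / 2) ^ (2 * r) +
            zeta_part \<mu> a \<theta> r / fact r * rGamma (\<nu> + real r + 1) * (x / 2) ^ (2 * r)) sums
          (S x + bessel_series \<nu> (zeta_part \<mu> a \<theta>) x)"
        unfolding S_def
        by (intro sums_add bessel_series_sums[OF even_conv_sing_coeff] bessel_series_sums[OF even_conv_zeta_part])
          (use \<mu> \<nu> a x' in auto)
      hence "(\<lambda>r. schlomilch_coeff \<mu> a \<theta> r / fact r * rGamma (\<nu> + real r + 1) * (x / 2) ^ (2 * r)) sums
          (S x + bessel_series \<nu> (zeta_part \<mu> a \<theta>) x)"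
        by (simp add: schlomilch_coeff_def add_divide_distrib distrib_right)
      hence "bessel_series \<nu> (schlomilch_coeff \<mu> a \<theta>) x = S x + bessel_series \<nu> (zeta_part \<mu> a \<theta>) x"
        unfolding bessel_series_def by (rule sums_unique[symmetric])
      moreover have "T x = bessel_series \<nu> (schlomilch_coeff \<mu> a \<theta>) x"
        unfolding T_def by (rule sums_unique[symmetric, OF schlomilch_sum_interior[OF \<mu> \<nu> a x'(1,2) pos]])
      ultimately show ?thesis by simp
    qed
    ultimately show ?thesis by simp
  qed
  define N where "N = \<theta> div 2"
  (* only the terms with m > N have a common sign, so the first N + 1 are split off *)
  define f where "f = (\<lambda>k x. (- 1) ^ N * ?\<Phi> (k + Suc N) x)"
  have f: "f k x = ((- 1) ^ N * ((- 1) ^ (k + Suc N) * zeta_cos_coeff \<theta> (k + Suc N))) *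
      (\<Sum>r\<le>k + Suc N. sin_moment \<nu> r * (\<bar>power_coeff \<mu> a (k + Suc N) r\<bar> * x ^ (2 * r) / fact (2 * r)))" for k x
  proof -
    have "((- 1) ^ N * (s * z)) * (s * p) = (- 1) ^ N * (z * p)" if "s * s = 1" for s z p :: real
    proof -
      have "((- 1) ^ N * (s * z)) * (s * p) = (- 1) ^ N * ((s * s) * (z * p))" by (simp only: mult_ac)
      thus ?thesis using that by simp
    qed
    thus ?thesis unfolding f_def mean_power_abs[OF \<mu>, symmetric]
      by (metis (no_types, lifting) minus_one_mult_self)
  qed
  have sgn: "0 \<le> (- 1) ^ N * ((- 1) ^ (k + Suc N) * zeta_cos_coeff \<theta> (k + Suc N))" for k
    unfolding N_def by (rule zeta_cos_coeff_sign) simp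
  have sm: "0 \<le> sin_moment \<nu> r" for r by (rule sin_moment_nonneg) (use \<nu> in simp)
  have "(\<lambda>k. f k b) sums ((- 1) ^ N * (T b - S b - (\<Sum>m<Suc N. ?\<Phi> m b)))"
  proof (rule monotone_series_left_limit[where c = "b / 2" and G = "\<lambda>x. (- 1) ^ N * (T x - S x - (\<Sum>m<Suc N. ?\<Phi> m x))"])
    show "0 \<le> f k x" if "b / 2 \<le> x" "x \<le> b" for k x
      unfolding f by (intro mult_nonneg_nonneg[OF sgn] sum_nonneg mult_nonneg_nonneg[OF sm]) (use that ab in auto)
    show "f k x \<le> f k b" if "b / 2 \<le> x" "x \<le> b" for k x
      unfolding f
      by (intro mult_left_mono[OF _ sgn] sum_mono mult_left_mono[OF _ sm] divide_right_mono mult_left_mono[OF power_mono])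
        (use that ab in auto)
    show "(f k \<longlongrightarrow> f k b) (at_left b)" for k
      unfolding f_def by (intro tendsto_mult[OF tendsto_const contP])
    show "((\<lambda>x. (- 1) ^ N * (T x - S x - (\<Sum>m<Suc N. ?\<Phi> m x))) \<longlongrightarrow> (- 1) ^ N * (T b - S b - (\<Sum>m<Suc N. ?\<Phi> m b))) (at_left b)"
      by (intro tendsto_mult[OF tendsto_const] tendsto_diff Tlim Slim tendsto_sum contP)
    show "(\<lambda>k. f k x) sums ((- 1) ^ N * (T x - S x - (\<Sum>m<Suc N. ?\<Phi> m x)))" if "b / 2 \<le> x" "x < b" for x
      unfolding f_def by (intro sums_mult sums_split_initial_segment inner that)
  qed (use ab in simp)
  hence "(\<lambda>k. (- 1) ^ N * f k b) sums ((- 1) ^ N * ((- 1) ^ N * (T b - S b - (\<Sum>m<Suc N. ?\<Phi> m b))))"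
    by (rule sums_mult)
  hence "(\<lambda>k. ?\<Phi> (k + Suc N) b) sums (T b - S b - (\<Sum>m<Suc N. ?\<Phi> m b))"
    unfolding f_def by (simp flip: mult.assoc power_mult_distrib)
  thus "(\<lambda>m. ?\<Phi> m b) sums ((\<Sum>n. schlomilch_term \<mu> \<nu> \<theta> a b n) - bessel_series \<nu> (sing_coeff \<mu> a \<theta>) b)"
    using sums_iff_shift[of "\<lambda>m. ?\<Phi> m b" "Suc N" "T b - S b - (\<Sum>m<Suc N. ?\<Phi> m b)"]
    unfolding T_def S_def diff_add_cancel by (rule iffD1[rotated])
qed

section \<open>Hypergeometric form\<close>

text \<open>Convergence of \<open>\<Sum>n. h n\<close> itself is not presupposed: if \<open>c = 0\<close> then \<open>x = 0\<close>. This matters for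
\<open>\<mu> = 0\<close>, where the factor in front of the \<open>3F2\<close> series vanishes.\<close>

lemma sums_cmult_imp_suminf:
  fixes c x :: real
  assumes "(\<lambda>n. c * h n) sums x" shows "c * suminf h = x"
proof (cases "c = 0")
  case True
  thus ?thesis using assms sums_unique2[OF sums_zero] by simp
next
  case False
  have "(\<lambda>n. inverse c * (c * h n)) sums (inverse c * x)" by (rule sums_mult[OF assms])
  hence "h sums (inverse c * x)" using False by (simp flip: mult.assoc)
  thus ?thesis using False by (simp add: sums_unique[symmetric])
qed

text \<open>With reciprocal Gamma functions the reflection of a Pochhammer symbol needs no exceptions at the
poles.\<close>

lemma pochhammer_minus_rGamma: "pochhammer (- z) n * rGamma (z + 1) = (- 1) ^ n * rGamma (z + 1 - real n)" for z :: real
  using pochhammer_rGamma[of "z + 1 - real n" n] by (simp add: pochhammer_minus algebra_simps)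

lemma inverse_pochhammer_Gamma:
  fixes \<nu> :: real
  assumes "\<nu> \<ge> 0" shows "1 / (Gamma (1 + \<nu>) * pochhammer (1 + \<nu>) n) = rGamma (\<nu> + real n + 1)"
proof -
  have "1 + \<nu> \<notin> \<int>\<^sub>\<le>\<^sub>0" using assms by (auto elim!: nonpos_Ints_cases)
  moreover have "Gamma (1 + \<nu>) \<noteq> 0" using Gamma_real_pos[of "1 + \<nu>"] assms by linarith
  ultimately show ?thesis
    by (simp add: pochhammer_Gamma rGamma_inverse_Gamma divide_inverse add_ac)
qed

lemma scaled_ratio_power:
  fixes a b :: real
  assumes "a > 0"
  shows "(a / 2) powi k * (b\<^sup>2 / a\<^sup>2) ^ r = (a / 2) powi (k - 2 * int r) * (b / 2) ^ (2 * r)"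
proof -
  have "b\<^sup>2 / a\<^sup>2 = (b / 2)\<^sup>2 / (a / 2)\<^sup>2" using assms by (simp add: power_divide)
  hence "(b\<^sup>2 / a\<^sup>2) ^ r = (b / 2) ^ (2 * r) / (a / 2) powi (2 * int r)"
    by (simp add: power_divide power_mult power_int_mult)
  thus ?thesis using assms by (simp add: power_int_diff)
qed

lemma summable_schlomilch_imp_S_bessel:
  fixes t :: nat
  assumes ab: "a > 0" "b > 0" and \<alpha>: "\<alpha> = \<mu> + \<nu> + real t" and s: "summable (schlomilch_term \<mu> \<nu> t a b)"
  shows "summable (\<lambda>n. bessel_term \<mu> \<nu> \<alpha> a b (Suc n))"
    "S_bessel \<mu> \<nu> \<alpha> a b = (\<Sum>n. schlomilch_term \<mu> \<nu> t a b n)"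
proof -
  define C where "C = (a / 2) powr \<mu> * (b / 2) powr \<nu>"
  have e: "bessel_term \<mu> \<nu> \<alpha> a b (Suc n) = C * schlomilch_term \<mu> \<nu> t a b n" for n
  proof -
    let ?k = "real (Suc n)"
    have k: "?k > 0" by simp
    have "(?k * a / 2) powr \<mu> = ?k powr \<mu> * (a / 2) powr \<mu>" "(?k * b / 2) powr \<nu> = ?k powr \<nu> * (b / 2) powr \<nu>"
      using powr_mult[of ?k "a / 2" \<mu>] powr_mult[of ?k "b / 2" \<nu>] k ab by (simp_all del: of_nat_Suc)
    moreover have "?k powr \<alpha> = ?k powr \<mu> * ?k powr \<nu> * ?k ^ t"
      using k by (simp add: \<alpha> powr_add powr_realpow del: of_nat_Suc)
    moreover have "?k powr \<mu> \<noteq> 0" "?k powr \<nu> \<noteq> 0" using k by simp_all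
    moreover have "x * c * j * (y * d * i) / (x * y * z) = c * d * (j * i / z)" if "x \<noteq> 0" "y \<noteq> 0" for x y z c d i j :: real
      using that by simp
    ultimately show ?thesis unfolding bessel_term_def bessel_J_eq C_def by (simp only:)
  qed
  show "summable (\<lambda>n. bessel_term \<mu> \<nu> \<alpha> a b (Suc n))" unfolding e by (rule summable_mult[OF s])
  have "2 powr (\<mu> + \<nu>) / (a powr \<mu> * b powr \<nu>) * C = 1"
    using ab by (simp add: C_def powr_divide powr_add)
  moreover have "S_bessel \<mu> \<nu> \<alpha> a b = 2 powr (\<mu> + \<nu>) / (a powr \<mu> * b powr \<nu>) * (C * (\<Sum>n. schlomilch_term \<mu> \<nu> t a b n))"
    unfolding S_bessel_def e suminf_mult[OF s] ..
  ultimately show "S_bessel \<mu> \<nu> \<alpha> a b = (\<Sum>n. schlomilch_term \<mu> \<nu> t a b n)" by (simp only: mult.assoc[symmetric] mult_1)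
qed

definition F_poly_term :: "real \<Rightarrow> nat \<Rightarrow> real \<Rightarrow> real \<Rightarrow> nat \<Rightarrow> real" where
  "F_poly_term \<nu> m \<mu> \<xi> r = pochhammer (- real m) r * pochhammer (- real m - \<mu>) r / (pochhammer (1 + \<nu>) r * fact r) * \<xi> ^ r"

lemma F_poly_sum: "F_poly \<nu> m \<mu> \<xi> = (\<Sum>r\<le>m. F_poly_term \<nu> m \<mu> \<xi> r)"
proof -
  have "pochhammer (- real m) r = 0" if "r > m" for r
    using that pochhammer_of_nat_eq_0_lemma by blast
  thus ?thesis unfolding F_poly_def hypergeo_2_1 F_poly_term_def
    by (intro suminf_finite) auto
qed

lemma power_coeff_F_poly_term:
  assumes a: "a > 0" and \<mu>: "\<mu> \<ge> 0" and \<nu>: "\<nu> \<ge> 0" and r: "r \<le> m"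
  shows "power_coeff \<mu> a m r / fact r * rGamma (\<nu> + real r + 1) * (b / 2) ^ (2 * r) =
    (- 1) ^ m * (a / 2) ^ (2 * m) / (Gamma (1 + \<nu>) * Gamma (real m + 1 + \<mu>) * fact m) * F_poly_term \<nu> m \<mu> (b\<^sup>2 / a\<^sup>2) r"
proof -
  have p1: "pochhammer (- real m) r = (- 1) ^ r * fact m / fact (m - r)"
  proof -
    have "pochhammer (- real m) r * rGamma (real m + 1) = (- 1) ^ r * rGamma (real m + 1 - real r)"
      by (rule pochhammer_minus_rGamma)
    moreover have "real m + 1 - real r = real (m - r) + 1" using r by (simp add: of_nat_diff)
    moreover have "rGamma (real k + 1) = 1 / fact k" for k
      using Gamma_fact[of k, where 'a = real] by (simp add: rGamma_inverse_Gamma divide_inverse add_ac)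
    ultimately have "pochhammer (- real m) r * (1 / fact m) = (- 1) ^ r * (1 / fact (m - r))" by (simp only:)
    moreover have "x = y * f / g" if "x * (1 / f) = y * (1 / g)" "f \<noteq> 0" "g \<noteq> 0" for x y f g :: real
      using that by (simp add: divide_simps)
    ultimately show ?thesis by simp
  qed
  have p2: "pochhammer (- real m - \<mu>) r / Gamma (real m + 1 + \<mu>) = (- 1) ^ r * rGamma (real (m - r) + 1 + \<mu>)"
  proof -
    have e: "- real m - \<mu> = - (real m + \<mu>)" "real m + 1 + \<mu> = real m + \<mu> + 1"
      "real (m - r) + 1 + \<mu> = real m + \<mu> + 1 - real r" using r by (simp_all add: of_nat_diff)
    show ?thesis unfolding e pochhammer_minus_rGamma[symmetric] by (simp add: rGamma_inverse_Gamma divide_inverse)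
  qed
  have p3: "(a / 2) ^ (2 * m) * (b\<^sup>2 / a\<^sup>2) ^ r = (a / 2) ^ (2 * (m - r)) * (b / 2) ^ (2 * r)"
  proof -
    have "(a / 2) ^ (2 * m) = (a / 2) ^ (2 * (m - r)) * (a / 2) ^ (2 * r)"
    proof -
      have "2 * (m - r) + 2 * r = 2 * m" using r by simp
      thus ?thesis by (simp only: power_add[symmetric])
    qed
    moreover have "(a / 2) ^ (2 * r) * (b\<^sup>2 / a\<^sup>2) ^ r = (b / 2) ^ (2 * r)"
    proof -
      have "(a / 2)\<^sup>2 * (b\<^sup>2 / a\<^sup>2) = (b / 2)\<^sup>2" using a by (simp add: power_divide)
      thus ?thesis by (simp only: power_mult power_mult_distrib[symmetric])
    qed
    ultimately show ?thesis by (simp only: mult.assoc)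
  qed
  have "(- 1) ^ m * (a / 2) ^ (2 * m) / (Gamma (1 + \<nu>) * Gamma (real m + 1 + \<mu>) * fact m) * F_poly_term \<nu> m \<mu> (b\<^sup>2 / a\<^sup>2) r
    = (- 1) ^ m / (fact m * fact r) * ((a / 2) ^ (2 * m) * (b\<^sup>2 / a\<^sup>2) ^ r) * (pochhammer (- real m - \<mu>) r / Gamma (real m + 1 + \<mu>)) *
      pochhammer (- real m) r * (1 / (Gamma (1 + \<nu>) * pochhammer (1 + \<nu>) r))"
    unfolding F_poly_term_def by (simp add: mult_ac)
  also have "\<dots> = (- 1) ^ m / (fact m * fact r) * ((a / 2) ^ (2 * (m - r)) * (b / 2) ^ (2 * r)) * ((- 1) ^ r * rGamma (real (m - r) + 1 + \<mu>)) *
      ((- 1) ^ r * fact m / fact (m - r)) * rGamma (\<nu> + real r + 1)"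
    unfolding p1 p2 p3 inverse_pochhammer_Gamma[OF \<nu>] ..
  also have "\<dots> = (- 1) ^ m * ((a / 2) ^ (2 * (m - r)) / fact (m - r) * rGamma (real (m - r) + 1 + \<mu>)) / fact r * rGamma (\<nu> + real r + 1) * (b / 2) ^ (2 * r)"
  proof -
    have "m' / (f * g) * (A * B) * (s * R) * (s * f / h) * V = m' * (A / h * R) / g * V * B"
      if "s * s = 1" "f \<noteq> 0" for m' f g A B s R h V :: real
    proof -
      have "m' / (f * g) * (A * B) * (s * R) * (s * f / h) * V = (s * s) * (m' * (A / h * R) / g * V * B)"
        using that(2) by (simp add: mult_ac)
      thus ?thesis using that(1) by simp
    qed
    note rearrange = this
    show ?thesis by (rule rearrange) simp_all
  qed
  finally show ?thesis unfolding power_coeff_le[OF r] by simp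
qed

lemma mean_power_F_poly:
  assumes a: "a > 0" and \<mu>: "\<mu> \<ge> 0" and \<nu>: "\<nu> \<ge> 0"
  shows "mean_power \<mu> \<nu> a m b =
    (- 1) ^ m * (a / 2) ^ (2 * m) / (Gamma (1 + \<nu>) * Gamma (real m + 1 + \<mu>) * fact m) * F_poly \<nu> m \<mu> (b\<^sup>2 / a\<^sup>2)"
proof -
  have "mean_power \<mu> \<nu> a m b = (\<Sum>r\<le>m. power_coeff \<mu> a m r / fact r * rGamma (\<nu> + real r + 1) * (b / 2) ^ (2 * r))"
    unfolding mean_power_finite bessel_series_term ..
  also have "\<dots> = (\<Sum>r\<le>m. (- 1) ^ m * (a / 2) ^ (2 * m) / (Gamma (1 + \<nu>) * Gamma (real m + 1 + \<mu>) * fact m) * F_poly_term \<nu> m \<mu> (b\<^sup>2 / a\<^sup>2) r)"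
    by (intro sum.cong refl power_coeff_F_poly_term assms) simp
  finally show ?thesis unfolding F_poly_sum sum_distrib_left .
qed

lemma B_coeff_mean_power:
  assumes a: "a > 0" and \<mu>: "\<mu> \<ge> 0" and \<nu>: "\<nu> \<ge> 0"
  shows "B_coeff \<mu> \<nu> \<theta> (b\<^sup>2 / a\<^sup>2) m * (a / 2) ^ (2 * m) = Gamma (1 + \<nu>) * (zeta_real (\<theta> - 2 * real m) * mean_power \<mu> \<nu> a m b)"
proof -
  have "Gamma (1 + \<nu>) \<noteq> 0" using Gamma_real_pos[of "1 + \<nu>"] \<nu> by linarith
  thus ?thesis unfolding mean_power_F_poly[OF assms] B_coeff_def by (simp add: add_ac mult_ac)
qed

text \<open>Term by term, the Pochhammer symbols are absorbed by shifting the arguments of the Gamma functions, and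
the powers of \<open>b\<^sup>2 / a\<^sup>2\<close> by shifting the exponent of \<open>a / 2\<close>.\<close>

lemma F_hat_eq:
  assumes a: "a > 0" and \<mu>: "\<mu> \<ge> 0" and \<nu>: "\<nu> \<ge> 0" and b: "0 < b" "b < a" and \<alpha>: "\<alpha> - \<mu> - \<nu> = 2 * real N"
  shows "F_hat \<mu> \<nu> \<alpha> a b = bessel_series \<nu> (sing_coeff \<mu> a (2 * N)) b"
proof -
  let ?C = "(a / 2) powr (2 * real N - 1) * Gamma (1/2 - real N) / 2 * rGamma (1 + \<nu>) * rGamma (\<mu> + real N + 1/2)"
  let ?h = "\<lambda>r. pochhammer (1/2 - real N) r * pochhammer (1/2 - real N - \<mu>) r / (pochhammer (1 + \<nu>) r * fact r) * (b\<^sup>2 / a\<^sup>2) ^ r"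
  have e: "(\<mu> + \<nu> + 1 - \<alpha>) / 2 = 1/2 - real N" "(\<nu> - \<mu> + 1 - \<alpha>) / 2 = 1/2 - real N - \<mu>"
    "\<mu> / 2 + \<nu> / 2 + 1 / 2 - \<alpha> / 2 = 1/2 - real N" "\<mu> / 2 - \<nu> / 2 + \<alpha> / 2 + 1 / 2 = \<mu> + real N + 1/2"
    using \<alpha> by (simp_all add: field_simps)
  have g\<nu>: "Gamma (1 + \<nu>) \<noteq> 0" using Gamma_real_pos[of "1 + \<nu>"] \<nu> by linarith
  have "?C * ?h r = sing_coeff \<mu> a (2 * N) r / fact r * rGamma (\<nu> + real r + 1) * (b / 2) ^ (2 * r)" for r
  proof -
    have p1: "Gamma (1/2 - real N) * pochhammer (1/2 - real N) r = Gamma (1/2 - of_int (int N - int r))"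
    proof -
      have n: "(1/2 - real N :: real) \<notin> \<int>\<^sub>\<le>\<^sub>0" using half_not_nonpos_Int[of "int N"] by simp
      hence "Gamma (1/2 - real N) \<noteq> 0" by (simp add: Gamma_eq_zero_iff)
      thus ?thesis using n by (simp add: pochhammer_Gamma algebra_simps)
    qed
    have p2: "pochhammer (1/2 - real N - \<mu>) r * rGamma (\<mu> + real N + 1/2) = (- 1) ^ r * rGamma (\<mu> + of_int (int N - int r) + 1/2)"
      using pochhammer_minus_rGamma[of "\<mu> + real N - 1/2" r] by (simp add: algebra_simps)
    have p3: "(a / 2) powr (2 * real N - 1) * (b\<^sup>2 / a\<^sup>2) ^ r = (a / 2) powi (2 * (int N - int r) - 1) * (b / 2) ^ (2 * r)"
    proof -
      have "(a / 2) powr (2 * real N - 1) = (a / 2) powi (2 * int N - 1)"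
        using a by (simp flip: powr_real_of_int')
      moreover have "2 * int N - 1 - 2 * int r = 2 * (int N - int r) - 1" by simp
      ultimately show ?thesis using scaled_ratio_power[OF a, of "2 * int N - 1" b r] by (simp only:)
    qed
    have p4: "rGamma (1 + \<nu>) / pochhammer (1 + \<nu>) r = rGamma (\<nu> + real r + 1)"
      unfolding inverse_pochhammer_Gamma[OF \<nu>, symmetric] by (simp add: rGamma_inverse_Gamma divide_inverse)
    have "?C * ?h r = ((a / 2) powr (2 * real N - 1) * (b\<^sup>2 / a\<^sup>2) ^ r) * (Gamma (1/2 - real N) * pochhammer (1/2 - real N) r) / 2 *
        (pochhammer (1/2 - real N - \<mu>) r * rGamma (\<mu> + real N + 1/2)) * (rGamma (1 + \<nu>) / pochhammer (1 + \<nu>) r) / fact r"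
      by (simp add: mult_ac)
    also have "\<dots> = sing_coeff \<mu> a (2 * N) r / fact r * rGamma (\<nu> + real r + 1) * (b / 2) ^ (2 * r)"
      unfolding p1 p2 p3 p4 by (simp add: sing_coeff_def sing_even_def mult_ac)
    finally show ?thesis .
  qed
  moreover have "(\<lambda>r. sing_coeff \<mu> a (2 * N) r / fact r * rGamma (\<nu> + real r + 1) * (b / 2) ^ (2 * r)) sums bessel_series \<nu> (sing_coeff \<mu> a (2 * N)) b"
    by (rule bessel_series_sums[OF even_conv_sing_coeff[OF a \<mu>]]) (use b \<nu> in auto)
  ultimately have "(\<lambda>r. ?C * ?h r) sums bessel_series \<nu> (sing_coeff \<mu> a (2 * N)) b" by simp
  from sums_cmult_imp_suminf[OF this] show ?thesis
    unfolding F_hat_def e hypergeo_2_1 \<alpha> .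
qed

text \<open>Repeated use of \<open>\<psi>(x + 1) = \<psi>(x) + 1 / x\<close>; this is the origin of the numbers \<open>D_coeff\<close>.\<close>

lemma Upsilon_hat_down:
  assumes "\<mu> \<ge> 0" "r \<le> N"
  shows "Upsilon_hat \<mu> (N - r) a = Upsilon_hat \<mu> N a - D_coeff r N \<mu> / fact r / 2"
  using assms(2)
proof (induction r)
  case (Suc r)
  have "Suc (N - Suc r) = N - r" using Suc.prems by simp
  hence "Upsilon_hat \<mu> (N - Suc r) a = Upsilon_hat \<mu> (N - r) a - 1 / 2 * (1 / real (N - r) + 1 / (real (N - r) + \<mu>))"
    using Upsilon_hat_Suc[OF assms(1), of "N - Suc r" a] by simp
  moreover have "D_coeff (Suc r) N \<mu> / fact (Suc r) = D_coeff r N \<mu> / fact r + (1 / real (N - r) + 1 / (real (N - r) + \<mu>))"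
  proof -
    have "D_coeff n N \<mu> / fact n = (\<Sum>k<n. 1 / (real N - real k) + 1 / (real N + \<mu> - real k))" for n
      by (simp add: D_coeff_def del: fact_Suc)
    moreover have "real (N - r) = real N - real r" using Suc.prems by (simp add: of_nat_diff)
    ultimately show ?thesis by (simp add: algebra_simps del: fact_Suc)
  qed
  moreover have "Upsilon_hat \<mu> (N - r) a = Upsilon_hat \<mu> N a - D_coeff r N \<mu> / fact r / 2"
    by (rule Suc.IH) (use Suc.prems in simp)
  moreover have "U = V - D' / 2" if "U = W - 1 / 2 * E" "D' = D + E" "W = V - D / 2" for U V W D D' E :: real
    using that by (simp add: field_simps)
  ultimately show ?case by blast
qed (simp add: D_coeff_def)

lemma F_poly_term_gchoose:
  "F_poly_term \<nu> N \<mu> \<xi> r = (real N gchoose r) * ((real N + \<mu>) gchoose r) * fact r * \<xi> ^ r / pochhammer (1 + \<nu>) r"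
proof -
  have "((- 1) ^ r / f * x) * ((- 1) ^ r / f * y) * f * z / p = x * y / (p * f) * z" if "f \<noteq> 0" for f x y z p :: real
  proof -
    have "((- 1) ^ r / f * x) * ((- 1) ^ r / f * y) * f * z / p = ((- 1) ^ r * (- 1) ^ r) * (x * y / (p * f) * z)"
      using that by (simp add: mult_ac)
    thus ?thesis by simp
  qed
  moreover have "- (real N + \<mu>) = - real N - \<mu>" by simp
  ultimately show ?thesis unfolding F_poly_term_def gbinomial_pochhammer by simp
qed

text \<open>The coefficients with \<open>r > N\<close>, where the index \<open>N - r\<close> is negative, make up the \<open>3F2\<close> part of
\<open>Delta\<close>.\<close>

lemma sing_odd_tail:
  assumes a: "a > 0" and \<mu>: "\<mu> \<ge> 0" and \<nu>: "\<nu> \<ge> 0"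
  shows "sing_coeff \<mu> a (2 * N + 1) (k + Suc N) / fact (k + Suc N) * rGamma (\<nu> + real (k + Suc N) + 1) * (b / 2) ^ (2 * (k + Suc N)) =
    (- 1) ^ N * (a / 2) ^ (2 * N) / (Gamma (1 + \<nu>) * Gamma (real N + 1 + \<mu>) * fact N) * (- 1 / 2) *
      (pochhammer \<mu> (N + 1) * (b\<^sup>2 / a\<^sup>2) ^ (N + 1) / (pochhammer (1 + \<nu>) (N + 1) * (real N + 1))) *
      (fact k * fact k * pochhammer (1 - \<mu>) k / (pochhammer (real N + \<nu> + 2) k * pochhammer (real N + 2) k * fact k) * (b\<^sup>2 / a\<^sup>2) ^ k)"
proof -
  let ?r = "k + Suc N" and ?\<xi> = "b\<^sup>2 / a\<^sup>2"
  have p1: "pochhammer \<mu> (N + 1) * pochhammer (1 - \<mu>) k / Gamma (real N + 1 + \<mu>) = (- 1) ^ k * rGamma (\<mu> - real k)"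
  proof -
    have "rGamma \<mu> = pochhammer \<mu> (N + 1) * rGamma (\<mu> + real (N + 1))" by (rule pochhammer_rGamma)
    moreover have "pochhammer (1 - \<mu>) k * rGamma \<mu> = (- 1) ^ k * rGamma (\<mu> - real k)"
      using pochhammer_minus_rGamma[of "\<mu> - 1" k] by simp
    moreover have "rGamma (\<mu> + real (N + 1)) = 1 / Gamma (real N + 1 + \<mu>)"
      by (simp add: rGamma_inverse_Gamma divide_inverse add_ac)
    moreover have "p * q / G = q * (p * (1 / G))" for p q G :: real by simp
    ultimately show ?thesis by (simp only:)
  qed
  have p2: "1 / (Gamma (1 + \<nu>) * pochhammer (1 + \<nu>) (N + 1) * pochhammer (real N + \<nu> + 2) k) = rGamma (\<nu> + real ?r + 1)"
  proof -
    have "pochhammer (1 + \<nu>) ((N + 1) + k) = pochhammer (1 + \<nu>) (N + 1) * pochhammer (1 + \<nu> + of_nat (N + 1)) k"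
      by (rule pochhammer_product')
    moreover have "1 + \<nu> + of_nat (N + 1) = real N + \<nu> + 2" "N + 1 + k = ?r" by simp_all
    ultimately have "pochhammer (1 + \<nu>) ?r = pochhammer (1 + \<nu>) (N + 1) * pochhammer (real N + \<nu> + 2) k" by (simp only:)
    thus ?thesis unfolding inverse_pochhammer_Gamma[OF \<nu>, of ?r, symmetric] by (simp only: mult.assoc)
  qed
  have p3: "fact N * (real N + 1) * pochhammer (real N + 2) k = fact ?r"
  proof -
    have "pochhammer (1::real) ((N + 1) + k) = pochhammer 1 (N + 1) * pochhammer (1 + of_nat (N + 1)) k"
      by (rule pochhammer_product')
    moreover have "1 + of_nat (N + 1) = real N + 2" "N + 1 + k = ?r" by simp_all
    ultimately have "fact ?r = fact (N + 1) * pochhammer (real N + 2) k" by (simp only: pochhammer_fact[symmetric])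
    thus ?thesis by (simp add: mult_ac add_ac)
  qed
  have p4: "(a / 2) ^ (2 * N) * ?\<xi> ^ ?r = (a / 2) powi (2 * (int N - int ?r)) * (b / 2) ^ (2 * ?r)"
  proof -
    have "int (2 * N) - 2 * int ?r = 2 * (int N - int ?r)" by simp
    thus ?thesis using scaled_ratio_power[OF a, of "int (2 * N)" b ?r] by (simp only: power_int_of_nat)
  qed
  have s: "sing_coeff \<mu> a (2 * N + 1) ?r = (- 1) ^ ?r * (1/2 * (a / 2) powi (2 * (int N - int ?r)) * fact k * rGamma (\<mu> - real k))"
    by (simp add: sing_coeff_def sing_odd_def nat_diff_distrib')
  have "(- 1) ^ N * (a / 2) ^ (2 * N) / (Gamma (1 + \<nu>) * Gamma (real N + 1 + \<mu>) * fact N) * (- 1 / 2) *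
      (pochhammer \<mu> (N + 1) * ?\<xi> ^ (N + 1) / (pochhammer (1 + \<nu>) (N + 1) * (real N + 1))) *
      (fact k * fact k * pochhammer (1 - \<mu>) k / (pochhammer (real N + \<nu> + 2) k * pochhammer (real N + 2) k * fact k) * ?\<xi> ^ k)
    = (- 1) ^ N * (- 1 / 2) * ((a / 2) ^ (2 * N) * (?\<xi> ^ (N + 1) * ?\<xi> ^ k)) * (pochhammer \<mu> (N + 1) * pochhammer (1 - \<mu>) k / Gamma (real N + 1 + \<mu>)) *
      (1 / (Gamma (1 + \<nu>) * pochhammer (1 + \<nu>) (N + 1) * pochhammer (real N + \<nu> + 2) k)) * fact k / (fact N * (real N + 1) * pochhammer (real N + 2) k)"
    by (simp add: mult_ac)
  also have "?\<xi> ^ (N + 1) * ?\<xi> ^ k = ?\<xi> ^ ?r" by (simp add: power_add mult_ac)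
  also have "(- 1) ^ N * (- 1 / 2) * ((a / 2) ^ (2 * N) * ?\<xi> ^ ?r) * (pochhammer \<mu> (N + 1) * pochhammer (1 - \<mu>) k / Gamma (real N + 1 + \<mu>)) *
      (1 / (Gamma (1 + \<nu>) * pochhammer (1 + \<nu>) (N + 1) * pochhammer (real N + \<nu> + 2) k)) * fact k / (fact N * (real N + 1) * pochhammer (real N + 2) k) =
     (- 1) ^ N * (- 1 / 2) * ((a / 2) powi (2 * (int N - int ?r)) * (b / 2) ^ (2 * ?r)) * ((- 1) ^ k * rGamma (\<mu> - real k)) * rGamma (\<nu> + real ?r + 1) * fact k / fact ?r"
    unfolding p1 p2 p3 p4 ..
  also have "\<dots> = sing_coeff \<mu> a (2 * N + 1) ?r / fact ?r * rGamma (\<nu> + real ?r + 1) * (b / 2) ^ (2 * ?r)"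
    unfolding s by (simp add: power_add mult_ac del: fact_Suc)
  finally show ?thesis by (rule sym)
qed

text \<open>The terms with \<open>r \<le> N\<close> give \<open>Upsilon_hat\<close> times \<open>F_poly\<close> together with the finite sum in
\<open>Delta\<close>.\<close>

lemma bessel_series_sing_odd:
  assumes a: "a > 0" and \<mu>: "\<mu> \<ge> 0" and \<nu>: "\<nu> \<ge> 0" and b: "0 < b" "b < a"
  shows "bessel_series \<nu> (sing_coeff \<mu> a (2 * N + 1)) b =
    (- 1) ^ N * (a / 2) ^ (2 * N) / (Gamma (1 + \<nu>) * Gamma (real N + 1 + \<mu>) * fact N) *
      (Upsilon_hat \<mu> N a * F_poly \<nu> N \<mu> (b\<^sup>2 / a\<^sup>2) - 1 / 2 * Delta \<mu> \<nu> N (b\<^sup>2 / a\<^sup>2))"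
proof -
  let ?\<xi> = "b\<^sup>2 / a\<^sup>2"
  let ?C = "(- 1) ^ N * (a / 2) ^ (2 * N) / (Gamma (1 + \<nu>) * Gamma (real N + 1 + \<mu>) * fact N)"
  let ?f = "\<lambda>r. sing_coeff \<mu> a (2 * N + 1) r / fact r * rGamma (\<nu> + real r + 1) * (b / 2) ^ (2 * r)"
  let ?E = "\<lambda>r. (real N gchoose r) * ((real N + \<mu>) gchoose r) * D_coeff r N \<mu> * ?\<xi> ^ r / pochhammer (1 + \<nu>) r"
  let ?K = "pochhammer \<mu> (N + 1) * ?\<xi> ^ (N + 1) / (pochhammer (1 + \<nu>) (N + 1) * (real N + 1))"
  let ?H = "hypergeo [1, 1, 1 - \<mu>] [real N + \<nu> + 2, real N + 2] ?\<xi>"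
  have f: "?f sums bessel_series \<nu> (sing_coeff \<mu> a (2 * N + 1)) b"
    by (rule bessel_series_sums[OF even_conv_sing_coeff[OF a \<mu>]]) (use b \<nu> in auto)
  have head: "?f r = ?C * (Upsilon_hat \<mu> N a * F_poly_term \<nu> N \<mu> ?\<xi> r - 1 / 2 * ?E r)" if r: "r \<le> N" for r
  proof -
    have i: "int N - int r = int (N - r)" using r by simp
    have "sing_coeff \<mu> a (2 * N + 1) r = power_coeff \<mu> a N r * Upsilon_hat \<mu> (N - r) a"
      by (simp add: sing_coeff_def power_coeff_def sing_odd_def i)
    hence "?f r = (power_coeff \<mu> a N r / fact r * rGamma (\<nu> + real r + 1) * (b / 2) ^ (2 * r)) * Upsilon_hat \<mu> (N - r) a"
      by simp
    also have "\<dots> = ?C * (F_poly_term \<nu> N \<mu> ?\<xi> r * Upsilon_hat \<mu> (N - r) a)"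
      unfolding power_coeff_F_poly_term[OF a \<mu> \<nu> r] by simp
    also have "F_poly_term \<nu> N \<mu> ?\<xi> r * Upsilon_hat \<mu> (N - r) a = Upsilon_hat \<mu> N a * F_poly_term \<nu> N \<mu> ?\<xi> r - 1 / 2 * ?E r"
    proof -
      have "F_poly_term \<nu> N \<mu> ?\<xi> r * (D_coeff r N \<mu> / fact r / 2) = 1 / 2 * ?E r"
        unfolding F_poly_term_gchoose by (simp add: mult_ac)
      moreover have "F * (U - d) = U * F - F * d" for F U d :: real by (simp add: algebra_simps)
      ultimately show ?thesis unfolding Upsilon_hat_down[OF \<mu> r] by (simp only:)
    qed
    finally show ?thesis .
  qed
  have "(\<lambda>k. ?f (k + Suc N)) sums (bessel_series \<nu> (sing_coeff \<mu> a (2 * N + 1)) b - (\<Sum>r<Suc N. ?f r))"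
    by (rule sums_split_initial_segment[OF f])
  hence "?C * (- 1 / 2) * ?K * (\<Sum>k. fact k * fact k * pochhammer (1 - \<mu>) k / (pochhammer (real N + \<nu> + 2) k * pochhammer (real N + 2) k * fact k) * ?\<xi> ^ k) =
      bessel_series \<nu> (sing_coeff \<mu> a (2 * N + 1)) b - (\<Sum>r<Suc N. ?f r)"
    unfolding sing_odd_tail[OF a \<mu> \<nu>] by (rule sums_cmult_imp_suminf)
  moreover have "?H = (\<Sum>k. fact k * fact k * pochhammer (1 - \<mu>) k / (pochhammer (real N + \<nu> + 2) k * pochhammer (real N + 2) k * fact k) * ?\<xi> ^ k)"
    by (simp add: hypergeo_def eval_fps_def pochhammer_fact[symmetric])
  ultimately
  have "?C * (- 1 / 2) * ?K * ?H = bessel_series \<nu> (sing_coeff \<mu> a (2 * N + 1)) b - (\<Sum>r<Suc N. ?f r)"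
    by (simp only:)
  moreover have "(\<Sum>r<Suc N. ?f r) = ?C * (Upsilon_hat \<mu> N a * F_poly \<nu> N \<mu> ?\<xi> - 1 / 2 * (\<Sum>r=1..N. ?E r))"
  proof -
    have "(\<Sum>r<Suc N. ?f r) = (\<Sum>r\<le>N. ?C * (Upsilon_hat \<mu> N a * F_poly_term \<nu> N \<mu> ?\<xi> r - 1 / 2 * ?E r))"
      unfolding lessThan_Suc_atMost by (rule sum.cong) (use head in auto)
    also have "\<dots> = ?C * (Upsilon_hat \<mu> N a * F_poly \<nu> N \<mu> ?\<xi> - 1 / 2 * (\<Sum>r\<le>N. ?E r))"
      by (simp only: F_poly_sum sum_distrib_left sum_subtractf right_diff_distrib)
    also have "(\<Sum>r\<le>N. ?E r) = (\<Sum>r=1..N. ?E r)"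
      by (rule sum.mono_neutral_right) (auto simp: D_coeff_def not_less_eq_eq)
    finally show ?thesis .
  qed
  moreover have "X = C * (u - 1 / 2 * (s + K * H))" if "C * (- 1 / 2) * K * H = X - Y" "Y = C * (u - 1 / 2 * s)" for X Y C u s K H :: real
    using that by (simp add: algebra_simps)
  ultimately show ?thesis unfolding Delta_def by blast
qed

theorem theorem4:
  fixes N :: nat and \<mu> \<nu> \<alpha> a b \<xi> \<theta> :: real
  assumes "\<mu> \<ge> 0" and "\<nu> \<ge> 0" and "\<alpha> > 0"
    and "a > 0" and "b > 0"
    and "\<xi> = b\<^sup>2 / a\<^sup>2" and "\<xi> < 1"
    and "0 < a + b" and "a + b \<le> 2 * pi"
    and "\<theta> = \<alpha> - \<mu> - \<nu>"
  shows "(\<theta> = 2 * real N \<longrightarrow>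
           summable (\<lambda>n. bessel_term \<mu> \<nu> \<alpha> a b (Suc n)) \<and>
           S_bessel \<mu> \<nu> \<alpha> a b =
             F_hat \<mu> \<nu> \<alpha> a b
             + 1 / Gamma (1 + \<nu>) * (\<Sum>m=0..N. B_coeff \<mu> \<nu> \<theta> \<xi> m * (a / 2) ^ (2 * m)))
       \<and> (\<theta> = 2 * real N + 1 \<longrightarrow>
           summable (\<lambda>n. bessel_term \<mu> \<nu> \<alpha> a b (Suc n)) \<and>
           summable (\<lambda>m. if m = N then 0 else B_coeff \<mu> \<nu> \<theta> \<xi> m * (a / 2) ^ (2 * m)) \<and>
           S_bessel \<mu> \<nu> \<alpha> a b =
             (- 1) ^ N * (a / 2) ^ (2 * N) / (Gamma (1 + \<nu>) * Gamma (real N + 1 + \<mu>) * fact N)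
               * (Upsilon_hat \<mu> N a * F_poly \<nu> N \<mu> \<xi> - 1 / 2 * Delta \<mu> \<nu> N \<xi>)
             + 1 / Gamma (1 + \<nu>) *
               (\<Sum>m. if m = N then 0 else B_coeff \<mu> \<nu> \<theta> \<xi> m * (a / 2) ^ (2 * m)))"
proof -
  note \<mu> = assms(1) and \<nu> = assms(2) and a = assms(4)
  have ba: "b < a"
  proof (rule ccontr)
    assume "\<not> b < a"
    hence "a\<^sup>2 \<le> b\<^sup>2" using a by (intro power_mono) auto
    hence "1 \<le> b\<^sup>2 / a\<^sup>2" using a by simp
    thus False using assms(6,7) by simp
  qed
  have schlomilch: "summable (\<lambda>n. bessel_term \<mu> \<nu> \<alpha> a b (Suc n))"
      "(\<lambda>m. zeta_cos_coeff t m * mean_power \<mu> \<nu> a m b) sums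
         (S_bessel \<mu> \<nu> \<alpha> a b - bessel_series \<nu> (sing_coeff \<mu> a t) b)" if t: "\<theta> = real t" for t
  proof -
    have pos: "\<mu> + \<nu> + real t > 0" and \<alpha>: "\<alpha> = \<mu> + \<nu> + real t" using assms(3,10) t by linarith+
    note L = schlomilch_sum[OF \<mu> \<nu> assms(5) ba assms(9) pos]
    note S = summable_schlomilch_imp_S_bessel[OF a assms(5) \<alpha> L(1)]
    show "summable (\<lambda>n. bessel_term \<mu> \<nu> \<alpha> a b (Suc n))" by (rule S(1))
    show "(\<lambda>m. zeta_cos_coeff t m * mean_power \<mu> \<nu> a m b) sums
         (S_bessel \<mu> \<nu> \<alpha> a b - bessel_series \<nu> (sing_coeff \<mu> a t) b)"
      unfolding S(2) by (rule L(2))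
  qed
  have G0: "Gamma (1 + \<nu>) \<noteq> 0" using Gamma_real_pos[of "1 + \<nu>"] \<nu> by linarith
  note B = B_coeff_mean_power[OF a \<mu> \<nu>]
  show ?thesis
  proof (intro conjI impI)
    assume t: "\<theta> = 2 * real N"
    hence t': "\<theta> = real (2 * N)" by simp
    show "summable (\<lambda>n. bessel_term \<mu> \<nu> \<alpha> a b (Suc n))" by (rule schlomilch(1)[OF t'])
    have "(\<lambda>m. zeta_cos_coeff (2 * N) m * mean_power \<mu> \<nu> a m b) sums
        (\<Sum>m=0..N. zeta_cos_coeff (2 * N) m * mean_power \<mu> \<nu> a m b)"
    proof (rule sums_finite)
      fix m assume "m \<notin> {0..N}"
      hence "real (2 * N) - 2 * real m = - real (2 * (m - N))" "1 \<le> m - N" by (simp_all add: of_nat_diff)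
      hence "zeta_cos_coeff (2 * N) m = 0" using zeta_real_neg_even[of "m - N"] by (simp add: zeta_cos_coeff_def)
      thus "zeta_cos_coeff (2 * N) m * mean_power \<mu> \<nu> a m b = 0" by simp
    qed simp
    hence "S_bessel \<mu> \<nu> \<alpha> a b - bessel_series \<nu> (sing_coeff \<mu> a (2 * N)) b =
        (\<Sum>m=0..N. zeta_cos_coeff (2 * N) m * mean_power \<mu> \<nu> a m b)"
      by (rule sums_unique2[OF schlomilch(2)[OF t']])
    also have "\<dots> = (\<Sum>m=0..N. 1 / Gamma (1 + \<nu>) * (B_coeff \<mu> \<nu> \<theta> \<xi> m * (a / 2) ^ (2 * m)))"
    proof (rule sum.cong[OF refl])
      fix m
      have "2 * m + 1 \<noteq> 2 * N" by presburger
      thus "zeta_cos_coeff (2 * N) m * mean_power \<mu> \<nu> a m b = 1 / Gamma (1 + \<nu>) * (B_coeff \<mu> \<nu> \<theta> \<xi> m * (a / 2) ^ (2 * m))"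
        using G0 unfolding assms(6) B t by (simp add: zeta_cos_coeff_def)
    qed
    finally show "S_bessel \<mu> \<nu> \<alpha> a b =
             F_hat \<mu> \<nu> \<alpha> a b
             + 1 / Gamma (1 + \<nu>) * (\<Sum>m=0..N. B_coeff \<mu> \<nu> \<theta> \<xi> m * (a / 2) ^ (2 * m))"
      using F_hat_eq[OF a \<mu> \<nu> assms(5) ba, of \<alpha> N] assms(10) t by (simp only: sum_distrib_left)
  next
    assume t: "\<theta> = 2 * real N + 1"
    hence t': "\<theta> = real (2 * N + 1)" by simp
    show "summable (\<lambda>n. bessel_term \<mu> \<nu> \<alpha> a b (Suc n))" by (rule schlomilch(1)[OF t'])
    have e: "(if m = N then 0 else B_coeff \<mu> \<nu> \<theta> \<xi> m * (a / 2) ^ (2 * m)) =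
        Gamma (1 + \<nu>) * (zeta_cos_coeff (2 * N + 1) m * mean_power \<mu> \<nu> a m b)" for m
      unfolding assms(6) B t by (simp add: zeta_cos_coeff_def add_ac)
    from sums_mult[OF schlomilch(2)[OF t'], of "Gamma (1 + \<nu>)"]
    have s: "(\<lambda>m. if m = N then 0 else B_coeff \<mu> \<nu> \<theta> \<xi> m * (a / 2) ^ (2 * m)) sums
        (Gamma (1 + \<nu>) * (S_bessel \<mu> \<nu> \<alpha> a b - bessel_series \<nu> (sing_coeff \<mu> a (2 * N + 1)) b))"
      unfolding e .
    note sums = sums_unique[OF s, symmetric]
    show "summable (\<lambda>m. if m = N then 0 else B_coeff \<mu> \<nu> \<theta> \<xi> m * (a / 2) ^ (2 * m))"
      using s by (rule sums_summable)
    show "S_bessel \<mu> \<nu> \<alpha> a b =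
             (- 1) ^ N * (a / 2) ^ (2 * N) / (Gamma (1 + \<nu>) * Gamma (real N + 1 + \<mu>) * fact N)
               * (Upsilon_hat \<mu> N a * F_poly \<nu> N \<mu> \<xi> - 1 / 2 * Delta \<mu> \<nu> N \<xi>)
             + 1 / Gamma (1 + \<nu>) *
               (\<Sum>m. if m = N then 0 else B_coeff \<mu> \<nu> \<theta> \<xi> m * (a / 2) ^ (2 * m))"
      using G0 unfolding sums unfolding assms(6) bessel_series_sing_odd[OF a \<mu> \<nu> assms(5) ba, symmetric]
      by simp
  qed
qed

end
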